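(* Let $\mathfrak g$ be a basic classical Lie superalgebra over $K$ from the list in the context, let $\chi\in\mathfrak g_{\bar 0}^*$ be nilpotent, and let $\mathfrak m\subseteq\mathfrak g$ be the associated subalgebra described in the context. Set $\delta=\dim U_\chi(\mathfrak m)$ and let $\mathcal Q_{\mathfrak m}=U_\chi(\mathfrak g)\otimes_{U_\chi(\mathfrak m)}K_\chi$ be the induced $U_\chi(\mathfrak g)$-module. Then $\mathcal Q_{\mathfrak m}$ is a projective $U_\chi(\mathfrak g)$-module and $$U_\chi(\mathfrak g)\cong M_\delta\big(W_\chi(\mathfrak g)^{op}\big)\quad\text{as algebras, where } W_\chi(\mathfrak g)=\mathrm{End}_{U_\chi(\mathfrak g)}(\mathcal Q_{\mathfrak m}).$$
   Context: $K$ is an algebraically closed field of characteristic $p>2$. All spaces, subalgebras, ideals, modules and submodules are $\mathbb Z_2$-graded. $\mathrm{End}$ denotes the superalgebra of all (even and odd) module endomorphisms, where homogeneous $f$ satisfies $f(um)=(-1)^{|f||u|}uf(m)$; ${}^{op}$ is the opposite superalgebra; $M_\delta(A)$ is the algebra of $\delta\times\delta$ matrices over $A$. A restricted Lie superalgebra is a Lie superalgebra $\mathfrak g$ whose even part is a restricted Lie algebra with $p$-th power map $x\mapsto x^{[p]}$ and such that $[x^{[p]},y]=(\mathrm{ad}\,x)^p(y)$ for $x\in\mathfrak g_{\bar 0},y\in\mathfrak g$. For $\chi\in\mathfrak g_{\bar 0}^*$ (extended by $\chi(\mathfrak g_{\bar 1})=0$), $U_\chi(\mathfrak g)=U(\mathfrak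 g)/\langle x^p-x^{[p]}-\chi(x)^p : x\in\mathfrak g_{\bar 0}\rangle$. For a restricted subalgebra $\mathfrak a$, $U_\chi(\mathfrak a)$ is taken with respect to $\chi|_{\mathfrak a}$. "Basic classical Lie superalgebra" means one of (ordinary Lie algebras excluded): $\mathfrak{gl}(m|n)$ ($p>2$); $\mathfrak{sl}(m|n)$ ($p>2$, $p\nmid m-n$); the ortho-symplectic $B(m,n)=\mathfrak{osp}(2m+1|2n)$, $C(n)=\mathfrak{osp}(2|2n)$, $D(m,n)=\mathfrak{osp}(2m|2n)$ ($p>2$); $D(2,1;\alpha)$, $\alpha\in K\setminus\{0,-1\}$ ($p>3$); $F(4)$ ($p>15$); $G(3)$ ($p>15$). Here $D(2,1;\alpha)$ is the $17$-dimensional simple Lie superalgebra with even part $\mathfrak{sl}(2)^{\oplus 3}$ and odd part $V\otimes V\otimes V$ ($V$ natural), with odd bracket (in one standard normalization) $[v_1\otimes v_2\otimes v_3,w_1\otimes w_2\otimes w_3]=\sum_i\sigma_i\prod_{j\ne i}\psi(v_j,w_j)P_i(v_i,w_i)$, $\psi$ the symplectic form on $V$, $P_i(x,y)z=\psi(y,z)x-\psi(z,x)y$ in the $i$-th $\mathfrak{sl}(2)$, $(\sigma_1,\sigma_2,\sigma_3)=(1,\alpha,-1-\alpha)$; $F(4)$ is the $40$-dimensional simple one with even part $B_3\oplus A_1$ and odd part (8-dimensional spin)$\otimes$(natural); $G(3)$ is the $31$-dimensional simple one with even part $G_2\oplus A_1$ and odd part (7-dimensional simple)$\otimes$(natural).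 Each carries a fixed nondegenerate invariant even supersymmetric form $(\cdot,\cdot)$, giving $\mathfrak g_{\bar 0}\cong\mathfrak g_{\bar 0}^*$, and a natural restricted structure ($\mathfrak g_{\bar 0}$ is the Lie algebra of a reductive group). $\chi\in\mathfrak g_{\bar 0}^*$ is nilpotent if it corresponds to a nilpotent $X\in\mathfrak g_{\bar 0}$, so $\chi=(X,\cdot)$. The grading. (a) For $\mathfrak g=\mathfrak{gl}(V),\mathfrak{sl}(V)$ choose homogeneous $w_1,\dots,w_r\in V_{\bar 0}\cup V_{\bar 1}$ and integers $\lambda_i\ge1$ such that the $X^jw_i$ ($0\le j<\lambda_i$) form a basis of $V$ and $X^{\lambda_i}w_i=0$; let $V(k)$ be the span of those $X^jw_i$ with $2j+1-\lambda_i=k$ and $\mathfrak g(k)=\{f\in\mathfrak g: f(V(l))\subseteq V(l+k)\ \forall l\}$. (b) For $\mathfrak g=\mathfrak{osp}(V)$ with form $\phi$, do the same with the $w_i$ chosen (as is possible) so that moreover $\phi(V(k),V(l))=0$ unless $k+l=0$. (c) For exceptional $\mathfrak g$, take an $\mathfrak{sl}(2)$-triple $\{X,H,Y\}$ in $\mathfrak g_{\bar 0}$ such that $KH$ lifts to a one-dimensional torus $\gamma:K^\times\to G_{\bar 0}$ ($G_{\bar 0}$ the simply connected group of $\mathfrak g_{\bar 0}$) for which $\mathfrak g(k)=\{z:\mathrm{Ad}(\gamma(t))z=t^kz\ \forall t\in K^\times\}$ defines a grading with the following properties. In all cases the grading is compatible with the $\mathbb Z_2$-grading and satisfies: $X\in\mathfrak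 g(2)$; $(\mathfrak g(k),\mathfrak g(l))=0$ if $k+l\ne0$; $\mathfrak g_X=\bigoplus_k\mathfrak g_X\cap\mathfrak g(k)$, with $\mathfrak g_X\cap\mathfrak g(s)=0$ for $s<0$; $\underline{\dim}\,\mathfrak g_X=\underline{\dim}\,\mathfrak g(0)+\underline{\dim}\,\mathfrak g(1)$, where $\mathfrak g_X$ is the centralizer of $X$ and $\underline{\dim}$ is the pair (even dimension $|$ odd dimension). The subalgebra $\mathfrak m$. On $\mathfrak g(-1)$ put $\langle x,y\rangle=(X,[x,y])=\chi([x,y])$; it is even, nondegenerate, symplectic on $\mathfrak g(-1)_{\bar 0}$ and symmetric on $\mathfrak g(-1)_{\bar 1}$. Let $\mathfrak g(-1)'_{\bar 0}\subset\mathfrak g(-1)_{\bar 0}$ be a maximal isotropic subspace. Let $r=\dim\mathfrak g(-1)_{\bar 1}$ and choose a basis $v_1,\dots,v_r$ of $\mathfrak g(-1)_{\bar 1}$ with $\langle v_i,v_j\rangle=\delta_{i+j,r+1}$; let $\mathfrak g(-1)'_{\bar 1}$ be the span of $v_1,\dots,v_{r/2}$ if $r$ is even and of $v_1,\dots,v_{(r-1)/2}$ if $r$ is odd. Put $\mathfrak g(-1)'=\mathfrak g(-1)'_{\bar 0}\oplus\mathfrak g(-1)'_{\bar 1}$ and $\mathfrak m=\bigoplus_{k\ge2}\mathfrak g(-k)\oplus\mathfrak g(-1)'$. $K_\chi$ denotes the one-dimensional $U_\chi(\mathfrak m)$-module on which $x\in\mathfrak m$ acts by $\chi(x)$. *)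

theory Defs
  imports
    "HOL-Library.Z2"
    "HOL-Algebra.QuotRing"
    "HOL-Algebra.Free_Abelian_Groups"
    "Jordan_Normal_Form.VS_Connect"
    "Jordan_Normal_Form.Determinant"
begin

section \<open>Superspaces\<close>

text \<open>The ground field is a type \<open>'k\<close>; \<^const>\<open>class_ring\<close> is the corresponding ring record.
  Parities are elements of \<^typ>\<open>bit\<close>. The record below serves for superspaces and superalgebras
  over \<open>'k\<close>, and, with the first parameter the type of an algebra, for supermodules over that
  algebra (the fields \<open>mult\<close> and \<open>one\<close> are then irrelevant).\<close>

record ('r, 'a) graded_module = "('r, 'a) module" +
  hcomp :: "bit \<Rightarrow> 'a set"

definition ksign :: "bit \<Rightarrow> bit \<Rightarrow> 'k::ring_1" where
  "ksign a b = (if a = 1 \<and> b = 1 then - 1 else 1)"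

abbreviation kspan :: "('k::field, 'a, 'c) module_scheme \<Rightarrow> 'a set \<Rightarrow> 'a set" where
  "kspan V S \<equiv> LinearCombinations.module.span class_ring V S"

abbreviation kbasis :: "('k::field, 'a, 'c) module_scheme \<Rightarrow> 'a set \<Rightarrow> bool" where
  "kbasis V B \<equiv> vectorspace.basis class_ring V B"

abbreviation kdim :: "('k::field, 'a, 'c) module_scheme \<Rightarrow> nat" where
  "kdim V \<equiv> vectorspace.dim class_ring V"

abbreviation ksubspace :: "'a set \<Rightarrow> ('k::field, 'a, 'c) module_scheme \<Rightarrow> bool" where
  "ksubspace W V \<equiv> VectorSpace.subspace class_ring W V"

definition superspace :: "('k::field, 'a, 'c) graded_module_scheme \<Rightarrow> bool" where
  "superspace V \<longleftrightarrow>
     vectorspace class_ring V \<and> (\<forall>i. ksubspace (hcomp V i) V) \<and>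
     hcomp V 0 \<inter> hcomp V 1 = {\<zero>\<^bsub>V\<^esub>} \<and>
     carrier V = {x \<oplus>\<^bsub>V\<^esub> y | x y. x \<in> hcomp V 0 \<and> y \<in> hcomp V 1}"

definition internal_direct_sum ::
  "('k::field, 'a, 'c) module_scheme \<Rightarrow> 'a set \<Rightarrow> (int \<Rightarrow> 'a set) \<Rightarrow> bool" where
  "internal_direct_sum V W U \<longleftrightarrow>
     ksubspace W V \<and> (\<forall>k. ksubspace (U k) V \<and> U k \<subseteq> W) \<and>
     (\<forall>z\<in>W. \<exists>!f. (\<forall>k. f k \<in> U k) \<and> finite {k. f k \<noteq> \<zero>\<^bsub>V\<^esub>} \<and>
                z = (\<Oplus>\<^bsub>V\<^esub>k\<in>{k. f k \<noteq> \<zero>\<^bsub>V\<^esub>}. f k))"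


section \<open>Lie superalgebras\<close>

text \<open>\<open>pmap\<close> is the \<open>p\<close>-th power map \<open>x \<mapsto> x\<^sup>[\<^sup>p\<^sup>]\<close>; only its values on the even part matter.\<close>

record ('k, 'g) lie_superalg = "('k, 'g) graded_module" +
  brk :: "'g \<Rightarrow> 'g \<Rightarrow> 'g"
  pmap :: "'g \<Rightarrow> 'g"

text \<open>The last axiom follows from the others in characteristic other than 2, 3; in characteristic 3 it is
  part of the usual definition.\<close>

locale lie_superalgebra =
  fixes L :: "('k::field, 'g) lie_superalg" (structure)
  assumes superspace: "superspace L"
    and brk_hcomp: "\<lbrakk>x \<in> hcomp L a; y \<in> hcomp L b\<rbrakk> \<Longrightarrow> brk L x y \<in> hcomp L (a + b)"
    and brk_add_left: "\<lbrakk>x \<in> carrier L; y \<in> carrier L; z \<in> carrier L\<rbrakk>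
          \<Longrightarrow> brk L (x \<oplus> y) z = brk L x z \<oplus> brk L y z"
    and brk_smult_left: "\<lbrakk>x \<in> carrier L; z \<in> carrier L\<rbrakk>
          \<Longrightarrow> brk L (c \<odot> x) z = c \<odot> brk L x z"
    and brk_add_right: "\<lbrakk>x \<in> carrier L; y \<in> carrier L; z \<in> carrier L\<rbrakk>
          \<Longrightarrow> brk L z (x \<oplus> y) = brk L z x \<oplus> brk L z y"
    and brk_smult_right: "\<lbrakk>x \<in> carrier L; z \<in> carrier L\<rbrakk>
          \<Longrightarrow> brk L z (c \<odot> x) = c \<odot> brk L z x"
    and antisym: "\<lbrakk>x \<in> hcomp L a; y \<in> hcomp L b\<rbrakk>
          \<Longrightarrow> brk L y x = (- ksign a b) \<odot> brk L x y"
    and jacobi: "\<lbrakk>x \<in> hcomp L a; y \<in> hcomp L b; z \<in> carrier L\<rbrakk>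
          \<Longrightarrow> brk L x (brk L y z) =
              brk L (brk L x y) z \<oplus> ksign a b \<odot> brk L y (brk L x z)"
    and odd_cube: "x \<in> hcomp L 1 \<Longrightarrow> brk L (brk L x x) x = \<zero>"

definition sub_lie :: "('k, 'g) lie_superalg \<Rightarrow> 'g set \<Rightarrow> ('k, 'g) lie_superalg" where
  "sub_lie L S = L\<lparr>carrier := S, hcomp := (\<lambda>i. hcomp L i \<inter> S)\<rparr>"

definition simple_lie :: "('k::field, 'g) lie_superalg \<Rightarrow> bool" where
  "simple_lie L \<longleftrightarrow>
     (\<exists>x\<in>carrier L. \<exists>y\<in>carrier L. brk L x y \<noteq> \<zero>\<^bsub>L\<^esub>) \<and>
     (\<forall>I. ksubspace I L \<and>
          I = {x \<oplus>\<^bsub>L\<^esub> y | x y. x \<in> I \<inter> hcomp L 0 \<and> y \<in> I \<inter> hcomp L 1} \<and>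
          (\<forall>x\<in>carrier L. \<forall>y\<in>I. brk L x y \<in> I)
          \<longrightarrow> I = {\<zero>\<^bsub>L\<^esub>} \<or> I = carrier L)"

definition centralizer :: "('k::field, 'g) lie_superalg \<Rightarrow> 'g \<Rightarrow> 'g set" where
  "centralizer L X = {z \<in> carrier L. brk L X z = \<zero>\<^bsub>L\<^esub>}"

definition invariant_form :: "('k::field, 'g) lie_superalg \<Rightarrow> ('g \<Rightarrow> 'g \<Rightarrow> 'k) \<Rightarrow> bool" where
  "invariant_form L B \<longleftrightarrow>
     (\<forall>x\<in>carrier L. \<forall>y\<in>carrier L. \<forall>z\<in>carrier L. \<forall>c.
        B (x \<oplus>\<^bsub>L\<^esub> y) z = B x z + B y z \<and> B (c \<odot>\<^bsub>L\<^esub> x) z = c * B x z \<and>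
        B z (x \<oplus>\<^bsub>L\<^esub> y) = B z x + B z y \<and> B z (c \<odot>\<^bsub>L\<^esub> x) = c * B z x \<and>
        B (brk L x y) z = B x (brk L y z)) \<and>
     (\<forall>a b. \<forall>x\<in>hcomp L a. \<forall>y\<in>hcomp L b. (a \<noteq> b \<longrightarrow> B x y = 0) \<and> B y x = ksign a b * B x y) \<and>
     (\<forall>x\<in>carrier L. (\<forall>y\<in>carrier L. B x y = 0) \<longrightarrow> x = \<zero>\<^bsub>L\<^esub>)"


section \<open>Reduced enveloping algebras\<close>

text \<open>The free associative algebra on the set \<open>G\<close>: finitely supported functions on words, with
  the convolution product.\<close>

definition free_algebra :: "'g set \<Rightarrow> ('k::field, 'g list \<Rightarrow> 'k) module" where
  "free_algebra G =
     \<lparr>carrier = {f. finite {w. f w \<noteq> 0} \<and> (\<forall>w. f w \<noteq> 0 \<longrightarrow> set w \<subseteq> G)},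
      mult = (\<lambda>f g w. \<Sum>i\<le>length w. f (take i w) * g (drop i w)),
      one = (\<lambda>w. if w = [] then 1 else 0),
      ring.zero = (\<lambda>w. 0),
      add = (\<lambda>f g w. f w + g w),
      smult = (\<lambda>c f w. c * f w)\<rparr>"

definition word :: "'g list \<Rightarrow> 'g list \<Rightarrow> 'k::field" where
  "word w = (\<lambda>v. if v = w then 1 else 0)"

text \<open>The first two families of relations turn the free algebra on the set \<open>carrier L\<close> into the
  tensor algebra of the vector space, the third gives the enveloping superalgebra, the last
  the reduction modulo \<open>x\<^sup>p - x\<^sup>[\<^sup>p\<^sup>] - \<chi>(x)\<^sup>p\<close>.\<close>

definition env_relations ::
  "('k::field, 'g) lie_superalg \<Rightarrow> ('g \<Rightarrow> 'k) \<Rightarrow> ('g list \<Rightarrow> 'k) set" where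
  "env_relations L \<chi> =
     {\<lambda>v. word [x \<oplus>\<^bsub>L\<^esub> y] v - word [x] v - word [y] v | x y. x \<in> carrier L \<and> y \<in> carrier L} \<union>
     {\<lambda>v. word [c \<odot>\<^bsub>L\<^esub> x] v - c * word [x] v | c x. x \<in> carrier L} \<union>
     {\<lambda>v. word [x, y] v - ksign a b * word [y, x] v - word [brk L x y] v
        | a b x y. x \<in> hcomp L a \<and> y \<in> hcomp L b} \<union>
     {\<lambda>v. word (replicate CHAR('k) x) v - word [pmap L x] v - \<chi> x ^ CHAR('k) * word [] v
        | x. x \<in> hcomp L 0}"

definition env_ideal ::
  "('k::field, 'g) lie_superalg \<Rightarrow> ('g \<Rightarrow> 'k) \<Rightarrow> ('g list \<Rightarrow> 'k) set" where
  "env_ideal L \<chi> = Idl\<^bsub>free_algebra (carrier L)\<^esub> (env_relations L \<chi>)"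

definition word_parity :: "('k, 'g) lie_superalg \<Rightarrow> 'g list \<Rightarrow> bit \<Rightarrow> bool" where
  "word_parity L w i \<longleftrightarrow> (\<exists>as. list_all2 (\<lambda>x a. x \<in> hcomp L a) w as \<and> sum_list as = i)"

definition reduced_env ::
  "('k::field, 'g) lie_superalg \<Rightarrow> ('g \<Rightarrow> 'k) \<Rightarrow> ('k, ('g list \<Rightarrow> 'k) set) graded_module" where
  "reduced_env L \<chi> =
     (let F = free_algebra (carrier L); I = env_ideal L \<chi>; U = F Quot I in
      \<lparr>carrier = carrier U, mult = mult U, one = one U, ring.zero = ring.zero U, add = add U,
       smult = (\<lambda>c u. (I +>\<^bsub>F\<^esub> (c \<odot>\<^bsub>F\<^esub> \<one>\<^bsub>F\<^esub>)) \<otimes>\<^bsub>U\<^esub> u),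
       hcomp = (\<lambda>i. {I +>\<^bsub>F\<^esub> f | f. f \<in> carrier F \<and> (\<forall>w. f w \<noteq> 0 \<longrightarrow> word_parity L w i)})\<rparr>)"

text \<open>The canonical homomorphism \<open>U\<^sub>\<chi>(S) \<rightarrow> U\<^sub>\<chi>(L)\<close> for a restricted subalgebra \<open>S\<close>, on cosets.\<close>

definition env_incl ::
  "('k::field, 'g) lie_superalg \<Rightarrow> ('g \<Rightarrow> 'k) \<Rightarrow> ('g list \<Rightarrow> 'k) set \<Rightarrow> ('g list \<Rightarrow> 'k) set" where
  "env_incl L \<chi> u = (\<Union>f\<in>u. env_ideal L \<chi> +>\<^bsub>free_algebra (carrier L)\<^esub> f)"

text \<open>The module \<open>K\<^sub>\<chi>\<close>: a coset acts through the algebra homomorphism with \<open>x \<mapsto> \<chi>(x)\<close>, evaluated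
  at any representative. It is purely even.\<close>

definition word_eval :: "('g \<Rightarrow> 'k::field) \<Rightarrow> ('g list \<Rightarrow> 'k) \<Rightarrow> 'k" where
  "word_eval \<chi> f = (\<Sum>w\<in>{w. f w \<noteq> 0}. f w * prod_list (map \<chi> w))"

definition char_module :: "('g \<Rightarrow> 'k::field) \<Rightarrow> (('g list \<Rightarrow> 'k) set, 'k) graded_module" where
  "char_module \<chi> =
     \<lparr>carrier = UNIV, mult = undefined, one = undefined, ring.zero = 0, add = (+),
      smult = (\<lambda>u c. word_eval \<chi> (SOME f. f \<in> u) * c),
      hcomp = (\<lambda>i. if i = 0 then UNIV else {0})\<rparr>"


section \<open>Supermodules\<close>

definition left_supermodule ::
  "('k::field, 'u, 'c) graded_module_scheme \<Rightarrow> ('u, 'm) graded_module \<Rightarrow> bool" where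
  "left_supermodule A M \<longleftrightarrow>
     abelian_group M \<and>
     (\<forall>a\<in>carrier A. \<forall>b\<in>carrier A. \<forall>x\<in>carrier M. \<forall>y\<in>carrier M.
        a \<odot>\<^bsub>M\<^esub> x \<in> carrier M \<and>
        (a \<oplus>\<^bsub>A\<^esub> b) \<odot>\<^bsub>M\<^esub> x = a \<odot>\<^bsub>M\<^esub> x \<oplus>\<^bsub>M\<^esub> b \<odot>\<^bsub>M\<^esub> x \<and>
        a \<odot>\<^bsub>M\<^esub> (x \<oplus>\<^bsub>M\<^esub> y) = a \<odot>\<^bsub>M\<^esub> x \<oplus>\<^bsub>M\<^esub> a \<odot>\<^bsub>M\<^esub> y \<and>
        (a \<otimes>\<^bsub>A\<^esub> b) \<odot>\<^bsub>M\<^esub> x = a \<odot>\<^bsub>M\<^esub> (b \<odot>\<^bsub>M\<^esub> x) \<and>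
        \<one>\<^bsub>A\<^esub> \<odot>\<^bsub>M\<^esub> x = x) \<and>
     (\<forall>i. subgroup (hcomp M i) (add_monoid M)) \<and>
     hcomp M 0 \<inter> hcomp M 1 = {\<zero>\<^bsub>M\<^esub>} \<and>
     carrier M = {x \<oplus>\<^bsub>M\<^esub> y | x y. x \<in> hcomp M 0 \<and> y \<in> hcomp M 1} \<and>
     (\<forall>i j. \<forall>a\<in>hcomp A i. \<forall>x\<in>hcomp M j. a \<odot>\<^bsub>M\<^esub> x \<in> hcomp M (i + j))"

definition supermodule_hom ::
  "('k::field, 'u, 'c) graded_module_scheme \<Rightarrow> ('u, 'm) graded_module \<Rightarrow> ('u, 'n) graded_module
     \<Rightarrow> ('m \<Rightarrow> 'n) set" where
  "supermodule_hom A M N =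
     {f. f \<in> carrier M \<rightarrow> carrier N \<and>
         (\<forall>x\<in>carrier M. \<forall>y\<in>carrier M. f (x \<oplus>\<^bsub>M\<^esub> y) = f x \<oplus>\<^bsub>N\<^esub> f y) \<and>
         (\<forall>a\<in>carrier A. \<forall>x\<in>carrier M. f (a \<odot>\<^bsub>M\<^esub> x) = a \<odot>\<^bsub>N\<^esub> f x) \<and>
         (\<forall>i. f ` hcomp M i \<subseteq> hcomp N i)}"

text \<open>Projectivity as the lifting property. The type arguments are the types of the elements of
  the test modules; being type variables in a theorem, they are universally quantified there.\<close>

definition projective_supermodule ::
  "'m itself \<Rightarrow> 'n itself \<Rightarrow> ('k::field, 'u, 'c) graded_module_scheme
     \<Rightarrow> ('u, 'q) graded_module \<Rightarrow> bool" where
  "projective_supermodule TM TN A P \<longleftrightarrow>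
     left_supermodule A P \<and>
     (\<forall>(M :: ('u, 'm) graded_module) (N :: ('u, 'n) graded_module) \<pi> f.
        left_supermodule A M \<and> left_supermodule A N \<and>
        \<pi> \<in> supermodule_hom A M N \<and> \<pi> ` carrier M = carrier N \<and> f \<in> supermodule_hom A P N
        \<longrightarrow> (\<exists>h\<in>supermodule_hom A P M. \<forall>x\<in>carrier P. \<pi> (h x) = f x))"

text \<open>The tensor product \<open>A \<otimes>\<^sub>B N\<close> for a ring homomorphism \<open>j : B \<rightarrow> A\<close> and a left \<open>B\<close>-module \<open>N\<close>,
  as a quotient of the free abelian group on \<open>A \<times> N\<close>.\<close>

definition tensor_relations ::
  "('k, 'u, 'c) graded_module_scheme \<Rightarrow> ('k, 'b, 'd) graded_module_scheme \<Rightarrow> ('b \<Rightarrow> 'u)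
     \<Rightarrow> ('b, 'n) graded_module \<Rightarrow> (('u \<times> 'n) \<Rightarrow>\<^sub>0 int) set" where
  "tensor_relations A B j N =
     {frag_of (a \<oplus>\<^bsub>A\<^esub> a', n) - frag_of (a, n) - frag_of (a', n)
        | a a' n. a \<in> carrier A \<and> a' \<in> carrier A \<and> n \<in> carrier N} \<union>
     {frag_of (a, n \<oplus>\<^bsub>N\<^esub> n') - frag_of (a, n) - frag_of (a, n')
        | a n n'. a \<in> carrier A \<and> n \<in> carrier N \<and> n' \<in> carrier N} \<union>
     {frag_of (a \<otimes>\<^bsub>A\<^esub> j b, n) - frag_of (a, b \<odot>\<^bsub>N\<^esub> n)
        | a b n. a \<in> carrier A \<and> b \<in> carrier B \<and> n \<in> carrier N}"

definition induced_module ::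
  "('k, 'u, 'c) graded_module_scheme \<Rightarrow> ('k, 'b, 'd) graded_module_scheme \<Rightarrow> ('b \<Rightarrow> 'u)
     \<Rightarrow> ('b, 'n) graded_module \<Rightarrow> ('u, (('u \<times> 'n) \<Rightarrow>\<^sub>0 int) set) graded_module" where
  "induced_module A B j N =
     (let G = free_Abelian_group (carrier A \<times> carrier N);
          T = generate G (tensor_relations A B j N) in
      \<lparr>carrier = carrier (G Mod T), mult = undefined, one = undefined,
       ring.zero = \<one>\<^bsub>G Mod T\<^esub>, add = mult (G Mod T),
       smult = (\<lambda>a q. \<Union>f\<in>q. T #>\<^bsub>G\<^esub> frag_extend (\<lambda>(a', n). frag_of (a \<otimes>\<^bsub>A\<^esub> a', n)) f),
       hcomp = (\<lambda>i. generate (G Mod T)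
                  {T #>\<^bsub>G\<^esub> frag_of (a, n) | a n s t. a \<in> hcomp A s \<and> n \<in> hcomp N t \<and> i = s + t})\<rparr>)"

definition Q_module ::
  "('k::field, 'g) lie_superalg \<Rightarrow> 'g set \<Rightarrow> ('g \<Rightarrow> 'k)
     \<Rightarrow> (('g list \<Rightarrow> 'k) set, ((('g list \<Rightarrow> 'k) set \<times> 'k) \<Rightarrow>\<^sub>0 int) set) graded_module" where
  "Q_module L S \<chi> =
     induced_module (reduced_env L \<chi>) (reduced_env (sub_lie L S) \<chi>) (env_incl L \<chi>) (char_module \<chi>)"


section \<open>Endomorphism superalgebra, opposite, matrices\<close>

definition super_endos ::
  "('k::field, 'u, 'c) graded_module_scheme \<Rightarrow> ('u, 'm) graded_module \<Rightarrow> bit \<Rightarrow> ('m \<Rightarrow> 'm) set" where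
  "super_endos A M i =
     {f \<in> carrier M \<rightarrow>\<^sub>E carrier M.
        (\<forall>x\<in>carrier M. \<forall>y\<in>carrier M. f (x \<oplus>\<^bsub>M\<^esub> y) = f x \<oplus>\<^bsub>M\<^esub> f y) \<and>
        (\<forall>j. f ` hcomp M j \<subseteq> hcomp M (i + j)) \<and>
        (\<forall>j. \<forall>u\<in>hcomp A j. \<forall>x\<in>carrier M.
           f (u \<odot>\<^bsub>M\<^esub> x) = (ksign i j \<odot>\<^bsub>A\<^esub> u) \<odot>\<^bsub>M\<^esub> f x)}"

definition End_superalgebra ::
  "('k::field, 'u, 'c) graded_module_scheme \<Rightarrow> ('u, 'm) graded_module
     \<Rightarrow> ('k, 'm \<Rightarrow> 'm) graded_module" where
  "End_superalgebra A M =
     \<lparr>carrier = {\<lambda>x\<in>carrier M. f x \<oplus>\<^bsub>M\<^esub> g x | f g. f \<in> super_endos A M 0 \<and> g \<in> super_endos A M 1},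
      mult = compose (carrier M),
      one = (\<lambda>x\<in>carrier M. x),
      ring.zero = (\<lambda>x\<in>carrier M. \<zero>\<^bsub>M\<^esub>),
      add = (\<lambda>f g. \<lambda>x\<in>carrier M. f x \<oplus>\<^bsub>M\<^esub> g x),
      smult = (\<lambda>c f. \<lambda>x\<in>carrier M. (c \<odot>\<^bsub>A\<^esub> \<one>\<^bsub>A\<^esub>) \<odot>\<^bsub>M\<^esub> f x),
      hcomp = super_endos A M\<rparr>"

definition hpart :: "('k, 'a, 'c) graded_module_scheme \<Rightarrow> bit \<Rightarrow> 'a \<Rightarrow> 'a" where
  "hpart A i a = (THE x. x \<in> hcomp A i \<and> (\<exists>y\<in>hcomp A (i + 1). a = x \<oplus>\<^bsub>A\<^esub> y))"

text \<open>On homogeneous elements the product is \<open>(-1)\<^bsup>|a||b|\<^esup> b a\<close>.\<close>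

definition opposite_superalgebra ::
  "('k::field, 'a) graded_module \<Rightarrow> ('k, 'a) graded_module" where
  "opposite_superalgebra A =
     A\<lparr>mult := (\<lambda>a b. finsum A
          (\<lambda>(i, j). ksign i j \<odot>\<^bsub>A\<^esub> (hpart A j b \<otimes>\<^bsub>A\<^esub> hpart A i a))
          ({0, 1} \<times> {0, 1}))\<rparr>"

definition matrix_algebra ::
  "nat \<Rightarrow> ('k, 'a, 'c) graded_module_scheme \<Rightarrow> ('k, nat \<times> nat \<Rightarrow> 'a) module" where
  "matrix_algebra d A =
     (let D = {..<d} \<times> {..<d} in
      \<lparr>carrier = D \<rightarrow>\<^sub>E carrier A,
       mult = (\<lambda>f g. \<lambda>(i, k)\<in>D. \<Oplus>\<^bsub>A\<^esub>j\<in>{..<d}. f (i, j) \<otimes>\<^bsub>A\<^esub> g (j, k)),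
       one = (\<lambda>(i, k)\<in>D. if i = k then \<one>\<^bsub>A\<^esub> else \<zero>\<^bsub>A\<^esub>),
       ring.zero = (\<lambda>(i, k)\<in>D. \<zero>\<^bsub>A\<^esub>),
       add = (\<lambda>f g. \<lambda>ik\<in>D. f ik \<oplus>\<^bsub>A\<^esub> g ik),
       smult = (\<lambda>c f. \<lambda>ik\<in>D. c \<odot>\<^bsub>A\<^esub> f ik)\<rparr>)"

definition algebra_iso ::
  "('k, 'a, 'c) module_scheme \<Rightarrow> ('k, 'b, 'd) module_scheme \<Rightarrow> bool" where
  "algebra_iso A B \<longleftrightarrow>
     (\<exists>h\<in>ring_iso A B. \<forall>c. \<forall>a\<in>carrier A. h (c \<odot>\<^bsub>A\<^esub> a) = c \<odot>\<^bsub>B\<^esub> h a)"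


section \<open>The matrix Lie superalgebras\<close>

text \<open>\<open>V = K\<^bsup>m|n\<^esup>\<close>: the first \<open>m\<close> coordinates are even, the remaining \<open>n\<close> odd.\<close>

definition par :: "nat \<Rightarrow> nat \<Rightarrow> bit" where
  "par m i = (if i < m then 0 else 1)"

definition vec_comp :: "nat \<Rightarrow> nat \<Rightarrow> bit \<Rightarrow> 'k::field vec set" where
  "vec_comp m n a = {v \<in> carrier_vec (m + n). \<forall>i<m + n. v $ i \<noteq> 0 \<longrightarrow> par m i = a}"

definition gl_comp :: "nat \<Rightarrow> nat \<Rightarrow> bit \<Rightarrow> 'k::field mat set" where
  "gl_comp m n a = {A \<in> carrier_mat (m + n) (m + n).
     \<forall>i<m + n. \<forall>j<m + n. A $$ (i, j) \<noteq> 0 \<longrightarrow> par m i = a + par m j}"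

definition supertrace :: "nat \<Rightarrow> 'k::field mat \<Rightarrow> 'k" where
  "supertrace m A = (\<Sum>i<dim_row A. if i < m then A $$ (i, i) else - A $$ (i, i))"

definition sl_comp :: "nat \<Rightarrow> nat \<Rightarrow> bit \<Rightarrow> 'k::field mat set" where
  "sl_comp m n a = {A \<in> gl_comp m n a. supertrace m A = 0}"

definition bilin :: "'k::field mat \<Rightarrow> 'k vec \<Rightarrow> 'k vec \<Rightarrow> 'k" where
  "bilin J v w = v \<bullet> (J *\<^sub>v w)"

text \<open>\<open>bilin J\<close> is even, nondegenerate, symmetric on the even and skew on the odd part.\<close>

definition osp_gram :: "nat \<Rightarrow> nat \<Rightarrow> 'k::field mat \<Rightarrow> bool" where
  "osp_gram m n J \<longleftrightarrow> J \<in> gl_comp m n 0 \<and> det J \<noteq> 0 \<and>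
     (\<forall>a b. \<forall>v\<in>vec_comp m n a. \<forall>w\<in>vec_comp m n b. bilin J v w = ksign a b * bilin J w v)"

definition osp_comp :: "nat \<Rightarrow> nat \<Rightarrow> 'k::field mat \<Rightarrow> bit \<Rightarrow> 'k mat set" where
  "osp_comp m n J a = {A \<in> gl_comp m n a.
     \<forall>b. \<forall>v\<in>vec_comp m n b. \<forall>w\<in>carrier_vec (m + n).
       bilin J (A *\<^sub>v v) w = - (ksign a b * bilin J v (A *\<^sub>v w))}"

definition mat_realized ::
  "nat \<Rightarrow> nat \<Rightarrow> (bit \<Rightarrow> 'k::field mat set) \<Rightarrow> ('g \<Rightarrow> 'k mat) \<Rightarrow> ('k, 'g) lie_superalg \<Rightarrow> bool" where
  "mat_realized m n C \<rho> L \<longleftrightarrow>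
     \<rho> \<in> LinearCombinations.module_hom class_ring L (module_mat TYPE('k) (m + n) (m + n)) \<and>
     inj_on \<rho> (carrier L) \<and> (\<forall>a. \<rho> ` hcomp L a = C a) \<and>
     (\<forall>a b. \<forall>x\<in>hcomp L a. \<forall>y\<in>hcomp L b.
        \<rho> (brk L x y) = \<rho> x * \<rho> y - ksign a b \<cdot>\<^sub>m (\<rho> y * \<rho> x)) \<and>
     (\<forall>x\<in>hcomp L 0. pmap L x \<in> hcomp L 0 \<and> \<rho> (pmap L x) = \<rho> x ^\<^sub>m CHAR('k))"

definition mat_nilpotent :: "'k::field mat \<Rightarrow> bool" where
  "mat_nilpotent A \<longleftrightarrow> (\<exists>k. A ^\<^sub>m k = 0\<^sub>m (dim_row A) (dim_row A))"

definition chain_basis ::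
  "nat \<Rightarrow> nat \<Rightarrow> 'k::field mat \<Rightarrow> 'k vec list \<Rightarrow> nat list \<Rightarrow> bool" where
  "chain_basis m n A ws ls \<longleftrightarrow>
     length ws = length ls \<and>
     (\<forall>i<length ws. (\<exists>a. ws ! i \<in> vec_comp m n a) \<and> ls ! i \<ge> 1 \<and>
        (A ^\<^sub>m (ls ! i)) *\<^sub>v (ws ! i) = 0\<^sub>v (m + n)) \<and>
     (let IJ = {(i, j). i < length ws \<and> j < ls ! i};
          b = (\<lambda>(i, j). (A ^\<^sub>m j) *\<^sub>v (ws ! i)) in
      inj_on b IJ \<and> kbasis (module_vec TYPE('k) (m + n)) (b ` IJ))"

definition chain_degree_space ::
  "nat \<Rightarrow> 'k::field mat \<Rightarrow> 'k vec list \<Rightarrow> nat list \<Rightarrow> int \<Rightarrow> 'k vec set" where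
  "chain_degree_space N A ws ls k =
     kspan (module_vec TYPE('k) N)
       {(A ^\<^sub>m j) *\<^sub>v (ws ! i) | i j. i < length ws \<and> j < ls ! i \<and> 2 * int j + 1 - int (ls ! i) = k}"

definition mat_degree_space ::
  "('k::field, 'g) lie_superalg \<Rightarrow> ('g \<Rightarrow> 'k mat) \<Rightarrow> (int \<Rightarrow> 'k vec set) \<Rightarrow> int \<Rightarrow> 'g set" where
  "mat_degree_space L \<rho> V k = {x \<in> carrier L. \<forall>l. \<forall>v\<in>V l. \<rho> x *\<^sub>v v \<in> V (l + k)}"


section \<open>The exceptional Lie superalgebras\<close>

text \<open>The split octonions as Zorn vector matrices: \<open>x = (a, u, v, b)\<close> with \<open>a = x$0\<close>, \<open>u = (x$1, x$2, x$3)\<close>,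
  \<open>v = (x$4, x$5, x$6)\<close>, \<open>b = x$7\<close>, and
  \<open>(a,u,v,b)(a',u',v',b') =
   (aa' + u.v', a u' + b' u - v\<times>v', a' v + b v' + u\<times>u', bb' + v.u')\<close>.\<close>

definition oct_mult :: "'k::field vec \<Rightarrow> 'k vec \<Rightarrow> 'k vec" where
  "oct_mult x y = vec_of_list
     [x$0 * y$0 + x$1 * y$4 + x$2 * y$5 + x$3 * y$6,
      x$0 * y$1 + x$1 * y$7 - (x$5 * y$6 - x$6 * y$5),
      x$0 * y$2 + x$2 * y$7 - (x$6 * y$4 - x$4 * y$6),
      x$0 * y$3 + x$3 * y$7 - (x$4 * y$5 - x$5 * y$4),
      x$4 * y$0 + x$7 * y$4 + (x$2 * y$3 - x$3 * y$2),
      x$5 * y$0 + x$7 * y$5 + (x$3 * y$1 - x$1 * y$3),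
      x$6 * y$0 + x$7 * y$6 + (x$1 * y$2 - x$2 * y$1),
      x$7 * y$7 + x$4 * y$1 + x$5 * y$2 + x$6 * y$3]"

definition oct_norm :: "'k::field vec \<Rightarrow> 'k" where
  "oct_norm x = x$0 * x$7 - (x$1 * x$4 + x$2 * x$5 + x$3 * x$6)"

definition oct_imag :: "'k::field vec set" where
  "oct_imag = {x \<in> carrier_vec 8. x$0 + x$7 = 0}"

definition oct_left :: "'k::field vec \<Rightarrow> 'k mat" where
  "oct_left x = mat 8 8 (\<lambda>(i, j). oct_mult x (unit_vec 8 j) $ i)"

text \<open>For \<open>x\<close> in the 7-dimensional space of trace-zero octonions, \<open>oct_left x\<close> squares to
  \<open>- oct_norm x\<close>. Thus \<open>K\<^sup>8\<close> is an irreducible module of the Clifford algebra of that quadratic space,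
  on which the even Clifford algebra acts faithfully as the algebra of all \<open>8 \<times> 8\<close> matrices. The
  commutators of the \<open>oct_left x\<close> span the image of \<open>so(7)\<close> in the spin representation. The
  Clifford conjugation is the adjoint for \<open>oct_norm\<close>, so that the spin group is as follows.\<close>

definition spin7_alg :: "'k::field mat set" where
  "spin7_alg = kspan (module_mat TYPE('k) 8 8)
     {oct_left x * oct_left y - oct_left y * oct_left x | x y. x \<in> oct_imag \<and> y \<in> oct_imag}"

definition spin7_group :: "'k::field mat set" where
  "spin7_group = {g \<in> carrier_mat 8 8.
     (\<forall>x\<in>carrier_vec 8. oct_norm (g *\<^sub>v x) = oct_norm x) \<and>
     (\<forall>x\<in>oct_imag. \<exists>y\<in>oct_imag. g * oct_left x = oct_left y * g)}"

text \<open>\<open>G\<^sub>2\<close> as derivations and automorphisms of the octonions, restricted to the trace-zero octonions;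
  the columns of \<open>oct_imag_basis\<close> are the basis \<open>e\<^sub>0 - e\<^sub>7, e\<^sub>1, \<dots>, e\<^sub>6\<close> of the latter.\<close>

definition oct_imag_basis :: "'k::field mat" where
  "oct_imag_basis = mat 8 7 (\<lambda>(i, j). if i = j then 1 else if i = 7 \<and> j = 0 then - 1 else 0)"

definition g2_alg :: "'k::field mat set" where
  "g2_alg = {A \<in> carrier_mat 7 7. \<exists>D\<in>carrier_mat 8 8.
     (\<forall>x\<in>carrier_vec 8. \<forall>y\<in>carrier_vec 8.
        D *\<^sub>v oct_mult x y = oct_mult (D *\<^sub>v x) y + oct_mult x (D *\<^sub>v y)) \<and>
     D * oct_imag_basis = oct_imag_basis * A}"

definition g2_group :: "'k::field mat set" where
  "g2_group = {A \<in> carrier_mat 7 7. \<exists>D\<in>carrier_mat 8 8. det D \<noteq> 0 \<and>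
     (\<forall>x\<in>carrier_vec 8. \<forall>y\<in>carrier_vec 8.
        D *\<^sub>v oct_mult x y = oct_mult (D *\<^sub>v x) (D *\<^sub>v y)) \<and>
     D * oct_imag_basis = oct_imag_basis * A}"

definition sl2_alg :: "'k::field mat set" where
  "sl2_alg = {A \<in> carrier_mat 2 2. A $$ (0, 0) + A $$ (1, 1) = 0}"

definition sl2_group :: "'k::field mat set" where
  "sl2_group = {A \<in> carrier_mat 2 2. det A = 1}"

text \<open>In the exceptional cases the even part is a direct sum of matrix Lie algebras, given by a list
  of triples (size \<open>N\<^sub>i\<close>, Lie algebra, simply connected group), and the odd part is the tensor product of
  the natural modules \<open>K\<^bsup>N\<^sub>i\<^esup>\<close>. A tensor is the function of its coordinates, indexed by lists.\<close>

type_synonym 'k factors = "(nat \<times> 'k mat set \<times> 'k mat set) list"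

definition D21_factors :: "'k::field factors" where
  "D21_factors = [(2, sl2_alg, sl2_group), (2, sl2_alg, sl2_group), (2, sl2_alg, sl2_group)]"

definition F4_factors :: "'k::field factors" where
  "F4_factors = [(8, spin7_alg, spin7_group), (2, sl2_alg, sl2_group)]"

definition G3_factors :: "'k::field factors" where
  "G3_factors = [(7, g2_alg, g2_group), (2, sl2_alg, sl2_group)]"

definition tensor_index :: "nat list \<Rightarrow> nat list set" where
  "tensor_index Ns = {js. length js = length Ns \<and> (\<forall>i<length Ns. js ! i < Ns ! i)}"

definition tensors :: "nat list \<Rightarrow> (nat list \<Rightarrow> 'k::field) set" where
  "tensors Ns = {T. \<forall>js. js \<notin> tensor_index Ns \<longrightarrow> T js = 0}"

definition pure_tensor :: "nat list \<Rightarrow> 'k::field vec list \<Rightarrow> nat list \<Rightarrow> 'k" where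
  "pure_tensor Ns vs js =
     (if js \<in> tensor_index Ns then \<Prod>i<length Ns. vs ! i $ (js ! i) else 0)"

definition slot_action ::
  "nat list \<Rightarrow> nat \<Rightarrow> 'k::field mat \<Rightarrow> (nat list \<Rightarrow> 'k) \<Rightarrow> nat list \<Rightarrow> 'k" where
  "slot_action Ns i A T js =
     (if js \<in> tensor_index Ns then \<Sum>k<Ns ! i. A $$ (js ! i, k) * T (js[i := k]) else 0)"

definition group_action ::
  "nat list \<Rightarrow> 'k::field mat list \<Rightarrow> (nat list \<Rightarrow> 'k) \<Rightarrow> nat list \<Rightarrow> 'k" where
  "group_action Ns gs T js =
     (if js \<in> tensor_index Ns
      then \<Sum>ks\<in>tensor_index Ns. (\<Prod>i<length Ns. gs ! i $$ (js ! i, ks ! i)) * T ks else 0)"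

definition exc_realized ::
  "'k::field factors \<Rightarrow> ('g \<Rightarrow> 'k mat list) \<Rightarrow> ('g \<Rightarrow> nat list \<Rightarrow> 'k)
     \<Rightarrow> ('k, 'g) lie_superalg \<Rightarrow> bool" where
  "exc_realized fs \<theta> \<tau> L \<longleftrightarrow>
     inj_on \<theta> (hcomp L 0) \<and>
     \<theta> ` hcomp L 0 = {As. length As = length fs \<and> (\<forall>i<length fs. As ! i \<in> fst (snd (fs ! i)))} \<and>
     inj_on \<tau> (hcomp L 1) \<and> \<tau> ` hcomp L 1 = tensors (map fst fs) \<and>
     (\<forall>x\<in>hcomp L 0. \<forall>y\<in>hcomp L 0. \<forall>c.
        \<theta> (x \<oplus>\<^bsub>L\<^esub> y) = map2 (+) (\<theta> x) (\<theta> y) \<and>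
        \<theta> (c \<odot>\<^bsub>L\<^esub> x) = map (\<lambda>A. c \<cdot>\<^sub>m A) (\<theta> x) \<and>
        \<theta> (brk L x y) = map2 (\<lambda>A B. A * B - B * A) (\<theta> x) (\<theta> y) \<and>
        pmap L x \<in> hcomp L 0 \<and> \<theta> (pmap L x) = map (\<lambda>A. A ^\<^sub>m CHAR('k)) (\<theta> x)) \<and>
     (\<forall>v\<in>hcomp L 1. \<forall>w\<in>hcomp L 1. \<forall>c.
        \<tau> (v \<oplus>\<^bsub>L\<^esub> w) = (\<lambda>js. \<tau> v js + \<tau> w js) \<and> \<tau> (c \<odot>\<^bsub>L\<^esub> v) = (\<lambda>js. c * \<tau> v js)) \<and>
     (\<forall>x\<in>hcomp L 0. \<forall>v\<in>hcomp L 1.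
        \<tau> (brk L x v) = (\<lambda>js. \<Sum>i<length fs. slot_action (map fst fs) i (\<theta> x ! i) (\<tau> v) js))"

definition sympl :: "'k::field vec \<Rightarrow> 'k vec \<Rightarrow> 'k" where
  "sympl v w = v$0 * w$1 - v$1 * w$0"

text \<open>The matrix of \<open>z \<mapsto> \<psi>(y,z)x - \<psi>(z,x)y\<close>.\<close>

definition sympl_mat :: "'k::field vec \<Rightarrow> 'k vec \<Rightarrow> 'k mat" where
  "sympl_mat x y = mat 2 2 (\<lambda>(a, b). sympl y (unit_vec 2 b) * x $ a - sympl (unit_vec 2 b) x * y $ a)"

definition D21_odd_bracket ::
  "'k::field \<Rightarrow> ('g \<Rightarrow> 'k mat list) \<Rightarrow> ('g \<Rightarrow> nat list \<Rightarrow> 'k) \<Rightarrow> ('k, 'g) lie_superalg \<Rightarrow> bool" where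
  "D21_odd_bracket \<alpha> \<theta> \<tau> L \<longleftrightarrow>
     (\<forall>v\<in>hcomp L 1. \<forall>w\<in>hcomp L 1. \<forall>vs ws.
        length vs = 3 \<and> length ws = 3 \<and> set vs \<subseteq> carrier_vec 2 \<and> set ws \<subseteq> carrier_vec 2 \<and>
        \<tau> v = pure_tensor [2, 2, 2] vs \<and> \<tau> w = pure_tensor [2, 2, 2] ws \<longrightarrow>
        (\<forall>i<3. \<theta> (brk L v w) ! i =
           ([1, \<alpha>, - 1 - \<alpha>] ! i * (\<Prod>j\<in>{..<3} - {i}. sympl (vs ! j) (ws ! j)))
             \<cdot>\<^sub>m sympl_mat (vs ! i) (ws ! i)))"


section \<open>Basic classical Lie superalgebras\<close>

text \<open>An identification of an abstract Lie superalgebra with a member of the list. \<open>GL\<close>, \<open>SL\<close> and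
  \<open>OSP\<close> carry the super dimension \<open>m|n\<close> of the natural module and the natural representation,
  \<open>OSP\<close> moreover the Gram matrix of the form on the natural module; the exceptional ones carry the
  identifications of the even and of the odd part.\<close>

datatype ('k, 'g) realization =
    GL nat nat "'g \<Rightarrow> 'k mat"
  | SL nat nat "'g \<Rightarrow> 'k mat"
  | OSP nat nat "'k mat" "'g \<Rightarrow> 'k mat"
  | D21 'k "'g \<Rightarrow> 'k mat list" "'g \<Rightarrow> nat list \<Rightarrow> 'k"
  | F4 "'g \<Rightarrow> 'k mat list" "'g \<Rightarrow> nat list \<Rightarrow> 'k"
  | G3 "'g \<Rightarrow> 'k mat list" "'g \<Rightarrow> nat list \<Rightarrow> 'k"

text \<open>The last argument is the fixed form on the Lie superalgebra: the supertrace form of the natural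
  module for the matrix superalgebras, any form with the required properties (unique up to a scalar)
  for the exceptional ones. \<open>OSP m (2n)\<close> with \<open>m, n \<ge> 1\<close> comprises \<open>B(m,n)\<close>, \<open>C(n)\<close> and \<open>D(m,n)\<close>.
  For \<open>F(4)\<close> and \<open>G(3)\<close> the odd bracket is determined up to isomorphism by simplicity.\<close>

fun basic_classical ::
  "('k::field, 'g) realization \<Rightarrow> ('k, 'g) lie_superalg \<Rightarrow> ('g \<Rightarrow> 'g \<Rightarrow> 'k) \<Rightarrow> bool" where
  "basic_classical (GL m n \<rho>) L B \<longleftrightarrow>
     CHAR('k) > 2 \<and> m \<ge> 1 \<and> n \<ge> 1 \<and> lie_superalgebra L \<and> mat_realized m n (gl_comp m n) \<rho> L \<and>
     (\<forall>x\<in>carrier L. \<forall>y\<in>carrier L. B x y = supertrace m (\<rho> x * \<rho> y))"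
| "basic_classical (SL m n \<rho>) L B \<longleftrightarrow>
     CHAR('k) > 2 \<and> m \<ge> 1 \<and> n \<ge> 1 \<and> \<not> int CHAR('k) dvd int m - int n \<and>
     lie_superalgebra L \<and> mat_realized m n (sl_comp m n) \<rho> L \<and>
     (\<forall>x\<in>carrier L. \<forall>y\<in>carrier L. B x y = supertrace m (\<rho> x * \<rho> y))"
| "basic_classical (OSP m n J \<rho>) L B \<longleftrightarrow>
     CHAR('k) > 2 \<and> m \<ge> 1 \<and> n \<ge> 1 \<and> even n \<and> osp_gram m n J \<and>
     lie_superalgebra L \<and> mat_realized m n (osp_comp m n J) \<rho> L \<and>
     (\<forall>x\<in>carrier L. \<forall>y\<in>carrier L. B x y = supertrace m (\<rho> x * \<rho> y))"
| "basic_classical (D21 \<alpha> \<theta> \<tau>) L B \<longleftrightarrow>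
     CHAR('k) > 3 \<and> \<alpha> \<noteq> 0 \<and> \<alpha> \<noteq> - 1 \<and> lie_superalgebra L \<and>
     exc_realized D21_factors \<theta> \<tau> L \<and> D21_odd_bracket \<alpha> \<theta> \<tau> L \<and> invariant_form L B"
| "basic_classical (F4 \<theta> \<tau>) L B \<longleftrightarrow>
     CHAR('k) > 15 \<and> lie_superalgebra L \<and> simple_lie L \<and>
     exc_realized F4_factors \<theta> \<tau> L \<and> invariant_form L B"
| "basic_classical (G3 \<theta> \<tau>) L B \<longleftrightarrow>
     CHAR('k) > 15 \<and> lie_superalgebra L \<and> simple_lie L \<and>
     exc_realized G3_factors \<theta> \<tau> L \<and> invariant_form L B"

fun nilpotent_element :: "('k::field, 'g) realization \<Rightarrow> 'g \<Rightarrow> bool" where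
  "nilpotent_element (GL m n \<rho>) X \<longleftrightarrow> mat_nilpotent (\<rho> X)"
| "nilpotent_element (SL m n \<rho>) X \<longleftrightarrow> mat_nilpotent (\<rho> X)"
| "nilpotent_element (OSP m n J \<rho>) X \<longleftrightarrow> mat_nilpotent (\<rho> X)"
| "nilpotent_element (D21 \<alpha> \<theta> \<tau>) X \<longleftrightarrow> (\<forall>A\<in>set (\<theta> X). mat_nilpotent A)"
| "nilpotent_element (F4 \<theta> \<tau>) X \<longleftrightarrow> (\<forall>A\<in>set (\<theta> X). mat_nilpotent A)"
| "nilpotent_element (G3 \<theta> \<tau>) X \<longleftrightarrow> (\<forall>A\<in>set (\<theta> X). mat_nilpotent A)"


section \<open>The grading\<close>

definition grading_properties ::
  "('k::field, 'g) lie_superalg \<Rightarrow> ('g \<Rightarrow> 'g \<Rightarrow> 'k) \<Rightarrow> 'g \<Rightarrow> (int \<Rightarrow> 'g set) \<Rightarrow> bool" where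
  "grading_properties L B X gr \<longleftrightarrow>
     internal_direct_sum L (carrier L) gr \<and>
     (\<forall>k l. \<forall>x\<in>gr k. \<forall>y\<in>gr l. brk L x y \<in> gr (k + l)) \<and>
     (\<forall>k. gr k = {x \<oplus>\<^bsub>L\<^esub> y | x y. x \<in> gr k \<inter> hcomp L 0 \<and> y \<in> gr k \<inter> hcomp L 1}) \<and>
     X \<in> gr 2 \<and>
     (\<forall>k l. k + l \<noteq> 0 \<longrightarrow> (\<forall>x\<in>gr k. \<forall>y\<in>gr l. B x y = 0)) \<and>
     internal_direct_sum L (centralizer L X) (\<lambda>k. centralizer L X \<inter> gr k) \<and>
     (\<forall>s<0. centralizer L X \<inter> gr s = {\<zero>\<^bsub>L\<^esub>}) \<and>
     (\<forall>i. kdim (L\<lparr>carrier := centralizer L X \<inter> hcomp L i\<rparr>) =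
          kdim (L\<lparr>carrier := gr 0 \<inter> hcomp L i\<rparr>) + kdim (L\<lparr>carrier := gr 1 \<inter> hcomp L i\<rparr>))"

text \<open>A cocharacter \<open>\<gamma> : K\<^sup>\<times> \<rightarrow> G\<close> into the product of the groups of \<open>fs\<close>: a homomorphism whose matrix
  entries are Laurent polynomials, the matrix \<open>C i k\<close> collecting the coefficients of \<open>t\<^sup>k\<close> in the
  \<open>i\<close>-th component. The derivative at 1 is then \<open>\<Sum>\<^sub>k k C i k\<close>.\<close>

definition cocharacter ::
  "'k::field factors \<Rightarrow> ('k \<Rightarrow> 'k mat list) \<Rightarrow> nat \<Rightarrow> (nat \<Rightarrow> int \<Rightarrow> 'k mat) \<Rightarrow> bool" where
  "cocharacter fs \<gamma> d C \<longleftrightarrow>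
     (\<forall>t. t \<noteq> 0 \<longrightarrow> length (\<gamma> t) = length fs) \<and>
     (\<forall>i<length fs. \<forall>t. t \<noteq> 0 \<longrightarrow>
        \<gamma> t ! i \<in> snd (snd (fs ! i)) \<and>
        \<gamma> t ! i = mat (fst (fs ! i)) (fst (fs ! i))
                    (\<lambda>ab. \<Sum>k\<in>{- int d..int d}. t powi k * C i k $$ ab) \<and>
        (\<forall>s. s \<noteq> 0 \<longrightarrow> \<gamma> (s * t) ! i = \<gamma> s ! i * \<gamma> t ! i))"

definition cochar_derivative ::
  "'k::field factors \<Rightarrow> nat \<Rightarrow> (nat \<Rightarrow> int \<Rightarrow> 'k mat) \<Rightarrow> 'k mat list" where
  "cochar_derivative fs d C =
     map (\<lambda>i. mat (fst (fs ! i)) (fst (fs ! i))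
                (\<lambda>ab. \<Sum>k\<in>{- int d..int d}. of_int k * C i k $$ ab)) [0..<length fs]"

text \<open>\<open>{z. Ad(\<gamma>(t)) z = t\<^sup>k z for all t}\<close>; \<open>Ad\<close> acts by conjugation on the even part and through the
  tensor product of the natural representations on the odd part.\<close>

definition exc_degree_space ::
  "'k::field factors \<Rightarrow> ('g \<Rightarrow> 'k mat list) \<Rightarrow> ('g \<Rightarrow> nat list \<Rightarrow> 'k) \<Rightarrow> ('k, 'g) lie_superalg
     \<Rightarrow> ('k \<Rightarrow> 'k mat list) \<Rightarrow> int \<Rightarrow> 'g set" where
  "exc_degree_space fs \<theta> \<tau> L \<gamma> k =
     {x \<oplus>\<^bsub>L\<^esub> v | x v. x \<in> hcomp L 0 \<and> v \<in> hcomp L 1 \<and>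
        (\<forall>t. t \<noteq> 0 \<longrightarrow>
           (\<forall>i<length fs. \<gamma> t ! i * \<theta> x ! i * \<gamma> (inverse t) ! i = (t powi k) \<cdot>\<^sub>m (\<theta> x ! i)) \<and>
           group_action (map fst fs) (\<gamma> t) (\<tau> v) = (\<lambda>js. t powi k * \<tau> v js))}"

definition exc_grading ::
  "'k::field factors \<Rightarrow> ('g \<Rightarrow> 'k mat list) \<Rightarrow> ('g \<Rightarrow> nat list \<Rightarrow> 'k) \<Rightarrow> ('k, 'g) lie_superalg
     \<Rightarrow> ('g \<Rightarrow> 'g \<Rightarrow> 'k) \<Rightarrow> 'g \<Rightarrow> (int \<Rightarrow> 'g set) \<Rightarrow> bool" where
  "exc_grading fs \<theta> \<tau> L B X gr \<longleftrightarrow>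
     (\<exists>H\<in>hcomp L 0. \<exists>Y\<in>hcomp L 0. \<exists>\<gamma> d C.
        brk L H X = 2 \<odot>\<^bsub>L\<^esub> X \<and> brk L H Y = (- 2) \<odot>\<^bsub>L\<^esub> Y \<and> brk L X Y = H \<and>
        cocharacter fs \<gamma> d C \<and>
        {map (\<lambda>A. c \<cdot>\<^sub>m A) (\<theta> H) | c. True} =
          {map (\<lambda>A. c \<cdot>\<^sub>m A) (cochar_derivative fs d C) | c. True} \<and>
        gr = exc_degree_space fs \<theta> \<tau> L \<gamma> \<and>
        grading_properties L B X gr)"

definition mat_grading ::
  "nat \<Rightarrow> nat \<Rightarrow> ('g \<Rightarrow> 'k::field mat) \<Rightarrow> ('k, 'g) lie_superalg \<Rightarrow> 'g
     \<Rightarrow> ((int \<Rightarrow> 'k vec set) \<Rightarrow> bool) \<Rightarrow> (int \<Rightarrow> 'g set) \<Rightarrow> bool" where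
  "mat_grading m n \<rho> L X P gr \<longleftrightarrow>
     (\<exists>ws ls. chain_basis m n (\<rho> X) ws ls \<and>
        (let V = chain_degree_space (m + n) (\<rho> X) ws ls in
         P V \<and> gr = mat_degree_space L \<rho> V))"

fun grading_for ::
  "('k::field, 'g) realization \<Rightarrow> ('k, 'g) lie_superalg \<Rightarrow> ('g \<Rightarrow> 'g \<Rightarrow> 'k) \<Rightarrow> 'g
     \<Rightarrow> (int \<Rightarrow> 'g set) \<Rightarrow> bool" where
  "grading_for (GL m n \<rho>) L B X gr = mat_grading m n \<rho> L X (\<lambda>V. True) gr"
| "grading_for (SL m n \<rho>) L B X gr = mat_grading m n \<rho> L X (\<lambda>V. True) gr"
| "grading_for (OSP m n J \<rho>) L B X gr =
     mat_grading m n \<rho> L X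
       (\<lambda>V. \<forall>k l. k + l \<noteq> 0 \<longrightarrow> (\<forall>v\<in>V k. \<forall>w\<in>V l. bilin J v w = 0)) gr"
| "grading_for (D21 \<alpha> \<theta> \<tau>) L B X gr = exc_grading D21_factors \<theta> \<tau> L B X gr"
| "grading_for (F4 \<theta> \<tau>) L B X gr = exc_grading F4_factors \<theta> \<tau> L B X gr"
| "grading_for (G3 \<theta> \<tau>) L B X gr = exc_grading G3_factors \<theta> \<tau> L B X gr"


section \<open>The subalgebra \<open>m\<close>\<close>

definition isotropic_subspace ::
  "('k::field, 'g) lie_superalg \<Rightarrow> ('g \<Rightarrow> 'k) \<Rightarrow> 'g set \<Rightarrow> 'g set \<Rightarrow> bool" where
  "isotropic_subspace L \<chi> W E \<longleftrightarrow>
     ksubspace E L \<and> E \<subseteq> W \<and> (\<forall>x\<in>E. \<forall>y\<in>E. \<chi> (brk L x y) = 0)"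

text \<open>The list \<open>vs\<close> is indexed from 0, so \<open>i + j = r + 1\<close> becomes \<open>i + j + 1 = r\<close>.\<close>

definition associated_m ::
  "('k::field, 'g) lie_superalg \<Rightarrow> ('g \<Rightarrow> 'k) \<Rightarrow> (int \<Rightarrow> 'g set) \<Rightarrow> 'g set \<Rightarrow> bool" where
  "associated_m L \<chi> gr S \<longleftrightarrow>
     (\<exists>E vs.
        isotropic_subspace L \<chi> (gr (- 1) \<inter> hcomp L 0) E \<and>
        (\<forall>E'. isotropic_subspace L \<chi> (gr (- 1) \<inter> hcomp L 0) E' \<and> E \<subseteq> E' \<longrightarrow> E' = E) \<and>
        distinct vs \<and> set vs \<subseteq> gr (- 1) \<inter> hcomp L 1 \<and>
        kbasis (L\<lparr>carrier := gr (- 1) \<inter> hcomp L 1\<rparr>) (set vs) \<and>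
        (\<forall>i<length vs. \<forall>j<length vs.
           \<chi> (brk L (vs ! i) (vs ! j)) = (if i + j + 1 = length vs then 1 else 0)) \<and>
        S = kspan L ((\<Union>k\<in>{2..}. gr (- k)) \<union> E \<union> set (take (length vs div 2) vs)))"

end

theory Submission imports Defs begin

text \<open>
  Let \<open>z\<^sub>1, \<dots>, z\<^sub>s\<close> be a homogeneous basis of the subalgebra \<open>m\<close>, with \<open>z\<^sub>i\<close> of degree \<open>- d\<^sub>i\<close>. Injectivity of \<open>ad X\<close> in
  negative degrees and nondegeneracy of the form yield homogeneous \<open>u\<^sub>j\<close> of degree \<open>d\<^sub>j - 2\<close> with
  \<open>\<chi>([z\<^sub>i, u\<^sub>j]) = \<delta>\<^sub>i\<^sub>j\<close>. Put \<open>\<zeta>\<^sub>i = z\<^sub>i - \<chi>(z\<^sub>i)\<close>. The \<open>\<zeta>\<^sub>i\<close> act on the ordered monomials in the \<open>u\<^sub>j\<close>, modulo the left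
  ideal generated by the \<open>\<zeta>\<^sub>i\<close> and up to terms of lower weight, like partial derivatives. Hence there are an even
  idempotent \<open>e\<close> with \<open>\<zeta>\<^sub>i e = 0\<close> for all \<open>i\<close> and \<open>1 - e\<close> in that left ideal, and elements \<open>p\<^sub>a, q\<^sub>a\<close>, one for each
  ordered monomial in the \<open>z\<^sub>i\<close> with exponents below \<open>p\<close> (even \<open>z\<^sub>i\<close>) or 2 (odd \<open>z\<^sub>i\<close>), with \<open>e p\<^sub>a = p\<^sub>a\<close>,
  \<open>p\<^sub>a q\<^sub>b e = \<delta>\<^sub>a\<^sub>b e\<close> and \<open>\<Sum>\<^sub>a q\<^sub>a p\<^sub>a = 1\<close>. So \<open>Q \<cong> U e\<close> is projective with endomorphism algebra \<open>(e U e)\<^sup>o\<^sup>p\<close>, and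
  \<open>U \<cong> M\<^sub>\<delta>(e U e)\<close>. No basis theorem for \<open>U\<close> is needed: the same argument shows that those
  monomials in the \<open>z\<^sub>i\<close> are linearly independent unless \<open>U = 0\<close>.
\<close>

section \<open>Monomial bases of quotients of associative algebras\<close>

text \<open>The differentiation property rests on the Kazhdan weight, which gives an element of
  degree \<open>k\<close> the weight \<open>k + 2\<close>. For \<open>d j \<le> d i\<close> the
  bracket of \<open>z i\<close> and \<open>u j\<close> has degree at most -2, so it lies in the
  subalgebra and acts as its \<chi>-value up to lower weight; and words of negative weight fall into
  the left ideal. Hence \<zeta>-monomials pair with \<open>u\<close>-monomials in a matrix that is
  triangular for the order by weight, then lexicographic, with products of factorials of exponents
  below p on the diagonal. Back substitution gives the elements p; the q are the
  \<open>u\<close>-monomials. A generator is a multiple of the top \<zeta>-monomial times the top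
  \<open>u\<close>-monomial, made even by averaging with the parity automorphism. Each family must
  supply two facts: \<chi>([x, y]) has no kernel in negative degrees, and the p-map takes degrees at
  most -d to degrees at most -pd, which controls the p-th powers of the \<zeta>'s. The second is
  read off matrix powers in a Jordan basis or, for the exceptional algebras, off Laurent degrees
  along the cocharacter.\<close>

inductive_set lspan :: "('k::field => 'a::ring_1) => 'a set => 'a set => 'a set"
 for sc :: "'k => 'a" and B G :: "'a set" where
 base: "x \<in> B ==> x \<in> lspan sc B G"
| gen: "x \<in> G ==> x \<in> lspan sc B G"
| add: "x \<in> lspan sc B G ==> y \<in> lspan sc B G ==> x + y \<in> lspan sc B G"
| scale: "x \<in> lspan sc B G ==> sc c * x \<in> lspan sc B G"

lemma lspan_mono: "x \<in> lspan sc B G ==> G \<subseteq> H ==> x \<in> lspan sc B H"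
 by (induction rule: lspan.induct) (auto intro: lspan.intros)

locale quotient_algebra =
 fixes sc :: "'k::field => 'a::ring_1" and R I :: "'a set"
 assumes sc_add: "sc (a + b) = sc a + sc b" and sc_mult: "sc (a * b) = sc a * sc b"
  and sc_1: "sc 1 = 1" and sc_commute: "sc c * x = x * sc c" and sc_R: "sc c \<in> R"
  and R_add: "[|x \<in> R; y \<in> R|] ==> x + y \<in> R" and R_mult: "[|x \<in> R; y \<in> R|] ==> x * y \<in> R"
  and I_R: "I \<subseteq> R" and I_0: "0 \<in> I" and I_add: "[|x \<in> I; y \<in> I|] ==> x + y \<in> I"
  and I_left: "[|x \<in> R; y \<in> I|] ==> x * y \<in> I" and I_right: "[|y \<in> I; x \<in> R|] ==> y * x \<in> I"
begin

lemma sc_0: "sc 0 = 0" using sc_add[of 0 0] by simp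
lemma sc_minus: "sc (- a) = - sc a" using sc_add[of "- a" a] by (simp add: sc_0 eq_neg_iff_add_eq_0)
lemma sc_minus1: "sc (- 1) * x = - x" by (simp add: sc_minus sc_1)
lemma sc_left_commute: "x * (sc c * y) = sc c * (x * y)" by (metis mult.assoc sc_commute)
lemma sc_inverse: "c \<noteq> 0 ==> sc (1 / c) * (sc c * x) = x"
 by (simp add: mult.assoc[symmetric] sc_mult[symmetric] sc_1)

lemma sc_of_nat: "sc (of_nat n) = of_nat n" by (induction n) (auto simp: sc_0 sc_1 sc_add)

lemma R_0: "0 \<in> R" using sc_R[of 0] by (simp add: sc_0)
lemma R_1: "1 \<in> R" using sc_R[of 1] by (simp add: sc_1)
lemma R_minus: "x \<in> R ==> - x \<in> R" using R_mult[OF sc_R, of x "- 1"] by (simp add: sc_minus1)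
lemma R_diff: "x \<in> R ==> y \<in> R ==> x - y \<in> R" using R_add[OF _ R_minus, of x y] by simp
lemma R_power: "x \<in> R ==> x ^ n \<in> R" by (induction n) (auto intro: R_1 R_mult)
lemma R_sum: "(\<And>a. a \<in> A ==> f a \<in> R) ==> sum f A \<in> R"
 by (induction A rule: infinite_finite_induct) (auto intro: R_0 R_add)
lemma R_prod_list: "(\<And>x. x \<in> set xs ==> f x \<in> R) ==> prod_list (map f xs) \<in> R"
 by (induction xs) (auto intro: R_1 R_mult)

lemma I_minus: "x \<in> I ==> - x \<in> I" using I_left[OF sc_R, of x "- 1"] by (simp add: sc_minus1)
lemma I_diff: "x \<in> I ==> y \<in> I ==> x - y \<in> I" using I_add[OF _ I_minus, of x y] by simp
lemma I_sum: "(\<And>a. a \<in> A ==> f a \<in> I) ==> sum f A \<in> I"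
 by (induction A rule: infinite_finite_induct) (auto intro: I_0 I_add)
lemma I_cancel: "x - y \<in> I ==> y \<in> I ==> x \<in> I" using I_add[of "x - y" y] by simp
lemma I_trans: "x - y \<in> I ==> y - z \<in> I ==> x - z \<in> I" using I_add[of "x - y" "y - z"] by simp
lemma I_sym: "x - y \<in> I ==> y - x \<in> I" using I_minus[of "x - y"] by simp

abbreviation Sp :: "'a set => 'a set" where "Sp \<equiv> lspan sc I"

lemma lspan_minus: "x \<in> lspan sc B G ==> - x \<in> lspan sc B G"
 by (drule lspan.scale[where c = "- 1"]) (simp add: sc_minus1)
lemma lspan_diff: "x \<in> lspan sc B G ==> y \<in> lspan sc B G ==> x - y \<in> lspan sc B G"
 by (drule lspan_minus[of y], drule (1) lspan.add) simp
lemma lspan_cancel: "x - y \<in> lspan sc B G ==> y \<in> lspan sc B G ==> x \<in> lspan sc B G"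
 using lspan.add[of "x - y" sc B G y] by simp

lemma lspan_left:
 assumes "x \<in> lspan sc B G" and "\<And>y. y \<in> B ==> r * y \<in> lspan sc B' H"
  and "\<And>g. g \<in> G ==> r * g \<in> lspan sc B' H"
 shows "r * x \<in> lspan sc B' H"
 using assms(1)
 by (induction rule: lspan.induct)
  (auto simp: assms(2,3) distrib_left sc_left_commute intro: lspan.intros)

lemma lspan_right:
 assumes "x \<in> lspan sc B G" and "\<And>y. y \<in> B ==> y * r \<in> lspan sc B' H"
  and "\<And>g. g \<in> G ==> g * r \<in> lspan sc B' H"
 shows "x * r \<in> lspan sc B' H"
 using assms(1)
 by (induction rule: lspan.induct)
  (auto simp: assms(2,3) distrib_right mult.assoc intro: lspan.intros)

lemma lspan_empty: "x \<in> Sp {} ==> x \<in> I"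
 by (induction rule: lspan.induct) (auto intro: I_add I_left sc_R)

lemma lspan_R: "x \<in> Sp G ==> G \<subseteq> R ==> x \<in> R"
 by (induction rule: lspan.induct) (use I_R in \<open>auto intro: R_add R_mult sc_R\<close>)

text \<open>Explicit coefficients are extracted only here, for the dimension count. Elsewhere
  membership in \<open>lspan\<close>, the span of \<open>G\<close> modulo \<open>B\<close>, is
  pushed through products by its induction rule.\<close>

lemma lspan_coeff:
 assumes "x \<in> Sp (f ` A)" and "finite A"
 shows "\<exists>c. x - (\<Sum>a\<in>A. sc (c a) * f a) \<in> I"
 using assms(1)
proof (induction rule: lspan.induct)
 case (base x)
 then show ?case by (intro exI[of _ "\<lambda>_. 0"]) (simp add: sc_0)
next
 case (gen x)
 then obtain b where "b \<in> A" "x = f b" by auto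
 then have "(\<Sum>a\<in>A. sc (if a = b then 1 else 0) * f a) = x"
  using assms(2) by (simp add: if_distrib[of sc] sc_0 sc_1 if_distrib[of "\<lambda>c. c * _"] cong: if_cong)
 then show ?case by (intro exI[of _ "\<lambda>a. if a = b then 1 else 0"]) (simp add: I_0)
next
 case (add x y)
 then obtain c c' where "x - (\<Sum>a\<in>A. sc (c a) * f a) \<in> I" "y - (\<Sum>a\<in>A. sc (c' a) * f a) \<in> I" by auto
 from I_add[OF this] show ?case
  by (intro exI[of _ "\<lambda>a. c a + c' a"]) (simp add: sc_add distrib_right sum.distrib algebra_simps)
next
 case (scale x e)
 then obtain c where "x - (\<Sum>a\<in>A. sc (c a) * f a) \<in> I" by auto
 from I_left[OF sc_R[of e] this] show ?case
  by (intro exI[of _ "\<lambda>a. e * c a"]) (simp add: sc_mult right_diff_distrib sum_distrib_left mult.assoc)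
qed

end

section \<open>Straightening ordered monomials in weighted generators\<close>

locale pbw = quotient_algebra sc R I for sc :: "'k::field => 'a::ring_1" and R I +
 fixes \<zeta> :: "nat => 'a" and d bd :: "nat => nat" and \<epsilon> :: "nat => nat => 'k" and s :: nat
 assumes \<zeta>_R: "i < s ==> \<zeta> i \<in> R" and d_pos: "i < s ==> d i \<ge> 1"
  and d_sorted: "[|i \<le> j; j < s|] ==> d j \<le> d i" and bd_ge: "i < s ==> bd i \<ge> 2"
  and swap: "[|i < s; j < s|] ==>
    \<zeta> i * \<zeta> j - sc (\<epsilon> i j) * (\<zeta> j * \<zeta> i) \<in> lspan sc I (\<zeta> ` {l. l < s \<and> d i + d j \<le> d l})"
  and pow: "i < s ==> \<zeta> i ^ bd i \<in> lspan sc I (\<zeta> ` {l. l < s \<and> bd i * d i \<le> d l})"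
begin

text \<open>Larger indices stand on the left. Since \<open>d\<close> does not increase with the
  index, every correction term produced by \<open>swap\<close> or \<open>pow\<close> at index
  \<open>k\<close> has weight above \<open>d k\<close>, hence index below \<open>k\<close> (see
  \<open>above\<close>), and can be moved further to the right by induction on
  \<open>k\<close>.\<close>

fun zmon :: "nat => (nat => nat) => 'a" where
 "zmon 0 a = 1"
| "zmon (Suc k) a = \<zeta> k ^ a k * zmon k a"

definition wt :: "nat => (nat => nat) => nat" where "wt k a = (\<Sum>i<k. a i * d i)"

definition box :: "nat => (nat => nat) set" where
 "box k = {a. \<forall>i. (i < k \<longrightarrow> a i < bd i) \<and> (k \<le> i \<longrightarrow> a i = 0)}"

definition Mk :: "nat => nat => 'a set" where
 "Mk k W = Sp {zmon k a | a. a \<in> box k \<and> W \<le> wt k a}"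

text \<open>Also bounds the exponent of the last generator: another \<open>\<zeta> k\<close> may be
  put in front without rewriting as long as the new exponent stays below
  \<open>bd k\<close>.\<close>

definition Nk :: "nat => nat => nat => 'a set" where
 "Nk k c W = Sp {zmon (Suc k) a | a. a \<in> box (Suc k) \<and> a k \<le> c \<and> W \<le> wt (Suc k) a}"

lemma zmon_cong: "(\<And>i. i < k ==> a i = b i) ==> zmon k a = zmon k b"
 by (induction k) auto

lemma wt_cong: "(\<And>i. i < k ==> a i = b i) ==> wt k a = wt k b"
 by (auto simp: wt_def)

lemma wt_Suc: "wt (Suc k) a = wt k a + a k * d k" by (simp add: wt_def)

lemma zmon_R: "k \<le> s ==> zmon k a \<in> R"
 by (induction k) (auto intro!: R_1 R_mult R_power \<zeta>_R)

lemma zmon_zero: "zmon k (\<lambda>_. 0) = 1" by (induction k) auto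

lemma Mk_R: "k \<le> s ==> x \<in> Mk k W ==> x \<in> R"
 unfolding Mk_def by (erule lspan_R) (auto intro: zmon_R)

lemma finite_box: "finite (box k)"
proof -
 define n where "n = Max (insert 0 (bd ` {..<k}))"
 have "bd i \<le> n" if "i < k" for i using that by (auto simp: n_def intro: Max_ge)
 then have "box k \<subseteq> {a. \<forall>i. (i \<in> {..<k} \<longrightarrow> a i \<in> {..n}) \<and> (i \<notin> {..<k} \<longrightarrow> a i = 0)}"
  by (auto simp: box_def) (meson less_le_trans less_imp_le)
 then show ?thesis by (rule finite_subset) (rule finite_set_of_finite_funs; simp)
qed

lemma Mk_mono: "x \<in> Mk k W ==> W' \<le> W ==> x \<in> Mk k W'"
 unfolding Mk_def by (erule lspan_mono) (auto intro: order_trans)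

lemma Nk_mono: "x \<in> Nk k c W ==> W' \<le> W ==> c \<le> c' ==> x \<in> Nk k c' W'"
 unfolding Nk_def by (erule lspan_mono) (auto intro: order_trans)

lemma Mk_Nk: "k < s ==> x \<in> Mk k W ==> x \<in> Nk k 0 W"
 unfolding Mk_def Nk_def
proof (erule lspan_mono, clarify)
 fix a assume "k < s" and a: "a \<in> box k" "W \<le> wt k a"
 then have "a k = 0" "a \<in> box (Suc k)" using bd_ge[of k] by (auto simp: box_def less_Suc_eq Suc_le_eq)
 then show "\<exists>b. zmon k a = zmon (Suc k) b \<and> b \<in> box (Suc k) \<and> b k \<le> 0 \<and> W \<le> wt (Suc k) b"
  using a by (intro exI[of _ a]) (auto simp: wt_Suc)
qed

lemma Nk_Mk: "x \<in> Nk k c W ==> x \<in> Mk (Suc k) W"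
 unfolding Mk_def Nk_def by (erule lspan_mono) auto

lemma Nk_mult:
 assumes "x \<in> Nk k c W" and "Suc c < bd k" and "k < s"
 shows "\<zeta> k * x \<in> Nk k (Suc c) (W + d k)"
 using assms(1) unfolding Nk_def
proof (rule lspan_left)
 fix g assume "g \<in> {zmon (Suc k) a |a. a \<in> box (Suc k) \<and> a k \<le> c \<and> W \<le> wt (Suc k) a}"
 then obtain a where a: "g = zmon (Suc k) a" "a \<in> box (Suc k)" "a k \<le> c" "W \<le> wt (Suc k) a" by auto
 let ?b = "a(k := Suc (a k))"
 have "zmon k ?b = zmon k a" "wt k ?b = wt k a" by (auto intro: zmon_cong wt_cong)
 then have "\<zeta> k * g = zmon (Suc k) ?b" "wt (Suc k) ?b = wt (Suc k) a + d k"
  using a by (auto simp: mult.assoc wt_Suc)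
 moreover have "?b \<in> box (Suc k)" using a assms by (auto simp: box_def)
 ultimately show "\<zeta> k * g \<in> Sp {zmon (Suc k) a |a. a \<in> box (Suc k) \<and> a k \<le> Suc c \<and> W + d k \<le> wt (Suc k) a}"
  using a by (intro lspan.gen CollectI exI[of _ ?b]) auto
qed (auto intro: lspan.base I_left \<zeta>_R assms)

lemma above: "k < s ==> l < s ==> d k < d l ==> l < k"
 using d_sorted[of k l] by (meson not_le)

text \<open>Straightening never lowers the weight. The outer induction is on the number of
  generators; an inner induction on the exponent carries \<open>\<zeta> i\<close> past the power of
  \<open>\<zeta> k\<close>, after which the outer hypothesis takes over.\<close>

lemma zeta_Mk: "k \<le> s ==> i < k ==> x \<in> Mk k W ==> \<zeta> i * x \<in> Mk k (W + d i)"
proof (induction k arbitrary: i x W)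
 case 0
 then show ?case by simp
next
 case (Suc k)
 have k: "k < s" "k \<le> s" using Suc.prems by auto
 \<comment> \<open>The exponent bound \<open>c\<close> in the conclusion guarantees that putting
   \<open>\<zeta> k\<close> back in front stays inside the box, so that \<open>pow\<close> is not
   called here. The index \<open>i\<close> stays general because the corrections from
   \<open>swap\<close> bring in other generators.\<close>
 have *: "c < bd k ==> i < k ==> x \<in> Mk k W ==> \<zeta> i * (\<zeta> k ^ c * x) \<in> Nk k c (W + c * d k + d i)" for c i x W
 proof (induction c arbitrary: i)
  case 0
  then show ?case using Suc.IH[OF k(2)] Mk_Nk k by simp
 next
  case (Suc c)
  define y where "y = \<zeta> k ^ c * x"
  have y: "y \<in> R" unfolding y_def using Suc k by (intro R_mult R_power \<zeta>_R Mk_R[of k x W]) auto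
  have iss: "i < s" using Suc k by simp
  have 1: "(\<zeta> i * \<zeta> k - sc (\<epsilon> i k) * (\<zeta> k * \<zeta> i)) * y \<in> Nk k (Suc c) (W + Suc c * d k + d i)"
   unfolding Nk_def
  proof (rule lspan_right[OF swap[OF iss k(1)]])
   fix g assume "g \<in> \<zeta> ` {l. l < s \<and> d i + d k \<le> d l}"
   then obtain l where l: "g = \<zeta> l" "l < s" "d i + d k \<le> d l" by auto
   then have "l < k" using above[OF k(1) l(2)] d_pos[OF iss] by auto
   then have "g * y \<in> Nk k c (W + c * d k + d l)" unfolding y_def l(1) using Suc.IH Suc.prems by simp
   then have "g * y \<in> Nk k (Suc c) (W + Suc c * d k + d i)" by (rule Nk_mono) (use l in auto)
   then show "g * y \<in> Sp {zmon (Suc k) a |a. a \<in> box (Suc k) \<and> a k \<le> Suc c \<and> W + Suc c * d k + d i \<le> wt (Suc k) a}"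
    by (simp add: Nk_def)
  qed (auto intro: lspan.base I_right y)
  have "\<zeta> i * y \<in> Nk k c (W + c * d k + d i)" unfolding y_def using Suc by simp
  from Nk_mult[OF this _ k(1)] have "\<zeta> k * (\<zeta> i * y) \<in> Nk k (Suc c) (W + Suc c * d k + d i)"
   using Suc.prems by (simp add: algebra_simps)
  then have 2: "sc (\<epsilon> i k) * (\<zeta> k * (\<zeta> i * y)) \<in> Nk k (Suc c) (W + Suc c * d k + d i)"
   unfolding Nk_def by (rule lspan.scale)
  have "\<zeta> i * (\<zeta> k ^ Suc c * x) = (\<zeta> i * \<zeta> k - sc (\<epsilon> i k) * (\<zeta> k * \<zeta> i)) * y + sc (\<epsilon> i k) * (\<zeta> k * (\<zeta> i * y))"
   by (simp add: y_def left_diff_distrib mult.assoc)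
  then show ?case using 1 2 by (simp add: Nk_def lspan.add)
 qed
 show ?case using Suc.prems(3) unfolding Mk_def
 proof (rule lspan_left)
  fix g assume "g \<in> {zmon (Suc k) a |a. a \<in> box (Suc k) \<and> W \<le> wt (Suc k) a}"
  then obtain a where a: "g = zmon (Suc k) a" "a \<in> box (Suc k)" "W \<le> wt (Suc k) a" by auto
  have ak: "a k < bd k" using a by (auto simp: box_def)
  have m: "zmon k a \<in> Mk k (wt k a)" unfolding Mk_def
  proof (rule lspan.gen, intro CollectI exI[of _ "a(k := 0)"] conjI)
   show "zmon k a = zmon k (a(k := 0))" by (rule zmon_cong) auto
   show "a(k := 0) \<in> box k" using a by (auto simp: box_def)
   show "wt k a \<le> wt k (a(k := 0))" by (rule eq_refl, rule wt_cong) auto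
  qed
  have "\<zeta> i * g \<in> Mk (Suc k) (W + d i)"
  proof (cases "i = k")
   case False
   then have "\<zeta> i * (\<zeta> k ^ a k * zmon k a) \<in> Nk k (a k) (wt k a + a k * d k + d i)"
    using *[OF ak _ m] Suc.prems by simp
   then show ?thesis using a by (auto simp: wt_Suc intro: Mk_mono Nk_Mk)
  next
   case ik: True
   show ?thesis
   proof (cases "Suc (a k) < bd k")
    case True
    have "g \<in> Nk k (a k) (wt (Suc k) a)" unfolding Nk_def using a by (intro lspan.gen) auto
    from Nk_mult[OF this True k(1)] show ?thesis using a ik by (auto intro: Mk_mono Nk_Mk)
   next
    case False
    then have bd: "bd k = Suc (a k)" using ak by simp
    \<comment> \<open>The exponent overflows. The full power is traded for generators of weight at
      least \<open>bd k * d k\<close>, which exceeds \<open>d k\<close> because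
      \<open>bd k \<ge> 2\<close>; so only indices below \<open>k\<close> appear and the outer
      hypothesis applies.\<close>
    have "\<zeta> k ^ bd k * zmon k a \<in> Mk (Suc k) (W + d i)" unfolding Mk_def
    proof (rule lspan_right[OF pow[OF k(1)]])
     fix g assume "g \<in> \<zeta> ` {l. l < s \<and> bd k * d k \<le> d l}"
     then obtain l where l: "g = \<zeta> l" "l < s" "bd k * d k \<le> d l" by auto
     have "d k < 2 * d k" using d_pos[OF k(1)] by simp
     also have "\<dots> \<le> bd k * d k" using bd_ge[OF k(1)] by (rule mult_right_mono) simp
     also note l(3)
     finally have "l < k" using above[OF k(1) l(2)] by simp
     then have "g * zmon k a \<in> Mk k (wt k a + d l)" using Suc.IH[OF k(2) _ m] l by simp
     then have "g * zmon k a \<in> Mk (Suc k) (W + d i)"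
      using Mk_Nk[OF k(1)] l bd a ik
      by (auto simp: wt_Suc intro!: Mk_mono[OF Nk_Mk[of _ k 0]])
     then show "g * zmon k a \<in> Sp {zmon (Suc k) a |a. a \<in> box (Suc k) \<and> W + d i \<le> wt (Suc k) a}"
      by (simp add: Mk_def)
    qed (auto intro: lspan.base I_right zmon_R k)
    then show ?thesis using a bd ik by (simp add: mult.assoc)
   qed
  qed
  then show "\<zeta> i * g \<in> Sp {zmon (Suc k) a |a. a \<in> box (Suc k) \<and> W + d i \<le> wt (Suc k) a}"
   by (simp add: Mk_def)
 qed (use Suc.prems in \<open>intro lspan.base I_left \<zeta>_R; simp\<close>)
qed

end

lemma (in pbw) box_less: "a \<in> box k ==> i < k ==> a i < bd i" by (simp add: box_def)

section \<open>The left ideal of the character and the Kazhdan filtration\<close>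

locale whittaker = pbw sc R I \<zeta> d bd \<epsilon> s
 for sc :: "'k::field => 'a::ring_1" and R I and \<zeta> :: "nat => 'a" and d bd :: "nat => nat" and \<epsilon> and s :: nat +
 fixes h :: "int => bit => 'g set" and \<iota> :: "'g => 'a" and br :: "'g => 'g => 'g" and \<chi> :: "'g => 'k"
  and z u :: "nat => 'g" and par :: "nat => bit"
 assumes h_R: "y \<in> h k a ==> \<iota> y \<in> R"
  and h_br: "[|x \<in> h k a; y \<in> h l b|] ==> br x y \<in> h (k + l) (a + b)"
  and br_I: "[|x \<in> h k a; y \<in> h l b|] ==> \<iota> x * \<iota> y - sc (ksign a b) * (\<iota> y * \<iota> x) - \<iota> (br x y) \<in> I"
  and low: "[|y \<in> h k a; k \<le> - 2|] ==> \<iota> y - sc (\<chi> y) \<in> lspan sc I (\<zeta> ` {l. l < s \<and> int (d l) = - k})"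
  and \<chi>_h: "[|y \<in> h k a; \<chi> y \<noteq> 0|] ==> k = - 2 \<and> a = 0"
  and z_h: "i < s ==> z i \<in> h (- int (d i)) (par i)"
  and \<zeta>_def: "i < s ==> \<zeta> i = \<iota> (z i) - sc (\<chi> (z i))"
  and u_h: "i < s ==> u i \<in> h (int (d i) - 2) (par i)"
  and dual: "[|i < s; j < s|] ==> \<chi> (br (z i) (u j)) = (if i = j then 1 else 0)"
  and bd_odd: "[|i < s; par i = 1|] ==> bd i = 2"
  and fact_nz: "[|i < s; n < bd i|] ==> (of_nat (fact n) :: 'k) \<noteq> 0"
begin

text \<open>The quotient of \<open>R\<close> by this left ideal is the induced module in disguise;
  \<open>fr_J\<close> and \<open>\<kappa>_eq\<close> make the identification.\<close>

inductive_set J :: "'a set" where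
 J_I: "x \<in> I ==> x \<in> J"
| J_gen: "r \<in> R ==> i < s ==> r * \<zeta> i \<in> J"
| J_add: "x \<in> J ==> y \<in> J ==> x + y \<in> J"

lemma J_left: "x \<in> J ==> r \<in> R ==> r * x \<in> J"
 by (induction rule: J.induct)
  (auto simp: distrib_left mult.assoc[symmetric] intro: J.intros I_left R_mult)

lemma J_zeta: "i < s ==> \<zeta> i \<in> J" using J_gen[OF R_1, of i] by simp

text \<open>Kazhdan weight of a word. The shift by 2 makes a bracket weigh two less than the product
  it comes from, and gives weight 0 to the elements on which \<chi> may be nonzero. The length
  \<open>n\<close> is recorded because \<open>F_neg\<close> is an induction on it.\<close>

inductive Wd :: "nat => int => 'a => bool" where
 Wd_1: "w \<ge> 0 ==> Wd n w 1"
| Wd_mult: "y \<in> h k a ==> Wd n w x ==> w + k + 2 \<le> w' ==> Wd (Suc n) w' (\<iota> y * x)"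

definition F :: "nat => int => 'a set" where "F n w = lspan sc J {x. Wd n w x}"

lemma Wd_mono: "Wd n w x ==> n \<le> n' ==> w \<le> w' ==> Wd n' w' x"
proof (induction arbitrary: n' w' rule: Wd.induct)
 case (Wd_1 w n)
 then show ?case by (intro Wd.Wd_1) simp
next
 case (Wd_mult y k a n w x w1)
 then obtain m where "n' = Suc m" "n \<le> m" by (cases n') auto
 then show ?case using Wd_mult by (auto intro!: Wd.Wd_mult[of y k a m w])
qed

lemma F_mono: "x \<in> F n w ==> n \<le> n' ==> w \<le> w' ==> x \<in> F n' w'"
 unfolding F_def by (erule lspan_mono) (auto intro: Wd_mono)

lemma J_F: "x \<in> J ==> x \<in> F n w" unfolding F_def by (rule lspan.base)
lemma F_add: "x \<in> F n w ==> y \<in> F n w ==> x + y \<in> F n w" unfolding F_def by (rule lspan.add)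
lemma F_scale: "x \<in> F n w ==> sc c * x \<in> F n w" unfolding F_def by (rule lspan.scale)
lemma Wd_R: "Wd n w x ==> x \<in> R"
 by (induction rule: Wd.induct) (auto intro: R_1 R_mult h_R)

lemma I_J_mult: "y \<in> I ==> x \<in> J ==> y * x \<in> J" using J_left I_R by blast

lemma I_F: "y \<in> I ==> x \<in> F n w ==> y * x \<in> F n' w'"
 unfolding F_def by (erule lspan_left) (auto intro: lspan.base I_J_mult J_I I_right Wd_R)

lemma iota_F: "y \<in> h k a ==> x \<in> F n w ==> \<iota> y * x \<in> F (Suc n) (w + k + 2)"
 unfolding F_def by (erule lspan_left) (auto intro: lspan.base lspan.gen J_left h_R Wd_mult)

text \<open>The scalar contained in \<open>\<zeta> i\<close> has to supercommute with
  \<open>\<iota> y\<close>. It does, since \<chi>(z i) is nonzero only for even \<open>z i\<close>,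
  where the sign is 1.\<close>

lemma zeta_iota:
 assumes i: "i < s" and y: "y \<in> h k b"
 shows "\<zeta> i * \<iota> y - sc (ksign (par i) b) * (\<iota> y * \<zeta> i) - \<iota> (br (z i) y) \<in> I"
proof -
 have "sc (\<chi> (z i)) * \<iota> y = sc (ksign (par i) b) * (\<iota> y * sc (\<chi> (z i)))"
 proof (cases "\<chi> (z i) = 0")
  case False
  then have "par i = 0" using \<chi>_h z_h i by blast
  then show ?thesis by (simp add: ksign_def sc_1 sc_commute)
 qed (simp add: sc_0)
 then have "\<zeta> i * \<iota> y - sc (ksign (par i) b) * (\<iota> y * \<zeta> i) - \<iota> (br (z i) y)
   = \<iota> (z i) * \<iota> y - sc (ksign (par i) b) * (\<iota> y * \<iota> (z i)) - \<iota> (br (z i) y)"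
  by (simp add: \<zeta>_def[OF i] left_diff_distrib right_diff_distrib)
 then show ?thesis using br_I[OF z_h[OF i] y] by simp
qed

text \<open>On its way to the right \<open>\<zeta> i\<close> replaces a letter by its bracket with
  \<open>z i\<close>: the degree drops by \<open>d i\<close> and the number of letters stays the
  same. At the right end \<open>\<zeta> i\<close> is swallowed by \<open>J\<close>.\<close>

lemma zeta_F: "i < s ==> x \<in> F n w ==> \<zeta> i * x \<in> F n (w - int (d i))"
proof -
 assume i: "i < s" and x: "x \<in> F n w"
 have *: "\<zeta> i * x \<in> F n (w - int (d i))" if "Wd n w x" for x n w
  using that
 proof (induction rule: Wd.induct)
  case (Wd_1 w n)
  then show ?case using J_zeta[OF i] by (auto intro: J_F)
 next
  case (Wd_mult y k a n w x w')
  let ?e = "ksign (par i) a"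
  let ?N = "Suc n" and ?W = "w' - int (d i)"
  have "\<iota> y * (\<zeta> i * x) \<in> F ?N ?W"
   using iota_F[OF Wd_mult.hyps(1) Wd_mult.IH] by (rule F_mono) (use Wd_mult.hyps in auto)
  then have 1: "sc ?e * (\<iota> y * (\<zeta> i * x)) \<in> F ?N ?W" by (rule F_scale)
  have "Wd ?N ?W (\<iota> (br (z i) y) * x)"
   using h_br[OF z_h[OF i] Wd_mult.hyps(1)] Wd_mult.hyps(2) by (rule Wd.Wd_mult) (use Wd_mult.hyps in auto)
  then have 2: "\<iota> (br (z i) y) * x \<in> F ?N ?W" unfolding F_def by (auto intro: lspan.gen)
  have 3: "(\<zeta> i * \<iota> y - sc ?e * (\<iota> y * \<zeta> i) - \<iota> (br (z i) y)) * x \<in> F ?N ?W"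
   using zeta_iota[OF i Wd_mult.hyps(1)] Wd_R[OF Wd_mult.hyps(2)] by (auto intro: J_F J_I I_right)
  have "\<zeta> i * (\<iota> y * x) = (\<zeta> i * \<iota> y - sc ?e * (\<iota> y * \<zeta> i) - \<iota> (br (z i) y)) * x
    + sc ?e * (\<iota> y * (\<zeta> i * x)) + \<iota> (br (z i) y) * x"
   by (simp add: algebra_simps)
  then show ?case using 1 2 3 by (simp add: F_add)
 qed
 show ?thesis using x[unfolded F_def] unfolding F_def
  by (rule lspan_left) (use * i in \<open>auto simp: F_def[symmetric] intro: J_F J_left \<zeta>_R\<close>)
qed

text \<open>Rewriting the letter through the \<zeta>'s gains twice: the weight drops by two more
  than for a product with \<open>\<iota> y\<close>, and the length bound does not grow.\<close>

lemma low_F: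
 assumes "y \<in> h k a" and "k \<le> - 2" and x: "x \<in> F n w"
 shows "(\<iota> y - sc (\<chi> y)) * x \<in> F n (w + k)"
 using low[OF assms(1,2)] unfolding F_def
proof (rule lspan_right)
 fix g assume "g \<in> \<zeta> ` {l. l < s \<and> int (d l) = - k}"
 then obtain l where "g = \<zeta> l" "l < s" "int (d l) = - k" by auto
 then show "g * x \<in> lspan sc J {x. Wd n (w + k) x}" using zeta_F[of l, OF _ x] by (simp add: F_def)
qed (use I_F[OF _ x] in \<open>auto simp: F_def\<close>)

text \<open>Split off the first letter. Either the rest already has negative weight, or the letter
  has degree at most -3; then its \<chi>-value is 0, it is a combination of \<zeta>'s, and
  \<open>low_F\<close> rewrites the word with a smaller length bound while its weight remains
  negative.\<close>

lemma F_neg: "w < 0 ==> F n w \<subseteq> J"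
proof (induction n arbitrary: w)
 case 0
 have *: "\<not> Wd 0 w x" for x using 0 by (auto elim: Wd.cases)
 show ?case
 proof
  fix x assume "x \<in> F 0 w"
  then show "x \<in> J" unfolding F_def
   by (induction rule: lspan.induct) (use * in \<open>auto intro: J_add J_left sc_R\<close>)
 qed
next
 case (Suc n)
 have *: "x \<in> J" if "Wd (Suc n) w x" for x
  using that
 proof cases
  case Wd_1
  then show ?thesis using Suc by simp
 next
  case (Wd_mult y k a v t)
  show ?thesis
  proof (cases "v < 0")
   case True
   have "t \<in> F n v" using Wd_mult unfolding F_def by (auto intro: lspan.gen)
   then show ?thesis using Suc.IH[OF True] Wd_mult by (auto intro: J_left h_R)
  next
   case False
   then have k: "k \<le> - 3" using Wd_mult Suc.prems by simp
   then have "\<chi> y = 0" using \<chi>_h[OF Wd_mult(2)] by auto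
   moreover have "t \<in> F n v" using Wd_mult unfolding F_def by (auto intro: lspan.gen)
   ultimately have "x \<in> F n (v + k)" using low_F[OF Wd_mult(2) _, of t n v] k Wd_mult(1) by (simp add: sc_0)
   moreover have "v + k < 0" using Wd_mult Suc.prems by simp
   ultimately show ?thesis using Suc.IH by blast
  qed
 qed
 show ?case
 proof
  fix x assume "x \<in> F (Suc n) w"
  then show "x \<in> J" unfolding F_def
   by (induction rule: lspan.induct) (auto intro: * J_add J_left sc_R)
 qed
qed

definition FF :: "int => 'a set" where "FF w = (\<Union>n. F n w)"

lemma FF_mono: "x \<in> FF w ==> w \<le> w' ==> x \<in> FF w'" unfolding FF_def using F_mono by blast

lemma FF_add:
 assumes "x \<in> FF w" and "y \<in> FF w" shows "x + y \<in> FF w"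
proof -
 from assms obtain m n where "x \<in> F m w" "y \<in> F n w" unfolding FF_def by blast
 then have "x + y \<in> F (max m n) w"
  by (intro F_add F_mono[of x m w "max m n" w] F_mono[of y n w "max m n" w]) auto
 then show ?thesis unfolding FF_def by blast
qed

lemma FF_scale: "x \<in> FF w ==> sc c * x \<in> FF w" unfolding FF_def using F_scale by blast
lemma FF_0: "0 \<in> FF w" unfolding FF_def using J_F[OF J_I[OF I_0]] by blast
lemma FF_1: "1 \<in> FF 0"
proof -
 have "1 \<in> F 0 0" unfolding F_def by (rule lspan.gen) (simp add: Wd_1)
 then show ?thesis unfolding FF_def by blast
qed
lemma FF_zeta: "i < s ==> x \<in> FF w ==> \<zeta> i * x \<in> FF (w - int (d i))"
 unfolding FF_def UN_iff using zeta_F[of i x] by fast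
lemma FF_iota: "y \<in> h k a ==> x \<in> FF w ==> \<iota> y * x \<in> FF (w + k + 2)"
 unfolding FF_def UN_iff using iota_F[of y k a x] by fast
lemma FF_u: "i < s ==> x \<in> FF w ==> \<iota> (u i) * x \<in> FF (w + int (d i))"
 using FF_iota[OF u_h, of i x w] by simp
lemma FF_neg: "w < 0 ==> x \<in> FF w ==> x \<in> J" unfolding FF_def using F_neg[of w] by fast

lemma FF_u_power: "i < s ==> x \<in> FF w ==> \<iota> (u i) ^ n * x \<in> FF (w + int n * int (d i))"
proof (induction n)
 case (Suc n)
 from FF_u[OF Suc.prems(1) Suc.IH[OF Suc.prems]] show ?case by (simp add: mult.assoc algebra_simps)
qed simp

lemma FF_zeta_power: "i < s ==> x \<in> FF w ==> \<zeta> i ^ n * x \<in> FF (w - int n * int (d i))"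
proof (induction n)
 case (Suc n)
 from FF_zeta[OF Suc.prems(1) Suc.IH[OF Suc.prems]] show ?case by (simp add: mult.assoc algebra_simps)
qed simp

text \<open>Modulo lower filtration degree, \<open>\<zeta> i\<close> acts on words in the \<open>u j\<close> with \<open>d j \<le> d i\<close>
 as the (super)derivation with \<open>u j \<mapsto> \<delta>\<^sub>i\<^sub>j\<close>.\<close>

lemma zeta_u:
 assumes i: "i < s" and j: "j < s" and dij: "d j \<le> d i" and x: "x \<in> FF w"
 shows "\<zeta> i * (\<iota> (u j) * x) - (if i = j then x else 0) - sc (ksign (par i) (par j)) * (\<iota> (u j) * (\<zeta> i * x))
   \<in> FF (w + int (d j) - int (d i) - 2)"
proof -
 let ?b = "br (z i) (u j)" and ?e = "ksign (par i) (par j)"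
 obtain n where n: "x \<in> F n w" using x unfolding FF_def by blast
 \<comment> \<open>Because \<open>d j \<le> d i\<close>, the bracket has degree at most -2 and acts
   as its \<chi>-value up to lower weight. This is the point where the order of the generators
   enters.\<close>
 have "(\<iota> ?b - sc (\<chi> ?b)) * x \<in> F n (w + (- int (d i) + (int (d j) - 2)))"
  using h_br[OF z_h[OF i] u_h[OF j]] _ n by (rule low_F) (use dij in simp)
 moreover have "(\<zeta> i * \<iota> (u j) - sc ?e * (\<iota> (u j) * \<zeta> i) - \<iota> ?b) * x \<in> F n (w + (- int (d i) + (int (d j) - 2)))"
  using zeta_iota[OF i u_h[OF j]] n by (rule I_F)
 ultimately have "(\<iota> ?b - sc (\<chi> ?b)) * x + (\<zeta> i * \<iota> (u j) - sc ?e * (\<iota> (u j) * \<zeta> i) - \<iota> ?b) * x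
   \<in> F n (w + (- int (d i) + (int (d j) - 2)))" by (rule F_add)
 also have "w + (- int (d i) + (int (d j) - 2)) = w + int (d j) - int (d i) - 2" by simp
 finally have "(\<iota> ?b - sc (\<chi> ?b)) * x + (\<zeta> i * \<iota> (u j) - sc ?e * (\<iota> (u j) * \<zeta> i) - \<iota> ?b) * x
   \<in> FF (w + int (d j) - int (d i) - 2)" unfolding FF_def by blast
 moreover have "sc (\<chi> ?b) * x = (if i = j then x else 0)" by (simp add: dual[OF i j] sc_1 sc_0)
 ultimately show ?thesis by (simp add: algebra_simps)
qed

lemma zeta_u_power:
 assumes k: "k < s" and r: "r \<in> FF w" and zr: "\<zeta> k * r \<in> FF (w - int (d k) - 1)"
  and b: "par k = 1 ==> b \<le> 1"
 shows "\<zeta> k * (\<iota> (u k) ^ b * r) - of_nat b * (\<iota> (u k) ^ (b - 1) * r) \<in> FF (w + int b * int (d k) - int (d k) - 1)"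
 using b
proof (induction b)
 case 0
 then show ?case using zr by simp
next
 case (Suc b)
 let ?U = "\<iota> (u k)" and ?x = "\<iota> (u k) ^ b * r" and ?W = "w + int (Suc b) * int (d k) - int (d k) - 1"
 have x: "?x \<in> FF (w + int b * int (d k))" using FF_u_power[OF k r] .
 have 1: "\<zeta> k * (?U * ?x) - ?x - sc (ksign (par k) (par k)) * (?U * (\<zeta> k * ?x)) \<in> FF ?W"
  using FF_mono[OF zeta_u[OF k k order_refl x], of ?W] by (simp add: algebra_simps)
 have 2: "sc (ksign (par k) (par k)) * (?U * (\<zeta> k * ?x)) - of_nat b * ?x \<in> FF ?W"
 proof (cases "par k = 1")
  case True
  then have b: "b = 0" using Suc.prems by simp
  have "?U * (\<zeta> k * r) \<in> FF ?W" using FF_u[OF k zr] b by (simp add: algebra_simps)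
  then show ?thesis using b by (simp add: FF_scale)
 next
  case False
  then have p: "par k = 0" by (cases "par k") auto
  have "?U * (\<zeta> k * ?x - of_nat b * (?U ^ (b - 1) * r)) \<in> FF (w + int b * int (d k) - int (d k) - 1 + int (d k))"
   by (rule FF_u[OF k Suc.IH]) (use p in auto)
  moreover have "?U * (of_nat b * (?U ^ (b - 1) * r)) = of_nat b * ?x"
  proof (cases b)
   case (Suc c)
   have "?U * (of_nat b * (?U ^ (b - 1) * r)) = of_nat b * (?U * ?U ^ (b - 1) * r)"
    by (metis mult.assoc mult_of_nat_commute)
   then show ?thesis using Suc by simp
  qed simp
  ultimately show ?thesis using p by (simp add: ksign_def sc_1 right_diff_distrib algebra_simps)
 qed
 from FF_add[OF 1 2] show ?case by (simp add: mult.assoc algebra_simps)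
qed

text \<open>Iterated power rule. Differences are truncated: for \<open>c > b\<close> the factor with
  \<open>i = b\<close> is 0, so the same formula records that differentiating too often kills the
  leading term.\<close>

lemma zeta_power_u_power:
 assumes k: "k < s" and r: "r \<in> FF w" and zr: "\<zeta> k * r \<in> FF (w - int (d k) - 1)"
  and b: "par k = 1 ==> b \<le> 1"
 shows "\<zeta> k ^ c * (\<iota> (u k) ^ b * r) - of_nat (\<Prod>i<c. b - i) * (\<iota> (u k) ^ (b - c) * r)
   \<in> FF (w + int b * int (d k) - int c * int (d k) - 1)"
proof (induction c)
 case 0
 then show ?case by (simp add: FF_0)
next
 case (Suc c)
 let ?U = "\<iota> (u k)" and ?n = "\<Prod>i<c. b - i" and ?W = "w + int b * int (d k) - int (Suc c) * int (d k) - 1"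
 have 1: "\<zeta> k * (\<zeta> k ^ c * (?U ^ b * r) - of_nat ?n * (?U ^ (b - c) * r)) \<in> FF ?W"
  using FF_zeta[OF k Suc.IH] by (simp add: algebra_simps)
 have c: "\<zeta> k * (of_nat ?n * (?U ^ (b - c) * r)) = of_nat ?n * (\<zeta> k * (?U ^ (b - c) * r))"
  by (metis mult.assoc mult_of_nat_commute)
 have 2: "of_nat ?n * (\<zeta> k * (?U ^ (b - c) * r)) - of_nat (?n * (b - c)) * (?U ^ (b - Suc c) * r) \<in> FF ?W"
 proof (cases "c \<le> b")
  case True
  have "\<zeta> k * (?U ^ (b - c) * r) - of_nat (b - c) * (?U ^ (b - c - 1) * r)
    \<in> FF (w + int (b - c) * int (d k) - int (d k) - 1)"
   by (rule zeta_u_power[OF k r zr]) (use b in auto)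
  then have "\<zeta> k * (?U ^ (b - c) * r) - of_nat (b - c) * (?U ^ (b - Suc c) * r) \<in> FF ?W"
   using True by (simp add: algebra_simps of_nat_diff)
  from FF_scale[OF this, of "of_nat ?n"] show ?thesis
   unfolding sc_of_nat by (simp only: right_diff_distrib mult.assoc of_nat_mult)
 next
  case False
  then have n0: "?n = 0" by (intro prod_zero) (auto intro!: bexI[of _ b])
  show ?thesis unfolding n0 by (simp add: FF_0)
 qed
 have "\<zeta> k ^ Suc c * (?U ^ b * r) - of_nat (\<Prod>i<Suc c. b - i) * (?U ^ (b - Suc c) * r)
  = \<zeta> k * (\<zeta> k ^ c * (?U ^ b * r) - of_nat ?n * (?U ^ (b - c) * r))
   + (of_nat ?n * (\<zeta> k * (?U ^ (b - c) * r)) - of_nat (?n * (b - c)) * (?U ^ (b - Suc c) * r))"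
  by (simp add: mult.assoc right_diff_distrib c)
 then show ?case using FF_add[OF 1 2] by (simp only:)
qed

end

section \<open>The triangular pairing of monomials and its consequences\<close>

context whittaker begin

text \<open>The two kinds of monomials are ordered oppositely, so that in
  \<open>Zmon k a * Umon k b\<close> the powers of \<open>\<zeta> k\<close> and of
  \<open>u k\<close> meet in the middle. The remaining \<open>u\<close>'s have larger index, thus no
  larger \<open>d\<close>, as \<open>zeta_u\<close> demands.\<close>

definition Umon :: "nat => (nat => nat) => 'a" where
 "Umon k b = prod_list (map (\<lambda>i. \<iota> (u i) ^ b i) [k..<s])"

definition Zmon :: "nat => (nat => nat) => 'a" where
 "Zmon k a = prod_list (map (\<lambda>i. \<zeta> i ^ a i) (rev [k..<s]))"

definition wts :: "nat => (nat => nat) => nat" where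
 "wts k a = (\<Sum>i\<in>{k..<s}. a i * d i)"

lemma Umon_Suc: "k < s ==> Umon k b = \<iota> (u k) ^ b k * Umon (Suc k) b"
 by (simp add: Umon_def upt_conv_Cons)

lemma Zmon_Suc: "k < s ==> Zmon k a = Zmon (Suc k) a * \<zeta> k ^ a k"
 by (simp add: Zmon_def upt_conv_Cons)

lemma wts_Suc: "k < s ==> wts k a = a k * d k + wts (Suc k) a"
 by (simp add: wts_def sum.atLeast_Suc_lessThan)

lemma zmon_Zmon: "zmon s a = Zmon 0 a"
proof -
 have "zmon k a = prod_list (map (\<lambda>i. \<zeta> i ^ a i) (rev [0..<k]))" for k
  by (induction k) auto
 then show ?thesis by (simp add: Zmon_def)
qed

lemma wts_wt: "wts 0 a = wt s a" by (simp add: wts_def wt_def atLeast0LessThan)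

lemma Umon_R: "Umon k b \<in> R"
 unfolding Umon_def by (rule R_prod_list) (auto intro!: R_power h_R u_h)

lemma FF_Umon: "k \<le> s ==> Umon k b \<in> FF (int (wts k b))"
proof (induction k rule: inc_induct)
 case base
 then show ?case using FF_1 by (simp add: Umon_def wts_def)
next
 case (step k)
 from FF_u_power[OF step.hyps(2) step.IH, of "b k"] show ?case
  using step.hyps by (simp add: Umon_Suc wts_Suc algebra_simps)
qed

text \<open>No \<open>u j\<close> occurs in this monomial, so its derivative vanishes to leading
  order. This provides the hypothesis \<open>zr\<close> of
  \<open>zeta_power_u_power\<close>.\<close>

lemma zeta_Umon: "k \<le> s ==> j < k ==> j < s ==> \<zeta> j * Umon k b \<in> FF (int (wts k b) - int (d j) - 1)"
proof (induction k rule: inc_induct)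
 case base
 then show ?case using J_F[OF J_zeta[of j]] unfolding FF_def by (auto simp: Umon_def)
next
 case (step k)
 have "\<zeta> j * (\<iota> (u k) ^ n * Umon (Suc k) b) \<in> FF (int (wts (Suc k) b) + int n * int (d k) - int (d j) - 1)" for n
 proof (induction n)
  case 0
  then show ?case using step by simp
 next
  case (Suc n)
  let ?x = "\<iota> (u k) ^ n * Umon (Suc k) b" and ?W = "int (wts (Suc k) b) + int (Suc n) * int (d k) - int (d j) - 1"
  have x: "?x \<in> FF (int (wts (Suc k) b) + int n * int (d k))"
   using step.hyps by (intro FF_u_power FF_Umon) auto
  have dd: "d k \<le> d j" using step by (intro d_sorted) auto
  have "\<zeta> j * (\<iota> (u k) * ?x) - 0 - sc (ksign (par j) (par k)) * (\<iota> (u k) * (\<zeta> j * ?x)) \<in> FF ?W"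
   using FF_mono[OF zeta_u[OF step.prems(2) step.hyps(2) dd x], of ?W] step.prems by (simp add: algebra_simps)
  moreover have "sc (ksign (par j) (par k)) * (\<iota> (u k) * (\<zeta> j * ?x)) \<in> FF ?W"
   using FF_scale[OF FF_u[OF step.hyps(2) Suc.IH]] by (simp add: algebra_simps)
  ultimately have "(\<zeta> j * (\<iota> (u k) * ?x) - 0 - sc (ksign (par j) (par k)) * (\<iota> (u k) * (\<zeta> j * ?x)))
    + sc (ksign (par j) (par k)) * (\<iota> (u k) * (\<zeta> j * ?x)) \<in> FF ?W" by (rule FF_add)
  then show ?case by (simp only: diff_0_right diff_add_cancel power_Suc mult.assoc)
 qed
 from this[of "b k"] show ?case using step.hyps by (simp add: Umon_Suc wts_Suc algebra_simps)
qed

lemma FF_Zmon: "k \<le> s ==> x \<in> FF w ==> Zmon k a * x \<in> FF (w - int (wts k a))"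
proof (induction k arbitrary: x w rule: inc_induct)
 case base
 then show ?case by (simp add: Zmon_def wts_def)
next
 case (step k)
 from step.IH[OF FF_zeta_power[OF step.hyps(2) step.prems]] show ?case
  using step.hyps by (simp add: Zmon_Suc wts_Suc mult.assoc algebra_simps)
qed

definition q :: nat where "q = Suc (Max (insert 0 (bd ` {..<s})))"

lemma bd_q: "i < s ==> bd i < q" by (auto simp: q_def less_Suc_eq_le intro: Max_ge)

text \<open>Comparing values of \<open>val k\<close> is comparing multi-indices lexicographically.\<close>

definition val :: "nat => (nat => nat) => nat" where
 "val k a = (\<Sum>i\<in>{k..<s}. a i * q ^ (s - 1 - i))"

lemma val_Suc: "k < s ==> val k a = a k * q ^ (s - Suc k) + val (Suc k) a"
 by (simp add: val_def sum.atLeast_Suc_lessThan)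

lemma val_less: "k \<le> s ==> a \<in> box s ==> val k a < q ^ (s - k)"
proof (induction k rule: inc_induct)
 case base
 then show ?case by (simp add: val_def)
next
 case (step k)
 have "a k < q" using box_less[OF step.prems step.hyps(2)] bd_q[OF step.hyps(2)] by simp
 have "val k a < (a k + 1) * q ^ (s - Suc k)" using step by (simp add: val_Suc)
 also have "\<dots> \<le> q * q ^ (s - Suc k)" using \<open>a k < q\<close> by (intro mult_right_mono) auto
 finally show ?case using step.hyps by (simp flip: power_Suc add: Suc_diff_Suc)
qed

definition cf :: "nat => (nat => nat) => nat" where "cf k a = (\<Prod>i\<in>{k..<s}. fact (a i))"

text \<open>The first differing exponent decides. If \<open>b k < a k\<close>, differentiating too
  often leaves nothing in leading weight; otherwise the comparison of \<open>val\<close> forces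
  \<open>a k = b k\<close>, the power contributes a factorial, and the remaining indices are handled
  by induction.\<close>

lemma Zmon_Umon:
 assumes "a \<in> box s" and "b \<in> box s"
 shows "k \<le> s ==> val k b \<le> val k a ==>
  Zmon k a * Umon k b - (if \<forall>i\<in>{k..<s}. a i = b i then of_nat (cf k a) else 0)
   \<in> FF (int (wts k b) - int (wts k a) - 1)"
proof (induction k rule: inc_induct)
 case base
 then show ?case by (simp add: Zmon_def Umon_def cf_def wts_def FF_0)
next
 case (step k)
 have k: "k < s" by fact
 let ?W = "int (wts k b) - int (wts k a) - 1"
 let ?r = "Umon (Suc k) b"
 let ?n = "\<Prod>i<a k. b k - i"
 have b1: "b k \<le> 1" if "par k = 1" using box_less[OF assms(2) k] bd_odd[OF k that] by simp
 have "\<zeta> k ^ a k * (\<iota> (u k) ^ b k * ?r) - of_nat ?n * (\<iota> (u k) ^ (b k - a k) * ?r)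
   \<in> FF (int (wts (Suc k) b) + int (b k) * int (d k) - int (a k) * int (d k) - 1)"
  using k b1 by (intro zeta_power_u_power FF_Umon zeta_Umon) auto
 from FF_Zmon[OF _ this, of "Suc k" a]
 have 1: "Zmon (Suc k) a * (\<zeta> k ^ a k * (\<iota> (u k) ^ b k * ?r)) - Zmon (Suc k) a * (of_nat ?n * (\<iota> (u k) ^ (b k - a k) * ?r))
   \<in> FF ?W"
  using k by (simp add: wts_Suc right_diff_distrib algebra_simps)
 have prod: "Zmon k a * Umon k b = Zmon (Suc k) a * (\<zeta> k ^ a k * (\<iota> (u k) ^ b k * ?r))"
  using k by (simp add: Zmon_Suc Umon_Suc mult.assoc)
 have ivl: "{k..<s} = insert k {Suc k..<s}" using k by auto
 show ?case
 proof (cases "b k < a k")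
  case True
  then have n0: "?n = 0" by (intro prod_zero) (auto intro!: bexI[of _ "b k"])
  show ?thesis using 1[unfolded n0] True prod k by (auto simp: ivl)
 next
  case False
  \<comment> \<open>A larger digit outweighs all later ones, because by \<open>val_less\<close>
    these amount to less than \<open>q ^ (s - Suc k)\<close>.\<close>
  have "a k = b k"
  proof (rule ccontr)
   assume "a k \<noteq> b k"
   then have "a k + 1 \<le> b k" using False by simp
   then have "(a k + 1) * q ^ (s - Suc k) \<le> b k * q ^ (s - Suc k)" by (rule mult_right_mono) simp
   moreover have "val (Suc k) a < q ^ (s - Suc k)" using k assms by (intro val_less) auto
   ultimately have "val k a < val k b" using k by (simp add: val_Suc)
   then show False using step.prems by simp
  qed
  then have v: "val (Suc k) b \<le> val (Suc k) a" using step.prems k by (simp add: val_Suc)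
  have n: "?n = fact (b k)" using \<open>a k = b k\<close>
   by (simp add: fact_prod_rev atLeast0LessThan)
  let ?D = "if \<forall>i\<in>{Suc k..<s}. a i = b i then of_nat (cf (Suc k) a) else 0"
  have "Zmon (Suc k) a * ?r - ?D \<in> FF ?W"
   using step.IH[OF v] k \<open>a k = b k\<close> by (simp add: wts_Suc)
  from FF_scale[OF this, of "of_nat ?n"]
  have 2: "of_nat ?n * (Zmon (Suc k) a * ?r) - of_nat ?n * ?D \<in> FF ?W"
   by (simp only: sc_of_nat right_diff_distrib)
  have eq1: "Zmon (Suc k) a * (of_nat ?n * (\<iota> (u k) ^ (b k - a k) * ?r)) = of_nat ?n * (Zmon (Suc k) a * ?r)"
   unfolding sc_of_nat[symmetric] sc_left_commute using \<open>a k = b k\<close> by simp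
  have eq2: "of_nat ?n * ?D = (if \<forall>i\<in>{k..<s}. a i = b i then of_nat (cf k a) else 0)"
   using k \<open>a k = b k\<close> n by (simp add: ivl cf_def)
  show ?thesis using FF_add[OF 1 2] unfolding prod eq1 eq2 by (simp only: diff_add_eq add_diff_cancel diff_add_cancel add_diff_eq)
 qed
qed

text \<open>A single number for the order by weight and then by lexicographic position;
  \<open>val 0 a < q ^ s\<close> keeps the two components apart.\<close>

definition key :: "(nat => nat) => nat" where "key a = wt s a * q ^ s + val 0 a"

lemma key_wt_less: "a \<in> box s ==> b \<in> box s ==> wt s a < wt s b ==> key a < key b"
proof -
 assume ab: "a \<in> box s" "b \<in> box s" "wt s a < wt s b"
 have "key a < (wt s a + 1) * q ^ s" using val_less[OF _ ab(1), of 0] by (simp add: key_def)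
 also have "\<dots> \<le> wt s b * q ^ s" using ab by (intro mult_right_mono) auto
 finally show ?thesis by (simp add: key_def)
qed

abbreviation Uu where "Uu \<equiv> Umon 0"

text \<open>For \<open>a\<close> of greater weight the product has negative weight and lies in
  \<open>J\<close>; for equal weights the error term in \<open>Zmon_Umon\<close> has weight -1 and
  lies in \<open>J\<close> as well. Thus modulo \<open>J\<close> the products form a triangular
  matrix of scalars with \<open>cf\<close> on the diagonal.\<close>

lemma pairing:
 assumes a: "a \<in> box s" and b: "b \<in> box s" and ab: "key b \<le> key a"
 shows "zmon s a * Uu b - (if a = b then of_nat (cf 0 a) else 0) \<in> J"
proof (cases "wt s b < wt s a")
 case True
 have "zmon s a * Uu b \<in> FF (int (wts 0 b) - int (wts 0 a))"
  unfolding zmon_Zmon by (intro FF_Zmon FF_Umon) auto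
 then show ?thesis using True FF_neg[of "int (wt s b) - int (wt s a)"] by (auto simp: wts_wt)
next
 case False
 moreover have "\<not> wt s a < wt s b" using key_wt_less[OF a b] ab by auto
 ultimately have w: "wt s a = wt s b" by simp
 then have "val 0 b \<le> val 0 a" using ab by (simp add: key_def)
 moreover have "(\<forall>i\<in>{0..<s}. a i = b i) \<longleftrightarrow> a = b"
  using a b by (auto simp: box_def fun_eq_iff)
 ultimately have "zmon s a * Uu b - (if a = b then of_nat (cf 0 a) else 0) \<in> FF (- 1)"
  using Zmon_Umon[OF a b, of 0] w by (simp add: zmon_Zmon wts_wt)
 then show ?thesis by (rule FF_neg[rotated]) simp
qed

lemma cf_nz: "a \<in> box s ==> (of_nat (cf 0 a) :: 'k) \<noteq> 0"
 using fact_nz box_less by (auto simp: cf_def of_nat_prod)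

text \<open>Representatives of the Whittaker vectors of the left regular module. Modulo
  \<open>I\<close> they form the right ideal generated by the \<open>e\<close> of
  \<open>exists_generator\<close>.\<close>

definition whit :: "'a => bool" where "whit r \<longleftrightarrow> r \<in> R \<and> (\<forall>i<s. \<zeta> i * r \<in> I)"

lemma J_whit: "x \<in> J ==> whit r ==> x * r \<in> I"
 by (induction rule: J.induct)
  (auto simp: whit_def distrib_right mult.assoc intro: I_right I_add I_left)

lemma whit_0: "whit 0" by (simp add: whit_def R_0 I_0)
lemma whit_diff: "whit x ==> whit y ==> whit (x - y)"
 by (simp add: whit_def R_diff I_diff right_diff_distrib)
lemma whit_add: "whit x ==> whit y ==> whit (x + y)"
 by (simp add: whit_def R_add I_add distrib_left)
lemma whit_mult: "whit x ==> y \<in> R ==> whit (x * y)"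
 by (simp add: whit_def R_mult I_right mult.assoc[symmetric])
lemma whit_scale: "whit x ==> whit (sc c * x)"
 by (simp add: whit_def R_mult sc_R sc_left_commute I_left)

lemma pairing_whit:
 assumes "a \<in> box s" "b \<in> box s" "key b \<le> key a" "whit r"
 shows "zmon s a * (Uu b * r) - (if a = b then sc (of_nat (cf 0 a)) * r else 0) \<in> I"
 using J_whit[OF pairing[OF assms(1-3)] assms(4)]
 by (auto simp: left_diff_distrib mult.assoc sc_of_nat split: if_splits)

text \<open>One more \<zeta> on the left raises the weight strictly, by \<open>zeta_Mk\<close> and
  \<open>d_pos\<close>, and so leads to monomials that are assumed to kill \<open>x\<close>.\<close>

lemma zmon_whit:
 assumes a: "a \<in> box s" and x: "x \<in> R" and *: "\<And>b. b \<in> box s ==> wt s a < wt s b ==> zmon s b * x \<in> I"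
 shows "whit (zmon s a * x)"
 unfolding whit_def
proof (intro conjI allI impI)
 show "zmon s a * x \<in> R" using x by (intro R_mult zmon_R) auto
 fix i assume i: "i < s"
 have "zmon s a \<in> Mk s (wt s a)" unfolding Mk_def using a by (intro lspan.gen) auto
 then have "\<zeta> i * zmon s a \<in> Mk s (wt s a + d i)" using i by (intro zeta_Mk) auto
 then have "\<zeta> i * zmon s a * x \<in> Sp {}" unfolding Mk_def
 proof (rule lspan_right)
  fix g assume "g \<in> {zmon s b |b. b \<in> box s \<and> wt s a + d i \<le> wt s b}"
  then obtain b where "g = zmon s b" "b \<in> box s" "wt s a + d i \<le> wt s b" by auto
  then show "g * x \<in> Sp {}" using *[of b] d_pos[OF i] by (auto intro: lspan.base)
 qed (auto intro: lspan.base I_right x)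
 then show "\<zeta> i * (zmon s a * x) \<in> I" using lspan_empty by (simp add: mult.assoc)
qed

text \<open>In \<open>t\<close> all exponents are maximal, so no monomial has greater weight and
  \<open>zmon s t\<close> turns any element of \<open>R\<close> into a Whittaker vector. Paired with
  \<open>Uu t\<close> it gives a nonzero scalar modulo \<open>J\<close>, which is divided
  out.\<close>

lemma exists_generator: "\<exists>e. whit e \<and> 1 - e \<in> J"
proof -
 define t where "t = (\<lambda>i. if i < s then bd i - 1 else 0)"
 have bd0: "i < s ==> 0 < bd i" for i using bd_ge[of i] by simp
 have t: "t \<in> box s" using bd0 by (auto simp: t_def box_def)
 have tm: "wt s b \<le> wt s t" if "b \<in> box s" for b
  unfolding wt_def
 proof (intro sum_mono mult_right_mono)
  fix i assume "i \<in> {..<s}"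
  then show "b i \<le> t i" using box_less[OF that, of i] by (auto simp: t_def)
 qed simp
 let ?c = "of_nat (cf 0 t) :: 'k"
 let ?e = "sc (1 / ?c) * (zmon s t * Uu t)"
 have "whit (zmon s t * Uu t)" by (rule zmon_whit[OF t Umon_R]) (use tm in fastforce)
 then have "whit ?e" by (rule whit_scale)
 moreover have "1 - ?e \<in> J"
 proof -
  have "sc (- 1 / ?c) * (zmon s t * Uu t - of_nat (cf 0 t)) \<in> J"
   using pairing[OF t t] by (intro J_left sc_R) auto
  moreover have "sc (1 / ?c) * of_nat (cf 0 t) = 1"
   using sc_inverse[OF cf_nz[OF t], of 1] by (simp add: sc_of_nat)
  ultimately show ?thesis by (simp add: right_diff_distrib sc_minus)
 qed
 ultimately show ?thesis by blast
qed

lemma I_sum_delta: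
 assumes "finite A" and "a \<in> A" and "\<And>b. b \<in> A ==> f b - (if a = b then y else 0) \<in> I"
 shows "sum f A - y \<in> I"
proof -
 have "(\<Sum>b\<in>A. f b - (if a = b then y else 0)) \<in> I" by (rule I_sum) (rule assms(3))
 then show ?thesis using assms(1,2) by (simp add: sum_subtractf)
qed

text \<open>Back substitution in the triangular pairing: \<open>n\<close> bounds the keys at which
  monomials still detect \<open>x\<close>. Subtracting the terms of key \<open>n\<close> lowers the
  bound, and at bound 0 the empty monomial shows \<open>x \<in> I\<close>.\<close>

lemma expand: "x \<in> R ==> (\<And>a. a \<in> box s ==> n \<le> key a ==> zmon s a * x \<in> I) ==>
  \<exists>p. (\<forall>a. whit (p a)) \<and> x - (\<Sum>a\<in>box s. Uu a * p a) \<in> I"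
proof (induction n arbitrary: x)
 case 0
 have "(\<lambda>_. 0) \<in> box s" using bd_ge by (force simp: box_def)
 from 0(2)[OF this] have "x \<in> I" by (simp add: zmon_zero)
 then show ?case by (intro exI[of _ "\<lambda>_. 0"]) (simp add: whit_0)
next
 case (Suc n)
 \<comment> \<open>The coefficient is forced by the diagonal entry \<open>cf 0 a\<close>. It is a
   Whittaker vector because monomials of greater weight have larger key and already kill
   \<open>x\<close>.\<close>
 define r where "r a = (if a \<in> box s \<and> key a = n then sc (1 / of_nat (cf 0 a)) * (zmon s a * x) else 0)" for a
 have r: "whit (r a)" for a
 proof (cases "a \<in> box s \<and> key a = n")
  case True
  have "whit (zmon s a * x)"
  proof (rule zmon_whit)
   fix b assume "b \<in> box s" "wt s a < wt s b"
   then show "zmon s b * x \<in> I" using key_wt_less[of a b] True by (intro Suc.prems) auto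
  qed (use True Suc.prems in auto)
  then show ?thesis using True by (simp add: r_def whit_scale)
 qed (auto simp: r_def whit_0)
 define y where "y = x - (\<Sum>a\<in>box s. Uu a * r a)"
 have "y \<in> R" unfolding y_def using r by (intro R_diff R_sum R_mult Umon_R Suc.prems) (auto simp: whit_def)
 moreover have "zmon s a * y \<in> I" if a: "a \<in> box s" "n \<le> key a" for a
 proof -
  have *: "zmon s a * (Uu b * r b) - (if a = b then sc (of_nat (cf 0 a)) * r a else 0) \<in> I" if "b \<in> box s" for b
  proof (cases "key b = n")
   case True
   then have "key b \<le> key a" using a by simp
   from pairing_whit[OF a(1) that this r[of b]] show ?thesis by (cases "a = b"; simp)
  next
   case False
   then have "r b = 0" by (simp add: r_def)
   then show ?thesis by (cases "a = b"; simp add: I_0)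
  qed
  have 1: "zmon s a * (\<Sum>b\<in>box s. Uu b * r b) - sc (of_nat (cf 0 a)) * r a \<in> I"
   unfolding sum_distrib_left by (rule I_sum_delta[OF finite_box a(1) *])
  have "zmon s a * x - sc (of_nat (cf 0 a)) * r a \<in> I"
  proof (cases "key a = n")
   case True
   have "sc (of_nat (cf 0 a)) * r a = zmon s a * x"
    unfolding r_def using sc_inverse[OF cf_nz[OF a(1)], of "zmon s a * x"] True a(1)
    by (simp only: sc_left_commute[of "sc _"] if_True simp_thms)
   then show ?thesis by (simp add: I_0)
  next
   case False
   then show ?thesis using Suc.prems(2)[OF a(1)] a by (simp add: r_def)
  qed
  from I_diff[OF this 1] show ?thesis by (simp add: y_def right_diff_distrib)
 qed
 ultimately obtain p where p: "\<forall>a. whit (p a)" "y - (\<Sum>a\<in>box s. Uu a * p a) \<in> I"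
  using Suc.IH by blast
 then show ?case using r
  by (intro exI[of _ "\<lambda>a. r a + p a"]) (auto simp: y_def whit_add distrib_left sum.distrib algebra_simps)
qed

lemma expand_all: "x \<in> R ==> \<exists>p. (\<forall>a. whit (p a)) \<and> x - (\<Sum>a\<in>box s. Uu a * p a) \<in> I"
proof (rule expand[of _ "Suc (Max (key ` box s))"])
 fix a assume a: "a \<in> box s" "Suc (Max (key ` box s)) \<le> key a"
 have "key a \<le> Max (key ` box s)" by (rule Max_ge) (use a finite_box in auto)
 then have False using a(2) by linarith
 then show "zmon s a * x \<in> I" ..
qed

text \<open>Induction downwards in \<open>key\<close>: multiplying by \<open>zmon s a\<close>
  isolates the coefficient at \<open>a\<close>, apart from terms of larger key, whose coefficients
  are already known to lie in \<open>I\<close>.\<close>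

lemma expand_unique:
 assumes r: "\<And>a. a \<in> box s ==> whit (r a)" and 0: "(\<Sum>a\<in>box s. Uu a * r a) \<in> I"
 shows "a \<in> box s ==> r a \<in> I"
proof (induction "Max (key ` box s) - key a" arbitrary: a rule: less_induct)
 case less
 have *: "zmon s a * (Uu b * r b) - (if a = b then sc (of_nat (cf 0 a)) * r a else 0) \<in> I" if b: "b \<in> box s" for b
 proof (cases "key b \<le> key a")
  case True
  from pairing_whit[OF less.prems b True r[OF b]] show ?thesis by (cases "a = b"; simp)
 next
  case False
  have "key b \<le> Max (key ` box s)" using b finite_box by simp
  then have "r b \<in> I" using False by (intro less.hyps b) auto
  then show ?thesis using False by (auto intro!: I_left zmon_R Umon_R)
 qed
 have 1: "zmon s a * (\<Sum>b\<in>box s. Uu b * r b) - sc (of_nat (cf 0 a)) * r a \<in> I"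
  unfolding sum_distrib_left by (rule I_sum_delta[OF finite_box less.prems *])
 have "zmon s a * (\<Sum>b\<in>box s. Uu b * r b) \<in> I" using 0 by (intro I_left zmon_R) auto
 from I_diff[OF this 1] have "sc (of_nat (cf 0 a)) * r a \<in> I" by simp
 from I_left[OF sc_R[of "1 / of_nat (cf 0 a)"] this] show ?case
  using sc_inverse[OF cf_nz[OF less.prems]] by simp
qed

text \<open>The \<open>p a\<close> are the coefficients in the expansion of 1. Inserting this
  expansion in front of \<open>Uu b * r\<close> gives a second expansion of an element that is
  already expanded; comparing the two by uniqueness yields the orthogonality.\<close>

theorem matrix_units:
 obtains p where "\<And>a. whit (p a)" and "1 - (\<Sum>a\<in>box s. Uu a * p a) \<in> I"
  and "\<And>a b r. a \<in> box s ==> b \<in> box s ==> whit r ==> p a * (Uu b * r) - (if a = b then r else 0) \<in> I"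
proof -
 obtain p where p: "\<forall>a. whit (p a)" "1 - (\<Sum>a\<in>box s. Uu a * p a) \<in> I"
  using expand_all[OF R_1] by blast
 have units: "p a * (Uu b * r) - (if a = b then r else 0) \<in> I" if "a \<in> box s" and b: "b \<in> box s" and r: "whit r" for a b r
 proof -
  let ?f = "\<lambda>c. p c * (Uu b * r) - (if c = b then r else 0)"
  have rR: "r \<in> R" using r by (simp add: whit_def)
  have "whit (?f c)" for c
   using p r rR by (intro whit_diff whit_mult R_mult Umon_R) (auto simp: whit_0)
  moreover have "(\<Sum>c\<in>box s. Uu c * ?f c) \<in> I"
  proof -
   have "(\<Sum>c\<in>box s. Uu c * ?f c) = (\<Sum>c\<in>box s. Uu c * (p c * (Uu b * r)) - (if c = b then Uu c * r else 0))"
    by (rule sum.cong) (auto simp: right_diff_distrib)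
   also have "\<dots> = (\<Sum>a\<in>box s. Uu a * p a) * (Uu b * r) - Uu b * r"
    unfolding sum_subtractf sum_distrib_right mult.assoc using b finite_box by simp
   also have "\<dots> = - ((1 - (\<Sum>a\<in>box s. Uu a * p a)) * (Uu b * r))" by (simp add: left_diff_distrib)
   also have "\<dots> \<in> I" using p rR by (intro I_minus I_right R_mult Umon_R) auto
   finally show ?thesis .
  qed
  ultimately show ?thesis by (rule expand_unique[of ?f, OF _ _ that(1)])
 qed
 show ?thesis by (rule that[OF p(1)[rule_format] p(2) units])
qed

text \<open>Multiply the relation by \<open>Uu a * e\<close>: terms of smaller key have coefficient
  0 by induction, those of larger key pair to zero. A nonzero coefficient at \<open>a\<close> would
  put \<open>e\<close> into \<open>I\<close>; then every Whittaker vector lies in \<open>I\<close>,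
  and by \<open>expand_all\<close> so does 1.\<close>

theorem zmon_independent:
 assumes "(\<Sum>a\<in>box s. sc (c a) * zmon s a) \<in> I" and "1 \<notin> I"
 shows "a \<in> box s ==> c a = 0"
proof (induction "key a" arbitrary: a rule: less_induct)
 case less
 obtain e where e: "whit e" "1 - e \<in> J" using exists_generator by blast
 have "sc (c b) * (zmon s b * (Uu a * e)) - (if a = b then sc (c a) * (sc (of_nat (cf 0 a)) * e) else 0) \<in> I"
  if b: "b \<in> box s" for b
 proof (cases "key a \<le> key b")
  case True
  from I_left[OF sc_R pairing_whit[OF b less.prems True e(1)], of "c b"] show ?thesis
   by (auto simp: right_diff_distrib)
 next
  case False
  then have "c b = 0" using less.hyps[of b] b by simp
  then show ?thesis using False by (auto simp: sc_0 I_0)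
 qed
 from I_sum_delta[OF finite_box less.prems this]
 have 1: "(\<Sum>b\<in>box s. sc (c b) * zmon s b) * (Uu a * e) - sc (c a) * (sc (of_nat (cf 0 a)) * e) \<in> I"
  unfolding sum_distrib_right mult.assoc .
 have "(\<Sum>b\<in>box s. sc (c b) * zmon s b) * (Uu a * e) \<in> I"
  using assms(1) e(1) by (intro I_right R_mult Umon_R) (auto simp: whit_def)
 from I_diff[OF this 1] have 2: "sc (c a) * (sc (of_nat (cf 0 a)) * e) \<in> I" by simp
 show ?case
 proof (rule ccontr)
  assume ca: "c a \<noteq> 0"
  have "sc (1 / of_nat (cf 0 a)) * (sc (1 / c a) * (sc (c a) * (sc (of_nat (cf 0 a)) * e))) \<in> I"
   by (intro I_left[OF sc_R] 2)
  then have eI: "e \<in> I" using ca cf_nz[OF less.prems] by (simp add: sc_inverse)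
  have wI: "r \<in> I" if "whit r" for r
  proof -
   have "(1 - e) * r \<in> I" using J_whit[OF e(2) that] .
   moreover have "e * r \<in> I" using eI that by (auto simp: whit_def intro: I_right)
   ultimately show ?thesis using I_add[of "(1 - e) * r" "e * r"] by (simp add: left_diff_distrib)
  qed
  obtain p where p: "\<forall>a. whit (p a)" "1 - (\<Sum>a\<in>box s. Uu a * p a) \<in> I"
   using expand_all[OF R_1] by blast
  have "(\<Sum>a\<in>box s. Uu a * p a) \<in> I" by (intro I_sum I_left Umon_R wI p(1)[rule_format])
  from I_cancel[OF p(2) this] show False using assms(2) by simp
 qed
qed

end

section \<open>Morita theory for an even full idempotent\<close>

lemma left_supermoduleD:
 assumes "left_supermodule A M"
 shows "abelian_group M" and "[|a \<in> carrier A; x \<in> carrier M|] ==> a \<odot>\<^bsub>M\<^esub> x \<in> carrier M"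
  and "[|a \<in> carrier A; b \<in> carrier A; x \<in> carrier M|] ==> (a \<oplus>\<^bsub>A\<^esub> b) \<odot>\<^bsub>M\<^esub> x = a \<odot>\<^bsub>M\<^esub> x \<oplus>\<^bsub>M\<^esub> b \<odot>\<^bsub>M\<^esub> x"
  and "[|a \<in> carrier A; b \<in> carrier A; x \<in> carrier M|] ==> (a \<otimes>\<^bsub>A\<^esub> b) \<odot>\<^bsub>M\<^esub> x = a \<odot>\<^bsub>M\<^esub> (b \<odot>\<^bsub>M\<^esub> x)"
  and "subgroup (hcomp M i) (add_monoid M)" and "hcomp M 0 \<inter> hcomp M 1 = {\<zero>\<^bsub>M\<^esub>}"
  and "x \<in> carrier M ==> \<exists>y\<in>hcomp M 0. \<exists>z\<in>hcomp M 1. x = y \<oplus>\<^bsub>M\<^esub> z"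
  and "[|a \<in> hcomp A i; x \<in> hcomp M j|] ==> a \<odot>\<^bsub>M\<^esub> x \<in> hcomp M (i + j)"
 using assms unfolding left_supermodule_def by blast+

text \<open>\<open>cls\<close> and \<open>\<kappa>\<close> send representatives to the records
  \<open>U\<close> and \<open>Q\<close>, and \<open>\<kappa>_eq\<close> says that \<open>Q\<close>
  is \<open>U e\<close>. The conditions on \<open>p\<close> and \<open>q\<close> express that
  \<open>U\<close> is a direct sum of \<delta> copies of \<open>U e\<close>: right multiplication by
  \<open>q k * e\<close> maps to the copies, right multiplication by \<open>p k\<close> maps back.
  The map \<sigma> is the parity automorphism.\<close>

locale morita = quotient_algebra sc R I for sc :: "'k::field => 'a::ring_1" and R I +
 fixes Rh :: "bit => 'a set" and \<sigma> :: "'a => 'a" and e :: 'a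
  and U :: "('k, 'u) graded_module" and Q :: "('u, 'q) graded_module"
  and cls :: "'a => 'u" and \<kappa> :: "'a => 'q" and \<delta> :: nat and p q :: "nat => 'a"
 assumes Rh_R: "Rh i \<subseteq> R" and Rh_add: "[|x \<in> Rh i; y \<in> Rh i|] ==> x + y \<in> Rh i"
  and Rh_mult: "[|x \<in> Rh i; y \<in> Rh j|] ==> x * y \<in> Rh (i + j)" and Rh_sc: "sc c \<in> Rh 0"
  and decomp: "x \<in> R ==> \<exists>y\<in>Rh 0. \<exists>z\<in>Rh 1. x - (y + z) \<in> I"
  and \<sigma>_add: "\<sigma> (x + y) = \<sigma> x + \<sigma> y" and \<sigma>_mult: "\<sigma> (x * y) = \<sigma> x * \<sigma> y" and \<sigma>_sc: "\<sigma> (sc c) = sc c"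
  and \<sigma>_R: "x \<in> R ==> \<sigma> x \<in> R" and \<sigma>_I: "x \<in> I ==> \<sigma> x \<in> I"
  and \<sigma>_even: "x \<in> Rh 0 ==> \<sigma> x - x \<in> I" and \<sigma>_odd: "x \<in> Rh 1 ==> \<sigma> x + x \<in> I"
  and two: "(2 :: 'k) \<noteq> 0"
  and e_Rh: "e \<in> Rh 0" and e_idem: "e * e - e \<in> I"
  and U_carrier: "carrier U = cls ` R" and cls_eq: "[|x \<in> R; y \<in> R|] ==> cls x = cls y \<longleftrightarrow> x - y \<in> I"
  and U_add: "[|x \<in> R; y \<in> R|] ==> cls x \<oplus>\<^bsub>U\<^esub> cls y = cls (x + y)"
  and U_mult: "[|x \<in> R; y \<in> R|] ==> cls x \<otimes>\<^bsub>U\<^esub> cls y = cls (x * y)"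
  and U_one: "\<one>\<^bsub>U\<^esub> = cls 1" and U_zero: "\<zero>\<^bsub>U\<^esub> = cls 0"
  and U_smult: "x \<in> R ==> c \<odot>\<^bsub>U\<^esub> cls x = cls (sc c * x)" and U_hcomp: "hcomp U i = cls ` Rh i"
  and Q_carrier: "carrier Q = \<kappa> ` R"
  and \<kappa>_eq: "[|x \<in> R; y \<in> R|] ==> \<kappa> x = \<kappa> y \<longleftrightarrow> (x - y) * e \<in> I"
  and Q_add: "[|x \<in> R; y \<in> R|] ==> \<kappa> x \<oplus>\<^bsub>Q\<^esub> \<kappa> y = \<kappa> (x + y)" and Q_zero: "\<zero>\<^bsub>Q\<^esub> = \<kappa> 0"
  and Q_smult: "[|a \<in> R; x \<in> R|] ==> cls a \<odot>\<^bsub>Q\<^esub> \<kappa> x = \<kappa> (a * x)" and Q_hcomp: "hcomp Q i = \<kappa> ` Rh i"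
  and p_R: "k < \<delta> ==> p k \<in> R" and q_R: "k < \<delta> ==> q k \<in> R" and e_p: "k < \<delta> ==> e * p k - p k \<in> I"
  and p_q: "[|k < \<delta>; l < \<delta>|] ==> p k * (q l * e) - (if k = l then e else 0) \<in> I"
  and q_p: "1 - (\<Sum>k<\<delta>. q k * p k) \<in> I"
begin

definition eqv :: "'a => 'a => bool" (infix "\<sim>\<^sub>I" 50) where "x \<sim>\<^sub>I y \<longleftrightarrow> x - y \<in> I"

lemma eqv_refl: "x \<sim>\<^sub>I x" by (simp add: eqv_def I_0)
lemma eqv_sym: "x \<sim>\<^sub>I y ==> y \<sim>\<^sub>I x" by (simp add: eqv_def I_sym)
lemma eqv_trans [trans]: "x \<sim>\<^sub>I y ==> y \<sim>\<^sub>I z ==> x \<sim>\<^sub>I z" by (simp add: eqv_def I_trans)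
lemma eqv_eq [trans]: "x \<sim>\<^sub>I y ==> y = z ==> x \<sim>\<^sub>I z" "x = y ==> y \<sim>\<^sub>I z ==> x \<sim>\<^sub>I z" by simp_all
lemma eqv_add: "x \<sim>\<^sub>I x' ==> y \<sim>\<^sub>I y' ==> x + y \<sim>\<^sub>I x' + y'"
 unfolding eqv_def using I_add[of "x - x'" "y - y'"] by (simp add: algebra_simps)
lemma eqv_minus: "x \<sim>\<^sub>I x' ==> - x \<sim>\<^sub>I - x'"
 unfolding eqv_def using I_minus[of "x - x'"] by simp
lemma eqv_diff: "x \<sim>\<^sub>I x' ==> y \<sim>\<^sub>I y' ==> x - y \<sim>\<^sub>I x' - y'"
 using eqv_add[OF _ eqv_minus, of x x' y y'] by simp
lemma eqv_left: "y \<sim>\<^sub>I y' ==> x \<in> R ==> x * y \<sim>\<^sub>I x * y'"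
 unfolding eqv_def right_diff_distrib[symmetric] by (rule I_left)
lemma eqv_right: "x \<sim>\<^sub>I x' ==> y \<in> R ==> x * y \<sim>\<^sub>I x' * y"
 unfolding eqv_def left_diff_distrib[symmetric] by (rule I_right)
lemma eqv_mult: "x \<sim>\<^sub>I x' ==> y \<sim>\<^sub>I y' ==> x' \<in> R ==> y \<in> R ==> x * y \<sim>\<^sub>I x' * y'"
 by (rule eqv_trans[OF eqv_right eqv_left])
lemma eqv_sum: "(\<And>a. a \<in> A ==> f a \<sim>\<^sub>I g a) ==> sum f A \<sim>\<^sub>I sum g A"
 by (induction A rule: infinite_finite_induct) (auto intro: eqv_refl eqv_add)

lemma \<sigma>_0: "\<sigma> 0 = 0" using \<sigma>_add[of 0 0] by simp
lemma \<sigma>_1: "\<sigma> 1 = 1" using \<sigma>_sc[of 1] by (simp add: sc_1)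
lemma \<sigma>_minus: "\<sigma> (- x) = - \<sigma> x" using \<sigma>_add[of "- x" x] by (simp add: \<sigma>_0 eq_neg_iff_add_eq_0)
lemma \<sigma>_diff: "\<sigma> (x - y) = \<sigma> x - \<sigma> y" using \<sigma>_add[of x "- y"] by (simp add: \<sigma>_minus)
lemma \<sigma>_eqv: "x \<sim>\<^sub>I y ==> \<sigma> x \<sim>\<^sub>I \<sigma> y" unfolding eqv_def \<sigma>_diff[symmetric] by (rule \<sigma>_I)

lemma \<sigma>_pair: "y \<in> Rh 0 ==> z \<in> Rh 1 ==> x \<sim>\<^sub>I y + z ==> \<sigma> x \<sim>\<^sub>I y - z"
proof -
 assume *: "y \<in> Rh 0" "z \<in> Rh 1" "x \<sim>\<^sub>I y + z"
 have "\<sigma> y \<sim>\<^sub>I y" "\<sigma> z \<sim>\<^sub>I - z" using \<sigma>_even[OF *(1)] \<sigma>_odd[OF *(2)] by (auto simp: eqv_def)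
 from eqv_add[OF this] have "\<sigma> (y + z) \<sim>\<^sub>I y - z" by (simp add: \<sigma>_add)
 with \<sigma>_eqv[OF *(3)] show ?thesis by (rule eqv_trans)
qed

lemma \<sigma>\<sigma>: "x \<in> R ==> \<sigma> (\<sigma> x) \<sim>\<^sub>I x"
proof -
 assume "x \<in> R"
 then obtain y z where *: "y \<in> Rh 0" "z \<in> Rh 1" "x \<sim>\<^sub>I y + z" using decomp[of x] unfolding eqv_def by blast
 from Rh_mult[OF Rh_sc[of "- 1"] *(2)] have mz: "- z \<in> Rh 1" by (simp add: sc_minus1)
 have "\<sigma> x \<sim>\<^sub>I y + - z" using \<sigma>_pair[OF *] by simp
 from \<sigma>_pair[OF *(1) mz this] have "\<sigma> (\<sigma> x) \<sim>\<^sub>I y + z" by simp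
 then show ?thesis using *(3) eqv_sym eqv_trans by blast
qed

text \<open>\<open>decomp\<close> only asserts that homogeneous parts exist modulo \<open>I\<close>.
  Averaging with \<sigma> gives parts that are functions of \<open>x\<close> and exactly additive;
  this is where 2 has to be invertible.\<close>

definition ev :: "'a => 'a" where "ev x = sc (1 / 2) * (x + \<sigma> x)"
definition od :: "'a => 'a" where "od x = sc (1 / 2) * (x - \<sigma> x)"

lemma half: "sc (1 / 2) * (x + x) = x"
proof -
 have "sc (1 / 2) * (x + x) = sc (1 / 2 + 1 / 2) * x" by (simp only: distrib_left distrib_right sc_add)
 also have "1 / 2 + 1 / 2 = (1 :: 'k)" using two by (metis add_divide_distrib divide_self one_add_one)
 finally show ?thesis by (simp add: sc_1)
qed

lemma ev_od: "ev x + od x = x" using half[of x] by (simp add: ev_def od_def distrib_left[symmetric])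
lemma ev_R: "x \<in> R ==> ev x \<in> R" by (simp add: ev_def R_mult sc_R R_add \<sigma>_R)
lemma od_R: "x \<in> R ==> od x \<in> R" by (simp add: od_def R_mult sc_R R_diff \<sigma>_R)
lemma ev_add: "ev (x + y) = ev x + ev y" by (simp add: ev_def \<sigma>_add distrib_left algebra_simps)
lemma od_add: "od (x + y) = od x + od y" by (simp add: od_def \<sigma>_add algebra_simps)
lemma ev_sc: "ev (sc c * x) = sc c * ev x" 
 unfolding ev_def \<sigma>_mult \<sigma>_sc distrib_left[symmetric] by (rule sc_left_commute)
lemma od_sc: "od (sc c * x) = sc c * od x" 
 unfolding od_def \<sigma>_mult \<sigma>_sc right_diff_distrib[symmetric] by (rule sc_left_commute)
lemma ev_eqv: "x \<sim>\<^sub>I y ==> ev x \<sim>\<^sub>I ev y" unfolding ev_def by (intro eqv_left eqv_add \<sigma>_eqv sc_R)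
lemma od_eqv: "x \<sim>\<^sub>I y ==> od x \<sim>\<^sub>I od y" unfolding od_def by (intro eqv_left eqv_diff \<sigma>_eqv sc_R)

lemma ev_Rh: "x \<in> Rh 0 ==> ev x \<sim>\<^sub>I x"
proof -
 assume "x \<in> Rh 0"
 then have "sc (1 / 2) * (x + \<sigma> x) \<sim>\<^sub>I sc (1 / 2) * (x + x)"
  by (intro eqv_left eqv_add eqv_refl sc_R) (simp add: eqv_def \<sigma>_even)
 then show ?thesis by (simp add: half ev_def)
qed
lemma od_Rh: "x \<in> Rh 1 ==> od x \<sim>\<^sub>I x"
proof -
 assume "x \<in> Rh 1"
 then have "sc (1 / 2) * (x - \<sigma> x) \<sim>\<^sub>I sc (1 / 2) * (x - - x)"
  by (intro eqv_left eqv_diff eqv_refl sc_R) (simp add: eqv_def \<sigma>_odd)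
 then show ?thesis by (simp add: half od_def)
qed
lemma od_even: "x \<in> Rh 0 ==> od x \<sim>\<^sub>I 0"
proof -
 assume "x \<in> Rh 0"
 then have "x - ev x \<sim>\<^sub>I ev x - ev x" by (intro eqv_diff eqv_refl eqv_sym[OF ev_Rh])
 moreover have "x - ev x = od x" using ev_od[of x] by (metis add_diff_cancel_left')
 ultimately show ?thesis by simp
qed
lemma ev_odd: "x \<in> Rh 1 ==> ev x \<sim>\<^sub>I 0"
proof -
 assume "x \<in> Rh 1"
 then have "x - od x \<sim>\<^sub>I od x - od x" by (intro eqv_diff eqv_refl eqv_sym[OF od_Rh])
 moreover have "x - od x = ev x" using ev_od[of x] by (metis add_diff_cancel_right')
 ultimately show ?thesis by simp
qed
lemma \<sigma>_ev: "x \<in> R ==> \<sigma> (ev x) \<sim>\<^sub>I ev x"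
proof -
 assume "x \<in> R"
 then have "sc (1 / 2) * (\<sigma> x + \<sigma> (\<sigma> x)) \<sim>\<^sub>I sc (1 / 2) * (\<sigma> x + x)" by (intro eqv_left eqv_add eqv_refl sc_R \<sigma>\<sigma>)
 then show ?thesis by (simp add: ev_def \<sigma>_mult \<sigma>_sc \<sigma>_add add.commute)
qed
lemma \<sigma>_od: "x \<in> R ==> \<sigma> (od x) \<sim>\<^sub>I - od x"
proof -
 assume "x \<in> R"
 then have "sc (1 / 2) * (\<sigma> x - \<sigma> (\<sigma> x)) \<sim>\<^sub>I sc (1 / 2) * (\<sigma> x - x)" by (intro eqv_left eqv_diff eqv_refl sc_R \<sigma>\<sigma>)
 then show ?thesis by (simp add: od_def \<sigma>_mult \<sigma>_sc \<sigma>_diff right_diff_distrib)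
qed

lemma disjoint: "x \<in> Rh 0 ==> y \<in> Rh 1 ==> x \<sim>\<^sub>I y ==> x \<sim>\<^sub>I 0"
proof -
 assume *: "x \<in> Rh 0" "y \<in> Rh 1" "x \<sim>\<^sub>I y"
 have "x \<sim>\<^sub>I ev x" using ev_Rh[OF *(1)] by (rule eqv_sym)
 also have "ev x \<sim>\<^sub>I ev y" using *(3) by (rule ev_eqv)
 also have "ev y \<sim>\<^sub>I 0" using ev_odd[OF *(2)] .
 finally show ?thesis .
qed

lemma Rh_minus: "x \<in> Rh i ==> - x \<in> Rh i"
 by (drule Rh_mult[OF Rh_sc[of "- 1"]]) (simp only: sc_minus1 add_0)
lemma Rh_0: "0 \<in> Rh i"
proof -
 obtain y z where "y \<in> Rh 0" "z \<in> Rh 1" using decomp[OF R_1] by blast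
 then have "sc 0 * y \<in> Rh 0" "sc 0 * z \<in> Rh 1" using Rh_mult[OF Rh_sc] by fastforce+
 then show ?thesis by (cases i) (auto simp: sc_0)
qed
lemma Rh_1: "1 \<in> Rh 0" using Rh_sc[of 1] by (simp add: sc_1)
lemma e_R: "e \<in> R" using e_Rh Rh_R by blast

lemma \<kappa>_eqv: "x \<in> R ==> y \<in> R ==> x \<sim>\<^sub>I y ==> \<kappa> x = \<kappa> y"
 by (simp add: \<kappa>_eq eqv_def I_right e_R)
lemma cls_eqv: "x \<in> R ==> y \<in> R ==> cls x = cls y \<longleftrightarrow> x \<sim>\<^sub>I y" by (simp add: cls_eq eqv_def)
lemma \<kappa>_eqv_iff: "x \<in> R ==> y \<in> R ==> \<kappa> x = \<kappa> y \<longleftrightarrow> x * e \<sim>\<^sub>I y * e"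
 by (simp add: \<kappa>_eq eqv_def left_diff_distrib)

lemma \<kappa>_e: "x \<in> R ==> \<kappa> (x * e) = \<kappa> x"
proof -
 assume x: "x \<in> R"
 have "x * (e * e) \<sim>\<^sub>I x * e" using e_idem x by (intro eqv_left) (simp_all add: eqv_def)
 then show ?thesis using x e_R by (simp add: \<kappa>_eqv_iff R_mult mult.assoc)
qed

lemma abelian_Q: "abelian_group Q"
proof (rule abelian_groupI)
 fix x y z assume "x \<in> carrier Q" "y \<in> carrier Q" "z \<in> carrier Q"
 then obtain a b c where "x = \<kappa> a" "y = \<kappa> b" "z = \<kappa> c" "a \<in> R" "b \<in> R" "c \<in> R" by (auto simp: Q_carrier)
 then show "x \<oplus>\<^bsub>Q\<^esub> y \<oplus>\<^bsub>Q\<^esub> z = x \<oplus>\<^bsub>Q\<^esub> (y \<oplus>\<^bsub>Q\<^esub> z)" by (simp add: Q_add R_add add.assoc)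
next
 fix x assume "x \<in> carrier Q"
 then obtain a where a: "x = \<kappa> a" "a \<in> R" by (auto simp: Q_carrier)
 then have "\<kappa> (- a) \<oplus>\<^bsub>Q\<^esub> x = \<zero>\<^bsub>Q\<^esub>" by (simp add: Q_add R_minus Q_zero)
 then show "\<exists>y\<in>carrier Q. y \<oplus>\<^bsub>Q\<^esub> x = \<zero>\<^bsub>Q\<^esub>" using a by (auto simp: Q_carrier R_minus)
qed (auto simp: Q_carrier Q_add Q_zero R_0 R_add add.commute)

lemma Q_minus: "x \<in> R ==> \<ominus>\<^bsub>Q\<^esub> \<kappa> x = \<kappa> (- x)"
 by (rule abelian_group.minus_equality[OF abelian_Q]) (auto simp: Q_carrier Q_add Q_zero R_minus)

lemma left_supermodule_Q: "left_supermodule U Q"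
 unfolding left_supermodule_def
proof (intro conjI ballI allI)
 show "abelian_group Q" by (rule abelian_Q)
 fix a b x y assume "a \<in> carrier U" "b \<in> carrier U" "x \<in> carrier Q" "y \<in> carrier Q"
 then obtain a' b' x' y' where *: "a = cls a'" "b = cls b'" "x = \<kappa> x'" "y = \<kappa> y'"
  and R: "a' \<in> R" "b' \<in> R" "x' \<in> R" "y' \<in> R" by (auto simp: Q_carrier U_carrier)
 show "a \<odot>\<^bsub>Q\<^esub> x \<in> carrier Q" using R by (simp add: * Q_smult Q_carrier R_mult)
 show "(a \<oplus>\<^bsub>U\<^esub> b) \<odot>\<^bsub>Q\<^esub> x = a \<odot>\<^bsub>Q\<^esub> x \<oplus>\<^bsub>Q\<^esub> b \<odot>\<^bsub>Q\<^esub> x"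
  using R by (simp add: * Q_smult U_add Q_add R_mult R_add distrib_right)
 show "a \<odot>\<^bsub>Q\<^esub> (x \<oplus>\<^bsub>Q\<^esub> y) = a \<odot>\<^bsub>Q\<^esub> x \<oplus>\<^bsub>Q\<^esub> a \<odot>\<^bsub>Q\<^esub> y"
  using R by (simp add: * Q_smult Q_add R_mult R_add distrib_left)
 show "(a \<otimes>\<^bsub>U\<^esub> b) \<odot>\<^bsub>Q\<^esub> x = a \<odot>\<^bsub>Q\<^esub> (b \<odot>\<^bsub>Q\<^esub> x)"
  using R by (simp add: * Q_smult U_mult R_mult mult.assoc)
 show "\<one>\<^bsub>U\<^esub> \<odot>\<^bsub>Q\<^esub> x = x" using R by (simp add: * Q_smult U_one R_1)
next
 fix i
 show "subgroup (hcomp Q i) (add_monoid Q)"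
 proof
  show "hcomp Q i \<subseteq> carrier (add_monoid Q)" using Rh_R by (auto simp: Q_hcomp Q_carrier)
  fix x assume "x \<in> hcomp Q i"
  then obtain x' where x: "x = \<kappa> x'" "x' \<in> Rh i" "x' \<in> R" using Rh_R by (auto simp: Q_hcomp)
  show "inv\<^bsub>add_monoid Q\<^esub> x \<in> hcomp Q i"
   using Q_minus[OF x(3)] x Rh_minus by (auto simp: a_inv_def Q_hcomp)
  fix y assume "y \<in> hcomp Q i"
  then obtain y' where y: "y = \<kappa> y'" "y' \<in> Rh i" "y' \<in> R" using Rh_R by (auto simp: Q_hcomp)
  show "x \<otimes>\<^bsub>add_monoid Q\<^esub> y \<in> hcomp Q i" using x y by (auto simp: Q_add Q_hcomp Rh_add)
 qed (auto simp: Q_zero Q_hcomp Rh_0)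
next
 show "hcomp Q 0 \<inter> hcomp Q 1 = {\<zero>\<^bsub>Q\<^esub>}"
 proof
  show "hcomp Q 0 \<inter> hcomp Q 1 \<subseteq> {\<zero>\<^bsub>Q\<^esub>}"
  proof
   fix x assume "x \<in> hcomp Q 0 \<inter> hcomp Q 1"
   then obtain y z where *: "x = \<kappa> y" "y \<in> Rh 0" "\<kappa> y = \<kappa> z" "z \<in> Rh 1" by (auto simp: Q_hcomp)
   have yz: "y \<in> R" "z \<in> R" using * Rh_R by auto
   have "y * e \<sim>\<^sub>I z * e" using * yz by (simp add: \<kappa>_eqv_iff)
   then have "y * e \<sim>\<^sub>I 0" using Rh_mult[OF *(2) e_Rh] Rh_mult[OF *(4) e_Rh] disjoint by simp
   then have "\<kappa> y = \<kappa> 0" using yz by (simp add: \<kappa>_eqv_iff R_0)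
   then show "x \<in> {\<zero>\<^bsub>Q\<^esub>}" using *(1) by (simp add: Q_zero)
  qed
 qed (auto simp: Q_zero Q_hcomp Rh_0)
 show "carrier Q = {x \<oplus>\<^bsub>Q\<^esub> y |x y. x \<in> hcomp Q 0 \<and> y \<in> hcomp Q 1}"
 proof (intro Set.set_eqI iffI)
  fix x assume "x \<in> carrier Q"
  then obtain x' where x: "x = \<kappa> x'" "x' \<in> R" by (auto simp: Q_carrier)
  then obtain y z where *: "y \<in> Rh 0" "z \<in> Rh 1" "x' \<sim>\<^sub>I y + z" using decomp[of x'] unfolding eqv_def by blast
  have yz: "y \<in> R" "z \<in> R" using * Rh_R by auto
  then have "x = \<kappa> y \<oplus>\<^bsub>Q\<^esub> \<kappa> z" using x * by (simp add: Q_add R_add \<kappa>_eqv)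
  then show "x \<in> {x \<oplus>\<^bsub>Q\<^esub> y |x y. x \<in> hcomp Q 0 \<and> y \<in> hcomp Q 1}" using * by (auto simp: Q_hcomp)
 next
  fix x assume "x \<in> {x \<oplus>\<^bsub>Q\<^esub> y |x y. x \<in> hcomp Q 0 \<and> y \<in> hcomp Q 1}"
  then obtain y z where "x = \<kappa> y \<oplus>\<^bsub>Q\<^esub> \<kappa> z" "y \<in> R" "z \<in> R" using Rh_R by (fastforce simp: Q_hcomp)
  then show "x \<in> carrier Q" by (simp add: Q_add Q_carrier R_add)
 qed
next
 fix i j a x assume "a \<in> hcomp U i" "x \<in> hcomp Q j"
 then obtain a' x' where "a = cls a'" "x = \<kappa> x'" "a' \<in> Rh i" "x' \<in> Rh j" by (auto simp: Q_hcomp U_hcomp)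
 moreover from this have "a' \<in> R" "x' \<in> R" using Rh_R by auto
 ultimately show "a \<odot>\<^bsub>Q\<^esub> x \<in> hcomp Q (i + j)"
  using Rh_mult[of a' i x' j] unfolding Q_hcomp by (simp only: Q_smult imageI)
qed

text \<open>A homomorphism from \<open>U e\<close> is determined by the image of
  \<open>\<kappa> 1\<close>, which equals \<open>\<kappa> e\<close>. Lift this image to an even
  element \<open>m0\<close> of \<open>M\<close> and send \<open>\<kappa> x\<close> to
  \<open>x e\<close> applied to \<open>m0\<close>.\<close>

lemma projective_Q: "projective_supermodule TYPE('m) TYPE('n) U Q"
 unfolding projective_supermodule_def
proof (intro conjI left_supermodule_Q allI impI)
 fix M :: "('u, 'm) graded_module" and N :: "('u, 'n) graded_module" and \<pi> f
 assume A: "left_supermodule U M \<and> left_supermodule U N \<and> \<pi> \<in> supermodule_hom U M N \<and>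
  \<pi> ` carrier M = carrier N \<and> f \<in> supermodule_hom U Q N"
 then have M: "left_supermodule U M" and N: "left_supermodule U N" and \<pi>: "\<pi> \<in> supermodule_hom U M N"
  and surj: "\<pi> ` carrier M = carrier N" and f: "f \<in> supermodule_hom U Q N" by auto
 interpret M: abelian_group M by (rule left_supermoduleD(1)[OF M])
 interpret N: abelian_group N by (rule left_supermoduleD(1)[OF N])
 note M_cl = left_supermoduleD(2)[OF M] and M_add = left_supermoduleD(3)[OF M]
  and M_mult = left_supermoduleD(4)[OF M] and M_hc = left_supermoduleD(8)[OF M]
  and N_sub = left_supermoduleD(5)[OF N]
 have M_sub: "hcomp M i \<subseteq> carrier M" for i
  using subgroup.subset[OF left_supermoduleD(5)[OF M, of i]] by simp
 have \<pi>_add: "\<pi> (x \<oplus>\<^bsub>M\<^esub> y) = \<pi> x \<oplus>\<^bsub>N\<^esub> \<pi> y" and \<pi>_cl: "\<pi> x \<in> carrier N" if "x \<in> carrier M" "y \<in> carrier M" for x y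
  using \<pi> that by (auto simp: supermodule_hom_def)
 have \<pi>_smult: "\<pi> (a \<odot>\<^bsub>M\<^esub> x) = a \<odot>\<^bsub>N\<^esub> \<pi> x" if "a \<in> carrier U" "x \<in> carrier M" for a x
  using \<pi> that by (auto simp: supermodule_hom_def)
 have \<pi>_hc: "\<pi> x \<in> hcomp N i" if "x \<in> hcomp M i" for x i
  using \<pi> that unfolding supermodule_hom_def by blast
 have f_smult: "f (cls a \<odot>\<^bsub>Q\<^esub> x) = cls a \<odot>\<^bsub>N\<^esub> f x" if "a \<in> R" "x \<in> carrier Q" for a x
  using f that by (auto simp: supermodule_hom_def U_carrier)
 have one: "\<kappa> 1 \<in> hcomp Q 0" "\<kappa> 1 \<in> carrier Q" by (auto simp: Q_hcomp Rh_1 Q_carrier R_1)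
 then have f1: "f (\<kappa> 1) \<in> hcomp N 0" "f (\<kappa> 1) \<in> carrier N"
  using f unfolding supermodule_hom_def by blast+
 obtain m where m: "m \<in> carrier M" "\<pi> m = f (\<kappa> 1)" using surj f1(2) by (metis imageE)
 obtain m0 m1 where m01: "m = m0 \<oplus>\<^bsub>M\<^esub> m1" "m0 \<in> hcomp M 0" "m1 \<in> hcomp M 1"
  using left_supermoduleD(7)[OF M m(1)] by blast
 have mc: "m0 \<in> carrier M" "m1 \<in> carrier M" using m01 M_sub by auto
 have sum: "f (\<kappa> 1) = \<pi> m0 \<oplus>\<^bsub>N\<^esub> \<pi> m1" using m m01 \<pi>_add mc by simp
 have pc: "\<pi> m0 \<in> carrier N" "\<pi> m1 \<in> carrier N" using mc \<pi>_cl by auto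
 \<comment> \<open>The odd part of the lift is mapped to an element that is both even and odd, hence
   to zero; so the even part alone is a lift.\<close>
 have "\<pi> m1 = \<ominus>\<^bsub>N\<^esub> \<pi> m0 \<oplus>\<^bsub>N\<^esub> f (\<kappa> 1)" using sum pc by (simp add: N.r_neg1)
 moreover have "\<ominus>\<^bsub>N\<^esub> \<pi> m0 \<in> hcomp N 0"
  using subgroup.m_inv_closed[OF N_sub \<pi>_hc[OF m01(2)]] by (simp add: a_inv_def)
 ultimately have "\<pi> m1 \<in> hcomp N 0" using subgroup.m_closed[OF N_sub _ f1(1)] by simp
 then have "\<pi> m1 = \<zero>\<^bsub>N\<^esub>" using \<pi>_hc[OF m01(3)] left_supermoduleD(6)[OF N] by blast
 then have m0: "\<pi> m0 = f (\<kappa> 1)" using sum pc by simp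
 define h where "h \<xi> = cls ((SOME x. x \<in> R \<and> \<kappa> x = \<xi>) * e) \<odot>\<^bsub>M\<^esub> m0" for \<xi>
 have h: "h (\<kappa> x) = cls (x * e) \<odot>\<^bsub>M\<^esub> m0" if "x \<in> R" for x
 proof -
  have "\<exists>y. y \<in> R \<and> \<kappa> y = \<kappa> x" using that by blast
  from someI_ex[OF this] have "(SOME y. y \<in> R \<and> \<kappa> y = \<kappa> x) \<in> R" "(SOME y. y \<in> R \<and> \<kappa> y = \<kappa> x) * e \<sim>\<^sub>I x * e"
   using that by (auto simp: \<kappa>_eqv_iff)
  then have "cls ((SOME y. y \<in> R \<and> \<kappa> y = \<kappa> x) * e) = cls (x * e)"
   using that e_R by (subst cls_eqv) (auto intro: R_mult)
  then show ?thesis by (simp add: h_def)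
 qed
 have clR: "cls x \<in> carrier U" if "x \<in> R" for x using that by (auto simp: U_carrier)
 have "h \<in> supermodule_hom U Q M"
  unfolding supermodule_hom_def
 proof (intro CollectI conjI ballI allI Pi_I)
  fix x assume "x \<in> carrier Q"
  then obtain x' where x: "x = \<kappa> x'" "x' \<in> R" by (auto simp: Q_carrier)
  show "h x \<in> carrier M" using x mc(1) e_R by (simp add: h M_cl clR R_mult)
  { fix y assume "y \<in> carrier Q"
   then obtain y' where y: "y = \<kappa> y'" "y' \<in> R" by (auto simp: Q_carrier)
   show "h (x \<oplus>\<^bsub>Q\<^esub> y) = h x \<oplus>\<^bsub>M\<^esub> h y"
    using x y mc(1) e_R by (simp add: h Q_add R_add distrib_right U_add[symmetric] R_mult M_add clR) }
  { fix a assume "a \<in> carrier U"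
   then obtain a' where a: "a = cls a'" "a' \<in> R" by (auto simp: U_carrier)
   show "h (a \<odot>\<^bsub>Q\<^esub> x) = a \<odot>\<^bsub>M\<^esub> h x"
    using x a mc(1) e_R by (simp add: h Q_smult mult.assoc R_mult M_mult[symmetric] clR U_mult) }
 next
  fix i show "h ` hcomp Q i \<subseteq> hcomp M i"
  proof
   fix y assume "y \<in> h ` hcomp Q i"
   then obtain x where x: "y = h (\<kappa> x)" "x \<in> Rh i" by (auto simp: Q_hcomp)
   then have "y = cls (x * e) \<odot>\<^bsub>M\<^esub> m0" using h Rh_R by auto
   moreover have "cls (x * e) \<in> hcomp U i"
    using Rh_mult[OF x(2) e_Rh] unfolding U_hcomp by (simp only: add_0_right imageI)
   ultimately show "y \<in> hcomp M i" using M_hc[OF _ m01(2), of _ i] by (simp only: add_0_right)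
  qed
 qed
 moreover have "\<pi> (h x) = f x" if "x \<in> carrier Q" for x
 proof -
  obtain x' where x: "x = \<kappa> x'" "x' \<in> R" using \<open>x \<in> carrier Q\<close> by (auto simp: Q_carrier)
  then have "\<pi> (h x) = cls (x' * e) \<odot>\<^bsub>N\<^esub> f (\<kappa> 1)" using mc(1) e_R by (simp add: h \<pi>_smult clR R_mult m0)
  also have "\<dots> = f (cls (x' * e) \<odot>\<^bsub>Q\<^esub> \<kappa> 1)" using x e_R one by (simp add: f_smult R_mult)
  also have "cls (x' * e) \<odot>\<^bsub>Q\<^esub> \<kappa> 1 = x" using x e_R by (simp add: Q_smult R_mult R_1 \<kappa>_e)
  finally show ?thesis .
 qed
 ultimately show "\<exists>h\<in>supermodule_hom U Q M. \<forall>x\<in>carrier Q. \<pi> (h x) = f x" by blast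
qed

end

section \<open>Endomorphisms of \<open>Q\<close> and the matrix isomorphism\<close>

context morita begin

text \<open>Representatives of the corner algebra \<open>e U e\<close>.\<close>

definition E :: "'a set" where "E = {c \<in> R. e * c \<sim>\<^sub>I c \<and> c * e \<sim>\<^sub>I c}"

abbreviation EQ where "EQ \<equiv> End_superalgebra U Q"

definition rp :: "'q => 'a" where "rp \<xi> = (SOME x. x \<in> R \<and> \<kappa> x = \<xi>)"

text \<open>Right multiplication by \<open>c\<close>. The twist by \<sigma> in front of the odd part
  of \<open>c\<close> produces the sign that an odd endomorphism must show when it passes an odd
  element of \<open>U\<close>.\<close>

definition T :: "'a => 'q => 'q" where
 "T c = (\<lambda>\<xi>\<in>carrier Q. \<kappa> (rp \<xi> * ev c + \<sigma> (rp \<xi>) * od c))"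

lemma E_R: "c \<in> E ==> c \<in> R" by (simp add: E_def)

lemma \<sigma>_e: "\<sigma> e \<sim>\<^sub>I e" using \<sigma>_even[OF e_Rh] by (simp add: eqv_def)

lemma E_left: "c \<in> E ==> e * c \<sim>\<^sub>I c" and E_right: "c \<in> E ==> c * e \<sim>\<^sub>I c"
 by (auto simp: E_def)

lemma E_add: "c \<in> E ==> d \<in> E ==> c + d \<in> E"
 by (simp add: E_def R_add distrib_left distrib_right eqv_add)
lemma E_sc: "c \<in> E ==> sc k * c \<in> E"
 by (simp add: E_def R_mult sc_R sc_left_commute mult.assoc eqv_left)
lemma E_mult: "c \<in> E ==> d \<in> E ==> c * d \<in> E"
 unfolding E_def by (auto simp: R_mult mult.assoc intro: eqv_left) (simp add: mult.assoc[symmetric] eqv_right)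
lemma E_0: "0 \<in> E" by (simp add: E_def R_0 eqv_refl)
lemma E_e: "e \<in> E" using e_idem by (simp add: E_def e_R eqv_def)
lemma E_minus: "c \<in> E ==> - c \<in> E" using E_sc[of c "- 1"] by (simp add: sc_minus1)
lemma E_sum: "(\<And>a. a \<in> A ==> f a \<in> E) ==> sum f A \<in> E"
 by (induction A rule: infinite_finite_induct) (auto intro: E_0 E_add)
lemma E_\<sigma>: "c \<in> E ==> \<sigma> c \<in> E"
proof -
 assume c: "c \<in> E"
 then have R: "\<sigma> c \<in> R" by (simp add: E_R \<sigma>_R)
 have "e * \<sigma> c \<sim>\<^sub>I \<sigma> e * \<sigma> c" using R by (intro eqv_right eqv_sym[OF \<sigma>_e])
 also have "\<sigma> e * \<sigma> c = \<sigma> (e * c)" by (simp add: \<sigma>_mult)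
 also have "\<dots> \<sim>\<^sub>I \<sigma> c" using E_left[OF c] by (rule \<sigma>_eqv)
 finally have 1: "e * \<sigma> c \<sim>\<^sub>I \<sigma> c" .
 have "\<sigma> c * e \<sim>\<^sub>I \<sigma> c * \<sigma> e" using R by (intro eqv_left eqv_sym[OF \<sigma>_e])
 also have "\<sigma> c * \<sigma> e = \<sigma> (c * e)" by (simp add: \<sigma>_mult)
 also have "\<dots> \<sim>\<^sub>I \<sigma> c" using E_right[OF c] by (rule \<sigma>_eqv)
 finally show ?thesis using 1 R by (simp add: E_def)
qed

lemma E_ev: "c \<in> E ==> ev c \<in> E" unfolding ev_def by (intro E_sc E_add E_\<sigma>)
lemma E_od: "c \<in> E ==> od c \<in> E"
 unfolding od_def diff_conv_add_uminus by (intro E_sc E_add E_minus E_\<sigma>)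

lemma ev_ev: "x \<in> R ==> ev (ev x) \<sim>\<^sub>I ev x"
proof -
 assume "x \<in> R"
 from eqv_left[OF eqv_add[OF eqv_refl \<sigma>_ev[OF this]] sc_R, of "1/2" "ev x"]
 show ?thesis by (simp only: half ev_def[of "ev x"])
qed
lemma od_od: "x \<in> R ==> od (od x) \<sim>\<^sub>I od x"
proof -
 assume "x \<in> R"
 from eqv_left[OF eqv_diff[OF eqv_refl \<sigma>_od[OF this]] sc_R, of "1/2" "od x"]
 show ?thesis by (simp only: half od_def[of "od x"] diff_minus_eq_add)
qed
lemma od_ev: "x \<in> R ==> od (ev x) \<sim>\<^sub>I 0"
proof -
 assume "x \<in> R"
 from eqv_left[OF eqv_diff[OF eqv_refl \<sigma>_ev[OF this]] sc_R, of "1/2" "ev x"]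
 show ?thesis by (simp only: od_def[of "ev x"] diff_self mult_zero_right)
qed
lemma ev_od0: "x \<in> R ==> ev (od x) \<sim>\<^sub>I 0"
proof -
 assume "x \<in> R"
 from eqv_left[OF eqv_add[OF eqv_refl \<sigma>_od[OF this]] sc_R, of "1/2" "od x"]
 show ?thesis by (simp only: ev_def[of "od x"] right_minus mult_zero_right)
qed

text \<open>The class of \<open>x\<close> determines only \<open>x e\<close>. Inserting
  \<open>e\<close> in front of each part of \<open>c\<close> makes the products depend on
  \<open>x e\<close> alone; for the odd part \<open>e\<close> is first replaced by the congruent
  \<open>\<sigma> e\<close>.\<close>

lemma T_welldef:
 assumes x: "x \<in> R" "y \<in> R" "\<kappa> x = \<kappa> y" and c: "c \<in> E" "d \<in> E" "c \<sim>\<^sub>I d"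
 shows "\<kappa> (x * ev c + \<sigma> x * od c) = \<kappa> (y * ev d + \<sigma> y * od d)"
proof -
 have R: "ev c \<in> R" "od c \<in> R" "ev d \<in> R" "od d \<in> R" "\<sigma> x \<in> R" "\<sigma> y \<in> R"
  using assms by (auto intro: ev_R od_R E_R \<sigma>_R)
 have e: "x * e \<sim>\<^sub>I y * e" using x by (simp add: \<kappa>_eqv_iff)
 have 1: "x * ev c \<sim>\<^sub>I y * ev d"
 proof -
  have "x * ev c \<sim>\<^sub>I x * (e * ev c)" using E_left[OF E_ev[OF c(1)]] x by (intro eqv_left) (auto intro: eqv_sym)
  also have "\<dots> = x * e * ev c" by (simp add: mult.assoc)
  also have "\<dots> \<sim>\<^sub>I y * e * ev d" using R x e_R by (intro eqv_mult[OF e ev_eqv[OF c(3)]] R_mult)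
  also have "\<dots> = y * (e * ev d)" by (simp add: mult.assoc)
  also have "\<dots> \<sim>\<^sub>I y * ev d" using E_left[OF E_ev[OF c(2)]] x by (intro eqv_left)
  finally show ?thesis .
 qed
 have 2: "\<sigma> x * od c \<sim>\<^sub>I \<sigma> y * od d"
 proof -
  have "\<sigma> x * od c \<sim>\<^sub>I \<sigma> x * (e * od c)" using E_left[OF E_od[OF c(1)]] R by (intro eqv_left) (auto intro: eqv_sym)
  also have "\<dots> \<sim>\<^sub>I \<sigma> x * (\<sigma> e * od c)" using R by (intro eqv_left eqv_right eqv_sym[OF \<sigma>_e])
  also have "\<dots> = \<sigma> (x * e) * od c" by (simp add: mult.assoc \<sigma>_mult)
  also have "\<dots> \<sim>\<^sub>I \<sigma> (y * e) * od d" using R x e_R by (intro eqv_mult[OF \<sigma>_eqv[OF e] od_eqv[OF c(3)]] \<sigma>_R R_mult)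
  also have "\<dots> = \<sigma> y * (\<sigma> e * od d)" by (simp add: mult.assoc \<sigma>_mult)
  also have "\<dots> \<sim>\<^sub>I \<sigma> y * (e * od d)" using R by (intro eqv_left eqv_right \<sigma>_e)
  also have "\<dots> \<sim>\<^sub>I \<sigma> y * od d" using E_left[OF E_od[OF c(2)]] R by (intro eqv_left)
  finally show ?thesis .
 qed
 show ?thesis using x R by (intro \<kappa>_eqv eqv_add 1 2 R_add R_mult)
qed

lemma rp: "x \<in> R ==> rp (\<kappa> x) \<in> R \<and> \<kappa> (rp (\<kappa> x)) = \<kappa> x"
 unfolding rp_def by (rule someI[of _ x]) simp

lemma T_\<kappa>: "c \<in> E ==> x \<in> R ==> T c (\<kappa> x) = \<kappa> (x * ev c + \<sigma> x * od c)"
 using T_welldef[of "rp (\<kappa> x)" x c c] rp[of x] by (simp add: T_def Q_carrier eqv_refl)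

lemma T_ext: "T c \<in> extensional (carrier Q)" by (simp add: T_def)

lemma T_eqI: "f \<in> extensional (carrier Q) ==> (\<And>x. x \<in> R ==> f (\<kappa> x) = T c (\<kappa> x)) ==> f = T c"
 by (rule extensionalityI[of _ "carrier Q"]) (simp_all add: T_ext, auto simp: Q_carrier)

lemma T_eqv: "c \<in> E ==> d \<in> E ==> c \<sim>\<^sub>I d ==> T c = T d"
 by (rule T_eqI[OF T_ext]) (simp add: T_\<kappa> T_welldef)

lemma T_1: "c \<in> E ==> T c (\<kappa> 1) = \<kappa> c" by (simp add: T_\<kappa> R_1 \<sigma>_1 ev_od)

lemma T_inj: "c \<in> E ==> d \<in> E ==> T c = T d ==> c \<sim>\<^sub>I d"
proof -
 assume c: "c \<in> E" and d: "d \<in> E" and "T c = T d"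
 then have "\<kappa> c = \<kappa> d" using T_1 by metis
 then have "c * e \<sim>\<^sub>I d * e" using c d by (simp add: \<kappa>_eqv_iff E_R)
 then show ?thesis using E_right[OF c] E_right[OF d] by (meson eqv_sym eqv_trans)
qed

lemma T_R: "c \<in> E ==> x \<in> R ==> x * ev c + \<sigma> x * od c \<in> R"
 using E_R[of c] by (auto intro!: R_add R_mult ev_R od_R \<sigma>_R)

lemma T_even: "c \<in> E ==> x \<in> R ==> T (ev c) (\<kappa> x) = \<kappa> (x * ev c)"
proof -
 assume c: "c \<in> E" and x: "x \<in> R"
 have "x * ev (ev c) + \<sigma> x * od (ev c) \<sim>\<^sub>I x * ev c + \<sigma> x * 0"
  using E_R[OF c] x by (intro eqv_add eqv_left ev_ev od_ev \<sigma>_R)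
 then show ?thesis using c x T_R[OF E_ev[OF c] x]
  by (simp add: T_\<kappa> E_ev \<kappa>_eqv R_mult ev_R E_R)
qed

lemma T_odd: "c \<in> E ==> x \<in> R ==> T (od c) (\<kappa> x) = \<kappa> (\<sigma> x * od c)"
proof -
 assume c: "c \<in> E" and x: "x \<in> R"
 have "x * ev (od c) + \<sigma> x * od (od c) \<sim>\<^sub>I x * 0 + \<sigma> x * od c"
  using E_R[OF c] x by (intro eqv_add eqv_left ev_od0 od_od \<sigma>_R)
 then show ?thesis using c x T_R[OF E_od[OF c] x]
  by (simp add: T_\<kappa> E_od \<kappa>_eqv R_mult od_R E_R \<sigma>_R)
qed

lemma ev_in: "x \<in> R ==> \<exists>y\<in>Rh 0. ev x \<sim>\<^sub>I y"
proof -
 assume "x \<in> R"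
 then obtain y z where *: "y \<in> Rh 0" "z \<in> Rh 1" "x \<sim>\<^sub>I y + z" using decomp[of x] unfolding eqv_def by blast
 from eqv_trans[OF ev_eqv[OF *(3), unfolded ev_add] eqv_add[OF ev_Rh[OF *(1)] ev_odd[OF *(2)]]]
 show ?thesis using * by auto
qed

lemma od_in: "x \<in> R ==> \<exists>y\<in>Rh 1. od x \<sim>\<^sub>I y"
proof -
 assume "x \<in> R"
 then obtain y z where *: "y \<in> Rh 0" "z \<in> Rh 1" "x \<sim>\<^sub>I y + z" using decomp[of x] unfolding eqv_def by blast
 from eqv_trans[OF od_eqv[OF *(3), unfolded od_add] eqv_add[OF od_even[OF *(1)] od_Rh[OF *(2)]]]
 show ?thesis using * by auto
qed

lemma \<sigma>_Rh: "x \<in> Rh i ==> \<exists>y\<in>Rh i. \<sigma> x \<sim>\<^sub>I y"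
proof -
 assume x: "x \<in> Rh i"
 show ?thesis
 proof (cases i)
  case zero
  then show ?thesis using x \<sigma>_even[of x] by (auto simp: eqv_def)
 next
  case one
  then show ?thesis using x \<sigma>_odd[of x] Rh_minus[of x 1] by (intro bexI[of _ "- x"]) (auto simp: eqv_def)
 qed
qed

lemma \<kappa>_Rh: "x \<in> Rh i ==> y \<in> R ==> y \<sim>\<^sub>I x ==> \<kappa> y \<in> hcomp Q i"
 using \<kappa>_eqv[of y x] Rh_R by (auto simp: Q_hcomp)

lemma T_add_Q: "c \<in> E ==> x \<in> R ==> y \<in> R ==> T c (\<kappa> x \<oplus>\<^bsub>Q\<^esub> \<kappa> y) = T c (\<kappa> x) \<oplus>\<^bsub>Q\<^esub> T c (\<kappa> y)"
 by (simp add: Q_add T_\<kappa> R_add T_R distrib_right \<sigma>_add algebra_simps)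

lemma super_endos_ev: "c \<in> E ==> T (ev c) \<in> super_endos U Q 0"
 unfolding super_endos_def
proof (intro CollectI conjI ballI allI)
 assume c: "c \<in> E"
 show "T (ev c) \<in> carrier Q \<rightarrow>\<^sub>E carrier Q"
  using c by (auto simp: PiE_def T_ext[unfolded Q_carrier] Q_carrier T_even R_mult ev_R E_R)
 show "T (ev c) (x \<oplus>\<^bsub>Q\<^esub> y) = T (ev c) x \<oplus>\<^bsub>Q\<^esub> T (ev c) y" if "x \<in> carrier Q" "y \<in> carrier Q" for x y
  using that c T_add_Q[OF E_ev] by (auto simp: Q_carrier)
 show "T (ev c) ` hcomp Q j \<subseteq> hcomp Q (0 + j)" for j
 proof
  fix y assume "y \<in> T (ev c) ` hcomp Q j"
  then obtain x where x: "y = T (ev c) (\<kappa> x)" "x \<in> Rh j" by (auto simp: Q_hcomp)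
  then have xR: "x \<in> R" using Rh_R by auto
  obtain d where d: "d \<in> Rh 0" "ev c \<sim>\<^sub>I d" using ev_in c E_R by blast
  have "\<kappa> (x * ev c) \<in> hcomp Q (j + 0)"
   using E_R[OF c] d xR by (intro \<kappa>_Rh[OF Rh_mult[OF x(2) d(1)]] eqv_left R_mult ev_R)
  then show "y \<in> hcomp Q (0 + j)" using x xR c by (simp add: T_even)
 qed
 fix j u x assume "u \<in> hcomp U j" "x \<in> carrier Q"
 then obtain a b where *: "u = cls a" "a \<in> Rh j" "x = \<kappa> b" "b \<in> R" by (auto simp: U_hcomp Q_carrier)
 moreover have "a \<in> R" using * Rh_R by auto
 ultimately show "T (ev c) (u \<odot>\<^bsub>Q\<^esub> x) = (ksign 0 j \<odot>\<^bsub>U\<^esub> u) \<odot>\<^bsub>Q\<^esub> T (ev c) x"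
  using c by (simp add: ksign_def U_smult sc_1 Q_smult T_even R_mult ev_R E_R mult.assoc)
qed

lemma super_endos_od: "c \<in> E ==> T (od c) \<in> super_endos U Q 1"
 unfolding super_endos_def
proof (intro CollectI conjI ballI allI)
 assume c: "c \<in> E"
 show "T (od c) \<in> carrier Q \<rightarrow>\<^sub>E carrier Q"
  using c by (auto simp: PiE_def T_ext[unfolded Q_carrier] Q_carrier T_odd R_mult od_R E_R \<sigma>_R)
 show "T (od c) (x \<oplus>\<^bsub>Q\<^esub> y) = T (od c) x \<oplus>\<^bsub>Q\<^esub> T (od c) y" if "x \<in> carrier Q" "y \<in> carrier Q" for x y
  using that c T_add_Q[OF E_od] by (auto simp: Q_carrier)
 show "T (od c) ` hcomp Q j \<subseteq> hcomp Q (1 + j)" for j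
 proof
  fix y assume "y \<in> T (od c) ` hcomp Q j"
  then obtain x where x: "y = T (od c) (\<kappa> x)" "x \<in> Rh j" by (auto simp: Q_hcomp)
  then have xR: "x \<in> R" using Rh_R by auto
  obtain d where d: "d \<in> Rh 1" "od c \<sim>\<^sub>I d" using od_in c E_R by blast
  obtain x' where x': "x' \<in> Rh j" "\<sigma> x \<sim>\<^sub>I x'" using \<sigma>_Rh x by blast
  have "\<kappa> (\<sigma> x * od c) \<in> hcomp Q (j + 1)"
   using E_R[OF c] d x' xR Rh_R[of j] by (intro \<kappa>_Rh[OF Rh_mult[OF x'(1) d(1)]] eqv_mult R_mult od_R \<sigma>_R) auto
  then show "y \<in> hcomp Q (1 + j)" using x xR c by (simp add: T_odd add.commute)
 qed
 fix j u x assume "u \<in> hcomp U j" "x \<in> carrier Q"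
 then obtain a b where *: "u = cls a" "a \<in> Rh j" "x = \<kappa> b" "b \<in> R" by (auto simp: U_hcomp Q_carrier)
 have aR: "a \<in> R" using * Rh_R by auto
 have "\<sigma> a \<sim>\<^sub>I sc (ksign 1 j) * a"
  using * \<sigma>_even[of a] \<sigma>_odd[of a] by (cases j) (auto simp: eqv_def ksign_def sc_1 sc_minus)
 then have "\<sigma> a * (\<sigma> b * od c) \<sim>\<^sub>I sc (ksign 1 j) * a * (\<sigma> b * od c)"
  using * E_R[OF c] by (intro eqv_right R_mult \<sigma>_R od_R)
 then have "\<kappa> (\<sigma> a * (\<sigma> b * od c)) = \<kappa> (sc (ksign 1 j) * a * (\<sigma> b * od c))"
  using * E_R[OF c] aR by (intro \<kappa>_eqv R_mult \<sigma>_R od_R sc_R)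
 then show "T (od c) (u \<odot>\<^bsub>Q\<^esub> x) = (ksign 1 j \<odot>\<^bsub>U\<^esub> u) \<odot>\<^bsub>Q\<^esub> T (od c) x"
  using * c aR by (simp add: U_smult Q_smult T_odd R_mult od_R E_R \<sigma>_R \<sigma>_mult mult.assoc sc_R)
qed

lemma T_sum: "c \<in> E ==> d \<in> E ==> (\<lambda>\<xi>\<in>carrier Q. T c \<xi> \<oplus>\<^bsub>Q\<^esub> T d \<xi>) = T (c + d)"
 by (rule T_eqI) (auto simp: Q_carrier T_\<kappa> E_add Q_add T_R ev_add od_add algebra_simps)

text \<open>An endomorphism is determined by its value \<open>\<kappa> c'\<close> at
  \<open>\<kappa> 1\<close>, and \<open>c' * e\<close> is the required element. It absorbs
  \<open>e\<close> on the left as well, because \<open>\<kappa> 1 = \<kappa> e\<close> and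
  \<open>f\<close> commutes with the even element \<open>e\<close>.\<close>

lemma super_endos_T:
 assumes f: "f \<in> super_endos U Q i"
 shows "\<exists>c\<in>E. f = T c \<and> (if i = 0 then c \<sim>\<^sub>I ev c else c \<sim>\<^sub>I od c)"
proof -
 have f_hc: "f ` hcomp Q j \<subseteq> hcomp Q (i + j)" for j using f by (auto simp: super_endos_def)
 have f_ext: "f \<in> extensional (carrier Q)" using f by (auto simp: super_endos_def PiE_def)
 have f_add: "f (x \<oplus>\<^bsub>Q\<^esub> y) = f x \<oplus>\<^bsub>Q\<^esub> f y" if "x \<in> carrier Q" "y \<in> carrier Q" for x y
  using f that by (auto simp: super_endos_def)
 have f_smult: "f (u \<odot>\<^bsub>Q\<^esub> x) = (ksign i j \<odot>\<^bsub>U\<^esub> u) \<odot>\<^bsub>Q\<^esub> f x" if "u \<in> hcomp U j" "x \<in> carrier Q" for u x j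
  using f that unfolding super_endos_def by blast
 have "\<kappa> 1 \<in> hcomp Q 0" using Rh_1 by (simp add: Q_hcomp)
 then have "f (\<kappa> 1) \<in> hcomp Q i" using f_hc[of 0, unfolded add_0_right] by blast
 then obtain c' where c': "f (\<kappa> 1) = \<kappa> c'" "c' \<in> Rh i" by (auto simp: Q_hcomp)
 have c'R: "c' \<in> R" using c' Rh_R by auto
 have fx: "f (\<kappa> x) = \<kappa> (sc (ksign i j) * x * c')" if "x \<in> Rh j" for x j
 proof -
  have xR: "x \<in> R" using that Rh_R by auto
  then have "f (\<kappa> x) = f (cls x \<odot>\<^bsub>Q\<^esub> \<kappa> 1)" by (simp add: Q_smult R_1)
  also have "\<dots> = (ksign i j \<odot>\<^bsub>U\<^esub> cls x) \<odot>\<^bsub>Q\<^esub> f (\<kappa> 1)"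
   using that R_1 by (intro f_smult) (auto simp: U_hcomp Q_carrier)
  finally show ?thesis using xR c' c'R by (simp add: U_smult Q_smult R_mult sc_R)
 qed
 define c where "c = c' * e"
 have cR: "c \<in> R" using c'R e_R by (simp add: c_def R_mult)
 have "\<kappa> c' = f (\<kappa> e)" using c' \<kappa>_e[OF R_1] by simp
 also have "\<dots> = \<kappa> (e * c')" using fx[OF e_Rh] by (simp add: ksign_def sc_1)
 finally have "c' * e \<sim>\<^sub>I e * c' * e" using c'R e_R by (simp add: \<kappa>_eqv_iff R_mult)
 then have 1: "e * c \<sim>\<^sub>I c" by (auto simp: c_def mult.assoc intro: eqv_sym)
 have "c * e \<sim>\<^sub>I c" unfolding c_def mult.assoc using e_idem c'R by (intro eqv_left) (simp_all add: eqv_def)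
 then have cE: "c \<in> E" using 1 cR by (simp add: E_def)
 have cRh: "c \<in> Rh i" using Rh_mult[OF c'(2) e_Rh] by (simp only: c_def add_0_right)
 have ce: "ev c + od c = c" by (rule ev_od)
 have fx': "f (\<kappa> x) = T c (\<kappa> x)" if x: "x \<in> Rh j" for x j
 proof -
  have xR: "x \<in> R" using that Rh_R by auto
  have "f (\<kappa> x) = \<kappa> (sc (ksign i j) * x * c)"
   using fx[OF x] \<kappa>_e[of "sc (ksign i j) * x * c'"] xR c'R by (simp add: c_def R_mult sc_R mult.assoc)
  moreover have "sc (ksign i j) * x * c \<sim>\<^sub>I x * ev c + \<sigma> x * od c"
  proof (cases i)
   case zero
   have "x * c + \<sigma> x * 0 \<sim>\<^sub>I x * ev c + \<sigma> x * od c"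
    using cRh zero xR by (intro eqv_add eqv_left \<sigma>_R eqv_sym[OF ev_Rh] eqv_sym[OF od_even]) auto
   then show ?thesis using zero by (simp add: ksign_def sc_1)
  next
   case one
   have s: "\<sigma> x \<sim>\<^sub>I sc (ksign i j) * x"
    using x \<sigma>_even[of x] \<sigma>_odd[of x] one by (cases j) (auto simp: eqv_def ksign_def sc_1 sc_minus)
   have "x * 0 + sc (ksign i j) * x * c \<sim>\<^sub>I x * ev c + \<sigma> x * od c"
    using cRh one xR cR s
    by (intro eqv_add eqv_left eqv_mult \<sigma>_R od_R eqv_sym[OF od_Rh] eqv_sym[OF ev_odd] eqv_sym[OF s]) auto
   then show ?thesis by simp
  qed
  ultimately show ?thesis using xR cR cE by (simp add: T_\<kappa> T_R \<kappa>_eqv R_mult sc_R)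
 qed
 have "f = T c"
 proof (rule T_eqI[OF f_ext])
  fix x assume x: "x \<in> R"
  then obtain y z where *: "y \<in> Rh 0" "z \<in> Rh 1" "x \<sim>\<^sub>I y + z" using decomp[of x] unfolding eqv_def by blast
  have yz: "y \<in> R" "z \<in> R" using * Rh_R by auto
  have "\<kappa> x = \<kappa> y \<oplus>\<^bsub>Q\<^esub> \<kappa> z" using * yz x by (simp add: Q_add \<kappa>_eqv R_add)
  then show "f (\<kappa> x) = T c (\<kappa> x)"
   using fx'[OF *(1)] fx'[OF *(2)] yz cE by (simp add: f_add T_add_Q Q_carrier)
 qed
 moreover have "if i = 0 then c \<sim>\<^sub>I ev c else c \<sim>\<^sub>I od c"
  using cRh eqv_sym[OF ev_Rh] eqv_sym[OF od_Rh] by (cases i) auto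
 ultimately show ?thesis using cE by blast
qed

lemma EQ_carrier: "carrier EQ = T ` E"
proof (intro Set.set_eqI iffI)
 fix f assume "f \<in> carrier EQ"
 then obtain g h where gh: "g \<in> super_endos U Q 0" "h \<in> super_endos U Q 1" "f = (\<lambda>x\<in>carrier Q. g x \<oplus>\<^bsub>Q\<^esub> h x)"
  by (auto simp: End_superalgebra_def)
 obtain c d where "c \<in> E" "g = T c" "d \<in> E" "h = T d" using super_endos_T[OF gh(1)] super_endos_T[OF gh(2)] by blast
 then show "f \<in> T ` E" using gh by (simp add: T_sum E_add)
next
 fix f assume "f \<in> T ` E"
 then obtain c where c: "f = T c" "c \<in> E" by auto
 have "f = (\<lambda>x\<in>carrier Q. T (ev c) x \<oplus>\<^bsub>Q\<^esub> T (od c) x)" using c by (simp add: T_sum E_ev E_od ev_od)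
 then show "f \<in> carrier EQ"
  unfolding End_superalgebra_def using super_endos_ev[OF c(2)] super_endos_od[OF c(2)] by auto
qed

lemma EQ_add: "c \<in> E ==> d \<in> E ==> T c \<oplus>\<^bsub>EQ\<^esub> T d = T (c + d)"
 using T_sum by (simp add: End_superalgebra_def)

lemma EQ_zero: "\<zero>\<^bsub>EQ\<^esub> = T 0"
 by (rule T_eqI) (auto simp: End_superalgebra_def Q_carrier T_\<kappa> E_0 Q_zero ev_def od_def \<sigma>_0)

lemma EQ_one: "\<one>\<^bsub>EQ\<^esub> = T e"
proof (rule T_eqI)
 fix x assume x: "x \<in> R"
 have "x * ev e + \<sigma> x * od e \<sim>\<^sub>I x * e + \<sigma> x * 0"
  using x by (intro eqv_add eqv_left \<sigma>_R ev_Rh od_even e_Rh)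
 then have "T e (\<kappa> x) = \<kappa> (x * e)" using x T_R[OF E_e x] by (simp add: T_\<kappa> E_e \<kappa>_eqv R_mult e_R)
 then show "\<one>\<^bsub>EQ\<^esub> (\<kappa> x) = T e (\<kappa> x)" using x by (simp add: End_superalgebra_def \<kappa>_e Q_carrier)
qed (simp add: End_superalgebra_def)

lemma EQ_smult: "c \<in> E ==> k \<odot>\<^bsub>EQ\<^esub> T c = T (sc k * c)"
proof (rule T_eqI)
 fix x assume c: "c \<in> E" and x: "x \<in> R"
 have "(k \<odot>\<^bsub>U\<^esub> \<one>\<^bsub>U\<^esub>) \<odot>\<^bsub>Q\<^esub> T c (\<kappa> x) = \<kappa> (sc k * (x * ev c + \<sigma> x * od c))"
  using c x by (simp add: U_one U_smult R_1 T_\<kappa> Q_smult sc_R T_R)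
 also have "sc k * (x * ev c + \<sigma> x * od c) = x * ev (sc k * c) + \<sigma> x * od (sc k * c)"
  unfolding ev_sc od_sc sc_left_commute[of x k] sc_left_commute[of "\<sigma> x" k] by (rule distrib_left)
 finally show "(k \<odot>\<^bsub>EQ\<^esub> T c) (\<kappa> x) = T (sc k * c) (\<kappa> x)"
  using c x by (simp add: End_superalgebra_def Q_carrier T_\<kappa> E_sc)
qed (simp add: End_superalgebra_def)

definition pt :: "bit => 'a => 'a" where "pt i c = (if i = 0 then ev c else od c)"

lemma pt_E: "c \<in> E ==> pt i c \<in> E" by (simp add: pt_def E_ev E_od)
lemma T_pt_endos: "c \<in> E ==> T (pt i c) \<in> super_endos U Q i"
 using super_endos_ev super_endos_od by (cases i) (auto simp: pt_def)

text \<open>The definite description in \<open>hpart\<close> requires that the homogeneous parts of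
  an endomorphism be unique; \<open>T_inj\<close> transfers this to uniqueness of the parts of
  \<open>c\<close> modulo \<open>I\<close>.\<close>

lemma hpart_EQ: "c \<in> E ==> hpart EQ i (T c) = T (pt i c)"
 unfolding hpart_def
proof (rule the_equality)
 assume c: "c \<in> E"
 have hc: "hcomp EQ j = super_endos U Q j" for j by (simp add: End_superalgebra_def)
 have "pt i c + pt (i + 1) c = c" using ev_od[of c] by (cases i) (auto simp: pt_def add.commute)
 then have "T c = T (pt i c) \<oplus>\<^bsub>EQ\<^esub> T (pt (i + 1) c)" using c by (simp add: EQ_add pt_E)
 then show "T (pt i c) \<in> hcomp EQ i \<and> (\<exists>y\<in>hcomp EQ (i + 1). T c = T (pt i c) \<oplus>\<^bsub>EQ\<^esub> y)"
  using T_pt_endos[OF c] unfolding hc by blast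
 fix f assume "f \<in> hcomp EQ i \<and> (\<exists>y\<in>hcomp EQ (i + 1). T c = f \<oplus>\<^bsub>EQ\<^esub> y)"
 then obtain g where f: "f \<in> super_endos U Q i" and g: "g \<in> super_endos U Q (i + 1)" and fg: "T c = f \<oplus>\<^bsub>EQ\<^esub> g"
  unfolding hc by blast
 from super_endos_T[OF f] obtain a where a: "a \<in> E" "f = T a" "a \<sim>\<^sub>I pt i a"
  by (auto simp: pt_def split: if_splits)
 from super_endos_T[OF g] obtain b where b: "b \<in> E" "g = T b"
  and b': "if i + 1 = 0 then b \<sim>\<^sub>I ev b else b \<sim>\<^sub>I od b" by blast
 have "T c = T (a + b)" using fg a b by (simp add: EQ_add)
 then have "c \<sim>\<^sub>I a + b" using c a b T_inj E_add by blast
 then have "pt i c \<sim>\<^sub>I pt i (a + b)" by (auto simp: pt_def intro: ev_eqv od_eqv)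
 also have "pt i (a + b) = pt i a + pt i b" by (simp add: pt_def ev_add od_add)
 also have "\<dots> \<sim>\<^sub>I a + 0"
 proof (rule eqv_add[OF eqv_sym[OF a(3)]])
  have bR: "b \<in> R" using b E_R by blast
  show "pt i b \<sim>\<^sub>I 0"
  proof (cases i)
   case zero
   then have "b \<sim>\<^sub>I od b" using b' by simp
   from eqv_trans[OF ev_eqv[OF this] ev_od0[OF bR]] show ?thesis using zero by (simp add: pt_def)
  next
   case one
   then have "b \<sim>\<^sub>I ev b" using b' by simp
   from eqv_trans[OF od_eqv[OF this] od_ev[OF bR]] show ?thesis using one by (simp add: pt_def)
  qed
 qed
 finally show "f = T (pt i c)" using a c by (auto intro: T_eqv eqv_sym pt_E)
qed

text \<open>Composition reverses the order of right multiplications. A sign arises when the \<sigma>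
  belonging to the outer map passes over \<open>pt i c\<close>; it is the sign of the opposite
  superalgebra, so the two cancel.\<close>

lemma T_comp:
 assumes c: "c \<in> E" and d: "d \<in> E"
 shows "ksign i j \<odot>\<^bsub>EQ\<^esub> (T (pt j d) \<otimes>\<^bsub>EQ\<^esub> T (pt i c)) = T (pt i c * pt j d)"
proof -
 let ?s = "\<lambda>i x. if i = (0::bit) then x else \<sigma> x" and ?k = "sc (ksign i j)"
 have R: "pt i c \<in> R" "pt j d \<in> R" using c d by (auto intro: E_R pt_E)
 have T: "T (pt i c) (\<kappa> x) = \<kappa> (?s i x * pt i c)" if "x \<in> R" "c \<in> E" for x c i
  using that by (simp add: pt_def T_even T_odd)
 have sR: "?s i x \<in> R" if "x \<in> R" for i x using that by (simp add: \<sigma>_R)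
 have s_add: "?s j (?s i x) \<sim>\<^sub>I ?s (i + j) x" if "x \<in> R" for x
  using that \<sigma>\<sigma>[OF that] by (cases i; cases j) (auto simp: eqv_refl)
 have s_pt: "?s j (pt i c) \<sim>\<^sub>I ?k * pt i c"
  using \<sigma>_ev[of c] \<sigma>_od[of c] E_R[OF c] by (cases i; cases j) (auto simp: eqv_refl pt_def ksign_def sc_1 sc_minus)
 have kk: "?k * (?k * x) = x" for x by (auto simp: ksign_def sc_1 sc_minus)
 have cE: "pt i c \<in> E" and dE: "pt j d \<in> E" using c d by (auto intro: pt_E)
 have comp: "T (pt j d) \<otimes>\<^bsub>EQ\<^esub> T (pt i c) = T (?k * (pt i c * pt j d))"
 proof (rule T_eqI)
  show "T (pt j d) \<otimes>\<^bsub>EQ\<^esub> T (pt i c) \<in> extensional (carrier Q)"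
   by (simp add: End_superalgebra_def compose_def)
  fix x assume x: "x \<in> R"
  have "(T (pt j d) \<otimes>\<^bsub>EQ\<^esub> T (pt i c)) (\<kappa> x) = T (pt j d) (T (pt i c) (\<kappa> x))"
   using x by (simp add: End_superalgebra_def compose_def Q_carrier)
  also have "\<dots> = \<kappa> (?s j (?s i x * pt i c) * pt j d)"
   using T[OF x c] T[OF _ d, of "?s i x * pt i c" j] sR[OF x] R by (simp add: R_mult)
  finally have 1: "(T (pt j d) \<otimes>\<^bsub>EQ\<^esub> T (pt i c)) (\<kappa> x) = \<kappa> (?s j (?s i x * pt i c) * pt j d)" .
  have "?s j (?s i x * pt i c) = ?s j (?s i x) * ?s j (pt i c)" by (simp add: \<sigma>_mult)
  also have "\<dots> \<sim>\<^sub>I ?s (i + j) x * (?k * pt i c)"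
   using x R by (intro eqv_mult s_add s_pt) (auto simp: \<sigma>_R)
  finally have "?s j (?s i x * pt i c) * pt j d \<sim>\<^sub>I ?s (i + j) x * (?k * pt i c) * pt j d"
   using R by (intro eqv_right)
  then have 2: "\<kappa> (?s j (?s i x * pt i c) * pt j d) = \<kappa> (?s (i + j) x * (?k * pt i c) * pt j d)"
   using x R sR[OF x] by (intro \<kappa>_eqv R_mult sc_R) (auto simp: \<sigma>_R R_mult)
  let ?w = "?k * (pt i c * pt j d)"
  have wE: "?w \<in> E" using cE dE by (intro E_sc E_mult)
  obtain a where a: "a \<in> Rh i" "pt i c \<sim>\<^sub>I a" using ev_in od_in E_R[OF c] by (cases i) (auto simp: pt_def)
  obtain b where b: "b \<in> Rh j" "pt j d \<sim>\<^sub>I b" using ev_in od_in E_R[OF d] by (cases j) (auto simp: pt_def)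
  have "?w \<sim>\<^sub>I ?k * (a * b)" using a b R Rh_R[of i] by (intro eqv_left eqv_mult sc_R) auto
  moreover have "?k * (a * b) \<in> Rh (0 + (i + j))" using a b by (intro Rh_mult Rh_sc)
  ultimately obtain v where v: "v \<in> Rh (i + j)" "?w \<sim>\<^sub>I v" by (simp only: add_0_left)
  \<comment> \<open>Modulo \<open>I\<close> the product is homogeneous of parity
    \<open>i + j\<close>, so only one of the two summands in \<open>T\<close> survives.\<close>
  have "pt (i + j) ?w \<sim>\<^sub>I ?w \<and> pt (i + j + 1) ?w \<sim>\<^sub>I 0"
  proof (cases "i + j")
   case zero
   then have "ev ?w \<sim>\<^sub>I ?w" "od ?w \<sim>\<^sub>I 0"
    using v ev_eqv[OF v(2)] od_eqv[OF v(2)] ev_Rh[of v] od_even[of v] by (auto intro: eqv_trans eqv_sym)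
   then show ?thesis unfolding zero by (simp add: pt_def)
  next
   case one
   then have "od ?w \<sim>\<^sub>I ?w" "ev ?w \<sim>\<^sub>I 0"
    using v ev_eqv[OF v(2)] od_eqv[OF v(2)] od_Rh[of v] ev_odd[of v] by (auto intro: eqv_trans eqv_sym)
   then show ?thesis unfolding one by (simp add: pt_def)
  qed
  then have "x * ev ?w + \<sigma> x * od ?w \<sim>\<^sub>I ?s (i + j) x * ?w"
  proof (cases "i + j")
   case zero
   assume "pt (i + j) ?w \<sim>\<^sub>I ?w \<and> pt (i + j + 1) ?w \<sim>\<^sub>I 0"
   then have "ev ?w \<sim>\<^sub>I ?w" "od ?w \<sim>\<^sub>I 0" unfolding zero by (simp_all add: pt_def)
   then have "x * ev ?w + \<sigma> x * od ?w \<sim>\<^sub>I x * ?w + \<sigma> x * 0" using x by (intro eqv_add eqv_left \<sigma>_R)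
   then show ?thesis unfolding zero by simp
  next
   case one
   assume "pt (i + j) ?w \<sim>\<^sub>I ?w \<and> pt (i + j + 1) ?w \<sim>\<^sub>I 0"
   then have "od ?w \<sim>\<^sub>I ?w" "ev ?w \<sim>\<^sub>I 0" unfolding one by (simp_all add: pt_def)
   then have "x * ev ?w + \<sigma> x * od ?w \<sim>\<^sub>I x * 0 + \<sigma> x * ?w" using x by (intro eqv_add eqv_left \<sigma>_R)
   then show ?thesis unfolding one by simp
  qed
  then have "T ?w (\<kappa> x) = \<kappa> (?s (i + j) x * ?w)"
   using T_R[OF wE x] R_mult[OF sR[OF x, of "i + j"] E_R[OF wE]] unfolding T_\<kappa>[OF wE x]
   by (intro \<kappa>_eqv)
  also have "?s (i + j) x * ?w = ?s (i + j) x * (?k * pt i c) * pt j d" by (simp only: mult.assoc)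
  finally show "(T (pt j d) \<otimes>\<^bsub>EQ\<^esub> T (pt i c)) (\<kappa> x) = T ?w (\<kappa> x)" using 1 2 by (simp only:)
 qed
 show ?thesis unfolding comp using cE dE by (simp add: EQ_smult E_sc E_mult kk)
qed

lemma abelian_monoid_EQ: "abelian_monoid EQ"
 by (rule abelian_monoidI) (auto simp: EQ_carrier EQ_add EQ_zero E_add E_0 ac_simps)

abbreviation OQ where "OQ \<equiv> opposite_superalgebra EQ"

lemma OQ_carrier: "carrier OQ = T ` E" by (simp add: opposite_superalgebra_def EQ_carrier)
lemma OQ_add: "c \<in> E ==> d \<in> E ==> T c \<oplus>\<^bsub>OQ\<^esub> T d = T (c + d)" by (simp add: opposite_superalgebra_def EQ_add)
lemma OQ_zero: "\<zero>\<^bsub>OQ\<^esub> = T 0" by (simp add: opposite_superalgebra_def EQ_zero)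
lemma OQ_one: "\<one>\<^bsub>OQ\<^esub> = T e" by (simp add: opposite_superalgebra_def EQ_one)
lemma OQ_smult: "c \<in> E ==> k \<odot>\<^bsub>OQ\<^esub> T c = T (sc k * c)" by (simp add: opposite_superalgebra_def EQ_smult)

lemma finsum_T:
 assumes "abelian_monoid A" and "carrier A = T ` E" and "\<zero>\<^bsub>A\<^esub> = T 0"
  and "\<And>c d. c \<in> E ==> d \<in> E ==> T c \<oplus>\<^bsub>A\<^esub> T d = T (c + d)"
  and "finite X" and "\<And>x. x \<in> X ==> f x \<in> E"
 shows "finsum A (\<lambda>x. T (f x)) X = T (\<Sum>x\<in>X. f x)"
proof -
 interpret abelian_monoid A by fact
 show ?thesis using assms(5,6)
 proof (induction X)
  case (insert a X)
  have "finsum A (\<lambda>x. T (f x)) (insert a X) = T (f a) \<oplus>\<^bsub>A\<^esub> finsum A (\<lambda>x. T (f x)) X"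
   using insert by (intro finsum_insert) (auto simp: assms(2))
  then show ?case using insert by (simp add: assms(4) E_sum)
 qed (simp add: assms(3))
qed

text \<open>The four products of homogeneous parts have lost their signs by \<open>T_comp\<close>
  and add up to \<open>c * d\<close>. So the opposite superalgebra of the endomorphisms is the
  corner algebra with its ordinary product.\<close>

lemma OQ_mult:
 assumes c: "c \<in> E" and d: "d \<in> E"
 shows "T c \<otimes>\<^bsub>OQ\<^esub> T d = T (c * d)"
proof -
 interpret abelian_monoid EQ by (rule abelian_monoid_EQ)
 have "T c \<otimes>\<^bsub>OQ\<^esub> T d = finsum EQ (\<lambda>(i, j). ksign i j \<odot>\<^bsub>EQ\<^esub> (hpart EQ j (T d) \<otimes>\<^bsub>EQ\<^esub> hpart EQ i (T c))) ({0, 1} \<times> {0, 1})"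
  by (simp add: opposite_superalgebra_def)
 also have "\<dots> = finsum EQ (\<lambda>x. T (case x of (i, j) => pt i c * pt j d)) ({0, 1} \<times> {0, 1})"
  using c d by (intro finsum_cong') (auto simp: hpart_EQ T_comp EQ_carrier E_mult pt_E)
 also have "\<dots> = T (\<Sum>x\<in>{0, 1} \<times> {0, 1}. case x of (i, j) => pt i c * pt j d)"
  using c d by (intro finsum_T abelian_monoid_EQ EQ_carrier EQ_zero EQ_add) (auto simp: E_mult pt_E)
 also have "(\<Sum>x\<in>{0, 1} \<times> {0, 1}. case x of (i, j) => pt i c * pt j d) = (\<Sum>i\<in>{0, 1}. pt i c) * (\<Sum>j\<in>{0, 1}. pt j d)"
  by (simp add: sum.cartesian_product[symmetric] distrib_left distrib_right add.assoc)
 also have "\<dots> = c * d" by (simp add: pt_def ev_od)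
 finally show ?thesis .
qed

lemma abelian_monoid_OQ: "abelian_monoid OQ"
 by (rule abelian_monoidI) (auto simp: OQ_carrier OQ_add OQ_zero E_add E_0 ac_simps)

text \<open>The matrix of \<open>x\<close> with respect to the decomposition of \<open>U\<close>
  into copies of \<open>U e\<close>; its entries lie in \<open>e U e\<close>.\<close>

definition entry :: "'a => nat => nat => 'a" where "entry x i k = p i * x * (q k * e)"

lemma entry_E: "x \<in> R ==> i < \<delta> ==> k < \<delta> ==> entry x i k \<in> E"
proof -
 assume *: "x \<in> R" "i < \<delta>" "k < \<delta>"
 have "e * entry x i k \<sim>\<^sub>I entry x i k"
  unfolding entry_def mult.assoc[symmetric] using * e_p[of i] p_R q_R e_R
  by (intro eqv_right R_mult) (auto simp: eqv_def)
 moreover have "entry x i k * e \<sim>\<^sub>I entry x i k"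
  unfolding entry_def mult.assoc using * e_idem p_R q_R
  by (intro eqv_left) (auto simp: eqv_def)
 ultimately show ?thesis using * p_R q_R e_R by (simp add: E_def entry_def R_mult)
qed

lemma entry_eqv: "x \<in> R ==> i < \<delta> ==> k < \<delta> ==> x \<sim>\<^sub>I y ==> entry x i k \<sim>\<^sub>I entry y i k"
 unfolding entry_def using p_R q_R e_R by (intro eqv_right eqv_left R_mult) auto

lemma entry_add: "entry (x + y) i k = entry x i k + entry y i k"
 by (simp add: entry_def distrib_left distrib_right)

text \<open>The \<open>e\<close> between two entries is absorbed by \<open>p j\<close>; then the sum
  of the \<open>q j * p j\<close> closes the gap between \<open>x\<close> and
  \<open>y\<close>.\<close>

lemma entry_mult:
 assumes "x \<in> R" "y \<in> R" "i < \<delta>" "k < \<delta>"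
 shows "(\<Sum>j<\<delta>. entry x i j * entry y j k) \<sim>\<^sub>I entry (x * y) i k"
proof -
 note R = assms p_R q_R e_R
 have "entry x i j * entry y j k \<sim>\<^sub>I p i * x * (q j * p j) * (y * (q k * e))" if j: "j < \<delta>" for j
 proof -
  have "entry x i j * entry y j k = (p i * x * q j) * ((e * p j) * (y * (q k * e)))"
   by (simp add: entry_def mult.assoc)
  also have "\<dots> \<sim>\<^sub>I (p i * x * q j) * (p j * (y * (q k * e)))"
   using R j e_p[OF j] by (intro eqv_left eqv_right R_mult) (auto simp: eqv_def)
  also have "\<dots> = p i * x * (q j * p j) * (y * (q k * e))" by (simp add: mult.assoc)
  finally show ?thesis .
 qed
 then have "(\<Sum>j<\<delta>. entry x i j * entry y j k) \<sim>\<^sub>I (\<Sum>j<\<delta>. p i * x * (q j * p j) * (y * (q k * e)))"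
  by (intro eqv_sum) auto
 also have "\<dots> = p i * x * (\<Sum>j<\<delta>. q j * p j) * (y * (q k * e))"
  by (simp add: sum_distrib_left sum_distrib_right)
 also have "\<dots> \<sim>\<^sub>I p i * x * 1 * (y * (q k * e))"
  using R q_p by (intro eqv_right eqv_left R_mult) (auto simp: eqv_def intro: I_sym)
 also have "\<dots> = entry (x * y) i k" by (simp add: entry_def mult.assoc)
 finally show ?thesis .
qed

text \<open>Multiplying the entries by \<open>q i\<close> on the left and \<open>p k\<close> on the
  right and summing up recovers \<open>x\<close>, since the \<open>q i * p i\<close> sum to 1 on
  both sides.\<close>

lemma entry_inj:
 assumes "x \<in> R" "y \<in> R" "\<And>i k. i < \<delta> ==> k < \<delta> ==> entry x i k \<sim>\<^sub>I entry y i k"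
 shows "x \<sim>\<^sub>I y"
proof -
 note R = p_R q_R e_R
 have *: "x \<sim>\<^sub>I (\<Sum>i<\<delta>. \<Sum>k<\<delta>. q i * entry x i k * p k)" if x: "x \<in> R" for x
 proof -
  have "(\<Sum>i<\<delta>. \<Sum>k<\<delta>. q i * entry x i k * p k) \<sim>\<^sub>I (\<Sum>i<\<delta>. \<Sum>k<\<delta>. (q i * p i) * x * (q k * p k))"
  proof (intro eqv_sum)
   fix i k assume "i \<in> {..<\<delta>}" "k \<in> {..<\<delta>}"
   then have ik: "i < \<delta>" "k < \<delta>" by auto
   have "q i * entry x i k * p k = (q i * p i * x * q k) * (e * p k)" by (simp add: entry_def mult.assoc)
   also have "\<dots> \<sim>\<^sub>I (q i * p i * x * q k) * p k" using x R ik e_p by (intro eqv_left R_mult) (auto simp: eqv_def)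
   finally show "q i * entry x i k * p k \<sim>\<^sub>I (q i * p i) * x * (q k * p k)" by (simp add: mult.assoc)
  qed
  also have "\<dots> = (\<Sum>i<\<delta>. q i * p i) * x * (\<Sum>k<\<delta>. q k * p k)"
   by (simp add: sum_distrib_left sum_distrib_right) (rule sum.swap)
  also have "\<dots> \<sim>\<^sub>I 1 * x * 1"
   using x R q_p by (intro eqv_mult eqv_right R_mult R_1 R_sum) (auto simp: eqv_def intro: I_sym R_mult)
  finally show ?thesis by (auto intro: eqv_sym)
 qed
 have "(\<Sum>i<\<delta>. \<Sum>k<\<delta>. q i * entry x i k * p k) \<sim>\<^sub>I (\<Sum>i<\<delta>. \<Sum>k<\<delta>. q i * entry y i k * p k)"
  using R assms by (intro eqv_sum eqv_right eqv_left) auto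
 then show ?thesis using *[OF assms(1)] *[OF assms(2)] by (meson eqv_trans eqv_sym)
qed

text \<open>The formula that inverts \<open>entry\<close> in \<open>entry_inj\<close> also supplies
  the preimage; the orthogonality \<open>p_q\<close> singles out the entry at
  \<open>(i, k)\<close>.\<close>

lemma entry_surj:
 assumes c: "\<And>i k. i < \<delta> ==> k < \<delta> ==> c i k \<in> E"
 shows "\<exists>x\<in>R. \<forall>i<\<delta>. \<forall>k<\<delta>. entry x i k \<sim>\<^sub>I c i k"
proof (intro bexI allI impI)
 note R = p_R q_R e_R
 let ?x = "\<Sum>i<\<delta>. \<Sum>k<\<delta>. q i * c i k * p k"
 show "?x \<in> R" using R c E_R by (intro R_sum R_mult) auto
 fix i k assume i: "i < \<delta>" and k: "k < \<delta>"
 have "entry ?x i k = (\<Sum>a<\<delta>. \<Sum>b<\<delta>. p i * (q a * c a b * p b) * (q k * e))"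
  by (simp add: entry_def sum_distrib_left sum_distrib_right)
 also have "\<dots> \<sim>\<^sub>I (\<Sum>a<\<delta>. \<Sum>b<\<delta>. if b = k then if a = i then c a b else 0 else 0)"
 proof (intro eqv_sum)
  fix a b assume "a \<in> {..<\<delta>}" "b \<in> {..<\<delta>}"
  then have ab: "a < \<delta>" "b < \<delta>" by auto
  have cE: "c a b \<in> E" and cR: "c a b \<in> R" using c ab E_R by auto
  let ?D = "if i = a then e else 0" and ?D' = "if b = k then e else 0"
  have DR: "?D \<in> R" "?D' \<in> R" using e_R R_0 by auto
  have "p i * (q a * c a b * p b) * (q k * e) = p i * (q a * c a b) * (p b * (q k * e))" by (simp add: mult.assoc)
  also have "\<dots> \<sim>\<^sub>I p i * (q a * c a b) * ?D'"
   using R ab i k cR p_q[OF ab(2) k] by (intro eqv_left R_mult) (auto simp: eqv_def)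
  also have "\<dots> = p i * q a * (c a b * ?D')" by (simp add: mult.assoc)
  also have "\<dots> \<sim>\<^sub>I p i * q a * (e * c a b * ?D')"
   using R ab i cR DR E_left[OF cE] by (intro eqv_left eqv_right R_mult) (auto intro: eqv_sym)
  also have "\<dots> = p i * (q a * e) * (c a b * ?D')" by (simp add: mult.assoc)
  also have "\<dots> \<sim>\<^sub>I ?D * (c a b * ?D')"
   using cR DR p_q[OF i ab(1)] by (intro eqv_right R_mult) (auto simp: eqv_def)
  also have "\<dots> \<sim>\<^sub>I (if b = k then if a = i then c a b else 0 else 0)"
   using E_left[OF cE] E_right[OF cE] e_R by (auto simp: eqv_refl intro: eqv_trans[OF eqv_left])
  finally show "p i * (q a * c a b * p b) * (q k * e) \<sim>\<^sub>I (if b = k then if a = i then c a b else 0 else 0)" .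
 qed
 also have "\<dots> = c i k" using i k by simp
 finally show "entry ?x i k \<sim>\<^sub>I c i k" .
qed

theorem iso_U: "algebra_iso U (matrix_algebra \<delta> OQ)"
proof -
 let ?D = "{..<\<delta>} \<times> {..<\<delta>}" and ?M = "matrix_algebra \<delta> OQ"
 define rep where "rep X = (SOME x. x \<in> R \<and> cls x = X)" for X
 have rep: "rep (cls x) \<in> R \<and> cls (rep (cls x)) = cls x" if "x \<in> R" for x
  unfolding rep_def by (rule someI[of _ x]) (simp add: that)
 define h where "h X = (\<lambda>(i, k)\<in>?D. T (entry (rep X) i k))" for X
 have h: "h (cls x) = (\<lambda>(i, k)\<in>?D. T (entry x i k))" if x: "x \<in> R" for x
 proof -
  have "T (entry (rep (cls x)) i k) = T (entry x i k)" if "i < \<delta>" "k < \<delta>" for i k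
   using rep[OF x] x that by (intro T_eqv entry_E entry_eqv) (auto simp: cls_eqv)
  then show ?thesis by (auto simp: h_def restrict_def fun_eq_iff)
 qed
 have M: "carrier ?M = ?D \<rightarrow>\<^sub>E T ` E"
  "f \<oplus>\<^bsub>?M\<^esub> g = (\<lambda>ik\<in>?D. f ik \<oplus>\<^bsub>OQ\<^esub> g ik)"
  "f \<otimes>\<^bsub>?M\<^esub> g = (\<lambda>(i, k)\<in>?D. \<Oplus>\<^bsub>OQ\<^esub>j\<in>{..<\<delta>}. f (i, j) \<otimes>\<^bsub>OQ\<^esub> g (j, k))"
  "\<one>\<^bsub>?M\<^esub> = (\<lambda>(i, k)\<in>?D. if i = k then T e else T 0)"
  "k \<odot>\<^bsub>?M\<^esub> f = (\<lambda>ik\<in>?D. k \<odot>\<^bsub>OQ\<^esub> f ik)" for f g k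
  unfolding matrix_algebra_def Let_def OQ_carrier OQ_one OQ_zero by simp_all
 interpret OQ: abelian_monoid OQ by (rule abelian_monoid_OQ)
 have "h \<in> Ring.ring_hom U ?M"
 proof (rule ring_hom_memI)
  fix X assume "X \<in> carrier U"
  then obtain x where x: "X = cls x" "x \<in> R" by (auto simp: U_carrier)
  then show "h X \<in> carrier ?M" by (auto simp: h M entry_E)
  fix Y assume "Y \<in> carrier U"
  then obtain y where y: "Y = cls y" "y \<in> R" by (auto simp: U_carrier)
  show "h (X \<oplus>\<^bsub>U\<^esub> Y) = h X \<oplus>\<^bsub>?M\<^esub> h Y"
   using x y by (auto simp: U_add h R_add M OQ_add entry_E entry_add fun_eq_iff restrict_def)
  have "(\<Oplus>\<^bsub>OQ\<^esub>j\<in>{..<\<delta>}. h X (i, j) \<otimes>\<^bsub>OQ\<^esub> h Y (j, k)) = T (entry (x * y) i k)" if ik: "i < \<delta>" "k < \<delta>" for i k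
  proof -
   have "(\<Oplus>\<^bsub>OQ\<^esub>j\<in>{..<\<delta>}. h X (i, j) \<otimes>\<^bsub>OQ\<^esub> h Y (j, k)) = finsum OQ (\<lambda>j. T (entry x i j * entry y j k)) {..<\<delta>}"
    using x y ik by (intro OQ.finsum_cong') (auto simp: h OQ_mult entry_E E_mult OQ_carrier)
   also have "\<dots> = T (\<Sum>j<\<delta>. entry x i j * entry y j k)"
    using x y ik by (intro finsum_T abelian_monoid_OQ OQ_carrier OQ_zero OQ_add) (auto simp: E_mult entry_E)
   also have "\<dots> = T (entry (x * y) i k)"
    using x y ik by (intro T_eqv entry_mult E_sum E_mult entry_E R_mult) auto
   finally show ?thesis .
  qed
  then show "h (X \<otimes>\<^bsub>U\<^esub> Y) = h X \<otimes>\<^bsub>?M\<^esub> h Y"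
   using x y by (auto simp: U_mult h[of "x * y"] R_mult M fun_eq_iff restrict_def)
 next
  have "T (entry 1 i k) = (if i = k then T e else T 0)" if ik: "i < \<delta>" "k < \<delta>" for i k
   using p_q[OF ik] ik by (auto simp: eqv_def entry_def intro!: T_eqv entry_E[OF R_1, unfolded entry_def mult_1_right] E_e E_0)
  then show "h \<one>\<^bsub>U\<^esub> = \<one>\<^bsub>?M\<^esub>" by (auto simp: U_one h R_1 M restrict_def fun_eq_iff)
 qed
 moreover have "bij_betw h (carrier U) (carrier ?M)"
  unfolding bij_betw_def
 proof
  show "inj_on h (carrier U)"
  proof (rule inj_onI)
   fix X Y assume "X \<in> carrier U" "Y \<in> carrier U" and eq: "h X = h Y"
   then obtain x y where x: "X = cls x" "x \<in> R" and y: "Y = cls y" "y \<in> R" by (auto simp: U_carrier)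
   have "entry x i k \<sim>\<^sub>I entry y i k" if "i < \<delta>" "k < \<delta>" for i k
   proof (rule T_inj)
    show "T (entry x i k) = T (entry y i k)"
     using fun_cong[OF eq, of "(i, k)"] that x y by (simp add: h)
   qed (use that x y in \<open>auto intro: entry_E\<close>)
   then show "X = Y" using entry_inj[OF x(2) y(2)] x y by (simp add: cls_eqv)
  qed
  show "h ` carrier U = carrier ?M"
  proof (intro equalityI subsetI)
   fix f assume "f \<in> h ` carrier U"
   then obtain x where x: "f = h (cls x)" "x \<in> R" by (auto simp: U_carrier)
   then show "f \<in> carrier ?M" unfolding x(1) h[OF x(2)] M(1) using x(2) by (auto simp: entry_E)
  next
   fix f assume f: "f \<in> carrier ?M"
   define c where "c i k = (SOME c. c \<in> E \<and> f (i, k) = T c)" for i k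
   have c: "c i k \<in> E \<and> f (i, k) = T (c i k)" if "i < \<delta>" "k < \<delta>" for i k
   proof -
    have "f (i, k) \<in> T ` E" using PiE_mem[OF f[unfolded M(1)], of "(i, k)"] that by simp
    then have "\<exists>d. d \<in> E \<and> f (i, k) = T d" by (simp add: image_iff Bex_def)
    from someI_ex[OF this] show ?thesis unfolding c_def .
   qed
   obtain x where x: "x \<in> R" "\<forall>i<\<delta>. \<forall>k<\<delta>. entry x i k \<sim>\<^sub>I c i k" using entry_surj[of c] c by blast
   have "h (cls x) (i, k) = f (i, k)" for i k
   proof (cases "i < \<delta> \<and> k < \<delta>")
    case True
    then have "T (entry x i k) = T (c i k)" using x c by (intro T_eqv entry_E) auto
    then show ?thesis using True x c by (simp add: h)
   next
    case False
    then show ?thesis using f x by (auto simp: M h PiE_def extensional_def)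
   qed
   then have "h (cls x) = f" by (auto simp: fun_eq_iff)
   then show "f \<in> h ` carrier U" using x by (auto simp: U_carrier)
  qed
 qed
 moreover have "h (k \<odot>\<^bsub>U\<^esub> X) = k \<odot>\<^bsub>?M\<^esub> h X" if "X \<in> carrier U" for k X
 proof -
  obtain x where x: "X = cls x" "x \<in> R" using \<open>X \<in> carrier U\<close> by (auto simp: U_carrier)
  have "entry (sc k * x) i j = sc k * entry x i j" for i j
   by (simp add: entry_def sc_left_commute mult.assoc)
  then show ?thesis
   using x by (auto simp: U_smult h[of "sc k * x"] h[of x] R_mult sc_R M OQ_smult entry_E fun_eq_iff restrict_def)
 qed
 ultimately show ?thesis unfolding algebra_iso_def ring_iso_def by blast
qed

end

section \<open>The free algebra as a type\<close>

text \<open>The wrapper makes words an additive monoid under concatenation, so that finitely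
  supported functions on them carry the convolution product of a monoid ring and form an instance of
  \<open>ring_1\<close>.\<close>

datatype 'g fword = FW (letters: "'g list")

instantiation fword :: (type) monoid_add
begin
definition zero_fword_def: "0 = FW []"
definition plus_fword_def: "v + w = FW (letters v @ letters w)"
instance by standard (auto simp: zero_fword_def plus_fword_def)
end

type_synonym ('k, 'g) fa = "'g fword \<Rightarrow>\<^sub>0 'k"

definition fsc :: "'k::field => ('k, 'g) fa" where "fsc c = Poly_Mapping.single 0 c"
definition flet :: "'g => ('k::field, 'g) fa" where "flet x = Poly_Mapping.single (FW [x]) 1"
text \<open>Dictionary between the ring type and the record \<open>free_algebra\<close>;
  \<open>fn_mult\<close> shows that the two convolutions agree, and
  \<open>carrier_free_algebra\<close> that nothing is lost.\<close>

definition fn :: "('k::field, 'g) fa => 'g list => 'k" where "fn f = (\<lambda>w. Poly_Mapping.lookup f (FW w))"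
definition fR :: "'g set => ('k::field, 'g) fa set" where
 "fR G = {f. \<forall>w\<in>Poly_Mapping.keys f. set (letters w) \<subseteq> G}"

lemma fa_induct [case_names single add]:
 fixes f :: "('k::field, 'g) fa"
 assumes "\<And>w c. P (Poly_Mapping.single w c)" and "\<And>f g. P f ==> P g ==> P (f + g)"
 shows "P f"
proof (induction f rule: update_induct)
 case const
 then show ?case using assms(1)[of 0 0] by simp
next
 case (update f a b)
 have "Poly_Mapping.update a b f = f + Poly_Mapping.single a b"
  using update by (intro poly_mapping_eqI) (auto simp: lookup_update lookup_add lookup_single when_def in_keys_iff)
 then show ?case using assms update by simp
qed

lemma fsc_mult_single: "fsc c * Poly_Mapping.single w b = Poly_Mapping.single w (c * b)"
 by (simp add: fsc_def mult_single)

lemma single_mult_fsc: "Poly_Mapping.single w b * fsc c = Poly_Mapping.single w (b * c)"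
 by (simp add: fsc_def mult_single)

lemma fsc_commute: "fsc c * f = f * fsc c"
proof (induction f rule: fa_induct)
 case (single w b)
 then show ?case unfolding fsc_mult_single single_mult_fsc by (simp add: mult.commute)
qed (simp add: distrib_left distrib_right)

lemma fsc_add: "fsc (a + b) = fsc a + fsc b" by (simp add: fsc_def single_add)
lemma fsc_mult: "fsc (a * b) = fsc a * fsc b" by (simp add: fsc_def mult_single)
lemma fsc_1: "fsc 1 = 1" by (simp add: fsc_def)

lemma single_FW: "Poly_Mapping.single (FW w) c = fsc c * prod_list (map flet w)"
proof (induction w arbitrary: c)
 case Nil
 then show ?case by (simp add: fsc_def zero_fword_def)
next
 case (Cons x w)
 have "Poly_Mapping.single (FW (x # w)) c = flet x * Poly_Mapping.single (FW w) c"
  by (simp add: flet_def mult_single plus_fword_def)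
 also have "\<dots> = fsc c * (flet x * prod_list (map flet w))"
  unfolding Cons mult.assoc[symmetric] fsc_commute[of c "flet x"] ..
 finally show ?case by simp
qed

lemma fn_inj: "fn f = fn g \<longleftrightarrow> f = g"
proof
 assume "fn f = fn g"
 then have "Poly_Mapping.lookup f (FW w) = Poly_Mapping.lookup g (FW w)" for w
  by (auto simp: fn_def dest: fun_cong[of _ _ w])
 then show "f = g" by (intro poly_mapping_eqI) (metis fword.exhaust)
qed simp

lemma fn_add: "fn (f + g) = (\<lambda>w. fn f w + fn g w)" by (simp add: fn_def lookup_add)
lemma fn_diff: "fn (f - g) = (\<lambda>w. fn f w - fn g w)" by (simp add: fn_def lookup_minus)
lemma fn_0: "fn 0 = (\<lambda>w. 0)" by (simp add: fn_def)
lemma fn_single: "fn (Poly_Mapping.single (FW v) c) = (\<lambda>w. if w = v then c else 0)"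
 by (auto simp: fn_def lookup_single when_def)
lemma fn_1: "fn 1 = (\<lambda>w. if w = [] then 1 else 0)"
 by (auto simp: fn_def lookup_one when_def zero_fword_def)
lemma fn_fsc: "fn (fsc c * f) = (\<lambda>w. c * fn f w)"
proof (induction f rule: fa_induct)
 case (single w b)
 then show ?case unfolding fsc_mult_single by (cases w) (auto simp: fn_single)
qed (simp add: distrib_left fn_add)

lemma fn_mult: "fn (f * g) = (\<lambda>w. \<Sum>i\<le>length w. fn f (take i w) * fn g (drop i w))"
proof (induction f rule: fa_induct)
 case (add f g)
 then show ?case by (simp add: distrib_right fn_add sum.distrib)
next
 case f: (single v c)
 show ?case
 proof (induction g rule: fa_induct)
  case (add f g)
  then show ?case by (simp add: distrib_left fn_add sum.distrib)
 next
  case (single u b)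
  obtain v' where v': "v = FW v'" by (cases v)
  obtain u' where u': "u = FW u'" by (cases u)
  note vu = v' u'
  have "(\<Sum>i\<le>length w. (if take i w = v' then c else 0) * (if drop i w = u' then b else 0)) = (if w = v' @ u' then c * b else 0)" for w
  proof -
   have "(\<Sum>i\<le>length w. (if take i w = v' then c else 0) * (if drop i w = u' then b else 0))
    = (\<Sum>i\<le>length w. if i = length v' then (if w = v' @ u' then c * b else 0) else 0)"
   proof (rule sum.cong[OF refl])
    fix i assume "i \<in> {..length w}"
    then have "take i w = v' \<and> drop i w = u' \<longleftrightarrow> i = length v' \<and> w = v' @ u'"
     by (metis append_eq_conv_conj atMost_iff length_take min.absorb2)
    then show "(if take i w = v' then c else 0) * (if drop i w = u' then b else 0)
     = (if i = length v' then (if w = v' @ u' then c * b else 0) else 0)"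
     by (cases "take i w = v'"; cases "drop i w = u'"; simp)
   qed
   also have "\<dots> = (if w = v' @ u' then c * b else 0)" by (auto simp: sum.delta)
   finally show ?thesis .
  qed
  then show ?case by (simp add: vu mult_single plus_fword_def fn_single)
 qed
qed

lemma fn_support: "{w. fn f w \<noteq> 0} = letters ` Poly_Mapping.keys f"
proof (intro equalityI subsetI)
 fix w assume "w \<in> {w. fn f w \<noteq> 0}"
 then have "FW w \<in> Poly_Mapping.keys f" by (simp add: fn_def in_keys_iff)
 then show "w \<in> letters ` Poly_Mapping.keys f" by (metis fword.sel imageI)
next
 fix w assume "w \<in> letters ` Poly_Mapping.keys f"
 then obtain v where "v \<in> Poly_Mapping.keys f" "w = letters v" by blast
 then show "w \<in> {w. fn f w \<noteq> 0}" by (simp add: fn_def in_keys_iff)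
qed

lemma fR_0: "0 \<in> fR G" by (simp add: fR_def)
lemma fR_add: "f \<in> fR G ==> g \<in> fR G ==> f + g \<in> fR G"
 using Poly_Mapping.keys_add[of f g] by (auto simp: fR_def)
lemma fR_mult: "f \<in> fR G ==> g \<in> fR G ==> f * g \<in> fR G"
 using Poly_Mapping.keys_mult[of f g] by (fastforce simp: fR_def plus_fword_def)
lemma fR_fsc: "fsc c \<in> fR G" by (auto simp: fR_def fsc_def zero_fword_def)
lemma fR_flet: "x \<in> G ==> flet x \<in> fR G" by (auto simp: fR_def flet_def)
lemma fR_mono: "G \<subseteq> H ==> f \<in> fR G ==> f \<in> fR H" by (auto simp: fR_def)
lemma fR_minus: "f \<in> fR G ==> - f \<in> fR G" by (simp add: fR_def)
lemma fR_diff: "f \<in> fR G ==> g \<in> fR G ==> f - g \<in> fR G"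
 using fR_add[OF _ fR_minus, of f G g] by simp
lemma fR_1: "1 \<in> fR G" using fR_fsc[of 1] by (simp add: fsc_1)

text \<open>Unlike \<open>fa_induct\<close>, this rule retains a property of the words that occur,
  such as having letters in a carrier or having a fixed parity.\<close>

lemma keys_induct [consumes 1, case_names zero single add]:
 fixes f :: "('k::field, 'g) fa"
 assumes "\<forall>w\<in>Poly_Mapping.keys f. P (letters w)" and "Q 0"
  and "\<And>w c. P w ==> Q (Poly_Mapping.single (FW w) c)" and "\<And>f g. Q f ==> Q g ==> Q (f + g)"
 shows "Q f"
 using assms(1)
proof (induction f rule: update_induct)
 case const
 then show ?case using assms(2) by simp
next
 case (update f a b)
 have eq: "Poly_Mapping.update a b f = f + Poly_Mapping.single a b"
  using update by (intro poly_mapping_eqI) (auto simp: lookup_update lookup_add lookup_single when_def in_keys_iff)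
 have k: "Poly_Mapping.keys (Poly_Mapping.update a b f) = insert a (Poly_Mapping.keys f)"
  using update by (auto simp: in_keys_iff lookup_update split: if_splits)
 obtain w where w: "a = FW w" by (cases a)
 then have "Q (Poly_Mapping.single a b)" using assms(3) update.prems k by simp
 then show ?case unfolding eq using assms(4) update k by simp
qed

lemma carrier_free_algebra: "carrier (free_algebra G) = fn ` fR G"
proof (intro Set.set_eqI iffI)
 fix f assume "f \<in> carrier (free_algebra G)"
 then have fin: "finite {w. f w \<noteq> 0}" and G: "\<And>w. f w \<noteq> 0 ==> set w \<subseteq> G" by (auto simp: free_algebra_def)
 have "{w. f (letters w) \<noteq> 0} = FW ` {w. f w \<noteq> 0}"
  by (auto simp: image_iff) (metis fword.collapse)
 then have fin': "finite {w. f (letters w) \<noteq> 0}" using fin by simp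
 let ?g = "Abs_poly_mapping (\<lambda>w. f (letters w))"
 have l: "Poly_Mapping.lookup ?g = (\<lambda>w. f (letters w))"
  using fin' by (simp add: Abs_poly_mapping_inverse)
 have "fn ?g = f" by (simp add: fn_def l)
 moreover have "?g \<in> fR G" using G by (auto simp: fR_def in_keys_iff l)
 ultimately show "f \<in> fn ` fR G" by (metis imageI)
next
 fix f assume "f \<in> fn ` fR G"
 then obtain g where g: "f = fn g" "g \<in> fR G" by auto
 have "set w \<subseteq> G" if "fn g w \<noteq> 0" for w
 proof -
  have "w \<in> letters ` Poly_Mapping.keys g" using that unfolding fn_support[symmetric] by simp
  then show ?thesis using g(2) by (auto simp: fR_def)
 qed
 then show "f \<in> carrier (free_algebra G)" by (simp add: free_algebra_def g(1) fn_support)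
qed

lemma free_algebra_simps:
 "fn f \<oplus>\<^bsub>free_algebra G\<^esub> fn g = fn (f + g)" "fn f \<otimes>\<^bsub>free_algebra G\<^esub> fn g = fn (f * g)"
 "\<one>\<^bsub>free_algebra G\<^esub> = fn 1" "\<zero>\<^bsub>free_algebra G\<^esub> = fn 0" "c \<odot>\<^bsub>free_algebra G\<^esub> fn f = fn (fsc c * f)"
proof -
 show "c \<odot>\<^bsub>free_algebra G\<^esub> fn f = fn (fsc c * f)" by (simp add: free_algebra_def fn_fsc)
qed (simp_all add: free_algebra_def fn_add fn_mult fn_1 fn_0)

lemma ring_free_algebra: "ring (free_algebra G)"
proof (rule ringI)
 show "abelian_group (free_algebra G)"
 proof (rule abelian_groupI)
  fix x assume "x \<in> carrier (free_algebra G)"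
  then obtain f where f: "x = fn f" "f \<in> fR G" by (auto simp: carrier_free_algebra)
  then have "fn (- f) \<in> carrier (free_algebra G)" "fn (- f) \<oplus>\<^bsub>free_algebra G\<^esub> x = \<zero>\<^bsub>free_algebra G\<^esub>"
   by (auto simp: carrier_free_algebra fR_minus free_algebra_simps)
  then show "\<exists>y\<in>carrier (free_algebra G). y \<oplus>\<^bsub>free_algebra G\<^esub> x = \<zero>\<^bsub>free_algebra G\<^esub>" by blast
 qed (auto simp: carrier_free_algebra free_algebra_simps fR_add fR_0 ac_simps)
 show "Group.monoid (free_algebra G)"
  by (rule monoidI) (auto simp: carrier_free_algebra free_algebra_simps fR_mult fR_1 mult.assoc)
qed (auto simp: carrier_free_algebra free_algebra_simps distrib_left distrib_right)

text \<open>The homomorphism given by the universal property of the free algebra. It is used twice: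
  for the parity automorphism, and with values in the field for the character \<chi>.\<close>

definition feval :: "('k::field => 'b::ring_1) => ('g => 'b) => ('k, 'g) fa => 'b" where
 "feval s \<phi> f = (\<Sum>w\<in>Poly_Mapping.keys f. s (Poly_Mapping.lookup f w) * prod_list (map \<phi> (letters w)))"

locale fa_hom =
 fixes s :: "'k::field => 'b::ring_1" and \<phi> :: "'g => 'b"
 assumes s_add: "s (a + b) = s a + s b" and s_mult: "s (a * b) = s a * s b" and s_1: "s 1 = 1"
  and s_commute: "s c * x = x * s c"
begin

lemma s_0: "s 0 = 0" using s_add[of 0 0] by simp

lemma feval_superset:
 assumes "finite A" and "Poly_Mapping.keys f \<subseteq> A"
 shows "feval s \<phi> f = (\<Sum>w\<in>A. s (Poly_Mapping.lookup f w) * prod_list (map \<phi> (letters w)))"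
 unfolding feval_def using assms
 by (intro sum.mono_neutral_left) (auto simp: in_keys_iff s_0)

lemma feval_add: "feval s \<phi> (f + g) = feval s \<phi> f + feval s \<phi> g"
proof -
 let ?A = "Poly_Mapping.keys f \<union> Poly_Mapping.keys g"
 have "feval s \<phi> (f + g) = (\<Sum>w\<in>?A. s (Poly_Mapping.lookup (f + g) w) * prod_list (map \<phi> (letters w)))"
  using Poly_Mapping.keys_add[of f g] by (intro feval_superset) auto
 moreover have "feval s \<phi> f = (\<Sum>w\<in>?A. s (Poly_Mapping.lookup f w) * prod_list (map \<phi> (letters w)))"
  by (intro feval_superset) auto
 moreover have "feval s \<phi> g = (\<Sum>w\<in>?A. s (Poly_Mapping.lookup g w) * prod_list (map \<phi> (letters w)))"
  by (intro feval_superset) auto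
 ultimately show ?thesis by (simp add: lookup_add s_add distrib_right sum.distrib)
qed

lemma feval_single: "feval s \<phi> (Poly_Mapping.single w c) = s c * prod_list (map \<phi> (letters w))"
 by (simp add: feval_superset[of "{w}"] lookup_single)

lemma feval_0: "feval s \<phi> 0 = 0" by (simp add: feval_def)
lemma feval_minus: "feval s \<phi> (- f) = - feval s \<phi> f"
 using feval_add[of "- f" f] by (simp add: feval_0 eq_neg_iff_add_eq_0)
lemma feval_diff: "feval s \<phi> (f - g) = feval s \<phi> f - feval s \<phi> g"
 using feval_add[of f "- g"] by (simp add: feval_minus)

lemma feval_mult: "feval s \<phi> (f * g) = feval s \<phi> f * feval s \<phi> g"
proof (induction f rule: fa_induct)
 case (add f g)
 then show ?case by (simp add: distrib_right feval_add)
next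
 case f: (single v c)
 show ?case
 proof (induction g rule: fa_induct)
  case (add f g)
  then show ?case by (simp add: distrib_left feval_add)
 next
  case (single u b)
  have "s c * s b * (prod_list (map \<phi> (letters v)) * prod_list (map \<phi> (letters u)))
   = s c * prod_list (map \<phi> (letters v)) * (s b * prod_list (map \<phi> (letters u)))"
   by (metis mult.assoc s_commute)
  then show ?case by (simp add: mult_single feval_single plus_fword_def s_mult)
 qed
qed

lemma feval_fsc: "feval s \<phi> (fsc c) = s c" by (simp add: fsc_def feval_single zero_fword_def)
lemma feval_flet: "feval s \<phi> (flet x) = \<phi> x" by (simp add: flet_def feval_single s_1)
lemma feval_1: "feval s \<phi> 1 = 1" using feval_fsc[of 1] by (simp add: fsc_1 s_1)
lemma feval_power: "feval s \<phi> (f ^ n) = feval s \<phi> f ^ n" by (induction n) (auto simp: feval_1 feval_mult)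

end

lemma fa_hom_fsc: "fa_hom fsc"
 by standard (rule fsc_add fsc_mult fsc_1 fsc_commute)+

lemma fa_hom_id: "fa_hom (\<lambda>c::'k::field. c)"
 by standard (auto simp: mult.commute)

lemma word_eval_fn: "word_eval \<chi> (fn f) = feval (\<lambda>c. c) \<chi> f"
proof -
 have inj: "inj_on letters (Poly_Mapping.keys f)" by (rule inj_onI) (erule fword.expand)
 show ?thesis unfolding word_eval_def fn_support feval_def sum.reindex[OF inj] by (simp add: fn_def)
qed

section \<open>Reduced enveloping algebras as quotients of the free algebra\<close>

definition env_rel :: "('k::field, 'g) lie_superalg => ('g => 'k) => ('k, 'g) fa set" where
 "env_rel L \<chi> =
   {flet (x \<oplus>\<^bsub>L\<^esub> y) - flet x - flet y | x y. x \<in> carrier L \<and> y \<in> carrier L} \<union>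
   {flet (c \<odot>\<^bsub>L\<^esub> x) - fsc c * flet x | c x. x \<in> carrier L} \<union>
   {flet x * flet y - fsc (ksign a b) * (flet y * flet x) - flet (brk L x y)
    | a b x y. x \<in> hcomp L a \<and> y \<in> hcomp L b} \<union>
   {flet x ^ CHAR('k) - flet (pmap L x) - fsc (\<chi> x ^ CHAR('k)) | x. x \<in> hcomp L 0}"

lemma word_fn: "(word w :: 'g list => 'k::field) = fn (prod_list (map flet w))"
proof -
 have "fn (prod_list (map flet w) :: ('k, 'g) fa) = fn (Poly_Mapping.single (FW w) 1)" by (simp add: single_FW fsc_1)
 then show ?thesis by (auto simp: word_def fn_single)
qed

lemma env_relations_fn: "env_relations L \<chi> = fn ` env_rel L \<chi>"
proof -
 have r: "word (replicate n x) = fn (flet x ^ n)" for x :: 'a and n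
  by (simp add: word_fn prod_list_replicate)
 have w: "word [x] = fn (flet x)" "word [x, y] = fn (flet x * flet y)" "word [] = fn 1" for x y :: 'a
  by (simp_all add: word_fn)
 have 1: "(\<lambda>v. word [x \<oplus>\<^bsub>L\<^esub> y] v - word [x] v - word [y] v) = fn (flet (x \<oplus>\<^bsub>L\<^esub> y) - flet x - flet y)" for x y
  by (simp add: w fn_diff)
 have 2: "(\<lambda>v. word [c \<odot>\<^bsub>L\<^esub> x] v - c * word [x] v) = fn (flet (c \<odot>\<^bsub>L\<^esub> x) - fsc c * flet x)" for c x
  by (simp add: w fn_diff fn_fsc)
 have 3: "(\<lambda>v. word [x, y] v - ksign a b * word [y, x] v - word [brk L x y] v)
   = fn (flet x * flet y - fsc (ksign a b) * (flet y * flet x) - flet (brk L x y))" for a b x y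
  by (simp add: w fn_diff fn_fsc)
 have 4: "(\<lambda>v. word (replicate CHAR('b) x) v - word [pmap L x] v - \<chi> x ^ CHAR('b) * word [] v)
   = fn (flet x ^ CHAR('b) - flet (pmap L x) - fsc (\<chi> x ^ CHAR('b)))" for x
 proof -
  have "fn (fsc c) v = c * fn 1 v" for c :: 'b and v :: "'a list"
   using fun_cong[OF fn_fsc[of c 1], of v] by simp
  then show ?thesis by (simp add: fn_diff r w(1,3))
 qed
 show ?thesis unfolding env_relations_def env_rel_def 1 2 3 4 image_Un by (intro arg_cong2[of _ _ _ _ "(\<union>)"]) blast+
qed

definition env_I :: "('k::field, 'g) lie_superalg => ('g => 'k) => ('k, 'g) fa set" where
 "env_I L \<chi> = {f \<in> fR (carrier L). fn f \<in> env_ideal L \<chi>}"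

definition env_cls :: "('k::field, 'g) lie_superalg => ('g => 'k) => ('k, 'g) fa => ('g list => 'k) set" where
 "env_cls L \<chi> f = env_ideal L \<chi> +>\<^bsub>free_algebra (carrier L)\<^esub> fn f"

definition fRh :: "('k::field, 'g) lie_superalg => bit => ('k, 'g) fa set" where
 "fRh L i = {f \<in> fR (carrier L). \<forall>w\<in>Poly_Mapping.keys f. word_parity L (letters w) i}"

text \<open>Only closure conditions, so that the ring theory of the reduced enveloping algebra
  applies to the restricted subalgebra \<open>sub_lie L S\<close> as well as to
  \<open>L\<close>.\<close>

locale env_algebra =
 fixes L :: "('k::field, 'g) lie_superalg" (structure) and \<chi> :: "'g => 'k"
 assumes add_cl: "[|x \<in> carrier L; y \<in> carrier L|] ==> x \<oplus> y \<in> carrier L"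
  and smult_cl: "x \<in> carrier L ==> c \<odot> x \<in> carrier L"
  and hc: "hcomp L a \<subseteq> carrier L"
  and brk_cl: "[|x \<in> hcomp L a; y \<in> hcomp L b|] ==> brk L x y \<in> carrier L"
  and pmap_cl: "x \<in> hcomp L 0 ==> pmap L x \<in> carrier L"
begin

abbreviation "F \<equiv> free_algebra (carrier L) :: ('k, 'g list => 'k) module"
abbreviation "I0 \<equiv> env_I L \<chi>"
abbreviation "RL \<equiv> fR (carrier L) :: ('k, 'g) fa set"
abbreviation "cls \<equiv> env_cls L \<chi>"

lemma fR_power: "f \<in> RL ==> f ^ n \<in> RL" by (induction n) (auto intro: fR_1 fR_mult)

lemma env_rel_R: "env_rel L \<chi> \<subseteq> RL"
proof
 fix r assume "r \<in> env_rel L \<chi>"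
 then show "r \<in> RL" unfolding env_rel_def
  using add_cl smult_cl hc brk_cl pmap_cl
  by (elim UnE CollectE exE conjE) (blast intro!: fR_diff fR_mult fR_power fR_flet fR_fsc)+
qed

sublocale F: ring F by (rule ring_free_algebra)

lemma ideal_env: "ideal (env_ideal L \<chi>) F"
 unfolding env_ideal_def env_relations_fn
 by (rule F.genideal_ideal) (use env_rel_R in \<open>auto simp: carrier_free_algebra\<close>)

lemma env_ideal_fn: "env_ideal L \<chi> = fn ` I0"
proof -
 interpret ideal "env_ideal L \<chi>" F by (rule ideal_env)
 show ?thesis using a_subset by (auto simp: env_I_def carrier_free_algebra)
qed

lemma fn_I0: "f \<in> RL ==> fn f \<in> env_ideal L \<chi> \<longleftrightarrow> f \<in> I0" by (simp add: env_I_def)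

lemma env_rel_I: "env_rel L \<chi> \<subseteq> I0"
proof
 fix r assume r: "r \<in> env_rel L \<chi>"
 have "fn ` env_rel L \<chi> \<subseteq> env_ideal L \<chi>"
  unfolding env_ideal_def env_relations_fn
  by (rule F.genideal_self) (use env_rel_R in \<open>auto simp: carrier_free_algebra\<close>)
 then show "r \<in> I0" using r env_rel_R by (auto simp: env_I_def)
qed

sublocale quotient_algebra fsc RL I0
proof -
 interpret ideal "env_ideal L \<chi>" F by (rule ideal_env)
 have *: "f + g \<in> I0" if "f \<in> I0" "g \<in> I0" for f g
  using that a_closed[of "fn f" "fn g"] by (auto simp: env_I_def free_algebra_simps fR_add)
 have l: "f * g \<in> I0" if "f \<in> RL" "g \<in> I0" for f g
  using that I_l_closed[of "fn g" "fn f"] by (auto simp: env_I_def free_algebra_simps fR_mult carrier_free_algebra)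
 have r: "g * f \<in> I0" if "f \<in> RL" "g \<in> I0" for f g
  using that I_r_closed[of "fn g" "fn f"] by (auto simp: env_I_def free_algebra_simps fR_mult carrier_free_algebra)
 have z: "0 \<in> I0" using zero_closed by (auto simp: env_I_def free_algebra_simps fR_0)
 show "quotient_algebra fsc RL I0"
 proof
  show "I0 \<subseteq> RL" by (auto simp: env_I_def)
 qed (assumption | rule fsc_add fsc_mult fsc_1 fsc_commute fR_fsc fR_add fR_mult * l r z)+
qed

text \<open>The universal property in the form used below: to show that a map respects the quotient,
  take for \<open>K\<close> the elements on which it behaves as wanted and check the
  relations.\<close>

lemma env_I_minimal:
 assumes K: "K \<subseteq> RL" "0 \<in> K" "\<And>x y. x \<in> K ==> y \<in> K ==> x + y \<in> K"
  and l: "\<And>x y. x \<in> RL ==> y \<in> K ==> x * y \<in> K" and r: "\<And>x y. x \<in> RL ==> y \<in> K ==> y * x \<in> K"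
  and rel: "env_rel L \<chi> \<subseteq> K"
 shows "I0 \<subseteq> K"
proof -
 have m: "- x \<in> K" if "x \<in> K" for x
  using l[OF fR_fsc that, of "- 1"] by (simp add: sc_minus1)
 have "ideal (fn ` K) F"
 proof (rule idealI)
  show "subgroup (fn ` K) (add_monoid F)"
  proof
   show "fn ` K \<subseteq> carrier (add_monoid F)" using K by (auto simp: carrier_free_algebra)
   fix x assume "x \<in> fn ` K"
   then obtain f where f: "x = fn f" "f \<in> K" "f \<in> RL" using K by auto
   have "\<ominus>\<^bsub>F\<^esub> x = fn (- f)"
    by (rule F.minus_equality) (auto simp: f free_algebra_simps carrier_free_algebra fR_minus)
   then show "inv\<^bsub>add_monoid F\<^esub> x \<in> fn ` K" using m[OF f(2)] by (simp add: a_inv_def)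
  qed (use K in \<open>auto simp: free_algebra_simps\<close>)
 qed (use l r in \<open>auto simp: ring_free_algebra carrier_free_algebra free_algebra_simps\<close>)
 then have "env_ideal L \<chi> \<subseteq> fn ` K"
  unfolding env_ideal_def env_relations_fn using rel by (intro F.genideal_minimal) auto
 then show ?thesis unfolding env_ideal_fn by (auto simp: fn_inj)
qed

abbreviation "U \<equiv> reduced_env L \<chi>"

lemma cls_eq: "f \<in> RL ==> g \<in> RL ==> cls f = cls g \<longleftrightarrow> f - g \<in> I0"
proof -
 assume fg: "f \<in> RL" "g \<in> RL"
 have "\<ominus>\<^bsub>F\<^esub> fn g = fn (- g)"
  by (rule F.minus_equality) (auto simp: fg free_algebra_simps carrier_free_algebra fR_minus)
 then have "fn f \<ominus>\<^bsub>F\<^esub> fn g = fn (f - g)" by (simp add: a_minus_def free_algebra_simps)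
 then show ?thesis
  using F.quotient_eq_iff_same_a_r_cos[OF ideal_env, of "fn f" "fn g"] fg
  by (simp add: env_cls_def carrier_free_algebra fn_I0 fR_diff)
qed

lemma U_carrier: "carrier U = cls ` RL"
 by (auto simp: reduced_env_def Let_def FactRing_def A_RCOSETS_defs a_r_coset_def carrier_free_algebra env_cls_def)

lemma U_add: "f \<in> RL ==> g \<in> RL ==> cls f \<oplus>\<^bsub>U\<^esub> cls g = cls (f + g)"
 using abelian_subgroup.a_rcos_sum[OF ideal.axioms(1)[OF ideal_env, THEN abelian_subgroupI3], of "fn f" "fn g"]
 by (simp add: reduced_env_def Let_def FactRing_def env_cls_def carrier_free_algebra free_algebra_simps F.abelian_group_axioms)

lemma U_mult: "f \<in> RL ==> g \<in> RL ==> cls f \<otimes>\<^bsub>U\<^esub> cls g = cls (f * g)"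
 using ideal.rcoset_mult_add[OF ideal_env, of "fn f" "fn g"]
 by (simp add: reduced_env_def Let_def FactRing_def env_cls_def carrier_free_algebra free_algebra_simps)

lemma U_one: "\<one>\<^bsub>U\<^esub> = cls 1"
 by (simp add: reduced_env_def Let_def FactRing_def env_cls_def free_algebra_simps)

lemma U_zero: "\<zero>\<^bsub>U\<^esub> = cls 0"
proof -
 have "env_ideal L \<chi> +>\<^bsub>F\<^esub> \<zero>\<^bsub>F\<^esub> = env_ideal L \<chi>"
  using F.a_coset_add_zero additive_subgroup.a_subset[OF ideal.axioms(1)[OF ideal_env]] by blast
 then show ?thesis by (simp add: reduced_env_def Let_def FactRing_def env_cls_def free_algebra_simps)
qed

lemma U_smult: "f \<in> RL ==> c \<odot>\<^bsub>U\<^esub> cls f = cls (fsc c * f)"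
 using U_mult[of "fsc c" f] by (simp add: reduced_env_def Let_def env_cls_def free_algebra_simps fR_fsc)

lemma U_hcomp: "hcomp U i = cls ` fRh L i"
proof -
 have "{f. f \<in> carrier F \<and> (\<forall>w. f w \<noteq> 0 \<longrightarrow> word_parity L w i)} = fn ` fRh L i"
 proof (intro equalityI subsetI)
  fix f assume f: "f \<in> {f. f \<in> carrier F \<and> (\<forall>w. f w \<noteq> 0 \<longrightarrow> word_parity L w i)}"
  then obtain g where g: "f = fn g" "g \<in> RL" by (auto simp: carrier_free_algebra)
  have "word_parity L (letters w) i" if "w \<in> Poly_Mapping.keys g" for w
  proof -
   have "letters w \<in> {w. fn g w \<noteq> 0}" unfolding fn_support using that by blast
   then show ?thesis using f g by auto
  qed
  then show "f \<in> fn ` fRh L i" using g by (auto simp: fRh_def)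
 next
  fix f assume "f \<in> fn ` fRh L i"
  then obtain g where g: "f = fn g" "g \<in> fRh L i" by auto
  have "word_parity L w i" if "fn g w \<noteq> 0" for w
  proof -
   have "w \<in> letters ` Poly_Mapping.keys g" using that unfolding fn_support[symmetric] by simp
   then show ?thesis using g by (auto simp: fRh_def)
  qed
  then show "f \<in> {f. f \<in> carrier F \<and> (\<forall>w. f w \<noteq> 0 \<longrightarrow> word_parity L w i)}"
   using g by (auto simp: fRh_def carrier_free_algebra)
 qed
 moreover have "hcomp U i = (\<lambda>f. env_ideal L \<chi> +>\<^bsub>F\<^esub> f) ` {f. f \<in> carrier F \<and> (\<forall>w. f w \<noteq> 0 \<longrightarrow> word_parity L w i)}"
  unfolding reduced_env_def Let_def image_def by auto
 ultimately show ?thesis by (simp only: image_image env_cls_def[abs_def])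
qed

lemma flet_add: "x \<in> carrier L ==> y \<in> carrier L ==> flet (x \<oplus> y) - (flet x + flet y) \<in> I0"
 unfolding diff_diff_eq[symmetric]
 by (rule subsetD[OF env_rel_I], unfold env_rel_def, rule UnI1, rule UnI1, rule UnI1) auto
lemma flet_smult: "x \<in> carrier L ==> flet (c \<odot> x) - fsc c * flet x \<in> I0"
 by (rule subsetD[OF env_rel_I], unfold env_rel_def, rule UnI1, rule UnI1, rule UnI2) auto
lemma flet_brk: "x \<in> hcomp L a ==> y \<in> hcomp L b ==>
  flet x * flet y - fsc (ksign a b) * (flet y * flet x) - flet (brk L x y) \<in> I0"
 by (rule subsetD[OF env_rel_I], unfold env_rel_def, rule UnI1, rule UnI2)
  (intro CollectI exI[of _ a] exI[of _ b] exI[of _ x] exI[of _ y] conjI refl)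
lemma flet_pmap: "x \<in> hcomp L 0 ==> flet x ^ CHAR('k) - flet (pmap L x) - fsc (\<chi> x ^ CHAR('k)) \<in> I0"
 by (rule subsetD[OF env_rel_I], unfold env_rel_def, rule UnI2) auto

lemma U_minus: "f \<in> RL ==> cls (- f) \<oplus>\<^bsub>U\<^esub> cls f = \<zero>\<^bsub>U\<^esub>"
 by (simp add: U_add fR_minus U_zero)

lemma abelian_group_U: "abelian_group U"
proof (rule abelian_groupI)
 fix x assume "x \<in> carrier U"
 then obtain f where "x = cls f" "f \<in> RL" by (auto simp: U_carrier)
 then show "\<exists>y\<in>carrier U. y \<oplus>\<^bsub>U\<^esub> x = \<zero>\<^bsub>U\<^esub>" using U_minus[of f] fR_minus[of f] unfolding U_carrier by blast
qed (auto simp: U_carrier U_add U_zero fR_add fR_0 ac_simps)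

lemma vectorspace_U: "vectorspace class_ring U"
proof -
 have "module class_ring U"
  by (rule moduleI[OF class_cring.cring_axioms abelian_group_U])
   (auto simp: U_carrier U_smult U_add fR_mult fR_fsc fR_add fsc_add fsc_mult fsc_1 distrib_left distrib_right
    mult.assoc class_ring_simps)
 then show ?thesis unfolding vectorspace_def using class_field by blast
qed

lemma finsum_cls: "finite A ==> (\<And>a. a \<in> A ==> g a \<in> RL) ==> finsum U (\<lambda>a. cls (g a)) A = cls (\<Sum>a\<in>A. g a)"
proof (induction A rule: finite_induct)
 interpret abelian_group U by (rule abelian_group_U)
 case (insert a A)
 have "finsum U (\<lambda>a. cls (g a)) (insert a A) = cls (g a) \<oplus>\<^bsub>U\<^esub> finsum U (\<lambda>a. cls (g a)) A"
  using insert by (intro finsum_insert) (auto simp: U_carrier)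
 then show ?case using insert by (simp add: U_add R_sum)
next
 interpret abelian_group U by (rule abelian_group_U)
 case empty
 then show ?case by (simp add: U_zero)
qed

text \<open>Turns spanning and independence, both stated as congruences, into a basis of the
  quotient. Distinct indices give distinct cosets because a coincidence would be a relation with
  coefficients 1 and -1.\<close>

lemma kdim_U:
 assumes A: "finite A" and f: "\<And>a. a \<in> A ==> f a \<in> RL"
  and gen: "\<And>x. x \<in> RL ==> \<exists>c. x - (\<Sum>a\<in>A. fsc (c a) * f a) \<in> I0"
  and ind: "\<And>c a. (\<Sum>a\<in>A. fsc (c a) * f a) \<in> I0 ==> a \<in> A ==> c a = 0"
 shows "kdim U = card A"
proof -
 interpret V: vectorspace class_ring U by (rule vectorspace_U)
 let ?b = "\<lambda>a. cls (f a)"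
 have inj: "inj_on ?b A"
 proof (rule inj_onI)
  fix a b assume ab: "a \<in> A" "b \<in> A" "?b a = ?b b"
  show "a = b"
  proof (rule ccontr)
   assume ne: "a \<noteq> b"
   define c :: "'a => 'k" where "c x = (if x = a then 1 else if x = b then - 1 else 0)" for x
   have "(\<Sum>x\<in>A. fsc (c x) * f x) = (\<Sum>x\<in>A. (if x = a then f a else 0) - (if x = b then f b else 0))"
    using ne by (intro sum.cong) (auto simp: c_def fsc_1 sc_minus sc_0)
   also have "\<dots> = f a - f b" using A ab by (simp add: sum_subtractf)
   finally have "(\<Sum>x\<in>A. fsc (c x) * f x) \<in> I0" using ab f cls_eq by simp
   from ind[OF this ab(1)] show False by (simp add: c_def)
  qed
 qed
 have lin: "V.lincomb c (?b ` B) = cls (\<Sum>a\<in>B. fsc (c (?b a)) * f a)" if B: "B \<subseteq> A" for c B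
 proof -
  have "V.lincomb c (?b ` B) = finsum U (\<lambda>a. c (?b a) \<odot>\<^bsub>U\<^esub> ?b a) B"
   unfolding V.lincomb_def using B f inj
   by (intro V.finsum_reindex inj_on_subset[OF inj]) (auto simp: U_smult U_carrier fR_mult fR_fsc)
  also have "\<dots> = finsum U (\<lambda>a. cls (fsc (c (?b a)) * f a)) B"
   using B f by (intro V.finsum_cong') (auto simp: U_smult U_carrier fR_mult fR_fsc)
  also have "\<dots> = cls (\<Sum>a\<in>B. fsc (c (?b a)) * f a)"
   using B f A by (intro finsum_cls) (auto intro: finite_subset fR_mult fR_fsc)
  finally show ?thesis .
 qed
 have sub: "?b ` A \<subseteq> carrier U" using f by (auto simp: U_carrier)
 have "V.span (?b ` A) = carrier U"
 proof
  show "V.span (?b ` A) \<subseteq> carrier U" using sub by (rule V.span_is_subset2)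
  show "carrier U \<subseteq> V.span (?b ` A)"
  proof
   fix X assume "X \<in> carrier U"
   then obtain x where x: "X = cls x" "x \<in> RL" by (auto simp: U_carrier)
   obtain c where c: "x - (\<Sum>a\<in>A. fsc (c a) * f a) \<in> I0" using gen[OF x(2)] by blast
   define c' where "c' v = c (inv_into A ?b v)" for v
   have "V.lincomb c' (?b ` A) = cls (\<Sum>a\<in>A. fsc (c a) * f a)"
    unfolding lin[OF order_refl] by (intro arg_cong[of _ _ cls] sum.cong) (auto simp: c'_def inv_into_f_f[OF inj])
   also have "\<dots> = X"
    unfolding x(1) using c x f by (subst cls_eq) (auto intro!: R_sum fR_mult fR_fsc intro: I_sym)
   finally have "X = V.lincomb c' (?b ` A)" by simp
   then show "X \<in> V.span (?b ` A)" unfolding V.span_def using A by (intro CollectI exI[of _ c'] exI[of _ "?b ` A"]) (auto simp: class_ring_simps)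
  qed
 qed
 moreover have "V.lin_indpt (?b ` A)"
 proof (rule V.finite_lin_indpt2)
  fix c assume "V.lincomb c (?b ` A) = \<zero>\<^bsub>U\<^esub>"
  then have "cls (\<Sum>a\<in>A. fsc (c (?b a)) * f a) = cls 0" by (simp add: lin U_zero)
  then have "(\<Sum>a\<in>A. fsc (c (?b a)) * f a) \<in> I0"
   using f by (subst (asm) cls_eq) (auto intro!: R_sum fR_mult fR_fsc fR_0)
  from ind[OF this] show "\<forall>v\<in>?b ` A. c v = \<zero>\<^bsub>class_ring\<^esub>" by (auto simp: class_ring_simps)
 qed (use A sub in auto)
 ultimately have "V.basis (?b ` A)" using sub by (simp add: V.basis_def)
 then have "V.dim = card (?b ` A)" using A by (intro V.dim_basis) auto
 then show ?thesis using inj by (simp add: card_image)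
qed

end

lemma ksubspaceD:
 assumes "ksubspace W V"
 shows "W \<subseteq> carrier V" "\<zero>\<^bsub>V\<^esub> \<in> W" "x \<in> W ==> y \<in> W ==> x \<oplus>\<^bsub>V\<^esub> y \<in> W" "x \<in> W ==> c \<odot>\<^bsub>V\<^esub> x \<in> W"
proof -
 interpret submodule class_ring W V using assms by (simp add: subspace_def)
 show "W \<subseteq> carrier V" "\<zero>\<^bsub>V\<^esub> \<in> W" "x \<in> W ==> y \<in> W ==> x \<oplus>\<^bsub>V\<^esub> y \<in> W" "x \<in> W ==> c \<odot>\<^bsub>V\<^esub> x \<in> W"
  using subset by (auto simp: class_ring_simps)
qed

section \<open>The parity automorphism\<close>

locale super_env_algebra = env_algebra L \<chi> for L :: "('k::field, 'g) lie_superalg" (structure) and \<chi> +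
 assumes lie: "lie_superalgebra L" and pmap_even: "x \<in> hcomp L 0 ==> pmap L x \<in> hcomp L 0"
  and two: "(2 :: 'k) \<noteq> 0"
begin

sublocale lie_superalgebra L by (rule lie)

lemma vectorspace_L: "vectorspace class_ring L" using superspace by (simp add: superspace_def)

sublocale V: vectorspace class_ring L by (rule vectorspace_L)

lemma hcomp_subspace: "ksubspace (hcomp L i) L" using superspace by (simp add: superspace_def)
lemmas hcomp_D = ksubspaceD[OF hcomp_subspace]

lemma hcomp_disjoint: "x \<in> hcomp L 0 ==> x \<in> hcomp L 1 ==> x = \<zero>"
 using superspace by (auto simp: superspace_def)

lemma hcomp_split: "x \<in> carrier L ==> \<exists>y\<in>hcomp L 0. \<exists>z\<in>hcomp L 1. x = y \<oplus> z"
 using superspace by (auto simp: superspace_def)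

lemma smult_m1: "x \<in> carrier L ==> (- 1) \<odot> x = \<ominus> x"
 using V.smult_minus_1[of x] by (simp add: class_ring_simps)

lemma split_unique:
 assumes "y \<in> hcomp L 0" "z \<in> hcomp L 1" "y' \<in> hcomp L 0" "z' \<in> hcomp L 1" "y \<oplus> z = y' \<oplus> z'"
 shows "y = y'" "z = z'"
proof -
 have c: "y \<in> carrier L" "z \<in> carrier L" "y' \<in> carrier L" "z' \<in> carrier L" using assms hc by auto
 have "y \<ominus> y' = y \<oplus> z \<ominus> z \<ominus> y'" using c by (simp add: a_minus_def V.a_assoc V.r_neg)
 also have "\<dots> = y' \<oplus> z' \<ominus> z \<ominus> y'" using assms(5) by simp
 also have "\<dots> = y' \<oplus> (\<ominus> y' \<oplus> (z' \<ominus> z))" using c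
  by (simp add: a_minus_def V.a_ac)
 also have "\<dots> = z' \<ominus> z" using c by (simp add: V.r_neg2)
 finally have eq: "y \<ominus> y' = z' \<ominus> z" .
 have "y \<ominus> y' \<in> hcomp L 0" unfolding a_minus_def using assms c hcomp_D(4)[of y' 0 "- 1"] by (auto simp: smult_m1 intro: hcomp_D(3))
 moreover have "z' \<ominus> z \<in> hcomp L 1" unfolding a_minus_def using assms c hcomp_D(4)[of z 1 "- 1"] by (auto simp: smult_m1 intro: hcomp_D(3))
 ultimately have "y \<ominus> y' = \<zero>" using eq hcomp_disjoint by simp
 then have "y \<ominus> y' \<oplus> y' = y'" "z' \<ominus> z \<oplus> z = z" using eq c by auto
 then show "y = y'" "z = z'" using c by (auto simp: a_minus_def V.a_assoc V.l_neg)
qed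

text \<open>Changes the sign of the odd part; the choice is unambiguous by
  \<open>split_unique\<close>.\<close>

definition sp :: "'g => 'g" where
 "sp x = (SOME w. \<exists>y\<in>hcomp L 0. \<exists>z\<in>hcomp L 1. x = y \<oplus> z \<and> w = y \<oplus> (- 1) \<odot> z)"

lemma sp_split: "y \<in> hcomp L 0 ==> z \<in> hcomp L 1 ==> sp (y \<oplus> z) = y \<oplus> (- 1) \<odot> z"
 unfolding sp_def by (rule some_equality) (blast, metis split_unique)

definition sg :: "bit => 'k" where "sg a = (if a = 0 then 1 else - 1)"

lemma sp_hom: "x \<in> hcomp L a ==> sp x = sg a \<odot> x"
proof -
 assume x: "x \<in> hcomp L a"
 then have c: "x \<in> carrier L" using hc by auto
 show ?thesis
 proof (cases a)
  case zero
  have "sp (x \<oplus> \<zero>) = x \<oplus> (- 1) \<odot> \<zero>" using x zero by (intro sp_split hcomp_D) auto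
  then show ?thesis using c zero V.smult_one[of x] by (simp add: smult_m1 sg_def class_ring_simps)
 next
  case one
  have "sp (\<zero> \<oplus> x) = \<zero> \<oplus> (- 1) \<odot> x" using x one by (intro sp_split hcomp_D) auto
  then show ?thesis using c one smult_cl by (simp add: sg_def)
 qed
qed

lemma smult_hcomp: "x \<in> hcomp L a ==> c \<odot> x \<in> hcomp L a" by (rule hcomp_D(4))
lemma sp_hcomp: "x \<in> hcomp L a ==> sp x \<in> hcomp L a" by (simp add: sp_hom smult_hcomp)

lemma sp_carrier: "x \<in> carrier L ==> sp x \<in> carrier L"
proof -
 assume "x \<in> carrier L"
 then obtain y z where *: "y \<in> hcomp L 0" "z \<in> hcomp L 1" "x = y \<oplus> z" using hcomp_split by metis
 then have "y \<in> carrier L" "z \<in> carrier L" using hc by auto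
 then show ?thesis using * by (simp add: sp_split add_cl smult_cl)
qed

lemma sp_add: "x \<in> carrier L ==> y \<in> carrier L ==> sp (x \<oplus> y) = sp x \<oplus> sp y"
proof -
 assume "x \<in> carrier L" "y \<in> carrier L"
 then obtain a b c d where *: "a \<in> hcomp L 0" "b \<in> hcomp L 1" "x = a \<oplus> b" "c \<in> hcomp L 0" "d \<in> hcomp L 1" "y = c \<oplus> d"
  using hcomp_split by metis
 have c: "a \<in> carrier L" "b \<in> carrier L" "c \<in> carrier L" "d \<in> carrier L" using * hc by auto
 have "x \<oplus> y = (a \<oplus> c) \<oplus> (b \<oplus> d)" using * c by (simp add: V.a_ac)
 then have "sp (x \<oplus> y) = (a \<oplus> c) \<oplus> (- 1) \<odot> (b \<oplus> d)" using * by (simp add: sp_split hcomp_D(3))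
 also have "\<dots> = sp x \<oplus> sp y" using * c by (simp add: sp_split smult_m1 V.minus_add V.a_ac)
 finally show ?thesis .
qed

lemma sp_smult: "x \<in> carrier L ==> sp (k \<odot> x) = k \<odot> sp x"
proof -
 assume "x \<in> carrier L"
 then obtain a b where *: "a \<in> hcomp L 0" "b \<in> hcomp L 1" "x = a \<oplus> b" using hcomp_split by metis
 have c: "a \<in> carrier L" "b \<in> carrier L" using * hc by auto
 have d: "k \<odot> (x \<oplus> y) = k \<odot> x \<oplus> k \<odot> y" if "x \<in> carrier L" "y \<in> carrier L" for x y
  using V.smult_r_distr[of k x y] that by (simp add: class_ring_simps)
 have m: "k \<odot> ((- 1) \<odot> b) = (- 1) \<odot> (k \<odot> b)"
  using V.smult_assoc1[of k "- 1" b] V.smult_assoc1[of "- 1" k b] c by (simp add: class_ring_simps)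
 show ?thesis using * c by (simp add: d sp_split smult_hcomp smult_cl m)
qed

lemma sg_add: "sg (a + b) = sg a * sg b" by (cases a; cases b) (auto simp: sg_def)

lemma sp_brk: "x \<in> hcomp L a ==> y \<in> hcomp L b ==> sp (brk L x y) = brk L (sp x) (sp y)"
proof -
 assume x: "x \<in> hcomp L a" and y: "y \<in> hcomp L b"
 then have c: "x \<in> carrier L" "y \<in> carrier L" "brk L x y \<in> carrier L" using hc brk_hcomp by blast+
 have "sp (brk L x y) = (sg a * sg b) \<odot> brk L x y"
  using sp_hom[OF brk_hcomp[OF x y]] by (simp only: sg_add)
 also have "\<dots> = sg a \<odot> (sg b \<odot> brk L x y)"
  using V.smult_assoc1[of "sg a" "sg b"] c by (simp add: class_ring_simps)
 also have "\<dots> = brk L (sp x) (sp y)"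
  unfolding sp_hom[OF x] sp_hom[OF y]
  using c by (subst brk_smult_left) (simp_all add: brk_smult_right smult_cl)
 finally show ?thesis .
qed

definition \<sigma> :: "('k, 'g) fa => ('k, 'g) fa" where "\<sigma> = feval fsc (\<lambda>x. flet (sp x))"

sublocale \<sigma>: fa_hom fsc "\<lambda>x. flet (sp x)" by (rule fa_hom_fsc)

lemma \<sigma>_simps: "\<sigma> (f + g) = \<sigma> f + \<sigma> g" "\<sigma> (f * g) = \<sigma> f * \<sigma> g" "\<sigma> (f - g) = \<sigma> f - \<sigma> g" "\<sigma> (fsc c) = fsc c"
  "\<sigma> (flet x) = flet (sp x)" "\<sigma> (f ^ n) = \<sigma> f ^ n" "\<sigma> 0 = 0"
 unfolding \<sigma>_def by (rule \<sigma>.feval_add \<sigma>.feval_mult \<sigma>.feval_diff \<sigma>.feval_fsc \<sigma>.feval_flet \<sigma>.feval_power \<sigma>.feval_0)+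

lemma \<sigma>_R: "f \<in> RL ==> \<sigma> f \<in> RL"
proof -
 assume "f \<in> RL"
 then have "\<forall>w\<in>Poly_Mapping.keys f. set (letters w) \<subseteq> carrier L" by (simp add: fR_def)
 then show ?thesis
 proof (induction f rule: keys_induct)
  case (single w c)
  then have "prod_list (map (\<lambda>x. flet (sp x)) w) \<in> RL"
   by (intro R_prod_list) (auto intro: fR_flet sp_carrier)
  then show ?case unfolding \<sigma>_def \<sigma>.feval_single by (auto intro: R_mult fR_fsc)
 qed (auto simp: \<sigma>_simps fR_0 fR_add)
qed

text \<open>\<open>sp\<close> is linear, respects brackets of homogeneous elements and fixes even
  elements, so each defining relation is carried to another defining relation.\<close>

lemma \<sigma>_I: "f \<in> I0 ==> \<sigma> f \<in> I0"
proof -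
 have "I0 \<subseteq> {f \<in> RL. \<sigma> f \<in> I0}"
 proof (rule env_I_minimal)
  show "env_rel L \<chi> \<subseteq> {f \<in> RL. \<sigma> f \<in> I0}"
  proof (intro subsetI CollectI conjI)
   fix r assume r: "r \<in> env_rel L \<chi>"
   then show "r \<in> RL" using env_rel_R by blast
   from r consider (1) x y where "r = flet (x \<oplus> y) - flet x - flet y" "x \<in> carrier L" "y \<in> carrier L"
    | (2) c x where "r = flet (c \<odot> x) - fsc c * flet x" "x \<in> carrier L"
    | (3) a b x y where "r = flet x * flet y - fsc (ksign a b) * (flet y * flet x) - flet (brk L x y)" "x \<in> hcomp L a" "y \<in> hcomp L b"
    | (4) x where "r = flet x ^ CHAR('k) - flet (pmap L x) - fsc (\<chi> x ^ CHAR('k))" "x \<in> hcomp L 0"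
    unfolding env_rel_def by (elim UnE CollectE exE conjE)
   then show "\<sigma> r \<in> I0"
   proof cases
    case 1
    then show ?thesis using flet_add[of "sp x" "sp y"] by (simp add: \<sigma>_simps sp_add sp_carrier diff_diff_eq)
   next
    case 2
    then show ?thesis using flet_smult[of "sp x" c] by (simp add: \<sigma>_simps sp_smult sp_carrier)
   next
    case 3
    then show ?thesis using flet_brk[OF sp_hcomp[OF 3(2)] sp_hcomp[OF 3(3)]]
     by (simp add: \<sigma>_simps sp_brk)
   next
    case 4
    have "sp y = y" if "y \<in> hcomp L 0" for y
     using sp_hom[OF that] that hc V.smult_one[of y] by (auto simp: sg_def class_ring_simps)
    then show ?thesis using flet_pmap[of x] 4 pmap_even[of x] by (simp add: \<sigma>_simps)
   qed
  qed
 qed (auto simp: \<sigma>_simps fR_0 I_0 fR_add I_add fR_mult I_left I_right \<sigma>_R intro: subsetD[OF I_R])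
 then show "f \<in> I0 ==> \<sigma> f \<in> I0" by blast
qed

lemma \<sigma>_word:
 assumes "list_all2 (\<lambda>x a. x \<in> hcomp L a) w as"
 shows "prod_list (map (\<lambda>x. flet (sp x)) w) - fsc (sg (sum_list as)) * prod_list (map flet w) \<in> I0"
 using assms
proof (induction rule: list_all2_induct)
 case Nil
 then show ?case by (simp add: sg_def fsc_1 I_0)
next
 case (Cons x w a as)
 let ?p = "prod_list (map (\<lambda>x. flet (sp x)) w)" and ?q = "prod_list (map flet w)"
 have wc: "set w \<subseteq> carrier L"
 proof
  fix v assume "v \<in> set w"
  then obtain i where "i < length w" "v = w ! i" by (auto simp: in_set_conv_nth)
  then have "v \<in> hcomp L (as ! i)" using Cons.hyps(2) by (auto simp: list_all2_conv_all_nth)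
  then show "v \<in> carrier L" using hc by blast
 qed
 have pR: "?p \<in> RL" using wc by (intro R_prod_list) (auto intro: fR_flet sp_carrier)
 have x: "x \<in> carrier L" using Cons.hyps hc by auto
 have "flet (sp x) - fsc (sg a) * flet x \<in> I0" using flet_smult[OF x, of "sg a"] Cons.hyps by (simp add: sp_hom)
 then have 1: "(flet (sp x) - fsc (sg a) * flet x) * ?p \<in> I0" using pR by (rule I_right)
 have 2: "fsc (sg a) * flet x * (?p - fsc (sg (sum_list as)) * ?q) \<in> I0"
  using Cons.IH x by (intro I_left R_mult fR_fsc fR_flet)
 have "fsc (sg (a + sum_list as)) * (flet x * ?q) = fsc (sg a) * flet x * (fsc (sg (sum_list as)) * ?q)"
  unfolding sg_add fsc_mult by (simp add: mult.assoc sc_left_commute[of "flet x"])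
 then have "prod_list (map (\<lambda>x. flet (sp x)) (x # w)) - fsc (sg (sum_list (a # as))) * prod_list (map flet (x # w))
  = (flet (sp x) - fsc (sg a) * flet x) * ?p + fsc (sg a) * flet x * (?p - fsc (sg (sum_list as)) * ?q)"
  by (simp add: left_diff_distrib right_diff_distrib)
 then show ?case using I_add[OF 1 2] by (simp only:)
qed

text \<open>Homogeneous elements are eigenvectors of \<sigma> only in the quotient: in the free
  algebra the letter \<open>sp x\<close> is unrelated to the letter \<open>x\<close>, and
  \<open>flet_smult\<close> has to link the two.\<close>

lemma \<sigma>_fRh: "f \<in> fRh L i ==> \<sigma> f - fsc (sg i) * f \<in> I0"
proof -
 assume "f \<in> fRh L i"
 then have "\<forall>w\<in>Poly_Mapping.keys f. word_parity L (letters w) i" by (simp add: fRh_def)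
 then show ?thesis
 proof (induction f rule: keys_induct)
  case zero
  then show ?case by (simp add: \<sigma>_simps I_0)
 next
  case (single w c)
  then obtain as where "list_all2 (\<lambda>x a. x \<in> hcomp L a) w as" "sum_list as = i" by (auto simp: word_parity_def)
  from I_left[OF fR_fsc[of c] \<sigma>_word[OF this(1)]] this(2) show ?case
   unfolding \<sigma>_def \<sigma>.feval_single unfolding single_FW
   by (simp add: right_diff_distrib sc_left_commute[of "fsc (sg i)"])
 next
  case (add f g)
  from I_add[OF this] show ?case by (simp add: \<sigma>_simps distrib_left algebra_simps)
 qed
qed

lemma fRh_R: "fRh L i \<subseteq> RL" by (auto simp: fRh_def)
lemma fRh_add: "f \<in> fRh L i ==> g \<in> fRh L i ==> f + g \<in> fRh L i"
 using Poly_Mapping.keys_add[of f g] by (auto simp: fRh_def fR_add)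
lemma fRh_mult: "f \<in> fRh L i ==> g \<in> fRh L j ==> f * g \<in> fRh L (i + j)"
proof -
 assume f: "f \<in> fRh L i" and g: "g \<in> fRh L j"
 have "word_parity L (letters w) (i + j)" if "w \<in> Poly_Mapping.keys (f * g)" for w
 proof -
  from that obtain u v where "u \<in> Poly_Mapping.keys f" "v \<in> Poly_Mapping.keys g" "w = u + v"
   using Poly_Mapping.keys_mult[of f g] by blast
  moreover from this obtain as bs where "list_all2 (\<lambda>x a. x \<in> hcomp L a) (letters u) as" "sum_list as = i"
   "list_all2 (\<lambda>x a. x \<in> hcomp L a) (letters v) bs" "sum_list bs = j"
   using f g unfolding fRh_def word_parity_def by blast
  ultimately show ?thesis unfolding word_parity_def
   by (intro exI[of _ "as @ bs"]) (simp only: plus_fword_def fword.sel list_all2_appendI sum_list_append simp_thms)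
 qed
 then show ?thesis using f g by (simp add: fRh_def fR_mult)
qed
lemma fRh_fsc: "fsc c \<in> fRh L 0"
proof -
 have "\<forall>w\<in>Poly_Mapping.keys (fsc c :: ('k, 'g) fa). letters w = []" by (auto simp: fsc_def zero_fword_def)
 then show ?thesis using fR_fsc[of c "carrier L"] by (auto simp: fRh_def word_parity_def)
qed
lemma fRh_flet: "x \<in> hcomp L a ==> flet x \<in> fRh L a"
 using hc by (auto simp: fRh_def flet_def fR_def word_parity_def intro!: exI[of _ "[a]"])

text \<open>The decomposition exists only modulo the ideal: an inhomogeneous element of the Lie
  superalgebra is a free letter of its own and splits into its parts through
  \<open>flet_add\<close>.\<close>

lemma fRh_decomp: "f \<in> RL ==> \<exists>y\<in>fRh L 0. \<exists>z\<in>fRh L 1. f - (y + z) \<in> I0"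
proof -
 define D where "D f \<longleftrightarrow> (\<exists>y\<in>fRh L 0. \<exists>z\<in>fRh L 1. f - (y + z) \<in> I0)" for f
 have D_add: "D (f + g)" if f: "D f" and g: "D g" for f g
 proof -
  from f g obtain y z y' z' where *: "y \<in> fRh L 0" "z \<in> fRh L 1" "f - (y + z) \<in> I0"
   "y' \<in> fRh L 0" "z' \<in> fRh L 1" "g - (y' + z') \<in> I0" unfolding D_def by blast
  have "f + g - ((y + y') + (z + z')) = (f - (y + z)) + (g - (y' + z'))" by simp
  then have "f + g - ((y + y') + (z + z')) \<in> I0" using I_add[OF *(3,6)] by (simp only:)
  then show ?thesis unfolding D_def using * fRh_add by blast
 qed
 have Fh: "D f" if f: "f \<in> fRh L i" for f i
 proof (cases i)
  case zero
  then show ?thesis unfolding D_def using f fRh_fsc[of 0] fRh_mult[OF f fRh_flet] 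
   by (intro bexI[of _ f] bexI[of _ 0]) (auto simp: I_0 fRh_def fR_0)
 next
  case one
  then show ?thesis unfolding D_def using f
   by (intro bexI[of _ 0] bexI[of _ f]) (auto simp: I_0 fRh_def fR_0)
 qed
 have word: "D (prod_list (map flet w))" if "set w \<subseteq> carrier L" for w
  using that
 proof (induction w)
  case Nil
  then show ?case using Fh[OF fRh_fsc[of 1]] by (simp add: fsc_1)
 next
  case (Cons x w)
  let ?q = "prod_list (map flet w)"
  obtain y z where q: "y \<in> fRh L 0" "z \<in> fRh L 1" "?q - (y + z) \<in> I0" using Cons unfolding D_def by auto
  obtain a b where x: "a \<in> hcomp L 0" "b \<in> hcomp L 1" "x = a \<oplus> b" using hcomp_split Cons.prems by (metis list.set_intros(1) subsetD)
  have xc: "x \<in> carrier L" "a \<in> carrier L" "b \<in> carrier L" using x hc Cons.prems by auto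
  have yzR: "y + z \<in> RL" using q fRh_R by (auto intro: fR_add)
  have "flet x - (flet a + flet b) \<in> I0" using flet_add xc x by simp
  then have 1: "(flet x - (flet a + flet b)) * (y + z) \<in> I0" using yzR by (rule I_right)
  have 2: "flet x * (?q - (y + z)) \<in> I0" using q(3) xc by (intro I_left fR_flet)
  have "D (flet a * y + flet b * y + flet a * z + flet b * z)"
   by (intro D_add; rule Fh[OF fRh_mult[OF fRh_flet]]) (use x q in auto)
  then obtain y' z' where yz: "y' \<in> fRh L 0" "z' \<in> fRh L 1"
   "flet a * y + flet b * y + flet a * z + flet b * z - (y' + z') \<in> I0" unfolding D_def by blast
  have "flet x * ?q - (y' + z') = flet x * (?q - (y + z)) + (flet x - (flet a + flet b)) * (y + z)
    + (flet a * y + flet b * y + flet a * z + flet b * z - (y' + z'))"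
   by (simp add: algebra_simps)
  then have "flet x * ?q - (y' + z') \<in> I0" using I_add[OF I_add[OF 2 1] yz(3)] by (simp only:)
  then show ?case unfolding D_def using yz by auto
 qed
 assume "f \<in> RL"
 then have "\<forall>w\<in>Poly_Mapping.keys f. set (letters w) \<subseteq> carrier L" by (simp add: fR_def)
 then have "D f"
 proof (induction f rule: keys_induct)
  case zero
  have "(0::('k,'g) fa) \<in> fRh L 0" by (simp add: fRh_def fR_0)
  then show ?case by (rule Fh)
 next
  case (single w c)
  from word[OF single] obtain y z where *: "y \<in> fRh L 0" "z \<in> fRh L 1" "prod_list (map flet w) - (y + z) \<in> I0" unfolding D_def by blast
  have "fsc c * (prod_list (map flet w) - (y + z)) \<in> I0" using *(3) by (intro I_left fR_fsc)
  then have "fsc c * prod_list (map flet w) - (fsc c * y + fsc c * z) \<in> I0" by (simp add: right_diff_distrib distrib_left)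
  moreover have "fsc c * y \<in> fRh L 0" "fsc c * z \<in> fRh L 1"
   using fRh_mult[OF fRh_fsc *(1)] fRh_mult[OF fRh_fsc *(2)] by (simp_all only: add_0_left)
  ultimately show ?case unfolding D_def single_FW by blast
 next
  case (add f g)
  then show ?case by (rule D_add)
 qed
 then show ?thesis by (simp add: D_def)
qed

end

section \<open>Reduced enveloping algebras of graded Lie superalgebras with dual bases\<close>

lemma commuting_binomial:
 fixes x y :: "'a::ring_1"
 assumes xy: "x * y = y * x"
 shows "(x + y) ^ n = (\<Sum>k\<le>n. of_nat (n choose k) * (x ^ k * y ^ (n - k)))"
proof (induction n)
 case (Suc n)
 let ?t = "\<lambda>n k. of_nat (n choose k) * (x ^ k * y ^ (n - k))"
 have yx: "y * (x ^ k * z) = x ^ k * (y * z)" for k z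
  by (simp only: mult.assoc[symmetric] power_commuting_commutes[OF xy])
 have of: "a * (of_nat m * b) = of_nat m * (a * b)" for a b :: 'a and m
  by (metis mult.assoc mult_of_nat_commute)
 have 1: "x * (\<Sum>k\<le>n. ?t n k) = (\<Sum>k=1..Suc n. of_nat (n choose (k - 1)) * (x ^ k * y ^ (Suc n - k)))"
 proof -
  have "x * (\<Sum>k\<le>n. ?t n k) = (\<Sum>k\<le>n. of_nat (n choose k) * (x ^ Suc k * y ^ (n - k)))"
   by (simp add: sum_distrib_left of mult.assoc)
  also have "\<dots> = (\<Sum>k=1..Suc n. of_nat (n choose (k - 1)) * (x ^ k * y ^ (Suc n - k)))"
   by (rule sum.reindex_bij_witness[of _ "\<lambda>k. k - 1" Suc]) auto
  finally show ?thesis .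
 qed
 have 2: "y * (\<Sum>k\<le>n. ?t n k) = (\<Sum>k\<le>n. of_nat (n choose k) * (x ^ k * y ^ (Suc n - k)))"
  by (simp add: sum_distrib_left of yx Suc_diff_le)
 have ins: "{..m} = insert 0 {1..m}" for m :: nat by auto
 have "(\<Sum>k\<le>Suc n. ?t (Suc n) k) = y ^ Suc n + (\<Sum>k=1..Suc n. ?t (Suc n) k)"
  unfolding ins[of "Suc n"] by (subst sum.insert) simp_all
 also have "(\<Sum>k=1..Suc n. ?t (Suc n) k)
   = (\<Sum>k=1..Suc n. of_nat (n choose k) * (x ^ k * y ^ (Suc n - k)))
    + (\<Sum>k=1..Suc n. of_nat (n choose (k - 1)) * (x ^ k * y ^ (Suc n - k)))"
  unfolding sum.distrib[symmetric]
 proof (rule sum.cong[OF refl])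
  fix k assume "k \<in> {1..Suc n}"
  then obtain j where "k = Suc j" by (cases k) auto
  then show "?t (Suc n) k = of_nat (n choose k) * (x ^ k * y ^ (Suc n - k)) + of_nat (n choose (k - 1)) * (x ^ k * y ^ (Suc n - k))"
   by (simp add: distrib_right[symmetric] add.commute)
 qed
 also have "y ^ Suc n + ((\<Sum>k=1..Suc n. of_nat (n choose k) * (x ^ k * y ^ (Suc n - k))) + z)
   = (\<Sum>k\<le>n. of_nat (n choose k) * (x ^ k * y ^ (Suc n - k))) + z" for z
 proof -
  have "(\<Sum>k\<le>n. of_nat (n choose k) * (x ^ k * y ^ (Suc n - k))) = (\<Sum>k\<le>Suc n. of_nat (n choose k) * (x ^ k * y ^ (Suc n - k)))"
   by (simp add: binomial_eq_0)
  also have "\<dots> = y ^ Suc n + (\<Sum>k=1..Suc n. of_nat (n choose k) * (x ^ k * y ^ (Suc n - k)))"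
   unfolding ins[of "Suc n"] by (subst sum.insert) simp_all
  finally show ?thesis by simp
 qed
 finally show ?case using 1 2 Suc by (simp add: distrib_right)
qed simp

text \<open>Frobenius: \<open>fsc c\<close> is central and the middle binomial coefficients vanish
  in the field. It identifies the p-th power of an even \<open>\<zeta> i\<close> with the image of
  \<open>z i\<close> under the p-map, up to the reduction relation.\<close>

lemma diff_fsc_power_CHAR:
 fixes x :: "('k::field, 'g) fa"
 assumes p: "prime CHAR('k)"
 shows "(x - fsc c) ^ CHAR('k) = x ^ CHAR('k) - fsc (c ^ CHAR('k))"
proof -
 let ?p = "CHAR('k)"
 interpret quotient_algebra fsc UNIV "{0} :: ('k, 'g) fa set"
  by unfold_locales (auto simp: fsc_add fsc_mult fsc_1 intro: fsc_commute)
 have on: "(of_nat m :: ('k, 'g) fa) = fsc (of_nat m)" for m by (simp add: sc_of_nat)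
 have zero: "(of_nat (?p choose k) :: ('k, 'g) fa) = 0" if "0 < k" "k < ?p" for k
 proof -
  have "?p dvd (?p choose k)" using p that by (intro dvd_choose_prime) auto
  then have "(of_nat (?p choose k) :: 'k) = 0" by (simp add: of_nat_eq_0_iff_char_dvd)
  then show ?thesis unfolding on by (simp add: sc_0)
 qed
 let ?y = "fsc (- c)"
 have p0: "0 < ?p" using p prime_gt_0_nat by blast
 have "(x + ?y) ^ ?p = (\<Sum>k\<le>?p. of_nat (?p choose k) * (x ^ k * ?y ^ (?p - k)))"
  by (rule commuting_binomial) (simp add: fsc_commute)
 also have "\<dots> = (\<Sum>k\<in>{0, ?p}. of_nat (?p choose k) * (x ^ k * ?y ^ (?p - k)))"
  by (intro sum.mono_neutral_right) (auto simp: zero)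
 also have "\<dots> = ?y ^ ?p + x ^ ?p" using p0 by simp
 finally have 1: "(x + ?y) ^ ?p = ?y ^ ?p + x ^ ?p" .
 have pw: "fsc a ^ n = fsc (a ^ n)" for a :: 'k and n by (induction n) (auto simp: fsc_1 fsc_mult)
 have neg: "(- c) ^ ?p = - (c ^ ?p)"
 proof (cases "?p = 2")
  case True
  then have "(2 :: 'k) = 0" using of_nat_CHAR[where 'a = 'k] by simp
  then have "a = - a" for a :: 'k by (metis add_eq_0_iff mult_2 mult_zero_left)
  then show ?thesis using True by (metis power2_minus)
 next
  case False
  then have "odd ?p" using p prime_odd_nat prime_ge_2_nat[OF p] by force
  then show ?thesis by simp
 qed
 show ?thesis using 1 unfolding pw neg by (simp add: sc_minus)
qed

text \<open>The Lie-theoretic input of the associative argument. By \<open>S_gen\<close> and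
  \<open>z_u\<close> the \<open>z i\<close> form a homogeneous basis of \<open>S\<close>, listed by
  decreasing depth \<open>d\<close>; \<open>z_pmap\<close> says that the p-map multiplies the depth
  by at least p.\<close>

locale good_grading = super_env_algebra L \<chi> for L :: "('k::field, 'g) lie_superalg" (structure) and \<chi> +
 fixes gr :: "int => 'g set" and S :: "'g set" and z u :: "nat => 'g" and d :: "nat => nat"
  and par :: "nat => bit" and s :: nat
 assumes prime_CHAR: "prime CHAR('k)"
  and gr_brk: "[|x \<in> gr k; y \<in> gr l|] ==> brk L x y \<in> gr (k + l)"
  and chi_add: "[|x \<in> carrier L; y \<in> carrier L|] ==> \<chi> (x \<oplus> y) = \<chi> x + \<chi> y"
  and chi_smult: "x \<in> carrier L ==> \<chi> (c \<odot> x) = c * \<chi> x"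
  and chi_gr: "[|x \<in> gr k; k \<noteq> - 2|] ==> \<chi> x = 0" and chi_odd: "x \<in> hcomp L 1 ==> \<chi> x = 0"
  and S_sub: "ksubspace S L" and S_low: "k \<le> - 2 ==> gr k \<subseteq> S"
  and S_brk: "[|x \<in> S; y \<in> S; x \<in> hcomp L a; y \<in> hcomp L b|] ==> brk L x y \<in> S \<and> \<chi> (brk L x y) = 0"
  and S_pmap: "[|x \<in> S; x \<in> hcomp L 0|] ==> pmap L x \<in> S \<and> \<chi> (pmap L x) = 0"
  and z_S: "i < s ==> z i \<in> S" and z_gr: "i < s ==> z i \<in> gr (- int (d i))"
  and z_par: "i < s ==> z i \<in> hcomp L (par i)" and d1: "i < s ==> 1 \<le> d i"
  and d_mono: "[|i \<le> j; j < s|] ==> d j \<le> d i"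
  and S_gen: "S \<subseteq> kspan L (z ` {..<s})"
  and gr_gen: "[|x \<in> S; x \<in> gr k|] ==> x \<in> kspan L (z ` {l. l < s \<and> int (d l) = - k})"
  and z_pmap: "[|i < s; par i = 0|] ==> pmap L (z i) \<in> kspan L (z ` {l. l < s \<and> CHAR('k) * d i \<le> d l})"
  and u_gr: "i < s ==> u i \<in> gr (int (d i) - 2)" and u_par: "i < s ==> u i \<in> hcomp L (par i)"
  and z_u: "[|i < s; j < s|] ==> \<chi> (brk L (z i) (u j)) = (if i = j then 1 else 0)"
begin

abbreviation "M \<equiv> sub_lie L S"
abbreviation "IS \<equiv> env_I M \<chi>"
lemmas S_D = ksubspaceD[OF S_sub]

lemma M_simps: "carrier M = S" "add M = add L" "smult M = smult L" "brk M = brk L" "pmap M = pmap L"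
  "hcomp M a = hcomp L a \<inter> S" "ring.zero M = ring.zero L"
 by (simp_all add: sub_lie_def)

sublocale M: env_algebra M \<chi>
 by standard (use S_brk S_pmap in \<open>auto simp: M_simps S_D(3,4)\<close>)

lemma IS_I0: "IS \<subseteq> I0"
proof -
 have sub: "fR S \<subseteq> RL" using S_D(1) by (auto intro: fR_mono)
 have "IS \<subseteq> {f \<in> fR S. f \<in> I0}"
 proof (rule M.env_I_minimal)
  have "env_rel M \<chi> \<subseteq> env_rel L \<chi>"
   unfolding env_rel_def M_simps using S_D(1) by (intro Un_mono) blast+
  then show "env_rel M \<chi> \<subseteq> {f \<in> fR S. f \<in> I0}" using env_rel_I M.env_rel_R by (auto simp: M_simps)
 qed (use sub in \<open>auto simp: M_simps I_0 I_add I_left I_right fR_0 fR_add fR_mult\<close>)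
 then show ?thesis by blast
qed

definition \<zeta> :: "nat => ('k, 'g) fa" where "\<zeta> i = flet (z i) - fsc (\<chi> (z i))"

text \<open>Subtracting the \<chi>-value from a letter is a linear operation modulo
  \<open>IS\<close>, so it carries spans of the \<open>z i\<close> to spans of the
  \<open>\<zeta> i\<close>.\<close>

lemma zeta_span:
 assumes X: "X \<subseteq> {..<s}" and y: "y \<in> kspan L (z ` X)"
 shows "flet y - fsc (\<chi> y) \<in> lspan fsc IS (\<zeta> ` X)"
proof -
 let ?W = "{y \<in> S. flet y - fsc (\<chi> y) \<in> lspan fsc IS (\<zeta> ` X)}"
 have cl: "x \<in> carrier L" if "x \<in> S" for x using that S_D(1) by blast
 have add: "x \<oplus> y \<in> ?W" if "x \<in> ?W" "y \<in> ?W" for x y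
 proof -
  have "flet (x \<oplus> y) - (flet x + flet y) \<in> IS" using M.flet_add[of x y] that by (simp add: M_simps)
  from lspan.add[OF lspan.base[OF this] lspan.add] that
  have "(flet (x \<oplus> y) - (flet x + flet y)) + ((flet x - fsc (\<chi> x)) + (flet y - fsc (\<chi> y))) \<in> lspan fsc IS (\<zeta> ` X)"
   by blast
  also have "(flet (x \<oplus> y) - (flet x + flet y)) + ((flet x - fsc (\<chi> x)) + (flet y - fsc (\<chi> y)))
   = flet (x \<oplus> y) - fsc (\<chi> (x \<oplus> y))" using that by (simp add: chi_add cl fsc_add)
  finally show ?thesis using that S_D(3) by blast
 qed
 have smult: "c \<odot> x \<in> ?W" if "x \<in> ?W" for c x
 proof -
  have "flet (c \<odot> x) - fsc c * flet x \<in> IS" using M.flet_smult[of x c] that by (simp add: M_simps)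
  from lspan.add[OF lspan.base[OF this] lspan.scale] that
  have "(flet (c \<odot> x) - fsc c * flet x) + fsc c * (flet x - fsc (\<chi> x)) \<in> lspan fsc IS (\<zeta> ` X)"
   by blast
  also have "(flet (c \<odot> x) - fsc c * flet x) + fsc c * (flet x - fsc (\<chi> x)) = flet (c \<odot> x) - fsc (\<chi> (c \<odot> x))"
   using that by (simp add: chi_smult cl fsc_mult right_diff_distrib)
  finally show ?thesis using that S_D(4) by blast
 qed
 have gen: "z ` X \<subseteq> ?W" using X z_S by (auto simp: \<zeta>_def[symmetric] intro!: lspan.gen)
 have zero: "\<zero> \<in> ?W"
 proof -
  have "flet (0 \<odot> \<zero>) - fsc 0 * flet \<zero> \<in> IS" using M.flet_smult[of "\<zero>" 0] S_D(2) by (simp add: M_simps)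
  moreover have "0 \<odot> \<zero> = \<zero>" using V.smult_r_null[of 0] by (simp add: class_ring_simps)
  moreover have "\<chi> \<zero> = 0" using chi_smult[of "\<zero>" 0] calculation(2) by simp
  ultimately show ?thesis using S_D(2) by (auto simp: sc_0 intro: lspan.base)
 qed
 have "submodule class_ring ?W L"
  by (rule submodule.intro) (use V.module_axioms S_D(1) add smult zero in \<open>auto simp: class_ring_simps\<close>)
 from V.span_is_subset[OF gen this] y show ?thesis by blast
qed

definition bd :: "nat => nat" where "bd i = (if par i = 0 then CHAR('k) else 2)"

lemma zeta_R: "i < s ==> \<zeta> i \<in> fR S" unfolding \<zeta>_def by (intro fR_diff fR_flet fR_fsc z_S)

lemma chi_z_odd: "i < s ==> par i = 1 ==> \<chi> (z i) = 0" using z_par chi_odd by metis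

lemma swap_S: "i < s ==> j < s ==> \<zeta> i * \<zeta> j - fsc (ksign (par i) (par j)) * (\<zeta> j * \<zeta> i) - flet (brk L (z i) (z j)) \<in> IS"
proof -
 assume i: "i < s" and j: "j < s"
 let ?k = "fsc (ksign (par i) (par j)) :: ('k, 'g) fa"
 have "flet (z i) * flet (z j) - ?k * (flet (z j) * flet (z i)) - flet (brk L (z i) (z j)) \<in> IS"
  using M.flet_brk[of "z i" "par i" "z j" "par j"] i j z_S z_par by (simp add: M_simps)
 moreover have "\<zeta> i * \<zeta> j - ?k * (\<zeta> j * \<zeta> i) = flet (z i) * flet (z j) - ?k * (flet (z j) * flet (z i))"
 \<comment> \<open>If both are odd, the \<chi>-values vanish. Otherwise the sign is 1, and the
   central scalars cancel in the commutator.\<close>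
 proof (cases "par i = 1 \<and> par j = 1")
  case True
  then show ?thesis using i j by (simp add: \<zeta>_def chi_z_odd sc_0)
 next
  case False
  then have k: "?k = 1" by (auto simp: ksign_def fsc_1)
  show ?thesis unfolding k \<zeta>_def
   using fsc_commute[of "\<chi> (z i)" "flet (z j)"] fsc_commute[of "\<chi> (z j)" "flet (z i)"]
    fsc_commute[of "\<chi> (z i)" "fsc (\<chi> (z j))"]
   by (simp only: mult_1 left_diff_distrib right_diff_distrib) simp
 qed
 ultimately show ?thesis by simp
qed

lemma br_z:
 assumes i: "i < s" and j: "j < s"
 shows "flet (brk L (z i) (z j)) \<in> lspan fsc IS (\<zeta> ` {l. l < s \<and> d i + d j \<le> d l})"
proof -
 let ?b = "brk L (z i) (z j)"
 have S: "?b \<in> S" "\<chi> ?b = 0" using S_brk i j z_S z_par by blast+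
 have "?b \<in> gr (- int (d i) + - int (d j))" using gr_brk z_gr i j by blast
 from gr_gen[OF S(1) this]
 have "flet ?b - fsc (\<chi> ?b) \<in> lspan fsc IS (\<zeta> ` {l. l < s \<and> int (d l) = - (- int (d i) + - int (d j))})"
  by (intro zeta_span) auto
 then show ?thesis using S(2) by (auto simp: sc_0 elim!: lspan_mono)
qed

text \<open>Straightening is set up inside the subalgebra, modulo its own ideal \<open>IS\<close>,
  because the dimension to be counted is that of its reduced enveloping algebra. The interpretation
  \<open>W\<close> reuses the same relations over \<open>L\<close> by means of
  \<open>lspan_I0\<close>.\<close>

sublocale P: pbw fsc "fR S" IS \<zeta> d bd "\<lambda>i j. ksign (par i) (par j)" s
proof -
 show "pbw fsc (fR S) IS \<zeta> d bd (\<lambda>i j. ksign (par i) (par j)) s"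
 proof (intro pbw.intro pbw_axioms.intro)
  show "quotient_algebra fsc (fR S) IS" using M.quotient_algebra_axioms by (simp add: M_simps)
 next
  fix i assume i: "i < s"
  show "\<zeta> i \<in> fR S" using i by (rule zeta_R)
  show "1 \<le> d i" using i by (rule d1)
  show "2 \<le> bd i" using prime_ge_2_nat[OF prime_CHAR] by (simp add: bd_def)
  show "\<zeta> i * \<zeta> j - fsc (ksign (par i) (par j)) * (\<zeta> j * \<zeta> i) \<in> lspan fsc IS (\<zeta> ` {l. l < s \<and> d i + d j \<le> d l})"
   if "j < s" for j
   using lspan.base[OF swap_S[OF i that]] br_z[OF i that] lspan_cancel by blast
  show "\<zeta> i ^ bd i \<in> lspan fsc IS (\<zeta> ` {l. l < s \<and> bd i * d i \<le> d l})"
  proof (cases "par i = 0")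
   case True
   let ?p = "CHAR('k)" and ?y = "pmap L (z i)"
   have "flet (z i) ^ ?p - flet ?y - fsc (\<chi> (z i) ^ ?p) \<in> IS"
    using M.flet_pmap[of "z i"] z_S[OF i] z_par[OF i] True by (simp add: M_simps)
   \<comment> \<open>The constant in the reduction relation cancels against the one from the
     Frobenius expansion, so that only the image under \<open>pmap\<close> remains.\<close>
   then have 1: "\<zeta> i ^ ?p - flet ?y \<in> IS"
    unfolding \<zeta>_def diff_fsc_power_CHAR[OF prime_CHAR] by (simp add: algebra_simps)
   have "flet ?y - fsc (\<chi> ?y) \<in> lspan fsc IS (\<zeta> ` {l. l < s \<and> ?p * d i \<le> d l})"
    using z_pmap[OF i True] by (intro zeta_span) auto
   moreover have "\<chi> ?y = 0" using S_pmap[OF z_S[OF i]] z_par[OF i] True by simp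
   ultimately have "flet ?y \<in> lspan fsc IS (\<zeta> ` {l. l < s \<and> ?p * d i \<le> d l})" by (simp add: sc_0)
   then show ?thesis using lspan_cancel[OF lspan.base[OF 1]] True by (simp add: bd_def)
  next
   case False
   then have odd: "par i = 1" by (cases "par i") auto
   let ?b = "flet (brk L (z i) (z i))"
   \<comment> \<open>The supercommutator of an odd \<open>\<zeta> i\<close> with itself is twice its
     square, so the square is half a bracket.\<close>
   have "\<zeta> i * \<zeta> i - fsc (- 1) * (\<zeta> i * \<zeta> i) - ?b \<in> IS" using swap_S[OF i i] odd by (simp add: ksign_def)
   then have "fsc (1 / 2) * (\<zeta> i * \<zeta> i - fsc (- 1) * (\<zeta> i * \<zeta> i) - ?b) \<in> IS" by (intro M.I_left fR_fsc)
   moreover have "fsc (1 / 2) * (\<zeta> i * \<zeta> i - fsc (- 1) * (\<zeta> i * \<zeta> i) - ?b) = \<zeta> i ^ 2 - fsc (1 / 2) * ?b"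
   proof -
    have "\<zeta> i * \<zeta> i - fsc (- 1) * (\<zeta> i * \<zeta> i) = fsc 2 * \<zeta> i ^ 2"
     by (simp add: sc_minus1 power2_eq_square fsc_add[of 1 1, simplified] fsc_1 distrib_right mult_2)
    then show ?thesis using two by (simp add: right_diff_distrib mult.assoc[symmetric] fsc_mult[symmetric] fsc_1)
   qed
   ultimately have "\<zeta> i ^ 2 - fsc (1 / 2) * ?b \<in> IS" by simp
   from lspan_cancel[OF lspan.base[OF this] lspan.scale[OF br_z[OF i i]]]
   have "\<zeta> i ^ 2 \<in> lspan fsc IS (\<zeta> ` {l. l < s \<and> d i + d i \<le> d l})" .
   then show ?thesis using odd by (simp add: bd_def mult_2)
  qed
 qed (rule d_mono)
qed

lemma lspan_I0: "x \<in> lspan fsc IS G ==> x \<in> lspan fsc I0 G"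
 by (induction rule: lspan.induct) (use IS_I0 in \<open>auto intro: lspan.intros\<close>)

text \<open>Exponents stay below p for both parities, since the bound 2 in the odd case is smaller
  than p.\<close>

lemma fact_CHAR: "n < bd i ==> (of_nat (fact n) :: 'k) \<noteq> 0"
proof
 assume n: "n < bd i" and "(of_nat (fact n) :: 'k) = 0"
 then have "CHAR('k) dvd fact n" by (simp only: of_nat_eq_0_iff_char_dvd)
 then have le: "CHAR('k) \<le> n" using prime_dvd_fact_iff[OF prime_CHAR] by simp
 have "CHAR('k) \<noteq> 2" using two of_nat_CHAR[where 'a = 'k] by (metis of_nat_numeral)
 then have "2 < CHAR('k)" using prime_ge_2_nat[OF prime_CHAR] by simp
 then show False using n le by (auto simp: bd_def split: if_splits)
qed

sublocale W: whittaker fsc RL I0 \<zeta> d bd "\<lambda>i j. ksign (par i) (par j)" s "\<lambda>k a. gr k \<inter> hcomp L a" flet "brk L" \<chi> z u par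
proof
 fix i assume i: "i < s"
 show "\<zeta> i \<in> RL" using zeta_R[OF i] S_D(1) fR_mono by blast
 show "1 \<le> d i" using i by (rule d1)
 show "2 \<le> bd i" using P.bd_ge[OF i] .
 show "\<zeta> i ^ bd i \<in> lspan fsc I0 (\<zeta> ` {l. l < s \<and> bd i * d i \<le> d l})" by (rule lspan_I0[OF P.pow[OF i]])
 show "z i \<in> gr (- int (d i)) \<inter> hcomp L (par i)" using z_gr[OF i] z_par[OF i] by blast
 show "\<zeta> i = flet (z i) - fsc (\<chi> (z i))" by (rule \<zeta>_def)
 show "u i \<in> gr (int (d i) - 2) \<inter> hcomp L (par i)" using u_gr[OF i] u_par[OF i] by blast
 show "bd i = 2" if "par i = 1" using that by (simp add: bd_def)
 show "(of_nat (fact n) :: 'k) \<noteq> 0" if "n < bd i" for n using that by (rule fact_CHAR)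
 fix j assume j: "j < s"
 show "\<zeta> i * \<zeta> j - fsc (ksign (par i) (par j)) * (\<zeta> j * \<zeta> i) \<in> lspan fsc I0 (\<zeta> ` {l. l < s \<and> d i + d j \<le> d l})"
  by (rule lspan_I0[OF P.swap[OF i j]])
 show "\<chi> (brk L (z i) (u j)) = (if i = j then 1 else 0)" using i j by (rule z_u)
next
 show "d j \<le> d i" if "i \<le> j" "j < s" for i j using that by (rule d_mono)
 fix x y :: 'g and k l a b
 show "flet y \<in> RL" if "y \<in> gr k \<inter> hcomp L a" using that hc by (auto intro: fR_flet)
 show "flet y - fsc (\<chi> y) \<in> lspan fsc I0 (\<zeta> ` {l. l < s \<and> int (d l) = - k})" if "y \<in> gr k \<inter> hcomp L a" "k \<le> - 2"
  using gr_gen[of y k] S_low[of k] that by (intro lspan_I0 zeta_span) auto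
 show "k = - 2 \<and> a = 0" if "y \<in> gr k \<inter> hcomp L a" "\<chi> y \<noteq> 0"
  using that chi_gr[of y k] chi_odd[of y] by (cases a) auto
 assume *: "x \<in> gr k \<inter> hcomp L a" "y \<in> gr l \<inter> hcomp L b"
 show "brk L x y \<in> gr (k + l) \<inter> hcomp L (a + b)" using * gr_brk brk_hcomp by blast
 show "flet x * flet y - fsc (ksign a b) * (flet y * flet x) - flet (brk L x y) \<in> I0" using * by (intro flet_brk) auto
qed

end

lemma (in env_algebra) env_cls_set: "f \<in> RL ==> cls f = (\<lambda>i. fn (i + f)) ` I0"
 unfolding env_cls_def a_r_coset_def' env_ideal_fn by (auto simp: free_algebra_simps)

context good_grading begin

abbreviation "clsM \<equiv> env_cls M \<chi>"
abbreviation "ev \<equiv> feval (\<lambda>c. c) \<chi>"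

sublocale evh: fa_hom "\<lambda>c::'k. c" \<chi> by (rule fa_hom_id)

lemma fRS_RL: "f \<in> fR S ==> f \<in> RL" using S_D(1) fR_mono by blast

text \<open>The union in \<open>env_incl\<close> runs over a whole coset of \<open>IS\<close>; as
  \<open>IS\<close> is contained in \<open>I0\<close>, all its members have the same class in the
  large algebra.\<close>

lemma env_incl_cls: "f \<in> fR S ==> env_incl L \<chi> (clsM f) = cls f"
proof -
 assume f: "f \<in> fR S"
 have "clsM f = (\<lambda>i. fn (i + f)) ` IS" using f by (intro M.env_cls_set) (simp add: M_simps)
 then have "env_incl L \<chi> (clsM f) = (\<Union>i\<in>IS. cls (i + f))" by (simp add: env_incl_def env_cls_def)
 also have "\<dots> = (\<Union>i\<in>IS. cls f)"
 proof (rule SUP_cong[OF refl])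
  fix i assume "i \<in> IS"
  then have "i \<in> I0" using IS_I0 by blast
  then show "cls (i + f) = cls f" using fRS_RL[OF f] subsetD[OF I_R] by (subst cls_eq) (auto intro: fR_add)
 qed
 also have "\<dots> = cls f" using M.I_0 by blast
 finally show ?thesis .
qed

text \<open>\<chi> is a character of the subalgebra: by \<open>S_brk\<close> and
  \<open>S_pmap\<close> it vanishes on brackets and on values of the p-map, so evaluation respects
  all relations. Hence the choice of a representative in \<open>char_module\<close> is
  harmless.\<close>

lemma ev_IS: "f \<in> IS ==> ev f = 0"
proof -
 have cl: "x \<in> carrier L" if "x \<in> S" for x using that S_D(1) by blast
 have "IS \<subseteq> {f \<in> fR S. ev f = 0}"
 proof (rule M.env_I_minimal)
  show "env_rel M \<chi> \<subseteq> {f \<in> fR S. ev f = 0}"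
  proof (intro subsetI CollectI conjI)
   fix r assume r: "r \<in> env_rel M \<chi>"
   then show "r \<in> fR S" using M.env_rel_R by (auto simp: M_simps)
   from r consider (1) x y where "r = flet (x \<oplus> y) - flet x - flet y" "x \<in> S" "y \<in> S"
    | (2) c x where "r = flet (c \<odot> x) - fsc c * flet x" "x \<in> S"
    | (3) a b x y where "r = flet x * flet y - fsc (ksign a b) * (flet y * flet x) - flet (brk L x y)"
      "x \<in> hcomp L a" "y \<in> hcomp L b" "x \<in> S" "y \<in> S"
    | (4) x where "r = flet x ^ CHAR('k) - flet (pmap L x) - fsc (\<chi> x ^ CHAR('k))" "x \<in> hcomp L 0" "x \<in> S"
    unfolding env_rel_def M_simps by (elim UnE CollectE exE conjE IntE)
   then show "ev r = 0"
   proof cases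
    case 1
    then show ?thesis by (simp add: evh.feval_diff evh.feval_flet chi_add cl)
   next
    case 2
    then show ?thesis by (simp add: evh.feval_diff evh.feval_flet evh.feval_mult evh.feval_fsc chi_smult cl)
   next
    case 3
    have "\<chi> x * \<chi> y = ksign a b * (\<chi> y * \<chi> x)"
     using chi_odd[of x] chi_odd[of y] 3 by (cases a; cases b) (auto simp: ksign_def)
    then show ?thesis using 3 S_brk[of x y a b]
     by (simp add: evh.feval_diff evh.feval_flet evh.feval_mult evh.feval_fsc)
   next
    case 4
    then show ?thesis using S_pmap[of x] by (simp add: evh.feval_diff evh.feval_flet evh.feval_power evh.feval_fsc)
   qed
  qed
 qed (auto simp: M_simps fR_0 evh.feval_0 fR_add evh.feval_add fR_mult evh.feval_mult)
 then show "f \<in> IS ==> ev f = 0" by blast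
qed

abbreviation "KM \<equiv> char_module \<chi> :: (('g list => 'k) set, 'k) graded_module"

lemma KM_simps: "carrier KM = UNIV" "x \<oplus>\<^bsub>KM\<^esub> y = x + y" "hcomp KM 0 = UNIV" "hcomp KM 1 = {0}"
 by (simp_all add: char_module_def)

lemma KM_smult: "b \<in> fR S ==> clsM b \<odot>\<^bsub>KM\<^esub> n = ev b * n"
proof -
 assume b: "b \<in> fR S"
 have c: "clsM b = (\<lambda>i. fn (i + b)) ` IS" using b by (intro M.env_cls_set) (simp add: M_simps)
 have "\<exists>f. f \<in> clsM b" using c M.I_0 by blast
 then have "(SOME f. f \<in> clsM b) \<in> clsM b" by (rule someI_ex)
 then obtain i where "i \<in> IS" "(SOME f. f \<in> clsM b) = fn (i + b)" using c by auto
 then show ?thesis by (simp add: char_module_def word_eval_fn evh.feval_add ev_IS)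
qed

subsection \<open>An even generator of the Whittaker module\<close>

lemma \<sigma>_zeta: "i < s ==> \<sigma> (\<zeta> i) - fsc (sg (par i)) * \<zeta> i \<in> I0"
proof -
 assume i: "i < s"
 have z: "z i \<in> hcomp L (par i)" using z_par[OF i] .
 have "flet (sp (z i)) - fsc (sg (par i)) * flet (z i) \<in> I0"
  using flet_smult[of "z i" "sg (par i)"] z hc by (auto simp: sp_hom)
 moreover have "fsc (sg (par i)) * fsc (\<chi> (z i)) = (fsc (\<chi> (z i)) :: ('k, 'g) fa)"
  using chi_z_odd[OF i] by (cases "par i") (auto simp: sg_def fsc_1 sc_0)
 ultimately show ?thesis by (simp add: \<zeta>_def \<sigma>_simps right_diff_distrib)
qed

lemma sg_sg: "fsc (sg a) * (fsc (sg a) * x) = (x :: ('k, 'g) fa)" by (cases a) (auto simp: sg_def fsc_1 sc_minus1)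

lemma \<sigma>_J: "x \<in> W.J ==> \<sigma> x \<in> W.J"
proof (induction rule: W.J.induct)
 case (J_I x)
 then show ?case by (intro W.J_I \<sigma>_I)
next
 case (J_gen r i)
 have "\<sigma> r * (\<sigma> (\<zeta> i) - fsc (sg (par i)) * \<zeta> i) \<in> W.J"
  using J_gen by (intro W.J_I I_left \<sigma>_R \<sigma>_zeta)
 moreover have "\<sigma> r * fsc (sg (par i)) * \<zeta> i \<in> W.J" using J_gen by (intro W.J_gen R_mult \<sigma>_R fR_fsc)
 ultimately have "\<sigma> r * (\<sigma> (\<zeta> i) - fsc (sg (par i)) * \<zeta> i) + \<sigma> r * fsc (sg (par i)) * \<zeta> i \<in> W.J" by (rule W.J_add)
 then show ?case by (simp add: \<sigma>_simps right_diff_distrib mult.assoc)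
next
 case (J_add x y)
 then show ?case by (simp add: \<sigma>_simps W.J_add)
qed

lemma \<sigma>_whit: "W.whit r ==> W.whit (\<sigma> r)"
 unfolding W.whit_def
proof (intro conjI allI impI)
 assume r: "r \<in> RL \<and> (\<forall>i<s. \<zeta> i * r \<in> I0)"
 show R: "\<sigma> r \<in> RL" using r \<sigma>_R by blast
 fix i assume i: "i < s"
 have "\<sigma> (\<zeta> i) * \<sigma> r \<in> I0" using \<sigma>_I[of "\<zeta> i * r"] r i by (simp add: \<sigma>_simps)
 moreover have "(\<sigma> (\<zeta> i) - fsc (sg (par i)) * \<zeta> i) * \<sigma> r \<in> I0" using \<sigma>_zeta[OF i] R by (rule I_right)
 ultimately have "\<sigma> (\<zeta> i) * \<sigma> r - (\<sigma> (\<zeta> i) - fsc (sg (par i)) * \<zeta> i) * \<sigma> r \<in> I0" by (rule I_diff)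
 then have "fsc (sg (par i)) * (\<zeta> i * \<sigma> r) \<in> I0" by (simp add: left_diff_distrib mult.assoc)
 from I_left[OF fR_fsc this, of "sg (par i)"] show "\<zeta> i * \<sigma> r \<in> I0" by (simp add: sg_sg)
qed

lemma whit_cong: "W.whit x ==> y \<in> RL ==> y - x \<in> I0 ==> W.whit y"
 unfolding W.whit_def
proof (intro conjI allI impI)
 assume *: "x \<in> RL \<and> (\<forall>i<s. \<zeta> i * x \<in> I0)" "y \<in> RL" "y - x \<in> I0"
 fix i assume i: "i < s"
 have "\<zeta> i * (y - x) \<in> I0" using * W.\<zeta>_R[OF i] by (intro I_left)
 then show "\<zeta> i * y \<in> I0" using * i I_cancel[of "\<zeta> i * y" "\<zeta> i * x"] by (simp add: right_diff_distrib)
qed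

lemma half: "fsc (1 / 2) * (x + x) = (x :: ('k, 'g) fa)"
proof -
 have "fsc (1 / 2) * (x + x) = fsc (1 / 2 + 1 / 2) * x" by (simp only: distrib_left distrib_right fsc_add)
 also have "1 / 2 + 1 / 2 = (1 :: 'k)" using two by (metis add_divide_distrib divide_self one_add_one)
 finally show ?thesis by (simp add: fsc_1)
qed

text \<open>\<sigma> preserves Whittaker vectors and the left ideal, so averaging a generator with
  its image keeps both properties; the average is congruent to the even part
  \<open>y\<close>.\<close>

lemma even_generator: "\<exists>e\<in>fRh L 0. W.whit e \<and> 1 - e \<in> W.J"
proof -
 obtain f where f: "W.whit f" "1 - f \<in> W.J" using W.exists_generator by blast
 then have "f \<in> RL" by (simp add: W.whit_def)
 then obtain y z where yz: "y \<in> fRh L 0" "z \<in> fRh L 1" "f - (y + z) \<in> I0" using fRh_decomp by blast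
 have yR: "y \<in> RL" using yz fRh_R by blast
 have "\<sigma> (f - (y + z)) + (\<sigma> y - fsc (sg 0) * y) + (\<sigma> z - fsc (sg 1) * z) \<in> I0"
  using yz by (intro I_add \<sigma>_I \<sigma>_fRh)
 then have 1: "\<sigma> f - (y - z) \<in> I0" by (simp add: \<sigma>_simps sg_def fsc_1 sc_minus1 algebra_simps)
 have "fsc (1 / 2) * ((f - (y + z)) + (\<sigma> f - (y - z))) \<in> I0" using 1 yz by (intro I_left fR_fsc I_add)
 moreover have "fsc (1 / 2) * ((f - (y + z)) + (\<sigma> f - (y - z))) = fsc (1 / 2) * (f + \<sigma> f) - fsc (1 / 2) * (y + y)"
  by (simp add: right_diff_distrib[symmetric] algebra_simps)
 ultimately have 2: "fsc (1 / 2) * (f + \<sigma> f) - y \<in> I0" by (simp add: half)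
 have "W.whit (fsc (1 / 2) * (f + \<sigma> f))" using f by (intro W.whit_scale W.whit_add \<sigma>_whit)
 then have w: "W.whit y" using yR I_sym[OF 2] by (rule whit_cong)
 have "fsc (1 / 2) * ((1 - f) + \<sigma> (1 - f)) + (fsc (1 / 2) * (f + \<sigma> f) - y) \<in> W.J"
  by (rule W.J_add[OF W.J_left[OF W.J_add[OF f(2) \<sigma>_J[OF f(2)]] fR_fsc] W.J_I[OF 2]])
 moreover have "fsc (1 / 2) * ((1 - f) + \<sigma> (1 - f)) + (fsc (1 / 2) * (f + \<sigma> f) - y) = 1 - y"
 proof -
  have "\<sigma> 1 = 1" using \<sigma>_simps(4)[of 1] by (simp add: fsc_1)
  then have "(1 - f) + \<sigma> (1 - f) = (1 + 1) - (f + \<sigma> f)" by (simp add: \<sigma>_simps)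
  then show ?thesis using half[of 1] by (simp only: right_diff_distrib) simp
 qed
 ultimately show ?thesis using yz w by auto
qed

definition e :: "('k, 'g) fa" where "e = (SOME e. e \<in> fRh L 0 \<and> W.whit e \<and> 1 - e \<in> W.J)"

lemma e: "e \<in> fRh L 0" "W.whit e" "1 - e \<in> W.J"
proof -
 have "\<exists>e. e \<in> fRh L 0 \<and> W.whit e \<and> 1 - e \<in> W.J" using even_generator by blast
 from someI_ex[OF this] show "e \<in> fRh L 0" "W.whit e" "1 - e \<in> W.J" by (auto simp: e_def)
qed

lemma eR: "e \<in> RL" using e fRh_R by blast

text \<open>With \<open>r = e\<close> this is idempotency; with \<open>r\<close> a coefficient from
  \<open>matrix_units\<close> it is the absorption of \<open>e\<close> required by
  \<open>morita\<close>.\<close>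

lemma e_whit: "W.whit r ==> e * r - r \<in> I0"
 using W.J_whit[OF e(3), of r] I_minus[of "(1 - e) * r"] by (simp add: left_diff_distrib)

lemma letter_e: "x \<in> S ==> (flet x - fsc (\<chi> x)) * e \<in> I0"
proof -
 assume "x \<in> S"
 then have "flet x - fsc (\<chi> x) \<in> lspan fsc IS (\<zeta> ` {..<s})" using S_gen by (intro zeta_span) auto
 then have "flet x - fsc (\<chi> x) \<in> lspan fsc I0 (\<zeta> ` {..<s})" by (rule lspan_I0)
 then have "(flet x - fsc (\<chi> x)) * e \<in> lspan fsc I0 {}"
  by (rule lspan_right) (use e(2) eR in \<open>auto simp: W.whit_def intro: lspan.base I_right\<close>)
 then show ?thesis by (rule lspan_empty)
qed

text \<open>The vector \<open>e\<close> spans a copy of the one-dimensional module of \<chi> inside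
  the regular module. This is what makes the map to \<open>U e\<close> in \<open>T_kernel\<close>
  balanced.\<close>

lemma fRS_e: "b \<in> fR S ==> (b - fsc (ev b)) * e \<in> I0"
proof -
 have word: "(prod_list (map flet w) - fsc (prod_list (map \<chi> w))) * e \<in> I0" if "set w \<subseteq> S" for w
  using that
 proof (induction w)
  case Nil
  then show ?case by (simp add: fsc_1 I_0)
 next
  case (Cons x w)
  let ?p = "prod_list (map flet w)" and ?c = "prod_list (map \<chi> w)"
  have "flet x * ((?p - fsc ?c) * e) \<in> I0" using Cons S_D(1) by (intro I_left[OF fR_flet]) auto
  moreover have "fsc ?c * ((flet x - fsc (\<chi> x)) * e) \<in> I0" using Cons.prems by (intro I_left[OF fR_fsc] letter_e) auto
  ultimately have "flet x * ((?p - fsc ?c) * e) + fsc ?c * ((flet x - fsc (\<chi> x)) * e) \<in> I0" by (rule I_add)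
  also have "flet x * ((?p - fsc ?c) * e) + fsc ?c * ((flet x - fsc (\<chi> x)) * e) = (flet x * ?p - fsc (\<chi> x * ?c)) * e"
   using sc_left_commute[of "flet x" ?c e]
   by (simp add: right_diff_distrib left_diff_distrib mult.assoc mult.commute[of "\<chi> x"] fsc_mult)
  finally show ?case by simp
 qed
 assume "b \<in> fR S"
 then have "\<forall>w\<in>Poly_Mapping.keys b. set (letters w) \<subseteq> S" by (simp add: fR_def)
 then show ?thesis
 proof (induction b rule: keys_induct)
  case zero
  then show ?case by (simp add: evh.feval_0 sc_0 I_0)
 next
  case (single w c)
  from I_left[OF fR_fsc word[OF single], of c] show ?case
   unfolding evh.feval_single unfolding single_FW fsc_mult fword.sel
   by (simp add: right_diff_distrib left_diff_distrib mult.assoc)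
 next
  case (add f g)
  from I_add[OF this] show ?case by (simp add: evh.feval_add fsc_add algebra_simps)
 qed
qed

subsection \<open>The induced module\<close>

abbreviation "N \<equiv> reduced_env M \<chi>"
abbreviation "Q \<equiv> Q_module L S \<chi>"
definition "G = free_Abelian_group (carrier U \<times> carrier KM)"
definition "T = generate G (tensor_relations U N (env_incl L \<chi>) KM)"
text \<open>\<open>fr f n\<close> stands for the formal tensor of \<open>f\<close> and
  \<open>n\<close>, and \<open>\<kappa> f\<close> for the tensor of \<open>f\<close> and 1. Every
  tensor takes the latter form, because scalars belong to the subalgebra and can be moved to the
  left factor.\<close>

definition fr :: "('k, 'g) fa => 'k => (('g list => 'k) set \<times> 'k) \<Rightarrow>\<^sub>0 int" where "fr f n = frag_of (cls f, n)"
definition \<kappa> :: "('k, 'g) fa => ((('g list => 'k) set \<times> 'k) \<Rightarrow>\<^sub>0 int) set" where "\<kappa> f = T #>\<^bsub>G\<^esub> fr f 1"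

lemma N_carrier: "carrier N = clsM ` fR S" using M.U_carrier by (simp add: M_simps)

lemma G_simps: "x \<in> carrier G \<longleftrightarrow> Poly_Mapping.keys x \<subseteq> carrier U \<times> UNIV" "x \<otimes>\<^bsub>G\<^esub> y = x + y" "\<one>\<^bsub>G\<^esub> = 0"
 by (auto simp: G_def KM_simps)

lemma group_G: "group G" by (simp add: G_def)

lemma inv_G: "x \<in> carrier G ==> inv\<^bsub>G\<^esub> x = - x" by (simp add: G_def)

lemma G_closed: "0 \<in> carrier G" "x \<in> carrier G ==> y \<in> carrier G ==> x + y \<in> carrier G"
  "x \<in> carrier G ==> - x \<in> carrier G" "x \<in> carrier G ==> y \<in> carrier G ==> x - y \<in> carrier G"
 using Poly_Mapping.keys_add[of x y] keys_diff[of x y] by (auto simp: G_simps)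

lemma fr_G: "f \<in> RL ==> fr f n \<in> carrier G" by (auto simp: fr_def G_simps U_carrier)

lemma rel_cases:
 assumes "r \<in> tensor_relations U N (env_incl L \<chi>) KM"
 obtains (1) f g n where "r = fr (f + g) n - fr f n - fr g n" "f \<in> RL" "g \<in> RL"
  | (2) f n m where "r = fr f (n + m) - fr f n - fr f m" "f \<in> RL"
  | (3) f b n where "r = fr (f * b) n - fr f (ev b * n)" "f \<in> RL" "b \<in> fR S"
 using assms unfolding tensor_relations_def
proof (elim UnE CollectE exE conjE)
 fix a a' n assume *: "r = frag_of (a \<oplus>\<^bsub>U\<^esub> a', n) - frag_of (a, n) - frag_of (a', n)" "a \<in> carrier U" "a' \<in> carrier U"
 then obtain f g where "a = cls f" "a' = cls g" "f \<in> RL" "g \<in> RL" by (auto simp: U_carrier)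
 then show thesis using * 1 by (simp add: U_add fr_def)
next
 fix a n m assume *: "r = frag_of (a, n \<oplus>\<^bsub>KM\<^esub> m) - frag_of (a, n) - frag_of (a, m)" "a \<in> carrier U"
 then obtain f where "a = cls f" "f \<in> RL" by (auto simp: U_carrier)
 then show thesis using * 2 by (simp add: KM_simps fr_def)
next
 fix a b n assume *: "r = frag_of (a \<otimes>\<^bsub>U\<^esub> env_incl L \<chi> b, n) - frag_of (a, b \<odot>\<^bsub>KM\<^esub> n)" "a \<in> carrier U" "b \<in> carrier N"
 then obtain f g where "a = cls f" "f \<in> RL" "b = clsM g" "g \<in> fR S" by (auto simp: U_carrier N_carrier)
 then show thesis using * 3 by (simp add: env_incl_cls U_mult fRS_RL KM_smult fr_def)
qed

lemma rel_intros:
 "f \<in> RL ==> g \<in> RL ==> fr (f + g) n - fr f n - fr g n \<in> T"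
 "f \<in> RL ==> fr f (n + m) - fr f n - fr f m \<in> T"
 "f \<in> RL ==> b \<in> fR S ==> fr (f * b) n - fr f (ev b * n) \<in> T"
proof -
 assume f: "f \<in> RL"
 have cf: "cls f \<in> carrier U" using f by (simp add: U_carrier)
 have kc: "n \<in> carrier KM" for n by (simp add: KM_simps)
 show "fr (f + g) n - fr f n - fr g n \<in> T" if g: "g \<in> RL"
 proof -
  have "cls g \<in> carrier U" using g by (simp add: U_carrier)
  then have "frag_of (cls f \<oplus>\<^bsub>U\<^esub> cls g, n) - frag_of (cls f, n) - frag_of (cls g, n) \<in> tensor_relations U N (env_incl L \<chi>) KM"
   unfolding tensor_relations_def using cf kc by blast
  then show ?thesis using f g by (auto simp: T_def U_add fr_def intro: generate.incl)
 qed
 show "fr f (n + m) - fr f n - fr f m \<in> T"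
 proof -
  have "frag_of (cls f, n \<oplus>\<^bsub>KM\<^esub> m) - frag_of (cls f, n) - frag_of (cls f, m) \<in> tensor_relations U N (env_incl L \<chi>) KM"
   unfolding tensor_relations_def using cf kc by blast
  then show ?thesis by (auto simp: T_def KM_simps fr_def intro: generate.incl)
 qed
 show "fr (f * b) n - fr f (ev b * n) \<in> T" if b: "b \<in> fR S"
 proof -
  have "clsM b \<in> carrier N" using b by (simp add: N_carrier)
  then have "frag_of (cls f \<otimes>\<^bsub>U\<^esub> env_incl L \<chi> (clsM b), n) - frag_of (cls f, clsM b \<odot>\<^bsub>KM\<^esub> n) \<in> tensor_relations U N (env_incl L \<chi>) KM"
   unfolding tensor_relations_def using cf kc by blast
  then show ?thesis using f b by (auto simp: T_def env_incl_cls U_mult fRS_RL KM_smult fr_def intro: generate.incl)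
 qed
qed

lemma rel_G: "tensor_relations U N (env_incl L \<chi>) KM \<subseteq> carrier G"
proof
 fix r assume "r \<in> tensor_relations U N (env_incl L \<chi>) KM"
 then show "r \<in> carrier G"
  by (cases rule: rel_cases) (auto intro!: G_closed fr_G fR_add fR_mult dest: fRS_RL)
qed

lemma T_sub: "subgroup T G" unfolding T_def by (rule group.generate_is_subgroup[OF group_G rel_G])
lemma T_G: "T \<subseteq> carrier G" using subgroup.subset[OF T_sub] .
lemma T_0: "0 \<in> T" using subgroup.one_closed[OF T_sub] by (simp add: G_simps)
lemma T_add: "x \<in> T ==> y \<in> T ==> x + y \<in> T" using subgroup.m_closed[OF T_sub] by (simp add: G_simps)
lemma T_minus: "x \<in> T ==> - x \<in> T"
proof -
 assume x: "x \<in> T"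
 then have "inv\<^bsub>G\<^esub> x = - x" using T_G by (intro inv_G) blast
 then show ?thesis using subgroup.m_inv_closed[OF T_sub x] by simp
qed
lemma T_diff: "x \<in> T ==> y \<in> T ==> x - y \<in> T" using T_add[OF _ T_minus, of x y] by simp

lemma coset_set: "T #>\<^bsub>G\<^esub> x = {t + x | t. t \<in> T}" by (auto simp: r_coset_def G_simps)

lemma coset_eq: "T #>\<^bsub>G\<^esub> x = T #>\<^bsub>G\<^esub> y \<longleftrightarrow> x - y \<in> T"
proof
 assume "T #>\<^bsub>G\<^esub> x = T #>\<^bsub>G\<^esub> y"
 moreover have "x \<in> T #>\<^bsub>G\<^esub> x" unfolding coset_set using T_0 by force
 ultimately show "x - y \<in> T" unfolding coset_set by auto
next
 assume xy: "x - y \<in> T"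
 have "t + x \<in> T #>\<^bsub>G\<^esub> y" if "t \<in> T" for t
  unfolding coset_set using T_add[OF that xy] by (intro CollectI exI[of _ "t + (x - y)"]) simp
 moreover have "t + y \<in> T #>\<^bsub>G\<^esub> x" if "t \<in> T" for t
  unfolding coset_set using T_diff[OF that xy] by (intro CollectI exI[of _ "t - (x - y)"]) simp
 ultimately show "T #>\<^bsub>G\<^esub> x = T #>\<^bsub>G\<^esub> y" unfolding coset_set by blast
qed

lemma coset_mult: "(T #>\<^bsub>G\<^esub> x) <#>\<^bsub>G\<^esub> (T #>\<^bsub>G\<^esub> y) = T #>\<^bsub>G\<^esub> (x + y)"
proof (intro equalityI subsetI)
 fix w assume "w \<in> (T #>\<^bsub>G\<^esub> x) <#>\<^bsub>G\<^esub> (T #>\<^bsub>G\<^esub> y)"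
 then obtain a b where "a \<in> T" "b \<in> T" "w = (a + x) + (b + y)" by (auto simp: set_mult_def coset_set G_simps)
 then show "w \<in> T #>\<^bsub>G\<^esub> (x + y)" unfolding coset_set using T_add by (intro CollectI exI[of _ "a + b"]) auto
next
 fix w assume "w \<in> T #>\<^bsub>G\<^esub> (x + y)"
 then obtain a where "a \<in> T" "w = (a + x) + (0 + y)" by (auto simp: coset_set algebra_simps)
 then show "w \<in> (T #>\<^bsub>G\<^esub> x) <#>\<^bsub>G\<^esub> (T #>\<^bsub>G\<^esub> y)" unfolding set_mult_def coset_set using T_0 by (auto simp: G_simps)
qed

lemma fr_0: "f \<in> RL ==> fr f 0 \<in> T" using T_minus[OF rel_intros(2)[of f 0 0]] by simp

lemma fr_scal: "f \<in> RL ==> T #>\<^bsub>G\<^esub> fr f n = \<kappa> (f * fsc n)"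
proof -
 assume f: "f \<in> RL"
 have "fr (f * fsc n) 1 - fr f n \<in> T" using rel_intros(3)[OF f fR_fsc, of n 1] by (simp add: evh.feval_fsc)
 from T_minus[OF this] show ?thesis unfolding \<kappa>_def coset_eq by simp
qed

lemma fr_J: "h \<in> W.J ==> fr h 1 \<in> T"
proof (induction rule: W.J.induct)
 case (J_I x)
 have "fr (0 + 0) 1 - fr 0 1 - fr 0 1 \<in> T" by (intro rel_intros fR_0)
 then have "fr 0 1 \<in> T" using T_minus by fastforce
 moreover have "cls x = cls 0" using J_I subsetD[OF I_R] by (subst cls_eq) (auto simp: fR_0)
 ultimately show ?case by (simp add: fr_def)
next
 case (J_gen r i)
 have "ev (\<zeta> i) = 0" by (simp add: \<zeta>_def evh.feval_diff evh.feval_flet evh.feval_fsc)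
 then have "fr (r * \<zeta> i) 1 - fr r 0 \<in> T" using rel_intros(3)[OF J_gen(1) zeta_R[OF J_gen(2)], of 1] by simp
 from T_add[OF this fr_0[OF J_gen(1)]] show ?case by simp
next
 case (J_add x y)
 have J_R: "x \<in> RL" if "x \<in> W.J" for x using that
  by (induction rule: W.J.induct) (use I_R W.\<zeta>_R in \<open>auto intro: R_mult R_add\<close>)
 have "fr (x + y) 1 - fr x 1 - fr y 1 \<in> T" using J_add J_R by (intro rel_intros)
 from T_add[OF T_add[OF this J_add.IH(1)] J_add.IH(2)] show ?case by simp
qed

text \<open>The map sending \<open>f\<close> and \<open>n\<close> to \<open>n f e\<close> is
  biadditive, and balanced over the subalgebra by \<open>fRS_e\<close>. Its extension to the free
  abelian group therefore kills \<open>T\<close> and detects \<open>f e\<close> in the tensor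
  product.\<close>

lemma T_kernel:
 assumes "f \<in> RL" "g \<in> RL" "fr f 1 - fr g 1 \<in> T"
 shows "cls (f * e) = cls (g * e)"
proof -
 interpret U: abelian_group U by (rule abelian_group_U)
 define \<phi> where "\<phi> = (\<lambda>(a, n). cls (fsc n) \<otimes>\<^bsub>U\<^esub> a \<otimes>\<^bsub>U\<^esub> cls e)"
 have \<phi>: "\<phi> (cls f, n) = cls (fsc n * f * e)" if "f \<in> RL" for f n
  using that eR by (simp add: \<phi>_def U_mult fR_fsc fR_mult)
 have "\<phi> ` (carrier U \<times> carrier KM) \<subseteq> carrier U"
  using eR by (auto simp: U_carrier \<phi> intro!: imageI fR_mult fR_fsc)
 then obtain \<Phi> where hom: "\<Phi> \<in> hom G (add_monoid U)" and fo: "\<And>x. x \<in> carrier U \<times> carrier KM ==> \<Phi> (frag_of x) = \<phi> x"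
  unfolding G_def
  using U.add.free_Abelian_group_universal[of \<phi> "carrier U \<times> carrier KM" thesis] by (simp; blast)
 have \<Phi>_add: "\<Phi> (x + y) = \<Phi> x \<oplus>\<^bsub>U\<^esub> \<Phi> y" and cl: "\<Phi> x \<in> carrier U" if "x \<in> carrier G" "y \<in> carrier G" for x y
  using hom that unfolding hom_def by (auto simp: G_simps)
 have \<Phi>_fr: "\<Phi> (fr f n) = cls (fsc n * f * e)" if "f \<in> RL" for f n
  using fo[of "(cls f, n)"] that \<phi> by (auto simp: fr_def U_carrier KM_simps)
 have \<Phi>_0: "\<Phi> 0 = \<zero>\<^bsub>U\<^esub>" 
 proof -
  have c: "\<Phi> 0 \<in> carrier U" using cl[of 0 0] G_closed(1) by blast
  have "\<Phi> 0 \<oplus>\<^bsub>U\<^esub> \<Phi> 0 = \<zero>\<^bsub>U\<^esub> \<oplus>\<^bsub>U\<^esub> \<Phi> 0" using \<Phi>_add[of 0 0] G_closed(1) c by simp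
  then show ?thesis using U.add.right_cancel[of "\<Phi> 0" "\<Phi> 0" "\<zero>\<^bsub>U\<^esub>"] c by simp
 qed
 have sub: "\<Phi> r = \<zero>\<^bsub>U\<^esub>" if "x \<in> carrier G" "y \<in> carrier G" "r = x - y" "\<Phi> x = \<Phi> y" for r x y
 proof -
  have r: "r \<in> carrier G" using that G_closed by auto
  have "\<Phi> (r + y) = \<Phi> r \<oplus>\<^bsub>U\<^esub> \<Phi> y" using r that by (intro \<Phi>_add)
  moreover have c: "\<Phi> r \<in> carrier U" "\<Phi> y \<in> carrier U" using cl[of r r] cl[of y y] r that by blast+
  ultimately have "\<Phi> r \<oplus>\<^bsub>U\<^esub> \<Phi> y = \<zero>\<^bsub>U\<^esub> \<oplus>\<^bsub>U\<^esub> \<Phi> y" using that by simp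
  then show ?thesis using U.add.right_cancel[of "\<Phi> y" "\<Phi> r" "\<zero>\<^bsub>U\<^esub>"] c by simp
 qed
 have rel: "\<Phi> r = \<zero>\<^bsub>U\<^esub>" if "r \<in> tensor_relations U N (env_incl L \<chi>) KM" for r
  using that
 proof (cases rule: rel_cases)
  case (1 f g n)
  show ?thesis
   by (rule sub[of "fr (f + g) n" "fr f n + fr g n"])
    (use 1 eR in \<open>auto simp: \<Phi>_fr \<Phi>_add fr_G G_closed fR_add U_add fR_mult fR_fsc distrib_left distrib_right\<close>)
 next
  case (2 f n m)
  show ?thesis
   by (rule sub[of "fr f (n + m)" "fr f n + fr f m"])
    (use 2 eR in \<open>auto simp: \<Phi>_fr \<Phi>_add fr_G G_closed fR_add U_add fR_mult fR_fsc fsc_add distrib_left distrib_right\<close>)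
 next
  case (3 f b n)
  have bR: "b \<in> RL" using 3 fRS_RL by blast
  have "fsc n * f * ((b - fsc (ev b)) * e) \<in> I0" using 3 by (intro I_left[OF R_mult[OF fR_fsc]] fRS_e)
  moreover have "fsc n * f * ((b - fsc (ev b)) * e) = fsc n * (f * b) * e - fsc (ev b * n) * f * e"
   by (simp add: left_diff_distrib right_diff_distrib mult.assoc fsc_mult sc_left_commute[of f] sc_left_commute[of "fsc n"])
  ultimately have "cls (fsc n * (f * b) * e) = cls (fsc (ev b * n) * f * e)"
   using 3 bR eR by (subst cls_eq) (auto intro!: fR_mult fR_fsc)
  then show ?thesis
   by (intro sub[of "fr (f * b) n" "fr f (ev b * n)"]) (use 3 bR in \<open>auto simp: \<Phi>_fr fr_G fR_mult\<close>)
 qed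
 have ker: "\<Phi> t = \<zero>\<^bsub>U\<^esub>" if "t \<in> T" for t
  using that unfolding T_def
 proof (induction rule: generate.induct)
  case one
  then show ?case by (simp add: \<Phi>_0 G_simps)
 next
  case (incl r)
  then show ?case by (rule rel)
 next
  case (inv r)
  have r: "r \<in> carrier G" using inv rel_G by blast
  then show ?case using rel[OF inv] by (intro sub[of 0 r]) (auto simp: inv_G \<Phi>_0 G_closed)
 next
  case (eng x y)
  have "x \<in> carrier G" "y \<in> carrier G" using eng.hyps T_G unfolding T_def by auto
  then show ?case using eng.IH \<Phi>_add by (simp add: G_simps)
 qed
 have "\<Phi> (fr f 1) = \<Phi> ((fr f 1 - fr g 1) + fr g 1)" by simp
 also have "\<dots> = \<Phi> (fr f 1 - fr g 1) \<oplus>\<^bsub>U\<^esub> \<Phi> (fr g 1)" using assms T_G fr_G by (intro \<Phi>_add) auto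
 also have "\<dots> = \<Phi> (fr g 1)" using ker[OF assms(3)] cl[OF fr_G fr_G, OF assms(2) assms(2)] by simp
 finally show ?thesis using assms by (simp add: \<Phi>_fr fsc_1)
qed

text \<open>One direction is \<open>T_kernel\<close>. For the other, with \<open>h = f - g\<close>,
  both \<open>h * (1 - e)\<close> and \<open>h * e\<close> lie in the left ideal, whose elements
  vanish in the tensor product by \<open>fr_J\<close>. So the induced module is
  \<open>U e\<close>.\<close>

lemma \<kappa>_eq: "f \<in> RL ==> g \<in> RL ==> \<kappa> f = \<kappa> g \<longleftrightarrow> (f - g) * e \<in> I0"
proof
 assume fg: "f \<in> RL" "g \<in> RL"
 assume "\<kappa> f = \<kappa> g"
 then have "cls (f * e) = cls (g * e)" using fg unfolding \<kappa>_def coset_eq by (rule_tac T_kernel)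
 then show "(f - g) * e \<in> I0" using fg eR by (simp add: cls_eq fR_mult left_diff_distrib)
next
 assume fg: "f \<in> RL" "g \<in> RL" and I: "(f - g) * e \<in> I0"
 let ?h = "f - g"
 have hR: "?h \<in> RL" using fg by (rule fR_diff)
 have "?h * (1 - e) + ?h * e \<in> W.J" by (rule W.J_add[OF W.J_left[OF e(3) hR] W.J_I[OF I]])
 then have h: "fr ?h 1 \<in> T" by (intro fr_J) (simp add: right_diff_distrib)
 have "fr (g + ?h) 1 - fr g 1 - fr ?h 1 \<in> T" using fg hR by (intro rel_intros)
 from T_add[OF this h] show "\<kappa> f = \<kappa> g" unfolding \<kappa>_def coset_eq by simp
qed

lemma Q_simps: "carrier Q = carrier (G Mod T)" "ring.zero Q = T" "add Q = mult (G Mod T)"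
 "a \<odot>\<^bsub>Q\<^esub> q = (\<Union>f\<in>q. T #>\<^bsub>G\<^esub> frag_extend (\<lambda>(a', n). frag_of (a \<otimes>\<^bsub>U\<^esub> a', n)) f)"
 "hcomp Q i = generate (G Mod T) {T #>\<^bsub>G\<^esub> frag_of (a, n) | a n s t. a \<in> hcomp U s \<and> n \<in> hcomp KM t \<and> i = s + t}"
 by (simp_all add: Q_module_def induced_module_def Let_def G_def T_def)

lemma Q_add: "f \<in> RL ==> g \<in> RL ==> \<kappa> f \<oplus>\<^bsub>Q\<^esub> \<kappa> g = \<kappa> (f + g)"
proof -
 assume fg: "f \<in> RL" "g \<in> RL"
 have "\<kappa> f \<oplus>\<^bsub>Q\<^esub> \<kappa> g = T #>\<^bsub>G\<^esub> (fr f 1 + fr g 1)" by (simp add: Q_simps FactGroup_def \<kappa>_def coset_mult)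
 also have "\<dots> = \<kappa> (f + g)" unfolding \<kappa>_def coset_eq using T_minus[OF rel_intros(1)[OF fg, of 1]] by (simp add: algebra_simps)
 finally show ?thesis .
qed

lemma Q_zero: "\<zero>\<^bsub>Q\<^esub> = \<kappa> 0"
proof -
 have "fr (0 + 0) 1 - fr 0 1 - fr 0 1 \<in> T" by (intro rel_intros fR_0)
 then have "\<kappa> 0 = T #>\<^bsub>G\<^esub> 0" unfolding \<kappa>_def coset_eq using T_minus by fastforce
 moreover have "T #>\<^bsub>G\<^esub> 0 = T" by (auto simp: coset_set)
 ultimately show ?thesis by (simp add: Q_simps)
qed

text \<open>Induction over formal integer combinations; a generator of the free group is brought
  into the form \<open>\<kappa> f\<close> by moving its scalar to the left, and differences of such
  classes are again of this form.\<close>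

lemma Q_carrier: "carrier Q = \<kappa> ` RL"
proof (intro equalityI subsetI)
 fix q assume "q \<in> carrier Q"
 then obtain x where x: "x \<in> carrier G" "q = T #>\<^bsub>G\<^esub> x" by (auto simp: Q_simps FactGroup_def RCOSETS_def)
 from x(1) have "Poly_Mapping.keys x \<subseteq> carrier U \<times> UNIV" by (simp add: G_simps)
 then have "\<exists>f\<in>RL. T #>\<^bsub>G\<^esub> x = \<kappa> f"
 proof (induction x rule: frag_induction)
  case zero
  have "T #>\<^bsub>G\<^esub> 0 = T" by (auto simp: coset_set)
  then have "T #>\<^bsub>G\<^esub> 0 = \<kappa> 0" using Q_zero by (simp add: Q_simps)
  then show ?case using fR_0 by blast
 next
  case (one x)
  then obtain f n where "x = (cls f, n)" "f \<in> RL" by (auto simp: U_carrier)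
  then show ?case using fr_scal[of f n] by (auto simp: fr_def intro!: bexI[of _ "f * fsc n"] fR_mult fR_fsc)
 next
  case (diff a b)
  then obtain f g where fg: "f \<in> RL" "g \<in> RL" "a - fr f 1 \<in> T" "b - fr g 1 \<in> T" by (auto simp: \<kappa>_def coset_eq)
  have "fr ((f - g) + g) 1 - fr (f - g) 1 - fr g 1 \<in> T" using fg by (intro rel_intros fR_diff)
  then have "(a - fr f 1) - (b - fr g 1) + (fr f 1 - fr (f - g) 1 - fr g 1) \<in> T"
   using fg by (intro T_add[OF T_diff]) auto
  then have "a - b - fr (f - g) 1 \<in> T" by (simp add: algebra_simps)
  then show ?case using fg by (auto simp: \<kappa>_def coset_eq intro!: bexI[of _ "f - g"] fR_diff)
 qed
 then show "q \<in> \<kappa> ` RL" using x by blast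
next
 fix q assume "q \<in> \<kappa> ` RL"
 then show "q \<in> carrier Q" using fr_G by (auto simp: Q_simps FactGroup_def RCOSETS_def \<kappa>_def)
qed

text \<open>The scalar multiplication of the record is a union over the members of a coset. Left
  multiplication maps relations to relations, so all members yield the same coset.\<close>

lemma Q_smult: "f \<in> RL ==> g \<in> RL ==> cls f \<odot>\<^bsub>Q\<^esub> \<kappa> g = \<kappa> (f * g)"
proof -
 assume f: "f \<in> RL" and g: "g \<in> RL"
 let ?x = "frag_extend (\<lambda>(a', n). frag_of (cls f \<otimes>\<^bsub>U\<^esub> a', n))"
 have fr: "?x (fr h n) = fr (f * h) n" if "h \<in> RL" for h n using that f by (simp add: fr_def U_mult)
 have rel: "?x r \<in> T" if "r \<in> tensor_relations U N (env_incl L \<chi>) KM" for r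
  using that
 proof (cases rule: rel_cases)
  case (1 h k n)
  then show ?thesis using rel_intros(1)[of "f * h" "f * k" n] f
   by (simp add: frag_extend_diff fr fR_add fR_mult distrib_left)
 next
  case (2 h n m)
  then show ?thesis using rel_intros(2)[of "f * h" n m] f by (simp add: frag_extend_diff fr fR_mult)
 next
  case (3 h b n)
  then show ?thesis using rel_intros(3)[of "f * h" b n] f
   by (simp add: frag_extend_diff fr fR_mult fRS_RL mult.assoc)
 qed
 have T: "?x t \<in> T" if "t \<in> T" for t
  using that unfolding T_def
 proof (induction rule: generate.induct)
  case one
  then show ?case using T_0 by (simp add: G_simps T_def)
 next
  case (incl r)
  then show ?case using rel by (simp add: T_def)
 next
  case (inv r)
  then have "r \<in> carrier G" using rel_G by blast
  then show ?case using rel[OF inv] T_minus by (simp add: inv_G frag_extend_minus T_def)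
 next
  case (eng x y)
  then show ?case using T_add by (simp add: G_simps frag_extend_add T_def)
 qed
 have "T #>\<^bsub>G\<^esub> ?x h = \<kappa> (f * g)" if h: "h \<in> \<kappa> g" for h
 proof -
  from h obtain t where t: "t \<in> T" "h = t + fr g 1" by (auto simp: \<kappa>_def coset_set)
  then show ?thesis unfolding \<kappa>_def coset_eq using T[OF t(1)] g by (simp add: frag_extend_add fr)
 qed
 moreover have "fr g 1 \<in> \<kappa> g" unfolding \<kappa>_def coset_set using T_0 by force
 ultimately show ?thesis unfolding Q_simps by auto
qed

text \<open>The module of \<chi> is purely even, so a homogeneous tensor has the parity of its left
  factor, and the generators already form a subgroup.\<close>

lemma Q_hcomp: "hcomp Q i = \<kappa> ` fRh L i"
proof -
 let ?H = "{T #>\<^bsub>G\<^esub> frag_of (a, n) | a n s t. a \<in> hcomp U s \<and> n \<in> hcomp KM t \<and> i = s + t}"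
 have mult: "\<kappa> f \<otimes>\<^bsub>G Mod T\<^esub> \<kappa> g = \<kappa> (f + g)" if "f \<in> RL" "g \<in> RL" for f g
  using Q_add[OF that] by (simp add: Q_simps)
 have one': "\<one>\<^bsub>G Mod T\<^esub> = \<kappa> 0" using Q_zero by (simp add: Q_simps)
 have normal: "normal T G" unfolding G_def
  by (rule comm_group.normal_iff_subgroup[OF abelian_free_Abelian_group, THEN iffD2])
   (use T_sub in \<open>simp add: G_def\<close>)
 interpret GT: group "G Mod T" by (rule normal.factorgroup_is_group[OF normal])
 have h0: "(0 :: ('k, 'g) fa) \<in> fRh L i" by (simp add: fRh_def fR_0)
 have hm: "- f \<in> fRh L i" if "f \<in> fRh L i" for f
  using fRh_mult[OF fRh_fsc that, of "- 1"] by (simp only: sc_minus1 add_0_left)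
 have H: "?H \<subseteq> \<kappa> ` fRh L i"
 proof
  fix q assume "q \<in> ?H"
  then obtain a n s t where q: "q = T #>\<^bsub>G\<^esub> frag_of (a, n)" "a \<in> hcomp U s" "n \<in> hcomp KM t" "i = s + t" by blast
  then obtain f where f: "a = cls f" "f \<in> fRh L s" by (auto simp: U_hcomp)
  then have "q = \<kappa> (f * fsc n)" using q fr_scal[of f n] fRh_R by (auto simp: fr_def)
  moreover have "f * fsc n \<in> fRh L i"
  proof (cases t)
   case zero
   then show ?thesis using fRh_mult[OF f(2) fRh_fsc, of n] q(4) by (simp only: add_0_right)
  next
   case one
   then show ?thesis using q(3) h0 by (simp add: KM_simps sc_0)
  qed
  ultimately show "q \<in> \<kappa> ` fRh L i" by blast
 qed
 show ?thesis unfolding Q_simps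
 proof (intro equalityI subsetI)
  fix q assume "q \<in> generate (G Mod T) ?H"
  then show "q \<in> \<kappa> ` fRh L i"
  proof (induction rule: generate.induct)
   case one
   then show ?case using h0 one' by blast
  next
   case (incl q)
   then show ?case using H by blast
  next
   case (inv q)
   then obtain f where f: "f \<in> fRh L i" "q = \<kappa> f" using H by blast
   then have fR: "f \<in> RL" using fRh_R by blast
   then have "\<kappa> (- f) \<in> carrier (G Mod T)" "\<kappa> f \<in> carrier (G Mod T)" 
    using Q_carrier imageI[OF fR_minus[OF fR], of \<kappa>] imageI[OF fR, of \<kappa>] by (simp_all add: Q_simps)
   then have "inv\<^bsub>G Mod T\<^esub> q = \<kappa> (- f)" 
    unfolding f(2) by (intro GT.inv_equality) (simp_all only: mult[OF fR_minus[OF fR] fR] one' left_minus)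
   then show ?case using hm f by blast
  next
   case (eng x y)
   then show ?case using mult fRh_R fRh_add by (smt (verit) imageE imageI subsetD)
  qed
 next
  fix q assume "q \<in> \<kappa> ` fRh L i"
  then obtain f where f: "q = \<kappa> f" "f \<in> fRh L i" by blast
  have "T #>\<^bsub>G\<^esub> frag_of (cls f, 1) \<in> ?H"
   using f(2) by (intro CollectI exI[of _ "cls f"] exI[of _ 1] exI[of _ i] exI[of _ 0]) (simp add: U_hcomp KM_simps)
  then show "q \<in> generate (G Mod T) ?H" unfolding f(1) \<kappa>_def fr_def by (rule generate.incl)
 qed
qed

text \<open>Letter by letter: a letter from \<open>S\<close> is its \<chi>-value plus a combination
  of \<zeta>'s, and \<open>zeta_Mk\<close> keeps the result within the span of the box
  monomials.\<close>

lemma fR_word_span: "x \<in> fR S ==> x \<in> P.Mk s 0"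
proof -
 have left: "flet y * x \<in> P.Mk s 0" if y: "y \<in> S" and x: "x \<in> P.Mk s 0" for x y
 proof -
  have l: "flet y - fsc (\<chi> y) \<in> lspan fsc IS (\<zeta> ` {..<s})" using y S_gen by (intro zeta_span) auto
  have "(flet y - fsc (\<chi> y)) * x \<in> P.Mk s 0"
   unfolding P.Mk_def
  proof (rule lspan_right[OF l])
   fix g assume "g \<in> \<zeta> ` {..<s}"
   then obtain i where i: "g = \<zeta> i" "i < s" by auto
   have "\<zeta> i * x \<in> P.Mk s (d i)" using P.zeta_Mk[of s i x 0] i x by simp
   then have "g * x \<in> P.Mk s 0" using P.Mk_mono i by blast
   then show "g * x \<in> lspan fsc IS {P.zmon s a |a. a \<in> P.box s \<and> 0 \<le> P.wt s a}" by (simp add: P.Mk_def)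
  qed (use P.Mk_R[OF order_refl x] in \<open>auto intro: lspan.base P.I_right\<close>)
  then have "(flet y - fsc (\<chi> y)) * x + fsc (\<chi> y) * x \<in> P.Mk s 0"
   using x unfolding P.Mk_def by (intro lspan.add lspan.scale)
  then show ?thesis by (simp add: left_diff_distrib)
 qed
 have one: "1 \<in> P.Mk s 0"
 proof -
  have "(\<lambda>_. 0) \<in> P.box s" using P.bd_ge by (force simp: P.box_def)
  then show ?thesis unfolding P.Mk_def by (intro lspan.gen CollectI exI[of _ "\<lambda>_. 0"]) (auto simp: P.zmon_zero)
 qed
 assume "x \<in> fR S"
 then have "\<forall>w\<in>Poly_Mapping.keys x. set (letters w) \<subseteq> S" by (simp add: fR_def)
 then show ?thesis
 proof (induction x rule: keys_induct)
  case zero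
  then show ?case unfolding P.Mk_def by (intro lspan.base P.I_0)
 next
  case (single w c)
  have "prod_list (map flet w) \<in> P.Mk s 0" using single by (induction w) (auto simp: one left)
  then show ?case unfolding single_FW P.Mk_def by (rule lspan.scale)
 next
  case (add f g)
  then show ?case unfolding P.Mk_def by (rule lspan.add)
 qed
qed

text \<open>Independence is imported from the large algebra: a relation modulo \<open>IS\<close> is
  also one modulo \<open>I0\<close>, where \<open>zmon_independent\<close> excludes it.\<close>

lemma kdim_N: "1 \<notin> I0 ==> kdim N = card (P.box s)"
proof (rule M.kdim_U)
 assume one: "1 \<notin> I0"
 show "finite (P.box s)" by (rule P.finite_box)
 show "P.zmon s a \<in> fR (carrier M)" for a using P.zmon_R[OF order_refl] by (simp add: M_simps)
 show "\<exists>c. x - (\<Sum>a\<in>P.box s. fsc (c a) * P.zmon s a) \<in> IS" if "x \<in> fR (carrier M)" for x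
 proof -
  have "x \<in> P.Mk s 0" using that by (intro fR_word_span) (simp add: M_simps)
  moreover have "{P.zmon s a |a. a \<in> P.box s \<and> 0 \<le> P.wt s a} = P.zmon s ` P.box s" by auto
  ultimately have "x \<in> lspan fsc IS (P.zmon s ` P.box s)" by (simp add: P.Mk_def)
  then show ?thesis using P.finite_box by (rule P.lspan_coeff)
 qed
 show "c a = 0" if "(\<Sum>a\<in>P.box s. fsc (c a) * P.zmon s a) \<in> IS" "a \<in> P.box s" for c a
  using W.zmon_independent[of c a] that one IS_I0 by blast
qed

theorem main:
 "projective_supermodule TYPE('m) TYPE('n) U Q \<and>
  algebra_iso U (matrix_algebra (kdim N) (opposite_superalgebra (End_superalgebra U Q)))"
proof -
 have ee: "e * e - e \<in> I0" using e_whit[OF e(2)] .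
 have "\<exists>p q. (\<forall>k<kdim N. p k \<in> RL \<and> q k \<in> RL \<and> e * p k - p k \<in> I0) \<and>
   (\<forall>k<kdim N. \<forall>l<kdim N. p k * (q l * e) - (if k = l then e else 0) \<in> I0) \<and>
   1 - (\<Sum>k<kdim N. q k * p k) \<in> I0"
 proof (cases "1 \<in> I0")
  case True
  then have "x \<in> I0" if "x \<in> RL" for x using I_left[OF that True] by simp
  then show ?thesis using eR fR_0 fR_minus[OF eR] by (intro exI[of _ "\<lambda>_. 0"]) (auto simp: fR_1)
 next
  case False
  let ?n = "card (P.box s)"
  obtain b where b: "bij_betw b {..<?n} (P.box s)"
   using ex_bij_betw_nat_finite[OF P.finite_box, of s] by (auto simp: atLeast0LessThan)
  have bb: "b k \<in> P.box s" if "k < ?n" for k using b that by (auto simp: bij_betw_def)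
  obtain p where p: "\<And>a. W.whit (p a)" "1 - (\<Sum>a\<in>P.box s. W.Uu a * p a) \<in> I0"
   "\<And>a b r. a \<in> P.box s ==> b \<in> P.box s ==> W.whit r ==> p a * (W.Uu b * r) - (if a = b then r else 0) \<in> I0"
   using W.matrix_units by blast
  have "(\<Sum>k<?n. W.Uu (b k) * p (b k)) = (\<Sum>a\<in>P.box s. W.Uu a * p a)"
   using b by (rule sum.reindex_bij_betw)
  moreover have "p (b k) * (W.Uu (b l) * e) - (if k = l then e else 0) \<in> I0" if "k < ?n" "l < ?n" for k l
  proof -
   have "b k = b l \<longleftrightarrow> k = l" using b that by (auto simp: bij_betw_def inj_on_def)
   then show ?thesis using p(3)[OF bb bb e(2), of k l] that by simp
  qed
  moreover have "p a \<in> RL" "e * p a - p a \<in> I0" for a using p(1)[of a] e_whit by (auto simp: W.whit_def)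
  ultimately show ?thesis unfolding kdim_N[OF False] using p(2) W.Umon_R
   by (intro exI[of _ "\<lambda>k. p (b k)"] exI[of _ "\<lambda>k. W.Uu (b k)"]) auto
 qed
 then obtain p q where pq: "\<And>k. k < kdim N ==> p k \<in> RL" "\<And>k. k < kdim N ==> q k \<in> RL"
  "\<And>k. k < kdim N ==> e * p k - p k \<in> I0"
  "\<And>k l. k < kdim N ==> l < kdim N ==> p k * (q l * e) - (if k = l then e else 0) \<in> I0"
  "1 - (\<Sum>k<kdim N. q k * p k) \<in> I0" by blast
 interpret X: morita fsc RL I0 "fRh L" \<sigma> e U Q cls \<kappa> "kdim N" p q
 proof
  show "\<sigma> x - x \<in> I0" if "x \<in> fRh L 0" for x using \<sigma>_fRh[OF that] by (simp add: sg_def fsc_1)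
  show "\<sigma> x + x \<in> I0" if "x \<in> fRh L 1" for x using \<sigma>_fRh[OF that] by (simp add: sg_def sc_minus1)
 qed (fact fRh_R fRh_add fRh_mult fRh_fsc fRh_decomp \<sigma>_simps \<sigma>_R \<sigma>_I two e ee U_carrier cls_eq U_add U_mult
   U_one U_zero U_smult U_hcomp Q_carrier \<kappa>_eq Q_add Q_zero Q_smult Q_hcomp pq
   | (rule \<sigma>_simps, assumption?) | erule (1) fRh_add fRh_mult cls_eq U_add U_mult \<kappa>_eq Q_add Q_smult pq(4)
   | erule fRh_decomp \<sigma>_R \<sigma>_I U_smult pq(1-3))+
 show ?thesis using X.projective_Q X.iso_U by blast
qed

end

section \<open>Gradings with a nondegenerate pairing\<close>

lemma super_env_algebraI:
 assumes lie: "lie_superalgebra L" and pm: "\<And>x. x \<in> hcomp L 0 ==> pmap L x \<in> hcomp L 0" and two: "(2 :: 'k::field) \<noteq> 0"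
 shows "super_env_algebra (L :: ('k, 'g) lie_superalg)"
proof -
 interpret lie_superalgebra L by (rule lie)
 interpret V: vectorspace class_ring L using superspace by (simp add: superspace_def)
 have hs: "hcomp L a \<subseteq> carrier L" for a
  by (rule ksubspaceD(1)) (use superspace in \<open>unfold superspace_def, blast\<close>)
 show ?thesis
 proof
  show "c \<odot>\<^bsub>L\<^esub> x \<in> carrier L" if "x \<in> carrier L" for c x using V.smult_closed[of c x] that by (simp add: class_ring_simps)
  show "brk L x y \<in> carrier L" if "x \<in> hcomp L a" "y \<in> hcomp L b" for x y a b using brk_hcomp[OF that] hs by blast
  show "pmap L x \<in> carrier L" if "x \<in> hcomp L 0" for x using pm[OF that] hs by blast
 qed (use hs lie pm two in auto)
qed

context super_env_algebra begin

lemma span_induct: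
 assumes x: "x \<in> kspan L A" and A: "A \<subseteq> carrier L" and P: "\<And>a. a \<in> A ==> P a" and zero: "P \<zero>"
  and add: "\<And>x y. x \<in> carrier L ==> y \<in> carrier L ==> P x ==> P y ==> P (x \<oplus> y)"
  and smult: "\<And>c x. x \<in> carrier L ==> P x ==> P (c \<odot> x)"
 shows "P x"
proof -
 have "submodule class_ring {x \<in> carrier L. P x} L"
  by (rule submodule.intro) (use V.module_axioms add smult zero add_cl smult_cl in \<open>auto simp: class_ring_simps\<close>)
 from V.span_is_subset[OF _ this, of A] x show ?thesis using A P by blast
qed

lemma span_sub: "A \<subseteq> carrier L ==> ksubspace (kspan L A) L" by (rule V.span_is_subspace)

lemma span_gen: "A \<subseteq> carrier L ==> A \<subseteq> kspan L A" by (rule V.in_own_span)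

lemma span_least: "ksubspace W L ==> A \<subseteq> W ==> kspan L A \<subseteq> W"
 using V.span_is_subset[of A W] by (simp add: subspace_def)

lemma brk_closed: "x \<in> carrier L ==> y \<in> carrier L ==> brk L x y \<in> carrier L"
proof -
 assume "x \<in> carrier L" "y \<in> carrier L"
 then obtain a b c e where x: "x = a \<oplus> b" "a \<in> hcomp L 0" "b \<in> hcomp L 1" and y: "y = c \<oplus> e" "c \<in> hcomp L 0" "e \<in> hcomp L 1"
  using hcomp_split by metis
 then have cl: "a \<in> carrier L" "b \<in> carrier L" "c \<in> carrier L" "e \<in> carrier L" using hc by auto
 then show ?thesis unfolding x(1) y(1)
  by (simp add: brk_add_left brk_add_right add_cl brk_cl[OF x(2) y(2)] brk_cl[OF x(2) y(3)] brk_cl[OF x(3) y(2)] brk_cl[OF x(3) y(3)])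
qed

lemma smult_simps: "0 \<odot> x = \<zero>" "1 \<odot> x = x" "(a * b) \<odot> x = a \<odot> (b \<odot> x)"
  "(a + b) \<odot> x = a \<odot> x \<oplus> b \<odot> x" if "x \<in> carrier L" for x
 using V.smult_l_null[of x] V.smult_one[of x] V.smult_assoc1[of a b x] V.smult_l_distr[of a b x] that
 by (simp_all add: class_ring_simps)

lemma smult_zero: "c \<odot> \<zero> = \<zero>" using V.smult_r_null[of c] by (simp add: class_ring_simps)

lemma smult_add: "x \<in> carrier L ==> y \<in> carrier L ==> c \<odot> (x \<oplus> y) = c \<odot> x \<oplus> c \<odot> y"
 using V.smult_r_distr[of c x y] by (simp add: class_ring_simps)

definition lin :: "('g => 'k) => bool" where
 "lin f \<longleftrightarrow> (\<forall>x\<in>carrier L. \<forall>y\<in>carrier L. f (x \<oplus> y) = f x + f y) \<and> (\<forall>c. \<forall>x\<in>carrier L. f (c \<odot> x) = c * f x)"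

lemma linD: "lin f ==> x \<in> carrier L ==> y \<in> carrier L ==> f (x \<oplus> y) = f x + f y"
  "lin f ==> x \<in> carrier L ==> f (c \<odot> x) = c * f x"
 by (auto simp: lin_def)

lemma lin_zero: "lin f ==> f \<zero> = 0" using linD(2)[of f "\<zero>" 0] by (simp add: smult_zero)

lemma lin_span: "x \<in> kspan L A ==> A \<subseteq> carrier L ==> lin f ==> (\<And>a. a \<in> A ==> f a = 0) ==> f x = 0"
 by (erule span_induct) (auto simp: linD lin_zero)

text \<open>Combinations of a family indexed by position, so that coefficients belong to indices and
  not to vectors, and sums can be handled by induction on the length.\<close>

primrec lc :: "(nat => 'k) => (nat => 'g) => nat => 'g" where
 "lc c z 0 = \<zero>"
| "lc c z (Suc n) = lc c z n \<oplus> c n \<odot> z n"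

lemma lc_sub: "ksubspace W L ==> (\<And>i. i < n ==> z i \<in> carrier L) ==> (\<And>i. i < n ==> c i \<noteq> 0 ==> z i \<in> W) ==> lc c z n \<in> W"
proof (induction n)
 case (Suc n)
 have "c n \<odot> z n \<in> W"
  using ksubspaceD(2,4)[OF Suc.prems(1)] Suc.prems(2,3)[of n] smult_simps(1) by (cases "c n = 0") auto
 then show ?case using ksubspaceD(3)[OF Suc.prems(1)] Suc by simp
qed (simp add: ksubspaceD)

lemma lc_cl: "(\<And>i. i < n ==> z i \<in> carrier L) ==> lc c z n \<in> carrier L"
 by (induction n) (auto intro: add_cl smult_cl)

lemma lin_lc: "lin f ==> (\<And>i. i < n ==> z i \<in> carrier L) ==> f (lc c z n) = (\<Sum>i<n. c i * f (z i))"
 by (induction n) (auto simp: lin_zero linD lc_cl smult_cl)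

lemma lc_zero: "(\<And>i. i < n ==> z i \<in> carrier L) ==> (\<And>i. i < n ==> c i = 0) ==> lc c z n = \<zero>"
 by (induction n) (auto simp: smult_simps(1))

lemma lc_add: "(\<And>i. i < n ==> z i \<in> carrier L) ==> lc (\<lambda>i. a i + b i) z n = lc a z n \<oplus> lc b z n"
proof (induction n)
 case (Suc n)
 have c: "lc a z n \<in> carrier L" "lc b z n \<in> carrier L" "a n \<odot> z n \<in> carrier L" "b n \<odot> z n \<in> carrier L"
  using Suc.prems by (auto intro: lc_cl smult_cl)
 show ?case using c Suc by (simp add: smult_simps(4) V.a_ac add_cl)
qed simp

lemma lc_smult: "(\<And>i. i < n ==> z i \<in> carrier L) ==> lc (\<lambda>i. a * b i) z n = a \<odot> lc b z n"
 by (induction n) (auto simp: smult_zero smult_add smult_simps(3) lc_cl smult_cl)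

lemma lc_single: "(\<And>i. i < n ==> z i \<in> carrier L) ==> j < n ==> lc (\<lambda>i. if j = i then 1 else 0) z n = z j"
proof (induction n)
 case (Suc n)
 then show ?case
  by (cases "j = n") (auto simp: lc_zero smult_simps(1,2) less_Suc_eq)
qed simp

end

section \<open>From a nondegenerate pairing to homogeneous dual bases\<close>

lemma bit_add_0: "(a :: bit) + b = 0 \<longleftrightarrow> a = b" by (cases a; cases b) auto

text \<open>What each family of Lie superalgebras has to provide. The finite separating set \<Phi>
  of linear forms stands in for finite dimension; \<open>nondeg\<close> concerns the pairing
  \<chi>([x, y]) in negative degrees, and \<open>pm_low\<close> says that the p-map multiplies depth
  by p.\<close>

locale chi_grading = super_env_algebra L \<chi> for L :: "('k::field, 'g) lie_superalg" (structure) and \<chi> +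
 fixes gr :: "int => 'g set" and S :: "'g set" and \<Phi> :: "('g => 'k) set"
 assumes prime_CHAR: "prime CHAR('k)"
  and gr_sub: "ksubspace (gr k) L"
  and gr_brk: "[|x \<in> gr k; y \<in> gr l|] ==> brk L x y \<in> gr (k + l)"
  and gr_split: "x \<in> gr k ==> \<exists>y\<in>gr k \<inter> hcomp L 0. \<exists>z\<in>gr k \<inter> hcomp L 1. x = y \<oplus> z"
  and chi_add: "[|x \<in> carrier L; y \<in> carrier L|] ==> \<chi> (x \<oplus> y) = \<chi> x + \<chi> y"
  and chi_smult: "x \<in> carrier L ==> \<chi> (c \<odot> x) = c * \<chi> x"
  and chi_gr: "[|x \<in> gr k; k \<noteq> - 2|] ==> \<chi> x = 0" and chi_odd: "x \<in> hcomp L 1 ==> \<chi> x = 0"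
  and nondeg: "[|x \<in> gr (- int d); x \<in> hcomp L a; 1 \<le> d; x \<noteq> \<zero>|]
   ==> \<exists>k b. \<exists>y\<in>gr k \<inter> hcomp L b. \<chi> (brk L x y) \<noteq> 0"
  and pm_low: "[|x \<in> kspan L (\<Union>k\<in>{..- int d}. gr k); x \<in> hcomp L 0; 1 \<le> d|]
   ==> pmap L x \<in> kspan L (\<Union>k\<in>{..- int (CHAR('k) * d)}. gr k)"
  and Phi_finite: "finite \<Phi>" and Phi_lin: "f \<in> \<Phi> ==> lin f"
  and Phi_inj: "[|x \<in> carrier L; \<And>f. f \<in> \<Phi> ==> f x = 0|] ==> x = \<zero>"
  and assoc: "associated_m L \<chi> gr S"
begin

lemmas gr_D = ksubspaceD[OF gr_sub]

lemma gr_cl: "x \<in> gr k ==> x \<in> carrier L" using gr_D(1) by blast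
lemma hc_cl: "x \<in> hcomp L a ==> x \<in> carrier L" using hc by blast

lemma lin_chi: "lin \<chi>" by (simp add: lin_def chi_add chi_smult)

lemma lin_left: "y \<in> carrier L ==> lin (\<lambda>x. \<chi> (brk L x y))"
 by (simp add: lin_def brk_add_left brk_smult_left chi_add chi_smult brk_closed)

lemma lin_right: "x \<in> carrier L ==> lin (\<lambda>y. \<chi> (brk L x y))"
 by (simp add: lin_def brk_add_right brk_smult_right chi_add chi_smult brk_closed)

lemma chi_degree: "\<chi> (brk L x y) \<noteq> 0 ==> x \<in> gr k ==> y \<in> gr l ==> k + l = - 2"
 using chi_gr gr_brk by blast

lemma chi_parity: "\<chi> (brk L x y) \<noteq> 0 ==> x \<in> hcomp L a ==> y \<in> hcomp L b ==> a = b"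
proof -
 assume *: "\<chi> (brk L x y) \<noteq> 0" "x \<in> hcomp L a" "y \<in> hcomp L b"
 then have "brk L x y \<in> hcomp L (a + b)" by (intro brk_hcomp)
 then have "a + b = 0" using chi_odd * by (cases "a + b") auto
 then show "a = b" by (simp only: bit_add_0)
qed

definition low :: "nat => 'g set" where "low d = kspan L (\<Union>k\<in>{..- int d}. gr k)"

lemma low_gens: "(\<Union>k\<in>{..- int d}. gr k) \<subseteq> carrier L" using gr_cl by blast

definition gens :: "'g set => 'g list => 'g set" where
 "gens E vs = (\<Union>k\<in>{2..}. gr (- k)) \<union> E \<union> set (take (length vs div 2) vs)"

lemma assocE:
 obtains E vs where "E \<subseteq> gr (- 1) \<inter> hcomp L 0" "\<And>x y. x \<in> E ==> y \<in> E ==> \<chi> (brk L x y) = 0"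
  "set vs \<subseteq> gr (- 1) \<inter> hcomp L 1" "S = kspan L (gens E vs)" "gens E vs \<subseteq> carrier L"
  "\<And>x y. x \<in> set (take (length vs div 2) vs) ==> y \<in> set (take (length vs div 2) vs) ==> \<chi> (brk L x y) = 0"
proof -
 from assoc obtain E vs where *: "isotropic_subspace L \<chi> (gr (- 1) \<inter> hcomp L 0) E" "set vs \<subseteq> gr (- 1) \<inter> hcomp L 1"
  "\<forall>i<length vs. \<forall>j<length vs. \<chi> (brk L (vs ! i) (vs ! j)) = (if i + j + 1 = length vs then 1 else 0)"
  "S = kspan L (gens E vs)"
  unfolding associated_m_def gens_def by blast
 have E: "E \<subseteq> gr (- 1) \<inter> hcomp L 0" "\<And>x y. x \<in> E ==> y \<in> E ==> \<chi> (brk L x y) = 0"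
  using *(1) unfolding isotropic_subspace_def by blast+
 have "set (take (length vs div 2) vs) \<subseteq> carrier L" using set_take_subset[of "length vs div 2" vs] *(2) gr_cl by blast
 then have g: "gens E vs \<subseteq> carrier L" unfolding gens_def using E(1) gr_cl by blast
 have v: "\<chi> (brk L x y) = 0" if xy: "x \<in> set (take (length vs div 2) vs)" "y \<in> set (take (length vs div 2) vs)" for x y
 proof -
  obtain i j where "i < length vs div 2" "j < length vs div 2" "x = vs ! i" "y = vs ! j"
   using xy by (auto simp: in_set_conv_nth)
  \<comment> \<open>Both indices lie in the first half of the list, so \<open>i + j + 1\<close>
    stays below its length; for odd length the middle vector is left out.\<close>
  then show ?thesis using *(3) by simp
 qed
 show thesis using that[OF E *(2) *(4) g v] .
qed

lemma S_sub: "ksubspace S L" using assocE span_sub by metis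
lemmas S_D = ksubspaceD[OF S_sub]

lemma S_low: "k \<le> - 2 ==> gr k \<subseteq> S"
proof
 fix x assume k: "k \<le> - 2" "x \<in> gr k"
 obtain E vs where S: "S = kspan L (gens E vs)" "gens E vs \<subseteq> carrier L" using assocE by metis
 have "x \<in> gr (- (- k)) \<and> - k \<in> {2..}" using k by simp
 then have "x \<in> gens E vs" unfolding gens_def by blast
 then show "x \<in> S" using span_gen[OF S(2)] S(1) by blast
qed

text \<open>All generators have degree at most -1, so brackets have degree at most -2 and lie in
  \<open>S\<close>. A nonzero \<chi>-value needs degree exactly -2, that is two generators of degree
  -1. Equal parities are excluded by isotropy, different ones because the bracket is then
  odd.\<close>

lemma gens_brk:
 assumes E: "E \<subseteq> gr (- 1) \<inter> hcomp L 0" "\<And>x y. x \<in> E ==> y \<in> E ==> \<chi> (brk L x y) = 0"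
  and vs: "set vs \<subseteq> gr (- 1) \<inter> hcomp L 1"
  "\<And>x y. x \<in> set (take (length vs div 2) vs) ==> y \<in> set (take (length vs div 2) vs) ==> \<chi> (brk L x y) = 0"
  and x: "x \<in> gens E vs" and y: "y \<in> gens E vs"
 shows "brk L x y \<in> S \<and> \<chi> (brk L x y) = 0"
proof -
 let ?T = "set (take (length vs div 2) vs)"
 have T: "?T \<subseteq> gr (- 1) \<inter> hcomp L 1" using set_take_subset[of "length vs div 2" vs] vs by blast
 have deg: "\<exists>k\<le>-1. w \<in> gr k \<and> (k = - 1 \<longrightarrow> w \<in> E \<union> ?T)" if w: "w \<in> gens E vs" for w
 proof (cases "w \<in> E \<union> ?T")
  case True
  then show ?thesis using E(1) T by (intro exI[of _ "- 1"]) auto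
 next
  case False
  then obtain k where "k \<ge> 2" "w \<in> gr (- k)" using w unfolding gens_def by auto
  then show ?thesis by (intro exI[of _ "- k"]) auto
 qed
 obtain k l where k: "k \<le> - 1" "x \<in> gr k" "k = - 1 \<longrightarrow> x \<in> E \<union> ?T" and l: "l \<le> - 1" "y \<in> gr l" "l = - 1 \<longrightarrow> y \<in> E \<union> ?T"
  using deg[OF x] deg[OF y] by blast
 have "brk L x y \<in> gr (k + l)" using gr_brk k l by blast
 then have S: "brk L x y \<in> S" using S_low[of "k + l"] k l by auto
 have "\<chi> (brk L x y) = 0"
 proof (rule ccontr)
  assume nz: "\<chi> (brk L x y) \<noteq> 0"
  then have "k + l = - 2" using chi_degree k(2) l(2) by blast
  then have xy: "x \<in> E \<union> ?T" "y \<in> E \<union> ?T" using k l by auto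
  have "x \<in> hcomp L 0 \<and> y \<in> hcomp L 1 \<or> x \<in> hcomp L 1 \<and> y \<in> hcomp L 0"
   using xy E(2)[of x y] vs(2)[of x y] nz E(1) T by blast
  then show False using chi_parity[OF nz, of 0 1] chi_parity[OF nz, of 1 0] by auto
 qed
 with S show ?thesis by blast
qed

lemma S_brk: "x \<in> S ==> y \<in> S ==> brk L x y \<in> S \<and> \<chi> (brk L x y) = 0"
proof -
 obtain E vs where E: "E \<subseteq> gr (- 1) \<inter> hcomp L 0" "\<And>x y. x \<in> E ==> y \<in> E ==> \<chi> (brk L x y) = 0"
  "set vs \<subseteq> gr (- 1) \<inter> hcomp L 1" and S: "S = kspan L (gens E vs)" "gens E vs \<subseteq> carrier L"
  and vs: "\<And>x y. x \<in> set (take (length vs div 2) vs) ==> y \<in> set (take (length vs div 2) vs) ==> \<chi> (brk L x y) = 0"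
  using assocE by metis
 note G = gens_brk[OF E vs]
 have 1: "brk L x y \<in> S \<and> \<chi> (brk L x y) = 0" if x: "x \<in> kspan L (gens E vs)" and y: "y \<in> gens E vs" for x y
  using x
 proof (rule span_induct)
  have cy: "y \<in> carrier L" using y S(2) by blast
  show "brk L \<zero> y \<in> S \<and> \<chi> (brk L \<zero> y) = 0"
   using brk_smult_left[of "\<zero>" y 0] cy S_D(2) lin_zero[OF lin_left[OF cy]] smult_simps(1)[OF brk_closed, of "\<zero>" y]
   by (simp add: smult_zero)
  show "brk L (a \<oplus> b) y \<in> S \<and> \<chi> (brk L (a \<oplus> b) y) = 0"
   if "a \<in> carrier L" "b \<in> carrier L" "brk L a y \<in> S \<and> \<chi> (brk L a y) = 0" "brk L b y \<in> S \<and> \<chi> (brk L b y) = 0" for a b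
   using that cy S_D(3) by (simp add: brk_add_left chi_add brk_closed)
  show "brk L (c \<odot> a) y \<in> S \<and> \<chi> (brk L (c \<odot> a) y) = 0"
   if "a \<in> carrier L" "brk L a y \<in> S \<and> \<chi> (brk L a y) = 0" for c a
   using that cy S_D(4) by (simp add: brk_smult_left chi_smult brk_closed)
 qed (use S(2) G y in auto)
 assume x: "x \<in> S" and "y \<in> S"
 then have y: "y \<in> kspan L (gens E vs)" using S(1) by simp
 have cx: "x \<in> carrier L" using x S_D(1) by blast
 show ?thesis using y
 proof (rule span_induct)
  show "brk L x \<zero> \<in> S \<and> \<chi> (brk L x \<zero>) = 0"
   using brk_smult_right[of "\<zero>" x 0] cx S_D(2) lin_zero[OF lin_right[OF cx]] smult_simps(1)[OF brk_closed, of x "\<zero>"]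
   by (simp add: smult_zero)
  show "brk L x (a \<oplus> b) \<in> S \<and> \<chi> (brk L x (a \<oplus> b)) = 0"
   if "a \<in> carrier L" "b \<in> carrier L" "brk L x a \<in> S \<and> \<chi> (brk L x a) = 0" "brk L x b \<in> S \<and> \<chi> (brk L x b) = 0" for a b
   using that cx S_D(3) by (simp add: brk_add_right chi_add brk_closed)
  show "brk L x (c \<odot> a) \<in> S \<and> \<chi> (brk L x (c \<odot> a)) = 0"
   if "a \<in> carrier L" "brk L x a \<in> S \<and> \<chi> (brk L x a) = 0" for c a
   using that cx S_D(4) by (simp add: brk_smult_right chi_smult brk_closed)
 qed (use S 1 x in auto)
qed

lemma S_low1: "S \<subseteq> low 1"
proof -
 obtain E vs where E: "E \<subseteq> gr (- 1) \<inter> hcomp L 0" "set vs \<subseteq> gr (- 1) \<inter> hcomp L 1" and S: "S = kspan L (gens E vs)"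
  using assocE by metis
 have "gens E vs \<subseteq> (\<Union>k\<in>{..- int 1}. gr k)"
 proof
  fix x assume "x \<in> gens E vs"
  then consider "x \<in> gr (- 1)" | k where "2 \<le> k" "x \<in> gr (- k)"
   unfolding gens_def using E set_take_subset[of "length vs div 2" vs] by blast
  then show "x \<in> (\<Union>k\<in>{..- int 1}. gr k)" by cases (force, force)
 qed
 then have "gens E vs \<subseteq> low 1" unfolding low_def using span_gen[OF low_gens, of 1] by blast
 then show ?thesis unfolding S low_def using span_least span_sub[OF low_gens] by blast
qed

text \<open>As p exceeds 2, the image has components in degrees at most -3 only: these belong to
  \<open>S\<close>, and \<chi> vanishes on them.\<close>

lemma S_pmap: "x \<in> S ==> x \<in> hcomp L 0 ==> pmap L x \<in> S \<and> \<chi> (pmap L x) = 0"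
proof -
 assume x: "x \<in> S" "x \<in> hcomp L 0"
 have p: "CHAR('k) > 2"
 proof -
  have "CHAR('k) \<noteq> 2" using two of_nat_CHAR[where 'a = 'k] by (metis of_nat_numeral)
  then show ?thesis using prime_ge_2_nat[OF prime_CHAR] by simp
 qed
 have y: "pmap L x \<in> kspan L (\<Union>k\<in>{..- int (CHAR('k) * 1)}. gr k)" using pm_low[of x 1] x S_low1 by (auto simp: low_def)
 have "(\<Union>k\<in>{..- int (CHAR('k) * 1)}. gr k) \<subseteq> S" using p by (intro UN_least S_low) auto
 then have "pmap L x \<in> S" using span_least[OF S_sub] y by blast
 moreover have "\<chi> (pmap L x) = 0"
  using y low_gens lin_chi by (rule lin_span) (use chi_gr p in force)
 ultimately show ?thesis by blast
qed

text \<open>A partial dual system: the \<open>z i\<close> lie in \<open>S\<close> but need not span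
  it yet. The degree of \<open>u i\<close> is forced by that of \<open>z i\<close>, since \<chi> is
  concentrated in degree -2.\<close>

definition dual :: "nat => (nat => 'g) => (nat => 'g) => (nat => nat) => (nat => bit) => bool" where
 "dual n z u d a \<longleftrightarrow>
   (\<forall>i<n. z i \<in> S \<and> z i \<in> gr (- int (d i)) \<and> z i \<in> hcomp L (a i) \<and>
    u i \<in> gr (int (d i) - 2) \<and> u i \<in> hcomp L (a i) \<and> 1 \<le> d i) \<and>
   (\<forall>i<n. \<forall>j<n. \<chi> (brk L (z i) (u j)) = (if i = j then 1 else 0))"

lemma dualD:
 assumes "dual n z u d a"
 shows "i < n ==> z i \<in> S" "i < n ==> z i \<in> gr (- int (d i))" "i < n ==> z i \<in> hcomp L (a i)"
  "i < n ==> u i \<in> gr (int (d i) - 2)" "i < n ==> u i \<in> hcomp L (a i)" "i < n ==> 1 \<le> d i"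
  "i < n ==> j < n ==> \<chi> (brk L (z i) (u j)) = (if i = j then 1 else 0)"
  "i < n ==> z i \<in> carrier L" "i < n ==> u i \<in> carrier L"
 using assms hc_cl unfolding dual_def by blast+

lemma dual_coeff:
 assumes D: "dual n z u d a" and j: "j < n"
 shows "\<chi> (brk L (lc c z n) (u j)) = c j" "\<chi> (brk L (z j) (lc c u n)) = c j"
proof -
 have "\<chi> (brk L (lc c z n) (u j)) = (\<Sum>i<n. c i * \<chi> (brk L (z i) (u j)))"
  using lin_lc[OF lin_left[OF dualD(9)[OF D j]], of n z c] dualD(8)[OF D] by blast
 also have "\<dots> = (\<Sum>i<n. if i = j then c i else 0)" by (intro sum.cong) (auto simp: dualD(7)[OF D] j)
 finally show "\<chi> (brk L (lc c z n) (u j)) = c j" using j by simp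
 have "\<chi> (brk L (z j) (lc c u n)) = (\<Sum>i<n. c i * \<chi> (brk L (z j) (u i)))"
  using lin_lc[OF lin_right[OF dualD(8)[OF D j]], of n u c] dualD(9)[OF D] by blast
 also have "\<dots> = (\<Sum>i<n. if i = j then c i else 0)" by (intro sum.cong) (auto simp: dualD(7)[OF D] j)
 finally show "\<chi> (brk L (z j) (lc c u n)) = c j" using j by simp
qed

text \<open>Pairing with the \<open>u j\<close> reads off coefficients, so the \<open>z i\<close>
  are independent. With more vectors than forms in \<Phi>, some nontrivial combination would be
  killed by all of \<Phi> and hence be zero.\<close>

lemma dual_bound: "dual n z u d a ==> n \<le> card \<Phi>"
proof (rule ccontr)
 assume D: "dual n z u d a" and "\<not> n \<le> card \<Phi>"
 then have n: "card \<Phi> < n" by simp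
 let ?N = "card \<Phi>"
 obtain h where h: "bij_betw h {..<?N} \<Phi>"
  using ex_bij_betw_nat_finite[OF Phi_finite] by (auto simp: atLeast0LessThan)
 define F where "F x i = h i x" for x i
 have lin_F: "lin (\<lambda>x. F x i)" if "i < ?N" for i
  using Phi_lin[OF bij_betwE[OF h, rule_format, of i]] that by (simp add: F_def)
 \<comment> \<open>The values of the forms make up the first rows and the matrix is filled up with
   zero rows. As \<open>card \<Phi> < n\<close>, the last row is zero, so the determinant vanishes
   and there is a kernel vector.\<close>
 let ?r = "\<lambda>i. if i = n - 1 then 0\<^sub>v n else vec n (\<lambda>j. if i < ?N then F (z j) i else 0)"
 let ?M = "mat\<^sub>r n n ?r"
 have "det ?M = 0" using n by (intro det_row_0) auto
 then obtain v where v: "v \<in> carrier_vec n" "v \<noteq> 0\<^sub>v n" "?M *\<^sub>v v = 0\<^sub>v n"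
  using det_0_iff_vec_prod_zero_field[of ?M n] by auto
 let ?x = "lc (\<lambda>j. v $ j) z n"
 have "F ?x i = 0" if i: "i < ?N" for i
 proof -
  have "F ?x i = (\<Sum>j<n. v $ j * F (z j) i)" using lin_lc[OF lin_F[OF i], of n z] dualD(8)[OF D] by blast
  also have "\<dots> = (?M *\<^sub>v v) $ i"
   using i n v(1) by (auto simp: scalar_prod_def atLeast0LessThan mult.commute)
  also have "\<dots> = 0" unfolding v(3) using i n by simp
  finally show ?thesis .
 qed
 then have hx: "h i ?x = 0" if "i < ?N" for i using that by (simp add: F_def)
 have "?x = \<zero>"
 proof (rule Phi_inj)
  show "?x \<in> carrier L" using lc_cl dualD(8)[OF D] by blast
  fix f assume "f \<in> \<Phi>"
  then obtain i where "i < ?N" "f = h i" using bij_betw_imp_surj_on[OF h] by blast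
  then show "f ?x = 0" using hx by blast
 qed
 then have "v $ j = 0" if "j < n" for j
  using dual_coeff(1)[OF D that, of "\<lambda>j. v $ j"] lin_zero[OF lin_left[OF dualD(9)[OF D that]]] by simp
 then show False using v by auto
qed

text \<open>A Gram-Schmidt step: remove from \<open>w\<close> its expansion, find a partner by
  \<open>nondeg\<close>, normalise it and make it orthogonal to the old \<open>z i\<close>. All
  coefficients vanish unless degree and parity agree, so homogeneity and membership in
  \<open>S\<close> survive.\<close>

lemma dual_extend:
 assumes D: "dual n z u d a" and w: "w \<in> S" "w \<in> gr (- int e)" "w \<in> hcomp L b" "1 \<le> e"
  and ne: "w \<noteq> lc (\<lambda>i. \<chi> (brk L w (u i))) z n"
 shows "\<exists>z u d a. dual (Suc n) z u d a"
proof -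
 note zc = dualD(8)[OF D] and uc = dualD(9)[OF D]
 have wc: "w \<in> carrier L" using w gr_cl by blast
 let ?c = "\<lambda>i. \<chi> (brk L w (u i))"
 have hom: "d i = e \<and> a i = b" if "i < n" "?c i \<noteq> 0" for i
  using chi_degree[OF that(2) w(2) dualD(4)[OF D that(1)]] chi_parity[OF that(2) w(3) dualD(5)[OF D that(1)]] by auto
 define w' where "w' = w \<oplus> lc (\<lambda>i. - ?c i) z n"
 have lcc: "lc (\<lambda>i. - ?c i) z n \<in> carrier L" "lc ?c z n \<in> carrier L" using zc by (auto intro: lc_cl)
 have w'_in: "w' \<in> W" if W: "ksubspace W L" "w \<in> W" "\<And>i. i < n ==> d i = e ==> a i = b ==> z i \<in> W" for W
  unfolding w'_def using hom W(2,3) zc by (intro ksubspaceD(3)[OF W(1)] lc_sub[OF W(1)]) auto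
 have w'S: "w' \<in> S" by (rule w'_in[OF S_sub w(1)]) (rule dualD(1)[OF D])
 have w'g: "w' \<in> gr (- int e)" by (rule w'_in[OF gr_sub w(2)]) (use dualD(2)[OF D] in blast)
 have w'h: "w' \<in> hcomp L b" by (rule w'_in[OF hcomp_subspace w(3)]) (use dualD(3)[OF D] in blast)
 have w'c: "w' \<in> carrier L" using w'g gr_cl by blast
 have nz: "w' \<noteq> \<zero>"
 proof
  assume "w' = \<zero>"
  moreover have "lc (\<lambda>i. - ?c i) z n \<oplus> lc ?c z n = \<zero>"
   using lc_add[of n z "\<lambda>i. - ?c i" ?c] lc_zero[of n z "\<lambda>i. - ?c i + ?c i"] zc by simp
  ultimately have "w = lc ?c z n" using V.a_assoc[OF wc lcc] wc lcc(2) by (simp add: w'_def)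
  then show False using ne by simp
 qed
 have w'u: "\<chi> (brk L w' (u j)) = 0" if j: "j < n" for j
  unfolding w'_def using linD(1)[OF lin_left[OF uc[OF j]] wc lcc(1)] dual_coeff(1)[OF D j] by simp
 obtain k b' u0 where u0: "u0 \<in> gr k" "u0 \<in> hcomp L b'" "\<chi> (brk L w' u0) \<noteq> 0"
  using nondeg[OF w'g w'h w(4) nz] by blast
 have k: "k = int e - 2" using chi_degree[OF u0(3) w'g u0(1)] by simp
 have b': "b' = b" using chi_parity[OF u0(3) w'h u0(2)] by simp
 define u1 where "u1 = inverse (\<chi> (brk L w' u0)) \<odot> u0"
 have u1: "u1 \<in> gr (int e - 2)" "u1 \<in> hcomp L b" using u0 k b' gr_D(4) hcomp_D(4) by (auto simp: u1_def)
 have u1c: "u1 \<in> carrier L" using u1 gr_cl by blast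
 have w'u1: "\<chi> (brk L w' u1) = 1"
  unfolding u1_def using linD(2)[OF lin_right[OF w'c] gr_cl[OF u0(1)]] u0(3) by simp
 define u' where "u' = u1 \<oplus> lc (\<lambda>i. - \<chi> (brk L (z i) u1)) u n"
 have hom': "d i = e \<and> a i = b" if "i < n" "\<chi> (brk L (z i) u1) \<noteq> 0" for i
  using chi_degree[OF that(2) dualD(2)[OF D that(1)] u1(1)] chi_parity[OF that(2) dualD(3)[OF D that(1)] u1(2)] by auto
 have u'_in: "u' \<in> W" if W: "ksubspace W L" "u1 \<in> W" "\<And>i. i < n ==> d i = e ==> a i = b ==> u i \<in> W" for W
  unfolding u'_def using hom' W(2,3) uc by (intro ksubspaceD(3)[OF W(1)] lc_sub[OF W(1)]) auto
 have u'g: "u' \<in> gr (int e - 2)" by (rule u'_in[OF gr_sub u1(1)]) (use dualD(4)[OF D] in blast)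
 have u'h: "u' \<in> hcomp L b" by (rule u'_in[OF hcomp_subspace u1(2)]) (use dualD(5)[OF D] in blast)
 have lcu: "lc (\<lambda>i. - \<chi> (brk L (z i) u1)) u n \<in> carrier L" using uc by (auto intro: lc_cl)
 have zu': "\<chi> (brk L (z j) u') = 0" if j: "j < n" for j
  unfolding u'_def using linD(1)[OF lin_right[OF zc[OF j]] u1c lcu] dual_coeff(2)[OF D j] by simp
 have "\<chi> (brk L w' (lc (\<lambda>i. - \<chi> (brk L (z i) u1)) u n)) = 0"
  using lin_lc[OF lin_right[OF w'c], of n u] uc w'u by simp
 then have w'u': "\<chi> (brk L w' u') = 1"
  unfolding u'_def using linD(1)[OF lin_right[OF w'c] u1c lcu] w'u1 by simp
 have "dual (Suc n) (z(n := w')) (u(n := u')) (d(n := e)) (a(n := b))"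
  unfolding dual_def less_Suc_eq using D w'S w'g w'h u'g u'h w(4) zu' w'u' w'u by (auto simp: dual_def)
 then show ?thesis by blast
qed

text \<open>Take a system that cannot be extended; one exists by \<open>dual_bound\<close>. By
  \<open>dual_extend\<close> every homogeneous element of \<open>S\<close> of negative degree then
  equals its expansion.\<close>

lemma exists_dual:
 obtains n z u d a where "dual n z u d a"
  "\<And>w e b. w \<in> S ==> w \<in> gr (- int e) ==> w \<in> hcomp L b ==> 1 \<le> e ==> w = lc (\<lambda>i. \<chi> (brk L w (u i))) z n"
proof -
 let ?P = "\<lambda>n. \<exists>z u d a. dual n z u d a"
 have "\<exists>n. ?P n \<and> \<not> ?P (Suc n)"
 proof (rule ccontr)
  assume *: "\<not> ?thesis"
  have "?P n" for n
  proof (induction n)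
   case (Suc n)
   then show ?case using * by blast
  qed (simp add: dual_def)
  then show False using dual_bound[of "Suc (card \<Phi>)"] by fastforce
 qed
 then obtain n z u d a where "dual n z u d a" "\<not> ?P (Suc n)" by blast
 then show thesis using dual_extend by (intro that) blast+
qed

lemma sorted_dual:
 obtains n z u d a where "dual n z u d a" "\<And>i j. i \<le> j ==> j < n ==> d j \<le> d i" "S \<subseteq> kspan L (z ` {..<n})"
proof -
 obtain n z u d a where D: "dual n z u d a" and
  ex: "\<And>w e b. w \<in> S ==> w \<in> gr (- int e) ==> w \<in> hcomp L b ==> 1 \<le> e ==> w = lc (\<lambda>i. \<chi> (brk L w (u i))) z n"
  using exists_dual by metis
 obtain E vs where E: "E \<subseteq> gr (- 1) \<inter> hcomp L 0" "set vs \<subseteq> gr (- 1) \<inter> hcomp L 1" and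
  S: "S = kspan L (gens E vs)" "gens E vs \<subseteq> carrier L"
  using assocE by metis
 have zc: "z ` {..<n} \<subseteq> carrier L" using dualD(8)[OF D] by blast
 note T = span_sub[OF zc]
 have hom: "w \<in> kspan L (z ` {..<n})" if "w \<in> S" "w \<in> gr (- int e)" "w \<in> hcomp L b" "1 \<le> e" for w e b
  by (subst ex[OF that]) (use dualD(8)[OF D] span_gen[OF zc] in \<open>auto intro!: lc_sub[OF T]\<close>)
 have gS: "gens E vs \<subseteq> S" using S span_gen by blast
 have "gens E vs \<subseteq> kspan L (z ` {..<n})"
 proof
  fix x assume x: "x \<in> gens E vs"
  then have xS: "x \<in> S" using gS by blast
  consider b where "x \<in> gr (- int 1)" "x \<in> hcomp L b" | k where "2 \<le> k" "x \<in> gr (- k)"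
   using x unfolding gens_def using E set_take_subset[of "length vs div 2" vs] by fastforce
  then show "x \<in> kspan L (z ` {..<n})"
  proof cases
   case 1
   then show ?thesis using hom[OF xS] by blast
  next
   case 2
   obtain y w where yw: "y \<in> gr (- k) \<inter> hcomp L 0" "w \<in> gr (- k) \<inter> hcomp L 1" "x = y \<oplus> w"
    using gr_split[OF 2(2)] by blast
   have k: "- k = - int (nat k)" "1 \<le> nat k" "gr (- k) \<subseteq> S" using 2 S_low[of "- k"] by auto
   have "y \<in> kspan L (z ` {..<n})" "w \<in> kspan L (z ` {..<n})"
    using yw k(3) hom[of y "nat k" 0, folded k(1), OF _ _ _ k(2)] hom[of w "nat k" 1, folded k(1), OF _ _ _ k(2)] by blast+
   then show ?thesis unfolding yw(3) by (rule ksubspaceD(3)[OF T])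
  qed
 qed
 then have gen: "S \<subseteq> kspan L (z ` {..<n})" unfolding S(1) by (rule span_least[OF T])
 \<comment> \<open>Sorting by the negative of \<open>d\<close> lists the depths in decreasing order,
   as the straightening argument requires.\<close>
 define js where "js = sort_key (\<lambda>i. - int (d i)) [0..<n]"
 have js: "length js = n" "distinct js" "set js = {..<n}" by (auto simp: js_def)
 have jn: "js ! i < n" if "i < n" for i using js nth_mem[of i js] that by auto
 have srt: "d (js ! j) \<le> d (js ! i)" if "i \<le> j" "j < n" for i j
  using sorted_nth_mono[of "map (\<lambda>i. - int (d i)) js" i j] sorted_sort_key[of "\<lambda>i. - int (d i)" "[0..<n]"] that js(1)
  by (simp add: js_def)
 have "dual n (\<lambda>i. z (js ! i)) (\<lambda>i. u (js ! i)) (\<lambda>i. d (js ! i)) (\<lambda>i. a (js ! i))"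
  unfolding dual_def
 proof (intro conjI allI impI)
  fix i j assume ij: "i < n" "j < n"
  have "js ! i = js ! j \<longleftrightarrow> i = j" using ij js by (simp add: nth_eq_iff_index_eq)
  then show "\<chi> (brk L (z (js ! i)) (u (js ! j))) = (if i = j then 1 else 0)" using dualD(7)[OF D jn[OF ij(1)] jn[OF ij(2)]] by simp
 qed (use dualD[OF D] jn in auto)
 moreover have "(\<lambda>i. z (js ! i)) ` {..<n} = z ` {..<n}"
 proof -
  have "(\<lambda>i. js ! i) ` {..<n} = {..<n}" using js by (auto simp: set_conv_nth)
  then show ?thesis by (metis image_image)
 qed
 ultimately show thesis
  using srt gen that[of n "\<lambda>i. z (js ! i)" "\<lambda>i. u (js ! i)" "\<lambda>i. d (js ! i)" "\<lambda>i. a (js ! i)"] by simp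
qed

lemma span_expand:
 assumes D: "dual n z u d a" and x: "x \<in> kspan L (z ` {..<n})"
 shows "x = lc (\<lambda>i. \<chi> (brk L x (u i))) z n"
proof -
 have zc: "z ` {..<n} \<subseteq> carrier L" using dualD(8)[OF D] by blast
 note zc' = dualD(8)[OF D]
 have gen: "z j = lc (\<lambda>i. \<chi> (brk L (z j) (u i))) z n" if "j < n" for j
 proof -
  have "lc (\<lambda>i. \<chi> (brk L (z j) (u i))) z m = lc (\<lambda>i. if j = i then 1 else 0) z m" if "m \<le> n" for m
   using that by (induction m) (auto simp: dualD(7)[OF D \<open>j < n\<close>])
  then show ?thesis using lc_single[OF zc' that] by simp
 qed
 have cong: "lc c z n = lc c' z n" if "\<And>i. i < n ==> c i = c' i" for c c'
 proof -
  have "lc c z m = lc c' z m" if "m \<le> n" for m using that \<open>\<And>i. i < n ==> c i = c' i\<close> by (induction m) auto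
  then show ?thesis by simp
 qed
 show ?thesis using x
 proof (rule span_induct)
  show "\<zero> = lc (\<lambda>i. \<chi> (brk L \<zero> (u i))) z n"
   using lc_zero[OF zc', of n] lin_zero[OF lin_left[OF dualD(9)[OF D]]] by simp
  fix x y assume xy: "x \<in> carrier L" "y \<in> carrier L" "x = lc (\<lambda>i. \<chi> (brk L x (u i))) z n" "y = lc (\<lambda>i. \<chi> (brk L y (u i))) z n"
  have "lc (\<lambda>i. \<chi> (brk L (x \<oplus> y) (u i))) z n = lc (\<lambda>i. \<chi> (brk L x (u i)) + \<chi> (brk L y (u i))) z n"
   using linD(1)[OF lin_left[OF dualD(9)[OF D]] xy(1,2)] by (intro cong) simp
  also have "\<dots> = x \<oplus> y" using lc_add[OF zc', of n] xy(3,4) by simp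
  finally show "x \<oplus> y = lc (\<lambda>i. \<chi> (brk L (x \<oplus> y) (u i))) z n" by simp
 next
  fix c x assume x: "x \<in> carrier L" "x = lc (\<lambda>i. \<chi> (brk L x (u i))) z n"
  have "lc (\<lambda>i. \<chi> (brk L (c \<odot> x) (u i))) z n = lc (\<lambda>i. c * \<chi> (brk L x (u i))) z n"
   using linD(2)[OF lin_left[OF dualD(9)[OF D]] x(1)] by (intro cong) simp
  also have "\<dots> = c \<odot> x" using lc_smult[OF zc', of n] x(2) by simp
  finally show "c \<odot> x = lc (\<lambda>i. \<chi> (brk L (c \<odot> x) (u i))) z n" by simp
 qed (use zc gen in auto)
qed

text \<open>The coefficient of \<open>z i\<close> in \<open>x\<close> is the \<chi>-value of the
  bracket with \<open>u i\<close>, so information on the degree of \<open>x\<close> limits the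
  indices that occur.\<close>

lemma span_restrict:
 assumes D: "dual n z u d a" and x: "x \<in> kspan L (z ` {..<n})" and A: "\<And>i. i < n ==> \<chi> (brk L x (u i)) \<noteq> 0 ==> Q i"
 shows "x \<in> kspan L (z ` {l. l < n \<and> Q l})"
proof -
 have zc: "z ` {l. l < n \<and> Q l} \<subseteq> carrier L" using dualD(8)[OF D] by blast
 have "lc (\<lambda>i. \<chi> (brk L x (u i))) z n \<in> kspan L (z ` {l. l < n \<and> Q l})"
  using A span_gen[OF zc] dualD(8)[OF D] by (intro lc_sub[OF span_sub[OF zc]]) auto
 then show ?thesis using span_expand[OF D x] by simp
qed

theorem projective_and_matrix:
 "projective_supermodule TYPE('m) TYPE('n) (reduced_env L \<chi>) (Q_module L S \<chi>)
  \<and> algebra_iso (reduced_env L \<chi>)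
    (matrix_algebra (kdim (reduced_env (sub_lie L S) \<chi>))
     (opposite_superalgebra (End_superalgebra (reduced_env L \<chi>) (Q_module L S \<chi>))))"
proof -
 obtain n z u d a where D: "dual n z u d a" and srt: "\<And>i j. i \<le> j ==> j < n ==> d j \<le> d i" and gen: "S \<subseteq> kspan L (z ` {..<n})"
  using sorted_dual by metis
 interpret good_grading L \<chi> gr S z u d a n
 proof (intro good_grading.intro good_grading_axioms.intro super_env_algebra_axioms)
  fix x k assume x: "x \<in> S" "x \<in> gr k"
  show "x \<in> kspan L (z ` {l. l < n \<and> int (d l) = - k})"
  proof (rule span_restrict[OF D])
   show "x \<in> kspan L (z ` {..<n})" using x gen by blast
   show "int (d i) = - k" if "i < n" "\<chi> (brk L x (u i)) \<noteq> 0" for i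
    using chi_degree[OF that(2) x(2) dualD(4)[OF D that(1)]] by linarith
  qed
 next
  fix i assume i: "i < n" "a i = 0"
  have z: "z i \<in> kspan L (\<Union>k\<in>{..- int (d i)}. gr k)" using dualD(2)[OF D i(1)] span_gen[OF low_gens, of "d i"] by blast
  have "z i \<in> hcomp L 0" using dualD(3)[OF D i(1)] i by simp
  note y = pm_low[OF z this dualD(6)[OF D i(1)]]
  show "pmap L (z i) \<in> kspan L (z ` {l. l < n \<and> CHAR('k) * d i \<le> d l})"
  proof (rule span_restrict[OF D])
   show "pmap L (z i) \<in> kspan L (z ` {..<n})" using S_pmap[of "z i"] dualD(1)[OF D i(1)] \<open>z i \<in> hcomp L 0\<close> gen by blast
   fix l assume l: "l < n" and nz: "\<chi> (brk L (pmap L (z i)) (u l)) \<noteq> 0"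
   \<comment> \<open>If \<open>d l\<close> were smaller, brackets of elements of degree at most
     \<open>- p * d i\<close> with \<open>u l\<close> would have degree below -2, where \<chi>
     vanishes; the coefficient of \<open>z l\<close> would be 0.\<close>
   show "CHAR('k) * d i \<le> d l"
   proof (rule ccontr)
    assume less: "\<not> CHAR('k) * d i \<le> d l"
    have "\<chi> (brk L (pmap L (z i)) (u l)) = 0"
    proof (rule lin_span[OF y low_gens lin_left[OF dualD(9)[OF D l]]])
     fix w assume "w \<in> (\<Union>k\<in>{..- int (CHAR('k) * d i)}. gr k)"
     then obtain k where k: "k \<le> - int (CHAR('k) * d i)" "w \<in> gr k" by blast
     have "int (d l) < int (CHAR('k) * d i)" using less by (simp only: of_nat_less_iff not_le)
     then have "k + (int (d l) - 2) \<noteq> - 2" using k(1) by linarith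
     then show "\<chi> (brk L w (u l)) = 0" using chi_degree[OF _ k(2) dualD(4)[OF D l]] by blast
    qed
    then show False using nz by simp
   qed
  qed
 qed (fact prime_CHAR gr_brk chi_add chi_smult chi_gr chi_odd S_sub S_low S_pmap gen srt dualD[OF D] | erule (1) S_brk)+
 show ?thesis by (rule main)
qed

end

section \<open>The exceptional Lie superalgebras\<close>

lemma infinite_alg_closed_field: "infinite (UNIV :: 'k::alg_closed_field set)"
proof
 assume fin: "finite (UNIV :: 'k set)"
 let ?q = "\<Prod>a\<in>UNIV. [:- a, 1:] :: 'k poly"
 have q: "poly ?q x = 0" for x using fin by (auto simp: poly_prod prod_zero_iff intro!: exI[of _ x])
 have q0: "?q \<noteq> 0" using fin by (auto simp: prod_zero_iff)
 show False
 proof (cases "degree (?q + 1) = 0")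
  case True
  then obtain c where "?q + 1 = [:c:]" by (rule degree_eq_zeroE)
  then have c: "?q = [:c - 1:]" by (metis add_diff_cancel_right' diff_pCons one_pCons diff_0_right)
  then have "c - 1 = 0" using q[of 0] by simp
  then show False using c q0 by simp
 next
  case False
  then obtain x where "poly (?q + 1) x = 0" using alg_closed_imp_poly_has_root[of "?q + 1"] by auto
  then show False using q[of x] by simp
 qed
qed

text \<open>Laurent polynomials of degree at most \<open>e\<close> as functions of a nonzero scalar.
  Writing them as a power times a polynomial in the inverse makes closure under sums and products
  immediate.\<close>

definition laurent_le :: "int => ('k::field => 'k) => bool" where
 "laurent_le e f \<longleftrightarrow> (\<exists>q. \<forall>t. t \<noteq> 0 \<longrightarrow> f t = t powi e * poly q (inverse t))"

lemma laurent_le_single: "k \<le> e ==> laurent_le e (\<lambda>t. t powi k * c)"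
proof -
 assume k: "k \<le> e"
 have "t powi k = t powi e * inverse t ^ nat (e - k)" if "t \<noteq> 0" for t :: 'a
 proof -
  have "t powi k = t powi (e + (- int (nat (e - k))))" using k by simp
  also have "\<dots> = t powi e * t powi (- int (nat (e - k)))" using that by (subst power_int_add) auto
  finally show ?thesis by (simp only: power_int_minus power_int_of_nat power_inverse)
 qed
 then show ?thesis unfolding laurent_le_def by (intro exI[of _ "monom c (nat (e - k))"]) (auto simp: poly_monom mult_ac)
qed

lemma laurent_le_zero: "laurent_le e (\<lambda>t. 0)" using laurent_le_single[of e e 0] by simp

lemma laurent_le_add: "laurent_le e f ==> laurent_le e g ==> laurent_le e (\<lambda>t. f t + g t)"
proof -
 assume "laurent_le e f" "laurent_le e g"
 then obtain p q where "\<forall>t. t \<noteq> 0 \<longrightarrow> f t = t powi e * poly p (inverse t)" "\<forall>t. t \<noteq> 0 \<longrightarrow> g t = t powi e * poly q (inverse t)"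
  by (auto simp: laurent_le_def)
 then show ?thesis unfolding laurent_le_def by (intro exI[of _ "p + q"]) (simp add: distrib_left)
qed

lemma laurent_le_mult: "laurent_le e f ==> laurent_le e' g ==> laurent_le (e + e') (\<lambda>t. f t * g t)"
proof -
 assume "laurent_le e f" "laurent_le e' g"
 then obtain p q where "\<forall>t. t \<noteq> 0 \<longrightarrow> f t = t powi e * poly p (inverse t)" "\<forall>t. t \<noteq> 0 \<longrightarrow> g t = t powi e' * poly q (inverse t)"
  by (auto simp: laurent_le_def)
 then show ?thesis unfolding laurent_le_def by (intro exI[of _ "p * q"]) (simp add: power_int_add)
qed

lemma laurent_le_sum: "(\<And>i. i \<in> A ==> laurent_le e (f i)) ==> laurent_le e (\<lambda>t. \<Sum>i\<in>A. f i t)"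
 by (induction A rule: infinite_finite_induct) (auto intro: laurent_le_zero laurent_le_add)

lemma laurent_le_cmult: "laurent_le e f ==> laurent_le e (\<lambda>t. c * f t)"
 using laurent_le_mult[OF laurent_le_single[of 0 0 c], of e f] by simp

lemma laurent_le_cong: "laurent_le e f ==> (\<And>t. t \<noteq> 0 ==> g t = f t) ==> laurent_le e g"
 by (simp add: laurent_le_def)

text \<open>Substitute the inverse of \<open>t\<close> and clear denominators with an upper bound
  \<open>M\<close> of the exponents: two polynomials agree at infinitely many points, so their
  coefficients agree, and on one side the coefficient in question is 0 by degree.\<close>

lemma laurent_le_coeff:
 fixes c :: "int => 'k::field"
 assumes inf: "infinite (UNIV :: 'k set)" and K: "finite K" and f: "laurent_le e f"
  and eq: "\<And>t. t \<noteq> 0 ==> f t = (\<Sum>k\<in>K. t powi k * c k)" and l: "l \<in> K" "e < l"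
 shows "c l = 0"
proof -
 obtain q where q: "\<And>t. t \<noteq> 0 ==> f t = t powi e * poly q (inverse t)" using f by (auto simp: laurent_le_def)
 obtain M where M: "\<And>k. k \<in> K ==> k \<le> M"
  using K by (metis Max_ge)
 let ?P = "\<Sum>k\<in>K. monom (c k) (nat (M - k))" and ?Q = "monom 1 (nat (M - e)) * q"
 have eM: "e < M" using M[OF l(1)] l(2) by simp
 have pw: "s powi M * inverse s powi k = s ^ nat (M - k)" if "s \<noteq> 0" "k \<le> M" for s :: 'k and k
 proof -
  have "s powi M * inverse s powi k = s powi (M + - k)"
   using that by (subst power_int_add) (auto simp: power_int_minus power_int_inverse)
  also have "\<dots> = s powi int (nat (M - k))" using that by simp
  finally show ?thesis by (simp only: power_int_of_nat)
 qed
 have "poly (?P - ?Q) s = 0" if s: "s \<noteq> 0" for s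
 proof -
  have "poly ?P s = s powi M * (\<Sum>k\<in>K. inverse s powi k * c k)"
   unfolding sum_distrib_left poly_sum
   by (intro sum.cong refl) (simp only: poly_monom pw[OF s M, symmetric] mult_ac)
  also have "\<dots> = s powi M * (inverse s powi e * poly q s)" using eq[of "inverse s"] q[of "inverse s"] s by simp
  also have "\<dots> = poly ?Q s" using pw[OF s, of e] eM by (simp only: poly_mult poly_monom mult_1 mult.assoc[symmetric])
  finally show ?thesis by simp
 qed
 then have "- {0} \<subseteq> {s. poly (?P - ?Q) s = 0}" by auto
 moreover have "infinite (- {0 :: 'k})" using inf by (simp add: Compl_eq_Diff_UNIV)
 ultimately have "infinite {s. poly (?P - ?Q) s = 0}" using infinite_super by blast
 then have PQ: "?P = ?Q" using poly_roots_finite[of "?P - ?Q"] by auto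
 have "coeff ?P (nat (M - l)) = (\<Sum>k\<in>K. if k = l then c k else 0)"
  unfolding coeff_sum using M l(1) by (intro sum.cong refl) (auto simp: nat_eq_iff)
 also have "\<dots> = c l" using K l by simp
 finally have "c l = coeff ?Q (nat (M - l))" using PQ by simp
 also have "\<dots> = 0" using l M[OF l(1)] by (simp add: coeff_monom_mult)
 finally show ?thesis .
qed

context super_env_algebra begin

definition even_part :: "'g => 'g" where "even_part x = (SOME y. y \<in> hcomp L 0 \<and> (\<exists>z\<in>hcomp L 1. x = y \<oplus> z))"
definition odd_part :: "'g => 'g" where "odd_part x = (SOME z. z \<in> hcomp L 1 \<and> (\<exists>y\<in>hcomp L 0. x = y \<oplus> z))"

lemma parts_split:
 assumes "y \<in> hcomp L 0" "z \<in> hcomp L 1"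
 shows "even_part (y \<oplus> z) = y" "odd_part (y \<oplus> z) = z"
 unfolding even_part_def odd_part_def using assms split_unique by (blast intro: some_equality)+

lemma parts:
 assumes "x \<in> carrier L"
 shows "even_part x \<in> hcomp L 0" "odd_part x \<in> hcomp L 1" "x = even_part x \<oplus> odd_part x"
proof -
 obtain y z where "y \<in> hcomp L 0" "z \<in> hcomp L 1" "x = y \<oplus> z" using hcomp_split[OF assms] by blast
 then show "even_part x \<in> hcomp L 0" "odd_part x \<in> hcomp L 1" "x = even_part x \<oplus> odd_part x"
  using parts_split by auto
qed

lemma parts_even: "x \<in> hcomp L 0 ==> even_part x = x" "x \<in> hcomp L 0 ==> odd_part x = \<zero>"
 using parts_split[of x "\<zero>"] hcomp_D(2) V.r_zero[OF subsetD[OF hc], of x 0] by simp_all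

lemma parts_add:
 assumes "x \<in> carrier L" "y \<in> carrier L"
 shows "even_part (x \<oplus> y) = even_part x \<oplus> even_part y" "odd_part (x \<oplus> y) = odd_part x \<oplus> odd_part y"
proof -
 note p = parts[OF assms(1)] parts[OF assms(2)]
 have c: "even_part x \<in> carrier L" "odd_part x \<in> carrier L" "even_part y \<in> carrier L" "odd_part y \<in> carrier L" using p hc by auto
 have "x \<oplus> y = (even_part x \<oplus> odd_part x) \<oplus> (even_part y \<oplus> odd_part y)" using p by simp
 also have "\<dots> = (even_part x \<oplus> even_part y) \<oplus> (odd_part x \<oplus> odd_part y)" using c by (simp add: V.a_ac)
 finally show "even_part (x \<oplus> y) = even_part x \<oplus> even_part y" "odd_part (x \<oplus> y) = odd_part x \<oplus> odd_part y"
  using parts_split[OF hcomp_D(3)[OF p(1,4)] hcomp_D(3)[OF p(2,5)]] by simp_all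
qed

lemma parts_smult:
 assumes "x \<in> carrier L"
 shows "even_part (c \<odot> x) = c \<odot> even_part x" "odd_part (c \<odot> x) = c \<odot> odd_part x"
proof -
 note p = parts[OF assms]
 have "c \<odot> (even_part x \<oplus> odd_part x) = c \<odot> even_part x \<oplus> c \<odot> odd_part x"
  by (intro smult_add subsetD[OF hc p(1)] subsetD[OF hc p(2)])
 then have e: "c \<odot> x = c \<odot> even_part x \<oplus> c \<odot> odd_part x" using p(3) by simp
 show "even_part (c \<odot> x) = c \<odot> even_part x" "odd_part (c \<odot> x) = c \<odot> odd_part x"
  unfolding e using parts_split[OF hcomp_D(4)[OF p(1)] hcomp_D(4)[OF p(2)]] by simp_all
qed

lemma finsum_sub: "finite K ==> ksubspace W L ==> (\<And>k. k \<in> K ==> f k \<in> W) ==> finsum L f K \<in> W"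
proof (induction K rule: finite_induct)
 case (insert k K)
 then have "f \<in> K \<rightarrow> carrier L" "f k \<in> carrier L" using ksubspaceD(1) by blast+
 then show ?case using insert ksubspaceD(3)[OF insert.prems(1)] by (subst V.finsum_insert) auto
qed (simp add: ksubspaceD)

lemma lin_finsum: "finite K ==> lin \<phi> ==> (\<And>k. k \<in> K ==> f k \<in> carrier L) ==> \<phi> (finsum L f K) = (\<Sum>k\<in>K. \<phi> (f k))"
proof (induction K rule: finite_induct)
 case (insert k K)
 then have "f \<in> K \<rightarrow> carrier L" "f k \<in> carrier L" by auto
 then show ?case using insert linD(1)[of \<phi> "f k" "finsum L f K"] by (simp add: V.finsum_insert V.finsum_closed)
qed (simp add: lin_zero)

lemma even_part_finsum:
 "finite K ==> (\<And>k. k \<in> K ==> f k \<in> carrier L) ==> even_part (finsum L f K) = finsum L (\<lambda>k. even_part (f k)) K"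
proof (induction K rule: finite_induct)
 case empty
 then show ?case using parts_even(1)[OF hcomp_D(2)] by simp
next
 case (insert k K)
 then have f: "f \<in> K \<rightarrow> carrier L" "f k \<in> carrier L" by auto
 moreover have "(\<lambda>k. even_part (f k)) \<in> K \<rightarrow> carrier L" "even_part (f k) \<in> carrier L"
  using parts(1) hc insert.prems by blast+
 ultimately have "even_part (finsum L f (insert k K)) = even_part (f k) \<oplus> even_part (finsum L f K)"
  "finsum L (\<lambda>k. even_part (f k)) (insert k K) = even_part (f k) \<oplus> finsum L (\<lambda>k. even_part (f k)) K"
  using V.finsum_insert[OF insert.hyps] parts_add(1)[OF f(2) V.finsum_closed[OF f(1)]] by simp_all
 then show ?case using insert by simp
qed

end

section \<open>Exceptional superalgebras: degrees along the cocharacter\<close>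

lemma conj_add:
 fixes G :: "'k::field mat"
 assumes "G \<in> carrier_mat N N" "A \<in> carrier_mat N N" "B \<in> carrier_mat N N" "H \<in> carrier_mat N N"
 shows "G * (A + B) * H = G * A * H + G * B * H"
 using assms by (simp add: mult_add_distrib_mat[of G N N] add_mult_distrib_mat[of "G * A" N N])

lemma conj_smult:
 fixes G :: "'k::field mat"
 assumes "G \<in> carrier_mat N N" "A \<in> carrier_mat N N" "H \<in> carrier_mat N N"
 shows "G * (c \<cdot>\<^sub>m A) * H = c \<cdot>\<^sub>m (G * A * H)"
 using assms by (simp add: mult_smult_distrib[of G N N] mult_smult_assoc_mat[of "G * A" N N])

locale exceptional_grading = super_env_algebra L \<chi> for L :: "('k::field, 'g) lie_superalg" (structure) and \<chi> +
 fixes fs :: "'k factors" and \<theta> :: "'g => 'k mat list" and \<tau> :: "'g => nat list => 'k"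
  and B :: "'g => 'g => 'k" and X :: 'g and gr :: "int => 'g set"
  and \<gamma> :: "'k => 'k mat list" and b :: nat and C :: "nat => int => 'k mat"
 assumes infinite: "infinite (UNIV :: 'k set)" and prime: "prime CHAR('k)"
  and alg: "i < length fs ==> fst (snd (fs ! i)) \<subseteq> carrier_mat (fst (fs ! i)) (fst (fs ! i))"
  and realized: "exc_realized fs \<theta> \<tau> L" and form: "invariant_form L B" and X_even: "X \<in> hcomp L 0"
  and chi: "x \<in> carrier L ==> \<chi> x = B X x" and cochar: "cocharacter fs \<gamma> b C"
  and gr_eq: "gr = exc_degree_space fs \<theta> \<tau> L \<gamma>" and props: "grading_properties L B X gr"
begin

abbreviation "dm i \<equiv> fst (fs ! i)"

lemma X_cl: "X \<in> carrier L" using X_even hc by blast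

lemmas props_D = props[unfolded grading_properties_def, THEN conjunct1]
 props[unfolded grading_properties_def, THEN conjunct2, THEN conjunct1]
 props[unfolded grading_properties_def, THEN conjunct2, THEN conjunct2, THEN conjunct1]
 props[unfolded grading_properties_def, THEN conjunct2, THEN conjunct2, THEN conjunct2, THEN conjunct1]
 props[unfolded grading_properties_def, THEN conjunct2, THEN conjunct2, THEN conjunct2, THEN conjunct2, THEN conjunct1]
 props[unfolded grading_properties_def, THEN conjunct2, THEN conjunct2, THEN conjunct2, THEN conjunct2,
  THEN conjunct2, THEN conjunct2, THEN conjunct1]
lemmas direct_sum_D = props_D(1)[unfolded internal_direct_sum_def, THEN conjunct2, THEN conjunct1]
 props_D(1)[unfolded internal_direct_sum_def, THEN conjunct2, THEN conjunct2]
lemmas realized_D = realized[unfolded exc_realized_def, THEN conjunct1]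
 realized[unfolded exc_realized_def, THEN conjunct2, THEN conjunct1]
 realized[unfolded exc_realized_def, THEN conjunct2, THEN conjunct2, THEN conjunct1]
 realized[unfolded exc_realized_def, THEN conjunct2, THEN conjunct2, THEN conjunct2, THEN conjunct1]
 realized[unfolded exc_realized_def, THEN conjunct2, THEN conjunct2, THEN conjunct2, THEN conjunct2, THEN conjunct1]
 realized[unfolded exc_realized_def, THEN conjunct2, THEN conjunct2, THEN conjunct2, THEN conjunct2, THEN conjunct2, THEN conjunct1]
lemmas form_D = form[unfolded invariant_form_def, THEN conjunct1]
 form[unfolded invariant_form_def, THEN conjunct2, THEN conjunct1]
 form[unfolded invariant_form_def, THEN conjunct2, THEN conjunct2]

lemma gr_sub: "ksubspace (gr k) L" using direct_sum_D(1) by blast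

lemma gr_cl: "x \<in> gr k ==> x \<in> carrier L" using ksubspaceD(1)[OF gr_sub] by blast

lemma gr_brk: "x \<in> gr k ==> y \<in> gr l ==> brk L x y \<in> gr (k + l)"
 using props_D(2) by blast

lemma gr_split: "x \<in> gr k ==> \<exists>y\<in>gr k \<inter> hcomp L 0. \<exists>z\<in>gr k \<inter> hcomp L 1. x = y \<oplus> z"
proof -
 assume x: "x \<in> gr k"
 have "gr k = {x \<oplus> y | x y. x \<in> gr k \<inter> hcomp L 0 \<and> y \<in> gr k \<inter> hcomp L 1}"
  using props_D(3) by (rule spec)
 then have "x \<in> {x \<oplus> y | x y. x \<in> gr k \<inter> hcomp L 0 \<and> y \<in> gr k \<inter> hcomp L 1}" by (rule subst) (rule x)
 then show ?thesis by blast
qed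

lemma gr_decomp: "x \<in> carrier L ==> \<exists>f K. (\<forall>k. f k \<in> gr k) \<and> finite K \<and> x = finsum L f K"
proof -
 assume "x \<in> carrier L"
 from ex1_implies_ex[OF bspec[OF direct_sum_D(2) this]]
 obtain f where "(\<forall>k. f k \<in> gr k) \<and> finite {k. f k \<noteq> \<zero>} \<and> x = (\<Oplus>k\<in>{k. f k \<noteq> \<zero>}. f k)" by (rule exE)
 then show ?thesis by (intro exI[of _ f] exI[of _ "{k. f k \<noteq> \<zero>}"])
qed

lemma even_part_gr: "x \<in> gr k ==> even_part x \<in> gr k"
 using gr_split parts_split(1) by fastforce

lemma B_D:
 assumes "x \<in> carrier L" "y \<in> carrier L" "z \<in> carrier L"
 shows "B z (x \<oplus> y) = B z x + B z y" "B z (c \<odot> x) = c * B z x" "B (brk L x y) z = B x (brk L y z)"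
 using form_D(1) assms by simp_all

lemma chi_add: "x \<in> carrier L ==> y \<in> carrier L ==> \<chi> (x \<oplus> y) = \<chi> x + \<chi> y"
 by (simp add: chi add_cl B_D(1)[of _ _ X] X_cl)

lemma chi_smult: "x \<in> carrier L ==> \<chi> (c \<odot> x) = c * \<chi> x"
 using B_D(2)[of x x X] by (simp add: chi smult_cl X_cl)

lemma chi_gr: "x \<in> gr k ==> k \<noteq> - 2 ==> \<chi> x = 0"
proof -
 assume x: "x \<in> gr k" "k \<noteq> - 2"
 have "2 + k \<noteq> 0" using x by simp
 then have "B X x = 0" using props_D(4,5) x by blast
 then show ?thesis using chi[OF gr_cl[OF x(1)]] by simp
qed

lemma chi_odd: "x \<in> hcomp L 1 ==> \<chi> x = 0"
proof -
 assume x: "x \<in> hcomp L 1"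
 have "(0 :: bit) \<noteq> 1 \<longrightarrow> B X x = 0" using form_D(2) X_even x by blast
 then show ?thesis using chi[OF subsetD[OF hc x]] by simp
qed

text \<open>By invariance \<chi>([x, y]) = ([X, x], y). If this vanishes for all \<open>y\<close>,
  then \<open>x\<close> centralises \<open>X\<close>, which \<open>grading_properties\<close>
  excludes for a nonzero \<open>x\<close> of negative degree.\<close>

lemma nondeg:
 assumes x: "x \<in> gr (- int d)" "1 \<le> d" "x \<noteq> \<zero>"
 shows "\<exists>k b. \<exists>y\<in>gr k \<inter> hcomp L b. \<chi> (brk L x y) \<noteq> 0"
proof (rule ccontr)
 assume *: "\<not> ?thesis"
 have xc: "x \<in> carrier L" using x gr_cl by blast
 have lin: "lin (\<lambda>y. \<chi> (brk L x y))" using xc by (simp add: lin_def brk_add_right brk_smult_right chi_add chi_smult brk_closed)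
 have hom: "\<chi> (brk L x w) = 0" if w: "w \<in> gr k" for w k
 proof -
  obtain w0 w1 where w: "w0 \<in> gr k \<inter> hcomp L 0" "w1 \<in> gr k \<inter> hcomp L 1" "w = w0 \<oplus> w1" using gr_split[OF w] by blast
  then have "\<chi> (brk L x w0) = 0" "\<chi> (brk L x w1) = 0" "w0 \<in> carrier L" "w1 \<in> carrier L" using * gr_cl by blast+
  then show ?thesis unfolding w(3) using linD(1)[OF lin, of w0 w1] by simp
 qed
 have "B (brk L X x) y = 0" if y: "y \<in> carrier L" for y
 proof -
  obtain f K where f: "\<forall>k. f k \<in> gr k" "finite K" "y = finsum L f K" using gr_decomp[OF y] by blast
  have "\<chi> (brk L x y) = (\<Sum>k\<in>K. \<chi> (brk L x (f k)))"
   unfolding f(3) using f gr_cl by (intro lin_finsum[OF f(2) lin]) blast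
  also have "\<dots> = 0" using f(1) hom by (intro sum.neutral) blast
  finally show ?thesis using B_D(3)[OF X_cl xc y] chi[OF brk_closed[OF xc y]] by simp
 qed
 then have "brk L X x = \<zero>" using form_D(3) brk_closed[OF X_cl xc] by blast
 then have "x \<in> centralizer L X \<inter> gr (- int d)" using xc x(1) by (simp add: centralizer_def)
 moreover have "centralizer L X \<inter> gr (- int d) = {\<zero>}" using props_D(6) x(2) by simp
 ultimately show False using x(3) by simp
qed

lemma theta_len: "x \<in> hcomp L 0 ==> length (\<theta> x) = length fs"
 and theta_cl: "x \<in> hcomp L 0 ==> i < length fs ==> \<theta> x ! i \<in> carrier_mat (dm i) (dm i)"
proof -
 assume x: "x \<in> hcomp L 0"
 have "\<theta> x \<in> {As. length As = length fs \<and> (\<forall>i<length fs. As ! i \<in> fst (snd (fs ! i)))}"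
  using realized_D(2) imageI[OF x, of \<theta>] by simp
 then have t: "length (\<theta> x) = length fs" "\<forall>i<length fs. \<theta> x ! i \<in> fst (snd (fs ! i))" by simp_all
 show "length (\<theta> x) = length fs" by (rule t)
 show "\<theta> x ! i \<in> carrier_mat (dm i) (dm i)" if "i < length fs" using t(2) alg[OF that] that by blast
qed

lemma theta_D:
 assumes "x \<in> hcomp L 0" "i < length fs"
 shows "y \<in> hcomp L 0 ==> \<theta> (x \<oplus> y) ! i = \<theta> x ! i + \<theta> y ! i"
  "\<theta> (c \<odot> x) ! i = c \<cdot>\<^sub>m (\<theta> x ! i)" "\<theta> (pmap L x) ! i = (\<theta> x ! i) ^\<^sub>m CHAR('k)"
proof -
 have *: "\<theta> (x \<oplus> y) = map2 (+) (\<theta> x) (\<theta> y) \<and> \<theta> (c \<odot> x) = map (\<lambda>A. c \<cdot>\<^sub>m A) (\<theta> x)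
   \<and> \<theta> (pmap L x) = map (\<lambda>A. A ^\<^sub>m CHAR('k)) (\<theta> x)" if "y \<in> hcomp L 0" for y
  using realized_D(5) assms that by blast
 show "\<theta> (x \<oplus> y) ! i = \<theta> x ! i + \<theta> y ! i" if "y \<in> hcomp L 0"
  using *[OF that] assms theta_len that by simp
 show "\<theta> (c \<odot> x) ! i = c \<cdot>\<^sub>m (\<theta> x ! i)" "\<theta> (pmap L x) ! i = (\<theta> x ! i) ^\<^sub>m CHAR('k)"
  using *[OF assms(1)] assms theta_len by simp_all
qed

lemma tau_D:
 assumes "v \<in> hcomp L 1"
 shows "w \<in> hcomp L 1 ==> \<tau> (v \<oplus> w) js = \<tau> v js + \<tau> w js" "\<tau> (c \<odot> v) js = c * \<tau> v js"
proof -
 note * = realized_D(6)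
 show "\<tau> (v \<oplus> w) js = \<tau> v js + \<tau> w js" if "w \<in> hcomp L 1" using * assms that by simp
 show "\<tau> (c \<odot> v) js = c * \<tau> v js" using * assms by simp
qed

lemma gamma_cl: "t \<noteq> 0 ==> i < length fs ==> \<gamma> t ! i \<in> carrier_mat (dm i) (dm i)"
 and gamma_mult: "t \<noteq> 0 ==> s \<noteq> 0 ==> i < length fs ==> \<gamma> (s * t) ! i = \<gamma> s ! i * \<gamma> t ! i"
proof -
 assume *: "t \<noteq> 0" "i < length fs"
 have "\<gamma> t ! i = mat (dm i) (dm i) (\<lambda>ab. \<Sum>k\<in>{- int b..int b}. t powi k * C i k $$ ab)"
  using cochar * unfolding cocharacter_def by blast
 then show "\<gamma> t ! i \<in> carrier_mat (dm i) (dm i)" by simp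
 show "\<gamma> (s * t) ! i = \<gamma> s ! i * \<gamma> t ! i" if "s \<noteq> 0" using cochar * that unfolding cocharacter_def by blast
qed

definition conj :: "nat => 'k => 'k mat => 'k mat" where "conj i t A = \<gamma> t ! i * A * \<gamma> (inverse t) ! i"

lemma conj_cl: "t \<noteq> 0 ==> i < length fs ==> A \<in> carrier_mat (dm i) (dm i) ==> conj i t A \<in> carrier_mat (dm i) (dm i)"
 unfolding conj_def using gamma_cl[of t i] gamma_cl[of "inverse t" i] by simp

text \<open>For fixed \<open>t\<close> a linear form in \<open>w\<close>; for fixed \<open>w\<close>
  a Laurent polynomial in \<open>t\<close>, to which the part of \<open>w\<close> of degree
  \<open>k\<close> contributes a multiple of the k-th power of \<open>t\<close>.\<close>

definition ent :: "nat => nat => nat => 'k => 'g => 'k" where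
 "ent i a c t w = conj i t (\<theta> (even_part w) ! i) $$ (a, c)"

lemma lin_ent: "i < length fs ==> a < dm i ==> c < dm i ==> t \<noteq> 0 ==> lin (ent i a c t)"
proof -
 assume *: "i < length fs" "a < dm i" "c < dm i" "t \<noteq> 0"
 note g = gamma_cl[OF *(4,1)] gamma_cl[of "inverse t" i]
 have th: "\<theta> (even_part x) ! i \<in> carrier_mat (dm i) (dm i)" if "x \<in> carrier L" for x using theta_cl[OF parts(1)[OF that] *(1)] .
 show ?thesis unfolding lin_def
 proof (intro conjI ballI allI)
  fix x y assume xy: "x \<in> carrier L" "y \<in> carrier L"
  have "conj i t (\<theta> (even_part (x \<oplus> y)) ! i) = conj i t (\<theta> (even_part x) ! i) + conj i t (\<theta> (even_part y) ! i)"
   unfolding parts_add(1)[OF xy] theta_D(1)[OF parts(1)[OF xy(1)] *(1) parts(1)[OF xy(2)]] conj_def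
   using g * xy th by (intro conj_add) auto
  then show "ent i a c t (x \<oplus> y) = ent i a c t x + ent i a c t y"
   using * conj_cl[OF *(4,1) th[OF xy(2)]] by (simp add: ent_def)
 next
  fix e x assume x: "x \<in> carrier L"
  have "conj i t (\<theta> (even_part (e \<odot> x)) ! i) = e \<cdot>\<^sub>m conj i t (\<theta> (even_part x) ! i)"
   unfolding parts_smult(1)[OF x] theta_D(2)[OF parts(1)[OF x] *(1)] conj_def
   using g * x th by (intro conj_smult) auto
  then show "ent i a c t (e \<odot> x) = e * ent i a c t x"
   using * conj_cl[OF *(4,1) th[OF x]] by (simp add: ent_def)
 qed
qed

lemma conj_gr: "x \<in> gr k ==> t \<noteq> 0 ==> i < length fs ==> conj i t (\<theta> (even_part x) ! i) = (t powi k) \<cdot>\<^sub>m (\<theta> (even_part x) ! i)"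
proof -
 assume x: "x \<in> gr k" and t: "t \<noteq> 0" "i < length fs"
 from x obtain y v where y: "x = y \<oplus> v" "y \<in> hcomp L 0" "v \<in> hcomp L 1"
  "\<forall>t. t \<noteq> 0 \<longrightarrow> (\<forall>i<length fs. \<gamma> t ! i * \<theta> y ! i * \<gamma> (inverse t) ! i = (t powi k) \<cdot>\<^sub>m (\<theta> y ! i))"
  unfolding gr_eq exc_degree_space_def by blast
 have "even_part x = y" using y parts_split(1) by simp
 then show ?thesis using y(4) t by (simp add: conj_def)
qed

lemma ent_gr:
 "x \<in> gr k ==> t \<noteq> 0 ==> i < length fs ==> a < dm i ==> c < dm i ==> ent i a c t x = t powi k * \<theta> (even_part x) ! i $$ (a, c)"
 using theta_cl[OF parts(1)[OF gr_cl], of x k i] by (simp add: ent_def conj_gr)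

lemma ent_low:
 assumes x: "x \<in> kspan L (\<Union>k\<in>{..- int d}. gr k)" and i: "i < length fs" "a < dm i" "c < dm i"
 shows "laurent_le (- int d) (\<lambda>t. ent i a c t x)"
 using x
proof (rule span_induct)
 show "laurent_le (- int d) (\<lambda>t. ent i a c t y)" if "y \<in> (\<Union>k\<in>{..- int d}. gr k)" for y
 proof -
  obtain k where k: "k \<le> - int d" "y \<in> gr k" using \<open>y \<in> (\<Union>k\<in>{..- int d}. gr k)\<close> by blast
  show ?thesis by (rule laurent_le_cong[OF laurent_le_single[OF k(1)]]) (rule ent_gr[OF k(2) _ i])
 qed
 show "laurent_le (- int d) (\<lambda>t. ent i a c t \<zero>)"
  by (rule laurent_le_cong[OF laurent_le_zero]) (rule lin_zero[OF lin_ent[OF i]])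
 show "laurent_le (- int d) (\<lambda>t. ent i a c t (y \<oplus> w))"
  if "y \<in> carrier L" "w \<in> carrier L" "laurent_le (- int d) (\<lambda>t. ent i a c t y)" "laurent_le (- int d) (\<lambda>t. ent i a c t w)" for y w
  by (rule laurent_le_cong[OF laurent_le_add[OF that(3,4)]]) (rule linD(1)[OF lin_ent[OF i] that(1,2)])
 show "laurent_le (- int d) (\<lambda>t. ent i a c t (e \<odot> y))"
  if "y \<in> carrier L" "laurent_le (- int d) (\<lambda>t. ent i a c t y)" for e y
  by (rule laurent_le_cong[OF laurent_le_cmult[OF that(2)]]) (rule linD(2)[OF lin_ent[OF i] that(1)])
qed (use gr_cl in blast)

text \<open>\<open>\<gamma> 1\<close> is idempotent, and conjugation by it fixes
  \<open>\<theta> x\<close> because it fixes every homogeneous part; multiplying the second fact by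
  \<open>\<gamma> 1\<close> gives the claim. It serves to cancel the inner factors in
  \<open>conj_power\<close>.\<close>

lemma gamma_one:
 assumes x: "x \<in> hcomp L 0" and i: "i < length fs"
 shows "\<gamma> 1 ! i * \<theta> x ! i = \<theta> x ! i"
proof -
 have xc: "x \<in> carrier L" using x hc by blast
 note g = gamma_cl[of 1 i, simplified, OF i] and th = theta_cl[OF x i]
 obtain f K where f: "\<forall>k. f k \<in> gr k" "finite K" "x = finsum L f K" using gr_decomp[OF xc] by blast
 have fc: "f k \<in> carrier L" for k using f(1) gr_cl by blast
 have "conj i 1 (\<theta> x ! i) = \<theta> x ! i"
 proof (rule eq_matI)
  fix a c assume "a < dim_row (\<theta> x ! i)" "c < dim_col (\<theta> x ! i)"
  then have ac: "a < dm i" "c < dm i" using th by auto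
  have 1: "\<theta> x ! i $$ (a, c) = (\<Sum>k\<in>K. \<theta> (even_part (f k)) ! i $$ (a, c))"
  proof -
   have "lin (\<lambda>w. \<theta> (even_part w) ! i $$ (a, c))"
    unfolding lin_def
   proof (intro conjI ballI allI)
    fix u v assume "u \<in> carrier L" "v \<in> carrier L"
    then show "\<theta> (even_part (u \<oplus> v)) ! i $$ (a, c) = \<theta> (even_part u) ! i $$ (a, c) + \<theta> (even_part v) ! i $$ (a, c)"
     using theta_cl[OF parts(1) i, of v] ac by (simp add: parts_add theta_D(1)[OF parts(1) i parts(1)])
   next
    fix e u assume "u \<in> carrier L"
    then show "\<theta> (even_part (e \<odot> u)) ! i $$ (a, c) = e * \<theta> (even_part u) ! i $$ (a, c)"
     using theta_cl[OF parts(1) i, of u] ac by (simp add: parts_smult theta_D(2)[OF parts(1) i])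
   qed
   from lin_finsum[OF f(2) this, of f, OF fc] show ?thesis using f(3) parts_even(1)[OF x] by simp
  qed
  have "ent i a c 1 x = (\<Sum>k\<in>K. ent i a c 1 (f k))"
   unfolding f(3) using lin_finsum[OF f(2) lin_ent[OF i ac], of 1 f] fc by simp
  also have "\<dots> = (\<Sum>k\<in>K. \<theta> (even_part (f k)) ! i $$ (a, c))"
   using ent_gr[OF _ _ i ac, of _ _ 1] f(1) by (intro sum.cong) auto
  finally show "conj i 1 (\<theta> x ! i) $$ (a, c) = \<theta> x ! i $$ (a, c)" using 1 by (simp add: ent_def parts_even(1)[OF x])
 qed (use th g in \<open>auto simp: conj_def\<close>)
 then have *: "\<gamma> 1 ! i * \<theta> x ! i * \<gamma> 1 ! i = \<theta> x ! i" by (simp add: conj_def)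
 have gg: "\<gamma> 1 ! i * \<gamma> 1 ! i = \<gamma> 1 ! i" using gamma_mult[of 1 1 i] i by simp
 have "\<gamma> 1 ! i * (\<gamma> 1 ! i * \<theta> x ! i * \<gamma> 1 ! i) = (\<gamma> 1 ! i * \<gamma> 1 ! i) * \<theta> x ! i * \<gamma> 1 ! i"
  using g th by (simp add: assoc_mult_mat[of _ "dm i" "dm i" _ "dm i" _ "dm i"])
 then show ?thesis unfolding gg * by simp
qed

text \<open>Between two conjugated factors \<open>\<gamma> (inverse t) * \<gamma> t\<close>
  collapses to \<open>\<gamma> 1\<close>, which acts trivially. So conjugation is multiplicative on
  powers, and Laurent degrees add up.\<close>

lemma conj_power:
 assumes x: "x \<in> hcomp L 0" "\<And>a c. a < dm i ==> c < dm i ==> laurent_le e (\<lambda>t. conj i t (\<theta> x ! i) $$ (a, c))" and i: "i < length fs"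
 shows "a < dm i ==> c < dm i ==> laurent_le (int (Suc n) * e) (\<lambda>t. conj i t ((\<theta> x ! i) ^\<^sub>m Suc n) $$ (a, c))"
proof (induction n arbitrary: a c)
 let ?A = "\<theta> x ! i"
 have A: "?A \<in> carrier_mat (dm i) (dm i)" using theta_cl[OF x(1) i] .
 {
  case 0
  then show ?case using x(2) A by simp
 next
  case (Suc n)
  have "conj i t (?A ^\<^sub>m Suc n * ?A) = conj i t (?A ^\<^sub>m Suc n) * conj i t ?A" if t: "t \<noteq> 0" for t
  proof -
   let ?g = "\<gamma> t ! i" and ?h = "\<gamma> (inverse t) ! i" and ?B = "?A ^\<^sub>m Suc n"
   have g: "?g \<in> carrier_mat (dm i) (dm i)" "?h \<in> carrier_mat (dm i) (dm i)" "?B \<in> carrier_mat (dm i) (dm i)"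
    using gamma_cl[OF t i] gamma_cl[of "inverse t" i] t i pow_carrier_mat[OF A, of "Suc n"] by (auto simp del: pow_mat.simps)
   have hg: "?h * ?g = \<gamma> 1 ! i" using gamma_mult[of t "inverse t" i] t i by simp
   have "conj i t ?B * conj i t ?A = ?g * (?B * ((?h * ?g) * ?A)) * ?h"
    unfolding conj_def using g A by (simp add: assoc_mult_mat[of _ "dm i" "dm i" _ "dm i" _ "dm i"] mult_carrier_mat[of _ "dm i" "dm i" _ "dm i"])
   then show ?thesis unfolding hg gamma_one[OF x(1) i] conj_def by simp
  qed
  then have eq: "conj i t (?A ^\<^sub>m Suc (Suc n)) $$ (a, c) = (\<Sum>k<dm i. conj i t (?A ^\<^sub>m Suc n) $$ (a, k) * conj i t ?A $$ (k, c))" if t: "t \<noteq> 0" for t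
   using conj_cl[OF t i A] conj_cl[OF t i pow_carrier_mat[OF A, of "Suc n"]] Suc.prems t
   by (simp add: scalar_prod_def atLeast0LessThan)
  have "laurent_le (int (Suc n) * e + e) (\<lambda>t. conj i t (?A ^\<^sub>m Suc (Suc n)) $$ (a, c))"
   by (rule laurent_le_cong[OF _ eq]) (use Suc x(2) in \<open>intro laurent_le_sum laurent_le_mult; auto\<close>)
  then show ?case by (simp add: algebra_simps)
 }
qed

lemma theta_zero: "x \<in> hcomp L 0 ==> (\<And>i a c. i < length fs ==> a < dm i ==> c < dm i ==> \<theta> x ! i $$ (a, c) = 0) ==> x = \<zero>"
proof -
 assume x: "x \<in> hcomp L 0" and z: "\<And>i a c. i < length fs ==> a < dm i ==> c < dm i ==> \<theta> x ! i $$ (a, c) = 0"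
 have zh: "\<zero> \<in> hcomp L 0" by (rule hcomp_D(2))
 have "\<theta> x = \<theta> \<zero>"
 proof (rule nth_equalityI)
  fix i assume "i < length (\<theta> x)"
  then have i: "i < length fs" using theta_len[OF x] by simp
  have "\<theta> \<zero> ! i = 0 \<cdot>\<^sub>m \<theta> \<zero> ! i" using theta_D(2)[OF zh i, of 0] by (simp add: smult_zero)
  then have "\<theta> \<zero> ! i $$ (a, c) = 0" if "a < dm i" "c < dm i" for a c
   using theta_cl[OF zh i] that by (metis carrier_matD index_smult_mat(1) mult_zero_left)
  then show "\<theta> x ! i = \<theta> \<zero> ! i" using theta_cl[OF zh i] theta_cl[OF x i] z[OF i] by (intro eq_matI) auto
 qed (simp add: theta_len[OF x] theta_len[OF zh])
 then show ?thesis using inj_onD[OF realized_D(1)] x zh by blast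
qed

lemma tau_zero: "x \<in> hcomp L 1 ==> (\<And>js. js \<in> tensor_index (map fst fs) ==> \<tau> x js = 0) ==> x = \<zero>"
proof -
 assume x: "x \<in> hcomp L 1" and z: "\<And>js. js \<in> tensor_index (map fst fs) ==> \<tau> x js = 0"
 have zh: "\<zero> \<in> hcomp L 1" by (rule hcomp_D(2))
 have "\<tau> x \<in> tensors (map fst fs)" using realized_D(4) imageI[OF x, of \<tau>] by simp
 then have "\<tau> x = (\<lambda>js. 0)" using z unfolding tensors_def by blast
 moreover have "\<tau> \<zero> = (\<lambda>js. 0)" using tau_D(2)[OF zh, of 0] by (auto simp: smult_zero)
 ultimately show ?thesis using inj_onD[OF realized_D(3) _ x zh] by simp
qed

text \<open>The p-map is the p-th matrix power, so along the cocharacter its Laurent degree is p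
  times as low. Comparing with the expansion into homogeneous parts kills every even part of degree
  above \<open>- p * d\<close>, although matrix products of homogeneous elements may leave the Lie
  algebra.\<close>

lemma pm_low:
 assumes x: "x \<in> kspan L (\<Union>k\<in>{..- int d}. gr k)" "x \<in> hcomp L 0"
 shows "pmap L x \<in> kspan L (\<Union>k\<in>{..- int (CHAR('k) * d)}. gr k)"
proof -
 let ?p = "CHAR('k)" and ?y = "pmap L x"
 have y: "?y \<in> hcomp L 0" using x(2) by (rule pmap_even)
 then have yc: "?y \<in> carrier L" using hc by blast
 obtain f K where f: "\<forall>k. f k \<in> gr k" "finite K" "?y = finsum L f K" using gr_decomp[OF yc] by blast
 have fc: "f k \<in> carrier L" for k using f(1) gr_cl by blast
 have high: "even_part (f k) = \<zero>" if k: "k \<in> K" "- int (?p * d) < k" for k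
 proof (rule theta_zero[OF parts(1)[OF fc]])
  fix i a c assume iac: "i < length fs" "a < dm i" "c < dm i"
  have "laurent_le (int (Suc (?p - 1)) * (- int d)) (\<lambda>t. conj i t ((\<theta> x ! i) ^\<^sub>m Suc (?p - 1)) $$ (a, c))"
   using ent_low[OF x(1) iac(1)] by (intro conj_power[OF x(2) _ iac]) (simp add: ent_def parts_even(1)[OF x(2)])
  moreover have "Suc (?p - 1) = ?p" using prime_gt_0_nat[OF prime] by simp
  ultimately have "laurent_le (- int (?p * d)) (\<lambda>t. ent i a c t ?y)"
   by (simp add: ent_def parts_even(1)[OF y] theta_D(3)[OF x(2) iac(1)])
  moreover have "ent i a c t ?y = (\<Sum>k\<in>K. t powi k * \<theta> (even_part (f k)) ! i $$ (a, c))" if t: "t \<noteq> 0" for t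
  proof -
   have "ent i a c t ?y = (\<Sum>k\<in>K. ent i a c t (f k))"
    unfolding f(3) by (rule lin_finsum[OF f(2) lin_ent[OF iac t]]) (rule fc)
   also have "\<dots> = (\<Sum>k\<in>K. t powi k * \<theta> (even_part (f k)) ! i $$ (a, c))"
    using ent_gr[OF _ t iac] f(1) by (intro sum.cong) auto
   finally show ?thesis .
  qed
  ultimately show "\<theta> (even_part (f k)) ! i $$ (a, c) = 0" by (rule laurent_le_coeff[OF infinite f(2) _ _ k])
 qed
 let ?W = "kspan L (\<Union>k\<in>{..- int (?p * d)}. gr k)"
 have gc: "(\<Union>k\<in>{..- int (?p * d)}. gr k) \<subseteq> carrier L" using gr_cl by blast
 have "?y = finsum L (\<lambda>k. even_part (f k)) K" using even_part_finsum[OF f(2) fc] f(3) parts_even(1)[OF y] by simp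
 moreover have "even_part (f k) \<in> ?W" if "k \<in> K" for k
 proof (cases "- int (?p * d) < k")
  case True
  then show ?thesis using high[OF that] ksubspaceD(2)[OF span_sub[OF gc]] by simp
 next
  case False
  then have "even_part (f k) \<in> (\<Union>k\<in>{..- int (?p * d)}. gr k)" 
   using even_part_gr f(1) by (intro UN_I[of k]) (simp_all only: atMost_iff not_less)
  then show ?thesis using span_gen[OF gc] by blast
 qed
 ultimately show ?thesis using finsum_sub[OF f(2) span_sub[OF gc]] by metis
qed

text \<open>The matrix entries of the even part and the tensor coordinates of the odd part: the
  separating set of linear forms for \<open>chi_grading\<close>.\<close>

definition coord :: "('g => 'k) set" where
 "coord = (\<lambda>(i, a, c) w. \<theta> (even_part w) ! i $$ (a, c)) ` (SIGMA i:{..<length fs}. {..<dm i} \<times> {..<dm i})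
   \<union> (\<lambda>js w. \<tau> (odd_part w) js) ` tensor_index (map fst fs)"

lemma finite_tensor_index: "finite (tensor_index Ns)"
proof (rule finite_subset)
 show "tensor_index Ns \<subseteq> {js. set js \<subseteq> {..<Suc (Max (set Ns))} \<and> length js = length Ns}"
 proof (intro subsetI CollectI conjI)
  fix js x assume js: "js \<in> tensor_index Ns" and "x \<in> set js"
  then obtain i where i: "i < length Ns" "x < Ns ! i" by (auto simp: tensor_index_def in_set_conv_nth)
  have "x < Max (set Ns)" by (rule less_le_trans[OF i(2)]) (use i(1) in simp)
  then show "x \<in> {..<Suc (Max (set Ns))}" by (simp add: less_Suc_eq)
 qed (auto simp: tensor_index_def)
qed (rule finite_lists_length_eq, simp)

lemma lin_coord: "\<phi> \<in> coord ==> lin \<phi>"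
 unfolding coord_def lin_def
 by (auto simp: parts_add parts_smult theta_D(1)[OF parts(1) _ parts(1)] theta_D(2)[OF parts(1)]
   tau_D(1)[OF parts(2) parts(2)] tau_D(2)[OF parts(2)] carrier_matD[OF theta_cl[OF parts(1)]])

lemma coord_inj: "x \<in> carrier L ==> (\<And>\<phi>. \<phi> \<in> coord ==> \<phi> x = 0) ==> x = \<zero>"
proof -
 assume x: "x \<in> carrier L" and z: "\<And>\<phi>. \<phi> \<in> coord ==> \<phi> x = 0"
 note p = parts[OF x]
 have "even_part x = \<zero>"
 proof (rule theta_zero[OF p(1)])
  fix i a c assume "i < length fs" "a < dm i" "c < dm i"
  then have "(\<lambda>w. \<theta> (even_part w) ! i $$ (a, c)) \<in> coord" unfolding coord_def by (intro UnI1 rev_image_eqI[of "(i, a, c)"]) auto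
  from z[OF this] show "\<theta> (even_part x) ! i $$ (a, c) = 0" .
 qed
 moreover have "odd_part x = \<zero>"
 proof (rule tau_zero[OF p(2)])
  fix js assume "js \<in> tensor_index (map fst fs)"
  then have "(\<lambda>w. \<tau> (odd_part w) js) \<in> coord" unfolding coord_def by blast
  from z[OF this] show "\<tau> (odd_part x) js = 0" .
 qed
 ultimately show ?thesis using p(3) by simp
qed

lemma chi_grading:
 assumes assoc: "associated_m L \<chi> gr S"
 shows "chi_grading L \<chi> gr S coord"
proof (intro chi_grading.intro chi_grading_axioms.intro super_env_algebra_axioms)
 show "finite coord" unfolding coord_def using finite_tensor_index by auto
 show "\<exists>k b. \<exists>y\<in>gr k \<inter> hcomp L b. \<chi> (brk L x y) \<noteq> 0" if "x \<in> gr (- int d)" "1 \<le> d" "x \<noteq> \<zero>" for x d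
  using that by (rule nondeg)
qed (fact assoc prime gr_sub gr_brk gr_split chi_add chi_smult chi_gr chi_odd lin_coord coord_inj | rule pm_low, assumption, assumption)+

end

section \<open>Gradings given by matrix coordinates\<close>

lemma kspan_induct:
 assumes V: "vectorspace class_ring V" and x: "x \<in> kspan V A" and A: "A \<subseteq> carrier V" and P: "\<And>a. a \<in> A ==> P a" and zero: "P \<zero>\<^bsub>V\<^esub>"
  and add: "\<And>x y. x \<in> carrier V ==> y \<in> carrier V ==> P x ==> P y ==> P (x \<oplus>\<^bsub>V\<^esub> y)"
  and smult: "\<And>c x. x \<in> carrier V ==> P x ==> P (c \<odot>\<^bsub>V\<^esub> x)"
 shows "P x"
proof -
 interpret V: vectorspace class_ring V by (rule V)
 have "submodule class_ring {x \<in> carrier V. P x} V"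
  by (rule submodule.intro)
   (use V.module_axioms add smult zero V.smult_closed in \<open>auto simp: class_ring_simps\<close>)
 from V.span_is_subset[OF _ this, of A] x show ?thesis using A P by blast
qed

lemma index_mult:
 "A \<in> carrier_mat N N ==> B \<in> carrier_mat N N ==> a < N ==> b < N ==> (A * B) $$ (a, b) = (\<Sum>k<N. A $$ (a, k) * B $$ (k, b))"
 for A :: "'k::field mat"
 by (simp add: scalar_prod_def atLeast0LessThan)

lemma mult_support:
 fixes A :: "'k::field mat"
 assumes "A \<in> carrier_mat N N" "B \<in> carrier_mat N N" "a < N" "b < N" "(A * B) $$ (a, b) \<noteq> 0"
 obtains k where "k < N" "A $$ (a, k) \<noteq> 0" "B $$ (k, b) \<noteq> 0"
proof -
 have "(\<Sum>k<N. A $$ (a, k) * B $$ (k, b)) \<noteq> 0" using assms(5) unfolding index_mult[OF assms(1-4)] .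
 then obtain k where "k \<in> {..<N}" "A $$ (a, k) * B $$ (k, b) \<noteq> 0" by (rule sum.not_neutral_contains_not_neutral)
 then show thesis using that[of k] by simp
qed

text \<open>The supertrace for an arbitrary assignment of parities to basis vectors; in a Jordan
  basis the even vectors need not precede the odd ones.\<close>

definition strd :: "(nat => bit) => 'k::field mat => 'k" where
 "strd q A = (\<Sum>i<dim_row A. ksign (q i) (q i) * A $$ (i, i))"

lemma strd_mult:
 assumes "A \<in> carrier_mat N N" "B \<in> carrier_mat N N"
 shows "strd q (A * B) = (\<Sum>a<N. \<Sum>k<N. ksign (q a) (q a) * (A $$ (a, k) * B $$ (k, a)))"
proof -
 have d: "dim_row (A * B) = N" using assms by simp
 show ?thesis unfolding strd_def d
  by (intro sum.cong refl) (simp only: lessThan_iff index_mult[OF assms] sum_distrib_left)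
qed

text \<open>The two index sets may carry different parity functions. With equal ones this is
  supersymmetry of the form; with different ones it gives invariance under a change of
  basis.\<close>

lemma strd_commute:
 fixes A :: "'k::field mat"
 assumes A: "A \<in> carrier_mat N N" and B: "B \<in> carrier_mat N N"
  and supp: "\<And>a k. a < N ==> k < N ==> A $$ (a, k) \<noteq> 0 ==> q a = c + q' k"
 shows "strd q (A * B) = ksign c c * strd q' (B * A)"
proof -
 have "ksign (q a) (q a) * (A $$ (a, k) * B $$ (k, a)) = ksign c c * (ksign (q' k) (q' k) * (B $$ (k, a) * A $$ (a, k)))"
  if "a < N" "k < N" for a k
 proof (cases "A $$ (a, k) = 0")
  case False
  then show ?thesis using supp[OF that False] by (cases c; cases "q' k") (auto simp: ksign_def)
 qed simp
 then have "strd q (A * B) = (\<Sum>a<N. \<Sum>k<N. ksign c c * (ksign (q' k) (q' k) * (B $$ (k, a) * A $$ (a, k))))"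
  unfolding strd_mult[OF A B] by (intro sum.cong) auto
 also have "\<dots> = ksign c c * strd q' (B * A)"
  unfolding strd_mult[OF B A] sum_distrib_left by (rule sum.swap)
 finally show ?thesis .
qed

lemma strd_support:
 fixes A :: "'k::field mat"
 assumes "A \<in> carrier_mat N N" "B \<in> carrier_mat N N" "strd q (A * B) \<noteq> 0"
 obtains a k where "a < N" "k < N" "A $$ (a, k) \<noteq> 0" "B $$ (k, a) \<noteq> 0"
proof -
 obtain a where "a \<in> {..<N}" "(\<Sum>k<N. ksign (q a) (q a) * (A $$ (a, k) * B $$ (k, a))) \<noteq> 0"
  using assms(3) unfolding strd_mult[OF assms(1,2)] by (rule sum.not_neutral_contains_not_neutral)
 moreover from this(2) obtain k where "k \<in> {..<N}" "ksign (q a) (q a) * (A $$ (a, k) * B $$ (k, a)) \<noteq> 0"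
  by (rule sum.not_neutral_contains_not_neutral)
 ultimately show thesis using that[of a k] by simp
qed

lemma strd_diff:
 "A \<in> carrier_mat N N ==> B \<in> carrier_mat N N ==> strd q (A - c \<cdot>\<^sub>m B) = strd q A - c * strd q B" for A :: "'k::field mat"
 by (simp add: strd_def sum_distrib_left sum_subtractf[symmetric] algebra_simps)

lemma bit_plus_one: "(a :: bit) \<noteq> 1 + a" by (cases a) auto

lemma bit_add_cancel: "(a :: bit) = c + b ==> b = c' + a ==> c' = c" by (cases a; cases b; cases c; cases c') auto

text \<open>\<open>mt\<close> is the matrix in a basis whose vectors have degree \<open>dg\<close>
  and parity \<open>pr\<close>. \<open>partner\<close> is nondegeneracy of the supertrace form on
  homogeneous elements; \<open>component\<close> keeps the degree components of strictly
  degree-lowering elements inside \<open>L\<close>, as needed for p-th powers.\<close>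

locale matrix_grading = super_env_algebra L \<chi> for L :: "('k::field, 'g) lie_superalg" (structure) and \<chi> +
 fixes N :: nat and mt :: "'g => 'k mat" and dg :: "nat => int" and pr :: "nat => bit" and X :: 'g and gr :: "int => 'g set"
 assumes prime: "prime CHAR('k)"
  and mt_cl: "x \<in> carrier L ==> mt x \<in> carrier_mat N N"
  and mt_add: "[|x \<in> carrier L; y \<in> carrier L|] ==> mt (x \<oplus> y) = mt x + mt y"
  and mt_smult: "x \<in> carrier L ==> mt (r \<odot> x) = r \<cdot>\<^sub>m mt x"
  and mt_inj: "[|x \<in> carrier L; y \<in> carrier L; mt x = mt y|] ==> x = y"
  and mt_par: "[|x \<in> hcomp L c; a < N; b < N; mt x $$ (a, b) \<noteq> 0|] ==> pr a = c + pr b"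
  and mt_brk: "[|x \<in> hcomp L c; y \<in> hcomp L e|] ==> mt (brk L x y) = mt x * mt y - ksign c e \<cdot>\<^sub>m (mt y * mt x)"
  and mt_pmap: "x \<in> hcomp L 0 ==> mt (pmap L x) = mt x ^\<^sub>m CHAR('k)"
  and X_even: "X \<in> hcomp L 0" and X_gr: "X \<in> gr 2"
  and chi: "x \<in> carrier L ==> \<chi> x = strd pr (mt X * mt x)"
  and gr_eq: "gr k = {x \<in> carrier L. \<forall>a<N. \<forall>b<N. mt x $$ (a, b) \<noteq> 0 \<longrightarrow> dg a = dg b + k}"
  and X_inj: "[|A \<in> carrier_mat N N; 1 \<le> d; \<And>a b. a < N ==> b < N ==> A $$ (a, b) \<noteq> 0 ==> dg a = dg b - int d; mt X * A = A * mt X|]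
   ==> A = 0\<^sub>m N N"
  and partner: "[|x \<in> gr k; x \<in> hcomp L c; x \<noteq> \<zero>|] ==> \<exists>l e. \<exists>y\<in>gr l \<inter> hcomp L e. strd pr (mt x * mt y) \<noteq> 0"
  and component: "[|x \<in> hcomp L 0; \<And>a b. a < N ==> b < N ==> mt x $$ (a, b) \<noteq> 0 ==> dg a < dg b|]
   ==> \<exists>y\<in>hcomp L 0. mt y = mat N N (\<lambda>(a, b). if dg a = dg b + k then mt x $$ (a, b) else 0)"
begin

lemma hc_cl: "x \<in> hcomp L a ==> x \<in> carrier L" using hc by blast

lemma grI: "x \<in> carrier L ==> (\<And>a b. a < N ==> b < N ==> mt x $$ (a, b) \<noteq> 0 ==> dg a = dg b + k) ==> x \<in> gr k"
 unfolding gr_eq by blast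

lemma gr_cl: "x \<in> gr k ==> x \<in> carrier L" unfolding gr_eq by blast

lemma gr_deg: "x \<in> gr k ==> a < N ==> b < N ==> mt x $$ (a, b) \<noteq> 0 ==> dg a = dg b + k"
 unfolding gr_eq by blast

lemma mt_index_add: "x \<in> carrier L ==> y \<in> carrier L ==> a < N ==> b < N ==> mt (x \<oplus> y) $$ (a, b) = mt x $$ (a, b) + mt y $$ (a, b)"
 using mt_cl[of y] by (simp add: mt_add)

lemma mt_index_smult: "x \<in> carrier L ==> a < N ==> b < N ==> mt (c \<odot> x) $$ (a, b) = c * mt x $$ (a, b)"
 using mt_cl[of x] by (simp add: mt_smult)

lemma lin_mt: "a < N ==> b < N ==> lin (\<lambda>x. mt x $$ (a, b))"
 by (simp add: lin_def mt_index_add mt_index_smult)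

lemma mt_zero: "a < N ==> b < N ==> mt \<zero> $$ (a, b) = 0" by (rule lin_zero[OF lin_mt])

lemma zero_cl: "\<zero> \<in> carrier L" by (rule hc_cl[OF hcomp_D(2)])

lemma mt_eq: "x \<in> carrier L ==> y \<in> carrier L ==> (\<And>a b. a < N ==> b < N ==> mt x $$ (a, b) = mt y $$ (a, b)) ==> x = y"
 using mt_cl[of x] mt_cl[of y] by (intro mt_inj) (auto intro!: eq_matI)

lemma gr_sub: "ksubspace (gr k) L"
proof -
 have z: "\<zero> \<in> gr k" by (rule grI[OF zero_cl]) (simp add: mt_zero)
 have a: "x \<oplus> y \<in> gr k" if "x \<in> gr k" "y \<in> gr k" for x y
 proof (rule grI)
  have c: "x \<in> carrier L" "y \<in> carrier L" using that gr_cl by auto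
  then show "x \<oplus> y \<in> carrier L" by (rule add_cl)
  fix a b assume ab: "a < N" "b < N" "mt (x \<oplus> y) $$ (a, b) \<noteq> 0"
  then have "mt x $$ (a, b) \<noteq> 0 \<or> mt y $$ (a, b) \<noteq> 0" using mt_index_add[OF c ab(1,2)] by auto
  then show "dg a = dg b + k" using gr_deg[OF that(1) ab(1,2)] gr_deg[OF that(2) ab(1,2)] by blast
 qed
 have s: "c \<odot> x \<in> gr k" if "x \<in> gr k" for c x
  using that gr_cl smult_cl by (intro grI) (auto simp: mt_index_smult dest: gr_deg)
 have "submodule class_ring (gr k) L"
  by (rule submodule.intro) (use V.module_axioms gr_cl z a s in \<open>auto simp: class_ring_simps\<close>)
 then show ?thesis using vectorspace_L by (simp add: subspace_def)
qed

lemma gr_split: "x \<in> gr k ==> \<exists>y\<in>gr k \<inter> hcomp L 0. \<exists>z\<in>gr k \<inter> hcomp L 1. x = y \<oplus> z"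
proof -
 assume x: "x \<in> gr k"
 then obtain y z where yz: "y \<in> hcomp L 0" "z \<in> hcomp L 1" "x = y \<oplus> z" using gr_cl hcomp_split by blast
 note c = hc_cl[OF yz(1)] hc_cl[OF yz(2)]
 have dj: "mt y $$ (a, b) = 0 \<or> mt z $$ (a, b) = 0" if "a < N" "b < N" for a b
 proof (rule ccontr)
  assume "\<not> ?thesis"
  then have "pr a = 0 + pr b" "pr a = 1 + pr b" using mt_par[OF yz(1) that] mt_par[OF yz(2) that] by auto
  then show False by (metis add_0 bit_plus_one)
 qed
 have "y \<in> gr k"
 proof (rule grI[OF c(1)])
  fix a b assume ab: "a < N" "b < N" "mt y $$ (a, b) \<noteq> 0"
  then have "mt x $$ (a, b) \<noteq> 0" using dj[OF ab(1,2)] mt_index_add[OF c ab(1,2)] yz(3) by simp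
  then show "dg a = dg b + k" by (rule gr_deg[OF x ab(1,2)])
 qed
 moreover have "z \<in> gr k"
 proof (rule grI[OF c(2)])
  fix a b assume ab: "a < N" "b < N" "mt z $$ (a, b) \<noteq> 0"
  then have "mt x $$ (a, b) \<noteq> 0" using dj[OF ab(1,2)] mt_index_add[OF c ab(1,2)] yz(3) by simp
  then show "dg a = dg b + k" by (rule gr_deg[OF x ab(1,2)])
 qed
 ultimately show ?thesis using yz by blast
qed

lemma gr_mult:
 assumes "x \<in> gr k" "y \<in> gr l" "a < N" "b < N" "(mt x * mt y) $$ (a, b) \<noteq> 0"
 shows "dg a = dg b + (k + l)"
proof -
 obtain c where "c < N" "mt x $$ (a, c) \<noteq> 0" "mt y $$ (c, b) \<noteq> 0"
  using mult_support[OF mt_cl[OF gr_cl[OF assms(1)]] mt_cl[OF gr_cl[OF assms(2)]] assms(3-5)] by blast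
 then show ?thesis using gr_deg[OF assms(1), of a c] gr_deg[OF assms(2), of c b] assms(3,4) by simp
qed

lemma gr_brk_hom:
 assumes x: "x \<in> gr k" "x \<in> hcomp L c" and y: "y \<in> gr l" "y \<in> hcomp L e"
 shows "brk L x y \<in> gr (k + l)"
proof (rule grI[OF brk_cl[OF x(2) y(2)]])
 fix a b assume ab: "a < N" "b < N" "mt (brk L x y) $$ (a, b) \<noteq> 0"
 have m: "mt x \<in> carrier_mat N N" "mt y \<in> carrier_mat N N" using mt_cl gr_cl x(1) y(1) by auto
 then have "mt (brk L x y) $$ (a, b) = (mt x * mt y) $$ (a, b) - ksign c e * (mt y * mt x) $$ (a, b)"
  using ab by (simp add: mt_brk[OF x(2) y(2)])
 then have "(mt x * mt y) $$ (a, b) \<noteq> 0 \<or> (mt y * mt x) $$ (a, b) \<noteq> 0" using ab(3) by auto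
 then show "dg a = dg b + (k + l)" using gr_mult[OF x(1) y(1) ab(1,2)] gr_mult[OF y(1) x(1) ab(1,2)] by auto
qed

lemma gr_brk: "x \<in> gr k ==> y \<in> gr l ==> brk L x y \<in> gr (k + l)"
proof -
 assume x: "x \<in> gr k" and y: "y \<in> gr l"
 obtain x0 x1 where x: "x0 \<in> gr k \<inter> hcomp L 0" "x1 \<in> gr k \<inter> hcomp L 1" "x = x0 \<oplus> x1" using gr_split[OF x] by blast
 obtain y0 y1 where y: "y0 \<in> gr l \<inter> hcomp L 0" "y1 \<in> gr l \<inter> hcomp L 1" "y = y0 \<oplus> y1" using gr_split[OF y] by blast
 have c: "x0 \<in> carrier L" "x1 \<in> carrier L" "y0 \<in> carrier L" "y1 \<in> carrier L" using x y gr_cl by auto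
 have b: "brk L x0 y0 \<in> gr (k + l)" "brk L x0 y1 \<in> gr (k + l)" "brk L x1 y0 \<in> gr (k + l)" "brk L x1 y1 \<in> gr (k + l)"
  using x y gr_brk_hom by blast+
 have "brk L x y = (brk L x0 y0 \<oplus> brk L x0 y1) \<oplus> (brk L x1 y0 \<oplus> brk L x1 y1)"
  unfolding x(3) y(3) using c by (simp add: brk_add_left brk_add_right add_cl brk_closed V.a_ac)
 then show ?thesis using b ksubspaceD(3)[OF gr_sub] by simp
qed

lemma X_cl: "X \<in> carrier L" using X_even hc_cl by blast

lemma chi_add: "x \<in> carrier L ==> y \<in> carrier L ==> \<chi> (x \<oplus> y) = \<chi> x + \<chi> y"
 using mt_cl[of x] mt_cl[of y] mt_cl[OF X_cl]
 by (simp add: chi add_cl strd_mult[of _ N] mt_cl mt_index_add sum.distrib distrib_left)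

lemma chi_smult: "x \<in> carrier L ==> \<chi> (c \<odot> x) = c * \<chi> x"
 using mt_cl[of x] mt_cl[OF X_cl]
 by (simp add: chi smult_cl strd_mult[of _ N] mt_cl mt_index_smult sum_distrib_left mult_ac)

lemma chi_gr: "x \<in> gr k ==> k \<noteq> - 2 ==> \<chi> x = 0"
proof (rule ccontr)
 assume x: "x \<in> gr k" "k \<noteq> - 2" "\<chi> x \<noteq> 0"
 then have "strd pr (mt X * mt x) \<noteq> 0" using chi gr_cl by simp
 then obtain a b where ab: "a < N" "b < N" "mt X $$ (a, b) \<noteq> 0" "mt x $$ (b, a) \<noteq> 0"
  by (rule strd_support[OF mt_cl[OF X_cl] mt_cl[OF gr_cl[OF x(1)]]])
 then show False using gr_deg[OF X_gr ab(1-3)] gr_deg[OF x(1) ab(2,1,4)] x(2) by simp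
qed

lemma chi_odd: "x \<in> hcomp L 1 ==> \<chi> x = 0"
proof (rule ccontr)
 assume x: "x \<in> hcomp L 1" "\<chi> x \<noteq> 0"
 then have "strd pr (mt X * mt x) \<noteq> 0" using chi hc_cl by simp
 then obtain a b where ab: "a < N" "b < N" "mt X $$ (a, b) \<noteq> 0" "mt x $$ (b, a) \<noteq> 0"
  by (rule strd_support[OF mt_cl[OF X_cl] mt_cl[OF hc_cl[OF x(1)]]])
 then have "pr a = 0 + pr b" "pr b = 1 + pr a" using mt_par[OF X_even ab(1-3)] mt_par[OF x(1) ab(2,1,4)] by auto
 then show False by (metis add_0 bit_plus_one)
qed

text \<open>The bracket of \<open>X\<close> and \<open>x\<close> is nonzero by \<open>X_inj\<close>,
  hence has a partner \<open>y\<close> under the supertrace form; moving \<open>y\<close> cyclically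
  shows that the same \<open>y\<close> pairs with \<open>x\<close> under \<chi>.\<close>

lemma nondeg:
 assumes x: "x \<in> gr (- int d)" "x \<in> hcomp L c" "1 \<le> d" "x \<noteq> \<zero>"
 shows "\<exists>k b. \<exists>y\<in>gr k \<inter> hcomp L b. \<chi> (brk L x y) \<noteq> 0"
proof -
 let ?w = "brk L X x" and ?s = "ksign c c :: 'k"
 have m: "mt X \<in> carrier_mat N N" "mt x \<in> carrier_mat N N" using mt_cl X_cl gr_cl x(1) by auto
 have w: "?w \<in> gr (2 + - int d)" using gr_brk[OF X_gr x(1)] .
 have wh: "?w \<in> hcomp L c" using brk_hcomp[OF X_even x(2)] by (simp only: add_0)
 have mw: "mt ?w = mt X * mt x - 1 \<cdot>\<^sub>m (mt x * mt X)" using mt_brk[OF X_even x(2)] by (simp add: ksign_def)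
 have "?w \<noteq> \<zero>"
 proof
  assume w0: "?w = \<zero>"
  have "mt X * mt x = mt x * mt X"
  proof (rule eq_matI)
   fix a b assume "a < dim_row (mt x * mt X)" "b < dim_col (mt x * mt X)"
   then have ab: "a < N" "b < N" using m by auto
   have "mt ?w $$ (a, b) = 0" unfolding w0 by (rule mt_zero[OF ab])
   then show "(mt X * mt x) $$ (a, b) = (mt x * mt X) $$ (a, b)" unfolding mw using m ab by simp
  qed (use m in auto)
  then have "mt x = 0\<^sub>m N N" using gr_deg[OF x(1)] by (intro X_inj[OF m(2) x(3)]) auto
  then have "x = \<zero>" using gr_cl[OF x(1)] zero_cl mt_zero by (intro mt_eq) auto
  then show False using x(4) by simp
 qed
 then obtain l e y where y: "y \<in> gr l" "y \<in> hcomp L e" "strd pr (mt ?w * mt y) \<noteq> 0" using partner[OF w wh] by blast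
 have my: "mt y \<in> carrier_mat N N" using mt_cl gr_cl y(1) by auto
 obtain a b where ab: "a < N" "b < N" "mt ?w $$ (a, b) \<noteq> 0" "mt y $$ (b, a) \<noteq> 0"
  using strd_support[OF mt_cl[OF gr_cl[OF w]] my y(3)] by blast
 have e: "e = c" using bit_add_cancel[OF mt_par[OF wh ab(1-3)] mt_par[OF y(2) ab(2,1,4)]] .
 have xy: "mt (brk L x y) = mt x * mt y - ?s \<cdot>\<^sub>m (mt y * mt x)" using mt_brk[OF x(2) y(2)] e by simp
 have "\<chi> (brk L x y) = strd pr (mt X * (mt x * mt y) - ?s \<cdot>\<^sub>m (mt X * (mt y * mt x)))"
  unfolding chi[OF brk_cl[OF x(2) y(2)]] xy using m my
  by (simp add: mult_minus_distrib_mat[of "mt X" N N "mt x * mt y" N "?s \<cdot>\<^sub>m (mt y * mt x)"]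
    mult_smult_distrib[of "mt X" N N "mt y * mt x" N ?s])
 also have "\<dots> = strd pr (mt X * mt x * mt y) - ?s * strd pr ((mt X * mt y) * mt x)"
  using m my by (subst strd_diff[of _ N]) (simp_all add: assoc_mult_mat[of _ N N _ N _ N])
 also have "strd pr ((mt X * mt y) * mt x) = ?s * strd pr (mt x * (mt X * mt y))"
 proof (rule strd_commute[of _ N])
  fix a k assume ak: "a < N" "k < N" "(mt X * mt y) $$ (a, k) \<noteq> 0"
  obtain i where i: "i < N" "mt X $$ (a, i) \<noteq> 0" "mt y $$ (i, k) \<noteq> 0" using mult_support[OF m(1) my ak] .
  show "pr a = c + pr k" using mt_par[OF X_even ak(1) i(1,2)] mt_par[OF y(2) i(1) ak(2) i(3)] e by (metis add_0)
 qed (use m my in auto)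
 also have "?s * (?s * strd pr (mt x * (mt X * mt y))) = strd pr (mt x * (mt X * mt y))" by (simp add: ksign_def)
 also have "strd pr (mt X * mt x * mt y) - strd pr (mt x * (mt X * mt y)) = strd pr (mt ?w * mt y)"
 proof -
  have one: "1 \<cdot>\<^sub>m M = M" for M :: "'k mat" by (rule eq_matI) auto
  have "mt ?w * mt y = mt X * mt x * mt y - 1 \<cdot>\<^sub>m (mt x * (mt X * mt y))"
   unfolding mw one using m my
   by (simp add: minus_mult_distrib_mat[of "mt X * mt x" N N "mt x * mt X" "mt y" N] assoc_mult_mat[of "mt x" N N "mt X" N "mt y" N])
  then show ?thesis using m my by (simp add: strd_diff[of _ N])
 qed
 finally have "\<chi> (brk L x y) \<noteq> 0" using y(3) by simp
 then show ?thesis using y(1,2) by blast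
qed

lemma low_index:
 assumes x: "x \<in> kspan L (\<Union>k\<in>{..- int d}. gr k)" and ab: "a < N" "b < N" "mt x $$ (a, b) \<noteq> 0"
 shows "dg a \<le> dg b - int d"
proof (rule ccontr)
 assume less: "\<not> dg a \<le> dg b - int d"
 have "mt x $$ (a, b) = 0"
  using x by (rule lin_span[OF _ _ lin_mt[OF ab(1,2)]]) (use gr_cl gr_deg[OF _ ab(1,2)] less in force)+
 then show False using ab(3) by simp
qed

lemma power_index:
 fixes A :: "'k mat"
 assumes A: "A \<in> carrier_mat N N" and d: "\<And>a b. a < N ==> b < N ==> A $$ (a, b) \<noteq> 0 ==> dg a \<le> dg b - int d"
 shows "a < N ==> b < N ==> (A ^\<^sub>m n) $$ (a, b) \<noteq> 0 ==> dg a \<le> dg b - int (n * d)"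
proof (induction n arbitrary: b)
 case 0
 then show ?case using A by (auto split: if_splits)
next
 case (Suc n)
 obtain k where k: "k < N" "(A ^\<^sub>m n) $$ (a, k) \<noteq> 0" "A $$ (k, b) \<noteq> 0"
  using mult_support[OF pow_carrier_mat[OF A, of n] A Suc.prems(1,2)] Suc.prems(3) unfolding pow_mat.simps by blast
 then show ?case using Suc.IH[OF Suc.prems(1) k(1,2)] d[OF k(1) Suc.prems(2) k(3)] by simp
qed

text \<open>A matrix lowering the degree by at least \<open>d\<close> has a p-th power lowering it
  by at least \<open>p * d\<close>. The power is the sum of its degree components, which lie in
  \<open>L\<close> by \<open>component\<close> and vanish in the higher degrees.\<close>

lemma pm_low:
 assumes x: "x \<in> kspan L (\<Union>k\<in>{..- int d}. gr k)" "x \<in> hcomp L 0" and d: "1 \<le> d"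
 shows "pmap L x \<in> kspan L (\<Union>k\<in>{..- int (CHAR('k) * d)}. gr k)"
proof -
 let ?p = "CHAR('k)" and ?y = "pmap L x"
 let ?W = "kspan L (\<Union>k\<in>{..- int (?p * d)}. gr k)"
 have y: "?y \<in> hcomp L 0" using x(2) by (rule pmap_even)
 note yc = hc_cl[OF y]
 have p: "0 < ?p * d" using prime_gt_0_nat[OF prime] d by simp
 have low: "dg a \<le> dg b - int (?p * d)" if "a < N" "b < N" "mt ?y $$ (a, b) \<noteq> 0" for a b
  using power_index[OF mt_cl[OF hc_cl[OF x(2)]] low_index[OF x(1)] that(1,2), of ?p] that(3) mt_pmap[OF x(2)] by simp
 have "\<exists>f. \<forall>k. f k \<in> hcomp L 0 \<and> mt (f k) = mat N N (\<lambda>(a, b). if dg a = dg b + k then mt ?y $$ (a, b) else 0)"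
 proof (intro choice allI)
  fix k
  have "dg a < dg b" if "a < N" "b < N" "mt ?y $$ (a, b) \<noteq> 0" for a b
   using low[OF that] p by linarith
  from component[OF y this, of k]
  show "\<exists>f. f \<in> hcomp L 0 \<and> mt f = mat N N (\<lambda>(a, b). if dg a = dg b + k then mt ?y $$ (a, b) else 0)" by blast
 qed
 then obtain f where f: "\<And>k. f k \<in> hcomp L 0"
  "\<And>k. mt (f k) = mat N N (\<lambda>(a, b). if dg a = dg b + k then mt ?y $$ (a, b) else 0)" by blast
 have fc: "f k \<in> carrier L" for k using f(1) hc_cl by blast
 \<comment> \<open>Each matrix position belongs to exactly one of these degrees, so the components
   add up to the whole matrix.\<close>
 let ?K = "(\<lambda>(a, b). dg a - dg b) ` ({..<N} \<times> {..<N})"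
 have K: "finite ?K" by simp
 have fs: "finsum L f ?K \<in> carrier L" using fc by (intro V.finsum_closed) auto
 have "?y = finsum L f ?K"
 proof (rule mt_eq[OF yc fs])
  fix a b assume ab: "a < N" "b < N"
  have "mt (finsum L f ?K) $$ (a, b) = (\<Sum>k\<in>?K. mt (f k) $$ (a, b))" by (rule lin_finsum[OF K lin_mt[OF ab]]) (rule fc)
  also have "\<dots> = (\<Sum>k\<in>?K. if k = dg a - dg b then mt ?y $$ (a, b) else 0)"
   using ab by (intro sum.cong) (auto simp: f(2))
  also have "\<dots> = mt ?y $$ (a, b)"
  proof -
   have "dg a - dg b \<in> ?K" using ab by (intro image_eqI[of _ _ "(a, b)"]) auto
   then show ?thesis using sum.delta[OF K, of "dg a - dg b" "\<lambda>_. mt ?y $$ (a, b)"] by (simp only: if_True)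
  qed
  finally show "mt ?y $$ (a, b) = mt (finsum L f ?K) $$ (a, b)" by simp
 qed
 moreover have gc: "(\<Union>k\<in>{..- int (?p * d)}. gr k) \<subseteq> carrier L" using gr_cl by blast
 have "f k \<in> ?W" for k
 proof (cases "k \<le> - int (?p * d)")
  case True
  have "f k \<in> gr k" by (rule grI[OF fc]) (auto simp: f(2) split: if_splits)
  then have "f k \<in> (\<Union>k\<in>{..- int (?p * d)}. gr k)" using True by (intro UN_I[of k]) (simp_all only: atMost_iff)
  then show ?thesis using span_gen[OF gc] by blast
 next
  case False
  have "f k = \<zero>"
  proof (rule mt_eq[OF fc zero_cl])
   fix a b assume ab: "a < N" "b < N"
   have "mt ?y $$ (a, b) = 0" if "dg a = dg b + k" using low[OF ab] that False by linarith
   then show "mt (f k) $$ (a, b) = mt \<zero> $$ (a, b)" using ab by (simp add: f(2) mt_zero)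
  qed
  then show ?thesis using ksubspaceD(2)[OF span_sub[OF gc]] by simp
 qed
 ultimately show ?thesis using finsum_sub[OF K span_sub[OF gc], of f] by simp
qed

definition coord :: "('g => 'k) set" where "coord = (\<lambda>(a, b) x. mt x $$ (a, b)) ` ({..<N} \<times> {..<N})"

lemma chi_grading:
 assumes assoc: "associated_m L \<chi> gr S"
 shows "chi_grading L \<chi> gr S coord"
proof (intro chi_grading.intro chi_grading_axioms.intro super_env_algebra_axioms)
 show "finite coord" by (simp add: coord_def)
 show "lin f" if "f \<in> coord" for f using that lin_mt by (auto simp: coord_def)
 show "x = \<zero>" if "x \<in> carrier L" "\<And>f. f \<in> coord ==> f x = 0" for x
 proof (rule mt_eq[OF that(1) zero_cl])
  fix a b assume ab: "a < N" "b < N"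
  then have "(\<lambda>x. mt x $$ (a, b)) \<in> coord" unfolding coord_def by (intro image_eqI[of _ _ "(a, b)"]) auto
  from that(2)[OF this] show "mt x $$ (a, b) = mt \<zero> $$ (a, b)" by (simp add: mt_zero[OF ab])
 qed
qed (fact assoc prime gr_sub gr_brk gr_split chi_add chi_smult chi_gr chi_odd nondeg pm_low)+

end

section \<open>Coordinates in a Jordan basis\<close>

lemma index_mult_vec:
 "A \<in> carrier_mat N N ==> v \<in> carrier_vec N ==> a < N ==> (A *\<^sub>v v) $ a = (\<Sum>k<N. A $$ (a, k) * v $ k)"
 for A :: "'k::field mat"
 by (auto simp: scalar_prod_def atLeast0LessThan)

lemma mult_vec_support:
 fixes A :: "'k::field mat"
 assumes "A \<in> carrier_mat N N" "v \<in> carrier_vec N" "a < N" "(A *\<^sub>v v) $ a \<noteq> 0"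
 obtains k where "k < N" "A $$ (a, k) \<noteq> 0" "v $ k \<noteq> 0"
proof -
 have "(\<Sum>k<N. A $$ (a, k) * v $ k) \<noteq> 0" using assms(4) unfolding index_mult_vec[OF assms(1-3)] .
 then obtain k where "k \<in> {..<N}" "A $$ (a, k) * v $ k \<noteq> 0" by (rule sum.not_neutral_contains_not_neutral)
 then show thesis using that[of k] by simp
qed

lemma mult_unit_vec: "A \<in> carrier_mat N N ==> k < N ==> A *\<^sub>v unit_vec N k = col A k" for A :: "'k::field mat"
proof (rule eq_vecI)
 assume A: "A \<in> carrier_mat N N" and k: "k < N"
 fix a assume "a < dim_vec (col A k)"
 then have a: "a < N" using A by simp
 have "(A *\<^sub>v unit_vec N k) $ a = (\<Sum>c<N. if c = k then A $$ (a, c) else 0)"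
  unfolding index_mult_vec[OF A unit_vec_carrier a] using k by (intro sum.cong) auto
 then show "(A *\<^sub>v unit_vec N k) $ a = col A k $ a" using A a k by simp
qed auto

lemma gl_comp_vec: "A \<in> gl_comp m n c ==> v \<in> vec_comp m n b ==> A *\<^sub>v v \<in> vec_comp m n (c + b)"
 for A :: "'k::field mat"
proof -
 assume A: "A \<in> gl_comp m n c" and v: "v \<in> vec_comp m n b"
 then have c: "A \<in> carrier_mat (m + n) (m + n)" "v \<in> carrier_vec (m + n)" by (auto simp: gl_comp_def vec_comp_def)
 have "par m a = c + b" if a: "a < m + n" "(A *\<^sub>v v) $ a \<noteq> 0" for a
 proof -
  obtain k where k: "k < m + n" "A $$ (a, k) \<noteq> 0" "v $ k \<noteq> 0" using mult_vec_support[OF c a] .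
  have "par m a = c + par m k" using A a(1) k unfolding gl_comp_def by blast
  moreover have "par m k = b" using v k unfolding vec_comp_def by blast
  ultimately show ?thesis by (simp only:)
 qed
 then show ?thesis using c unfolding vec_comp_def by simp
qed

lemma pow_vec_Suc: "A \<in> carrier_mat N N ==> w \<in> carrier_vec N ==> A *\<^sub>v ((A ^\<^sub>m j) *\<^sub>v w) = (A ^\<^sub>m Suc j) *\<^sub>v w"
 for A :: "'k::field mat"
proof (induction j arbitrary: w)
 case (Suc j)
 have p: "A ^\<^sub>m i \<in> carrier_mat N N" for i using Suc.prems(1) by (rule pow_carrier_mat)
 have w: "A *\<^sub>v w \<in> carrier_vec N" using Suc.prems by simp
 have s: "(A ^\<^sub>m Suc i) *\<^sub>v w = (A ^\<^sub>m i) *\<^sub>v (A *\<^sub>v w)" for i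
  using assoc_mult_mat_vec[OF p[of i] Suc.prems(1,2)] by simp
 show ?case unfolding s[of j] s[of "Suc j"] by (rule Suc.IH[OF Suc.prems(1) w])
qed simp

lemma pow_vec_comp: "A \<in> gl_comp m n 0 ==> w \<in> vec_comp m n c ==> (A ^\<^sub>m j) *\<^sub>v w \<in> vec_comp m n c"
 for A :: "'k::field mat"
proof (induction j)
 case 0
 then have c: "dim_row A = m + n" "w \<in> carrier_vec (m + n)" by (auto simp: gl_comp_def vec_comp_def)
 have "(A ^\<^sub>m 0) *\<^sub>v w = w" using c by simp
 then show ?case using 0(2) by (simp only:)
next
 case (Suc j)
 have "A \<in> carrier_mat (m + n) (m + n)" "w \<in> carrier_vec (m + n)" using Suc.prems by (auto simp: gl_comp_def vec_comp_def)
 from pow_vec_Suc[OF this, of j] show ?case using gl_comp_vec[OF Suc.prems(1) Suc.IH[OF Suc.prems]] by (simp only: add_0)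
qed

definition chain_index :: "'k vec list => nat list => (nat \<times> nat) set" where
 "chain_index ws ls = {(i, j). i < length ws \<and> j < ls ! i}"

lemma finite_chain_index: "finite (chain_index ws ls)"
proof -
 have "chain_index ws ls = (SIGMA i:{..<length ws}. {..<ls ! i})" by (auto simp: chain_index_def)
 then show ?thesis by simp
qed

text \<open>\<open>P\<close> has the chain vectors as columns, enumerated by \<open>h\<close>, and
  \<open>Q\<close> is its inverse. Since the nilpotent matrix is even, each chain consists of
  vectors of one parity, and both matrices respect parities.\<close>

lemma exists_coordinates:
 fixes A :: "'k::field mat"
 assumes A: "A \<in> gl_comp m n 0" and cb: "chain_basis m n A ws ls" and two: "(2 :: 'k) \<noteq> 0"
 obtains P Q h pr where "P \<in> carrier_mat (m + n) (m + n)" "Q \<in> carrier_mat (m + n) (m + n)" "P * Q = 1\<^sub>m (m + n)" "Q * P = 1\<^sub>m (m + n)"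
  "bij_betw h {..<m + n} (chain_index ws ls)"
  "\<And>k. k < m + n ==> col P k = (A ^\<^sub>m snd (h k)) *\<^sub>v (ws ! fst (h k))"
  "\<And>a k. a < m + n ==> k < m + n ==> P $$ (a, k) \<noteq> 0 ==> par m a = pr k"
  "\<And>a k. a < m + n ==> k < m + n ==> Q $$ (k, a) \<noteq> 0 ==> pr k = par m a"
proof -
 let ?N = "m + n"
 let ?I = "chain_index ws ls" and ?b = "\<lambda>(i, j). (A ^\<^sub>m j) *\<^sub>v (ws ! i)"
 interpret vs: vec_space "TYPE('k)" ?N .
 note cb' = cb[unfolded chain_basis_def Let_def, folded chain_index_def]
 have inj: "inj_on ?b ?I" using cb' by (elim conjE)
 have basis: "vs.basis (?b ` ?I)" using cb' by (elim conjE)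
 have w: "\<exists>c. ws ! i \<in> vec_comp m n c" if "i < length ws" for i
  using cb'[THEN conjunct2, THEN conjunct1, rule_format, OF that] by (elim conjE)
 have "card (?b ` ?I) = ?N" using vs.dim_basis[OF finite_imageI[OF finite_chain_index] basis] vs.dim_is_n by simp
 then have card: "card ?I = ?N" using card_image[OF inj] by simp
 obtain h where h: "bij_betw h {..<?N} ?I"
  using ex_bij_betw_nat_finite[OF finite_chain_index, of ws ls] card by (auto simp: atLeast0LessThan)
 have hI: "h k \<in> ?I" if "k < ?N" for k using bij_betwE[OF h] that by simp
 then have fh: "fst (h k) < length ws" if "k < ?N" for k using that by (force simp: chain_index_def)
 define pw where "pw i = (SOME c. ws ! i \<in> vec_comp m n c)" for i
 have pw: "ws ! i \<in> vec_comp m n (pw i)" if "i < length ws" for i unfolding pw_def by (rule someI_ex[OF w[OF that]])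
 define pr where "pr k = pw (fst (h k))" for k
 define P where "P = mat ?N ?N (\<lambda>(a, k). ?b (h k) $ a)"
 have P: "P \<in> carrier_mat ?N ?N" by (simp add: P_def)
 have bc: "?b (h k) \<in> vec_comp m n (pr k)" if "k < ?N" for k
  using pow_vec_comp[OF A pw[OF fh[OF that]], of "snd (h k)"] by (simp add: pr_def split_beta)
 then have bv: "?b (h k) \<in> carrier_vec ?N" if "k < ?N" for k using that unfolding vec_comp_def by blast
 have col: "col P k = ?b (h k)" if "k < ?N" for k
  by (rule eq_vecI) (use that bv[OF that] in \<open>auto simp: P_def\<close>)
 \<comment> \<open>Spanning gives a right inverse column by column; for square matrices it is
   automatically two-sided.\<close>
 have ex: "\<exists>u\<in>carrier_vec ?N. P *\<^sub>v u = v" if v: "v \<in> carrier_vec ?N" for v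
 proof -
  have "v \<in> vs.span (?b ` ?I)" using basis v unfolding vs.basis_def by (simp add: module_vec_simps)
  then show ?thesis
  proof (rule kspan_induct[OF vs.vectorspace_axioms])
   show "?b ` ?I \<subseteq> carrier (module_vec TYPE('k) ?N)" using basis unfolding vs.basis_def by (elim conjE) (simp only: module_vec_simps)
   fix w assume "w \<in> ?b ` ?I"
   then obtain p where p: "w = ?b p" "p \<in> ?I" by (rule imageE)
   from p(2) have "p \<in> h ` {..<?N}" unfolding bij_betw_imp_surj_on[OF h] .
   then obtain k where k: "p = h k" "k \<in> {..<?N}" by (rule imageE)
   then have k: "k < ?N" "w = ?b (h k)" using p(1) by (simp_all only: lessThan_iff)
   then have "P *\<^sub>v unit_vec ?N k = w" using col[OF k(1)] mult_unit_vec[OF P k(1)] by simp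
   then show "\<exists>u\<in>carrier_vec ?N. P *\<^sub>v u = w" by (intro bexI[of _ "unit_vec ?N k"]) auto
  next
   have "P *\<^sub>v 0\<^sub>v ?N = 0\<^sub>v ?N" using P by (intro eq_vecI) auto
   then show "\<exists>u\<in>carrier_vec ?N. P *\<^sub>v u = \<zero>\<^bsub>module_vec TYPE('k) ?N\<^esub>" by (intro bexI[of _ "0\<^sub>v ?N"]) (auto simp: module_vec_simps)
  next
   fix x y assume "\<exists>u\<in>carrier_vec ?N. P *\<^sub>v u = x" "\<exists>u\<in>carrier_vec ?N. P *\<^sub>v u = y"
   then obtain u u' where "u \<in> carrier_vec ?N" "P *\<^sub>v u = x" "u' \<in> carrier_vec ?N" "P *\<^sub>v u' = y" by blast
   then show "\<exists>u\<in>carrier_vec ?N. P *\<^sub>v u = x \<oplus>\<^bsub>module_vec TYPE('k) ?N\<^esub> y"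
    using mult_add_distrib_mat_vec[OF P, of u u'] by (intro bexI[of _ "u + u'"]) (auto simp: module_vec_simps)
  next
   fix c x assume "\<exists>u\<in>carrier_vec ?N. P *\<^sub>v u = x"
   then obtain u where "u \<in> carrier_vec ?N" "P *\<^sub>v u = x" by blast
   then show "\<exists>u\<in>carrier_vec ?N. P *\<^sub>v u = c \<odot>\<^bsub>module_vec TYPE('k) ?N\<^esub> x"
    using mult_mat_vec[OF P, of u c] by (intro bexI[of _ "c \<cdot>\<^sub>v u"]) (auto simp: module_vec_simps)
  qed
 qed
 obtain q where q: "q a \<in> carrier_vec ?N" "P *\<^sub>v q a = unit_vec ?N a" for a
  using ex[OF unit_vec_carrier] by metis
 define Q where "Q = mat ?N ?N (\<lambda>(k, a). q a $ k)"
 have Q: "Q \<in> carrier_mat ?N ?N" by (simp add: Q_def)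
 have PQ: "P * Q = 1\<^sub>m ?N"
 proof (rule eq_matI)
  fix a b assume "a < dim_row (1\<^sub>m ?N :: 'k mat)" "b < dim_col (1\<^sub>m ?N :: 'k mat)"
  then have ab: "a < ?N" "b < ?N" by auto
  have "(P * Q) $$ (a, b) = (P *\<^sub>v q b) $ a"
   unfolding index_mult[OF P Q ab] index_mult_vec[OF P q(1) ab(1)] using ab by (simp add: Q_def)
  then show "(P * Q) $$ (a, b) = 1\<^sub>m ?N $$ (a, b)" using ab by (simp add: q(2))
 qed (use P Q in auto)
 have QP: "Q * P = 1\<^sub>m ?N" by (rule mat_mult_left_right_inverse[OF P Q PQ])
 have Ppar: "par m a = pr k" if ak: "a < ?N" "k < ?N" "P $$ (a, k) \<noteq> 0" for a k
  using bc[OF ak(2)] ak unfolding vec_comp_def by (auto simp: P_def)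
 have Qpar: "pr k = par m a" if ak: "a < ?N" "k < ?N" "Q $$ (k, a) \<noteq> 0" for a k
 proof (rule ccontr)
  assume ne: "pr k \<noteq> par m a"
  let ?s = "\<lambda>f. mat ?N ?N (\<lambda>(i, j). if i = j then ksign (f i) (f i) else 0) :: 'k mat"
  have s: "?s f \<in> carrier_mat ?N ?N" for f by simp
  have left: "(?s f * M) $$ (i, j) = ksign (f i) (f i) * M $$ (i, j)"
   if "M \<in> carrier_mat ?N ?N" "i < ?N" "j < ?N" for M f i j
  proof -
   have "(?s f * M) $$ (i, j) = (\<Sum>k<?N. if k = i then ksign (f i) (f i) * M $$ (i, j) else 0)"
    unfolding index_mult[OF s that] using that by (intro sum.cong) auto
   then show ?thesis using that by simp
  qed
  have right: "(M * ?s f) $$ (i, j) = M $$ (i, j) * ksign (f j) (f j)"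
   if "M \<in> carrier_mat ?N ?N" "i < ?N" "j < ?N" for M f i j
  proof -
   have "(M * ?s f) $$ (i, j) = (\<Sum>k<?N. if k = j then M $$ (i, j) * ksign (f j) (f j) else 0)"
    unfolding index_mult[OF that(1) s that(2,3)] using that by (intro sum.cong) auto
   then show ?thesis using that by simp
  qed
  \<comment> \<open>\<open>P\<close> intertwines the diagonal sign matrices of the two bases, hence
    so does \<open>Q\<close>. An entry of \<open>Q\<close> joining different parities would equal
    its own negative.\<close>
  have "?s (par m) * P = P * ?s pr"
  proof (rule eq_matI)
   fix i j assume "i < dim_row (P * ?s pr)" "j < dim_col (P * ?s pr)"
   then have ij: "i < ?N" "j < ?N" using P by auto
   show "(?s (par m) * P) $$ (i, j) = (P * ?s pr) $$ (i, j)"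
    unfolding left[OF P ij] right[OF P ij] using Ppar[OF ij] by (cases "P $$ (i, j) = 0") auto
  qed (use P in auto)
  then have "Q * (?s (par m) * P) * Q = Q * (P * ?s pr) * Q" by simp
  moreover have "Q * (?s (par m) * P) * Q = Q * (?s (par m) * (P * Q))"
   using P Q s by (simp add: assoc_mult_mat[of _ ?N ?N _ ?N _ ?N] mult_carrier_mat[of _ ?N ?N _ ?N])
  moreover have "Q * (P * ?s pr) * Q = (Q * P) * (?s pr * Q)"
   using P Q s by (simp add: assoc_mult_mat[of _ ?N ?N _ ?N _ ?N] mult_carrier_mat[of _ ?N ?N _ ?N])
  ultimately have qs: "Q * ?s (par m) = ?s pr * Q"
   unfolding PQ QP using Q s by (simp add: right_mult_one_mat[of _ ?N ?N] left_mult_one_mat[of _ ?N ?N])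
  have "Q $$ (k, a) * ksign (par m a) (par m a) = ksign (pr k) (pr k) * Q $$ (k, a)"
   by (rule trans[OF _ left[OF Q ak(2,1)]]) (rule right[OF Q ak(2,1), of "par m", unfolded qs, symmetric])
  then have "ksign (par m a) (par m a) = (ksign (pr k) (pr k) :: 'k)" using ak(3) by simp
  moreover have "(1 :: 'k) \<noteq> - 1" using two by (metis add_neg_numeral_special(7) diff_minus_eq_add eq_iff_diff_eq_0 one_add_one)
  ultimately show False using ne by (cases "pr k"; cases "par m a") (auto simp: ksign_def)
 qed
 show thesis
  by (rule that[OF P Q PQ QP h _ Ppar Qpar]) (simp add: col split_beta)
qed

locale coordinates = super_env_algebra L \<chi> for L :: "('k::field, 'g) lie_superalg" (structure) and \<chi> +
 fixes m n :: nat and \<rho> :: "'g => 'k mat" and C :: "bit => 'k mat set" and X :: 'g and gr :: "int => 'g set"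
  and ws :: "'k vec list" and ls :: "nat list" and P Q :: "'k mat" and h :: "nat => nat \<times> nat" and pr :: "nat => bit"
 assumes prime: "prime CHAR('k)"
  and realized: "mat_realized m n C \<rho> L" and C_gl: "C c \<subseteq> gl_comp m n c"
  and X_even: "X \<in> hcomp L 0" and chi: "x \<in> carrier L ==> \<chi> x = supertrace m (\<rho> X * \<rho> x)"
  and chain: "chain_basis m n (\<rho> X) ws ls"
  and gr_def: "gr = mat_degree_space L \<rho> (chain_degree_space (m + n) (\<rho> X) ws ls)"
  and P: "P \<in> carrier_mat (m + n) (m + n)" and Q: "Q \<in> carrier_mat (m + n) (m + n)"
  and PQ: "P * Q = 1\<^sub>m (m + n)" and QP: "Q * P = 1\<^sub>m (m + n)"
  and bij: "bij_betw h {..<m + n} (chain_index ws ls)"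
  and col_P: "k < m + n ==> col P k = (\<rho> X ^\<^sub>m snd (h k)) *\<^sub>v (ws ! fst (h k))"
  and P_par: "[|a < m + n; k < m + n; P $$ (a, k) \<noteq> 0|] ==> par m a = pr k"
  and Q_par: "[|a < m + n; k < m + n; Q $$ (k, a) \<noteq> 0|] ==> pr k = par m a"
begin

abbreviation "N \<equiv> m + n"
definition dg :: "nat => int" where "dg k = 2 * int (snd (h k)) + 1 - int (ls ! fst (h k))"
definition mt :: "'g => 'k mat" where "mt x = Q * \<rho> x * P"

lemmas assoc = assoc_mult_mat[of _ N N _ N _ N]
lemmas mcl = mult_carrier_mat[of _ N N _ N]

lemma rho_D: "x \<in> carrier L ==> \<rho> x \<in> carrier_mat N N"
  "x \<in> carrier L ==> y \<in> carrier L ==> \<rho> (x \<oplus> y) = \<rho> x + \<rho> y" "x \<in> carrier L ==> \<rho> (r \<odot> x) = r \<cdot>\<^sub>m \<rho> x"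
 using realized unfolding mat_realized_def LinearCombinations.module_hom_def by (auto simp: module_mat_simps class_ring_simps)

lemma rho_inj: "inj_on \<rho> (carrier L)" and rho_hcomp: "\<rho> ` hcomp L a = C a"
 using realized unfolding mat_realized_def by blast+

lemma rho_brk: "x \<in> hcomp L a ==> y \<in> hcomp L b ==> \<rho> (brk L x y) = \<rho> x * \<rho> y - ksign a b \<cdot>\<^sub>m (\<rho> y * \<rho> x)"
 and rho_pmap: "x \<in> hcomp L 0 ==> \<rho> (pmap L x) = \<rho> x ^\<^sub>m CHAR('k)"
 using realized unfolding mat_realized_def by blast+

lemma hc_cl: "x \<in> hcomp L a ==> x \<in> carrier L" using hc by blast

lemma X_cl: "X \<in> carrier L" using X_even hc_cl by blast

lemma mt_cl: "x \<in> carrier L ==> mt x \<in> carrier_mat N N"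
 unfolding mt_def using P Q rho_D(1) by (intro mcl) auto

lemma PQ_id: "M \<in> carrier_mat N N ==> Q * (P * M * Q) * P = M" "M \<in> carrier_mat N N ==> P * (Q * M * P) * Q = M"
proof -
 assume M: "M \<in> carrier_mat N N"
 have "Q * (P * M * Q) * P = (Q * P) * M * (Q * P)" using P Q M by (simp add: assoc mcl)
 then show "Q * (P * M * Q) * P = M" unfolding QP using M by simp
 have "P * (Q * M * P) * Q = (P * Q) * M * (P * Q)" using P Q M by (simp add: assoc mcl)
 then show "P * (Q * M * P) * Q = M" unfolding PQ using M by simp
qed

lemma conj_mult: "M \<in> carrier_mat N N ==> M' \<in> carrier_mat N N ==> Q * (M * M') * P = (Q * M * P) * (Q * M' * P)"
proof -
 assume M: "M \<in> carrier_mat N N" "M' \<in> carrier_mat N N"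
 have "(Q * M * P) * (Q * M' * P) = Q * M * ((P * Q) * (M' * P))" using P Q M by (simp add: assoc mcl)
 also have "\<dots> = Q * M * (M' * P)" unfolding PQ using left_mult_one_mat[OF mcl[OF M(2) P]] by simp
 finally show ?thesis using P Q M by (simp add: assoc mcl)
qed

lemma mt_power: "x \<in> carrier L ==> Q * (\<rho> x ^\<^sub>m k) * P = mt x ^\<^sub>m k"
proof (induction k)
 case 0
 then show ?case using Q P QP rho_D(1)[OF 0] mt_cl[OF 0] by simp
next
 case (Suc k)
 have "Q * (\<rho> x ^\<^sub>m Suc k) * P = (Q * (\<rho> x ^\<^sub>m k) * P) * (Q * \<rho> x * P)"
  using conj_mult[OF pow_carrier_mat[OF rho_D(1)[OF Suc.prems], of k] rho_D(1)[OF Suc.prems]] by simp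
 then show ?case using Suc by (simp add: mt_def)
qed

lemma mt_par: "x \<in> hcomp L c ==> a < N ==> b < N ==> mt x $$ (a, b) \<noteq> 0 ==> pr a = c + pr b"
proof -
 assume x: "x \<in> hcomp L c" and ab: "a < N" "b < N" "mt x $$ (a, b) \<noteq> 0"
 note r = rho_D(1)[OF hc_cl[OF x]]
 obtain k where k: "k < N" "(Q * \<rho> x) $$ (a, k) \<noteq> 0" "P $$ (k, b) \<noteq> 0"
  using mult_support[OF mcl[OF Q r] P ab(1,2)] ab(3) unfolding mt_def by blast
 obtain l where l: "l < N" "Q $$ (a, l) \<noteq> 0" "\<rho> x $$ (l, k) \<noteq> 0" using mult_support[OF Q r ab(1) k(1,2)] .
 have "\<rho> x \<in> C c" using imageI[OF x, of \<rho>] unfolding rho_hcomp .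
 then have "\<rho> x \<in> gl_comp m n c" by (rule subsetD[OF C_gl])
 then have "par m l = c + par m k" using l k unfolding gl_comp_def by blast
 then show ?thesis using Q_par[OF l(1) ab(1) l(2)] P_par[OF k(1) ab(2) k(3)] by (simp only:)
qed

lemma gl_lift:
 assumes M: "M \<in> carrier_mat N N" "\<And>a b. a < N ==> b < N ==> M $$ (a, b) \<noteq> 0 ==> pr a = c + pr b"
 shows "P * M * Q \<in> gl_comp m n c"
 unfolding gl_comp_def
proof (intro CollectI conjI allI impI)
 show "P * M * Q \<in> carrier_mat N N" using P Q M(1) by (intro mcl)
 fix a b assume ab: "a < N" "b < N" "(P * M * Q) $$ (a, b) \<noteq> 0"
 obtain k where k: "k < N" "(P * M) $$ (a, k) \<noteq> 0" "Q $$ (k, b) \<noteq> 0" using mult_support[OF mcl[OF P M(1)] Q ab] .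
 obtain l where l: "l < N" "P $$ (a, l) \<noteq> 0" "M $$ (l, k) \<noteq> 0" using mult_support[OF P M(1) ab(1) k(1,2)] .
 show "par m a = c + par m b" using P_par[OF ab(1) l(1,2)] M(2)[OF l(1) k(1) l(3)] Q_par[OF ab(2) k(1,3)] by (simp only:)
qed

lemma lift: "M \<in> carrier_mat N N ==> P * M * Q \<in> C c ==> \<exists>x\<in>hcomp L c. mt x = M"
proof -
 assume M: "M \<in> carrier_mat N N" "P * M * Q \<in> C c"
 have "P * M * Q \<in> \<rho> ` hcomp L c" using M(2) unfolding rho_hcomp .
 then obtain x where x: "P * M * Q = \<rho> x" "x \<in> hcomp L c" by (rule imageE)
 have "mt x = M" using PQ_id(1)[OF M(1)] unfolding x(1) mt_def .
 then show ?thesis using x(2) by (intro bexI)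
qed

text \<open>\<open>Q\<close> is moved around cyclically. No sign appears because \<open>Q\<close>
  preserves parities; only the parity function changes from one basis to the other.\<close>

lemma strd_conj: "M \<in> carrier_mat N N ==> supertrace m M = strd pr (Q * M * P)"
proof -
 assume M: "M \<in> carrier_mat N N"
 have e: "(M * P) * Q = M" using M P Q PQ by (simp add: assoc)
 have "supertrace m M = strd (par m) M" by (auto simp: supertrace_def strd_def par_def ksign_def intro!: sum.cong)
 also have "\<dots> = strd (par m) ((M * P) * Q)" unfolding e ..
 also have "strd (par m) ((M * P) * Q) = strd pr (Q * (M * P))"
  using strd_commute[OF Q mcl[OF M P], of pr 0 "par m"] Q_par by (simp add: ksign_def)
 also have "Q * (M * P) = Q * M * P" using M P Q by (simp add: assoc)
 finally show ?thesis .
qed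

lemma P_vec: "k < N ==> Q *\<^sub>v col P k = unit_vec N k"
 using col_mult2[OF Q P, of k] QP by simp

lemma degree_space: "v \<in> chain_degree_space N (\<rho> X) ws ls l \<longleftrightarrow> v \<in> carrier_vec N \<and> (\<forall>a<N. (Q *\<^sub>v v) $ a \<noteq> 0 \<longrightarrow> dg a = l)"
  (is "?L \<longleftrightarrow> ?R")
proof -
 interpret vs: vec_space "TYPE('k)" N .
 let ?G = "{col P k | k. k < N \<and> dg k = l}"
 have G: "{(\<rho> X ^\<^sub>m j) *\<^sub>v (ws ! i) | i j. i < length ws \<and> j < ls ! i \<and> 2 * int j + 1 - int (ls ! i) = l} = ?G"
 proof (intro equalityI subsetI)
  fix v assume "v \<in> {(\<rho> X ^\<^sub>m j) *\<^sub>v (ws ! i) | i j. i < length ws \<and> j < ls ! i \<and> 2 * int j + 1 - int (ls ! i) = l}"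
  then obtain i j where ij: "v = (\<rho> X ^\<^sub>m j) *\<^sub>v (ws ! i)" "(i, j) \<in> chain_index ws ls" "2 * int j + 1 - int (ls ! i) = l"
   by (auto simp: chain_index_def)
  then obtain k where "k < N" "h k = (i, j)" using bij_betw_imp_surj_on[OF bij] by (metis imageE lessThan_iff)
  then show "v \<in> ?G" using ij by (intro CollectI exI[of _ k]) (simp add: col_P dg_def)
 next
  fix v assume "v \<in> ?G"
  then obtain k where k: "v = col P k" "k < N" "dg k = l" by blast
  have "h k \<in> chain_index ws ls" using bij_betwE[OF bij] k(2) by simp
  then show "v \<in> {(\<rho> X ^\<^sub>m j) *\<^sub>v (ws ! i) | i j. i < length ws \<and> j < ls ! i \<and> 2 * int j + 1 - int (ls ! i) = l}"
   using k by (intro CollectI exI[of _ "fst (h k)"] exI[of _ "snd (h k)"]) (auto simp: col_P dg_def chain_index_def)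
 qed
 have Gc: "?G \<subseteq> carrier_vec N" using P by auto
 then have Gc': "?G \<subseteq> carrier (module_vec TYPE('k) N)" by (simp only: module_vec_simps)
 show ?thesis
 proof
  assume ?L
  then have v: "v \<in> kspan (module_vec TYPE('k) N) ?G" by (simp add: chain_degree_space_def G)
  show ?R
  proof (rule kspan_induct[OF vs.vectorspace_axioms v Gc'])
   fix w assume "w \<in> ?G"
   then obtain k where k: "w = col P k" "k < N" "dg k = l" by blast
   then show "w \<in> carrier_vec N \<and> (\<forall>a<N. (Q *\<^sub>v w) $ a \<noteq> 0 \<longrightarrow> dg a = l)" using P by (auto simp: P_vec split: if_splits)
  next
   show "\<zero>\<^bsub>module_vec TYPE('k) N\<^esub> \<in> carrier_vec N \<and> (\<forall>a<N. (Q *\<^sub>v \<zero>\<^bsub>module_vec TYPE('k) N\<^esub>) $ a \<noteq> 0 \<longrightarrow> dg a = l)"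
    using Q by (auto simp: module_vec_simps)
  next
   fix x y assume "x \<in> carrier_vec N \<and> (\<forall>a<N. (Q *\<^sub>v x) $ a \<noteq> 0 \<longrightarrow> dg a = l)" "y \<in> carrier_vec N \<and> (\<forall>a<N. (Q *\<^sub>v y) $ a \<noteq> 0 \<longrightarrow> dg a = l)"
   then show "x \<oplus>\<^bsub>module_vec TYPE('k) N\<^esub> y \<in> carrier_vec N \<and> (\<forall>a<N. (Q *\<^sub>v (x \<oplus>\<^bsub>module_vec TYPE('k) N\<^esub> y)) $ a \<noteq> 0 \<longrightarrow> dg a = l)"
    using Q by (auto simp: module_vec_simps index_mult_vec[OF Q] distrib_left sum.distrib simp del: index_mult_mat_vec)
  next
   fix c x assume x: "x \<in> carrier_vec N \<and> (\<forall>a<N. (Q *\<^sub>v x) $ a \<noteq> 0 \<longrightarrow> dg a = l)"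
   then have "Q *\<^sub>v (c \<cdot>\<^sub>v x) = c \<cdot>\<^sub>v (Q *\<^sub>v x)" using mult_mat_vec[OF Q] by blast
   then show "c \<odot>\<^bsub>module_vec TYPE('k) N\<^esub> x \<in> carrier_vec N \<and> (\<forall>a<N. (Q *\<^sub>v (c \<odot>\<^bsub>module_vec TYPE('k) N\<^esub> x)) $ a \<noteq> 0 \<longrightarrow> dg a = l)"
    using x Q by (auto simp: module_vec_simps simp del: index_mult_mat_vec)
  qed
 next
  assume R: ?R
  define u where "u = Q *\<^sub>v v"
  have u: "u \<in> carrier_vec N" "\<And>a. a < N ==> u $ a \<noteq> 0 ==> dg a = l" using R Q by (auto simp: u_def simp del: index_mult_mat_vec)
  have v: "v = P *\<^sub>v u" unfolding u_def using assoc_mult_mat_vec[OF P Q, of v] R PQ by simp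
  have W: "ksubspace (vs.span ?G) (module_vec TYPE('k) N)" by (rule vs.span_is_subspace[OF Gc])
  have gen: "?G \<subseteq> vs.span ?G" by (rule vs.in_own_span[OF Gc])
  have z: "0\<^sub>v N \<in> vs.span ?G" using ksubspaceD(2)[OF W] by (simp add: module_vec_simps)
  \<comment> \<open>Truncation at \<open>r\<close> lets an induction add one column of
    \<open>P\<close> at a time, and a column enters with nonzero coefficient only if it has degree
    \<open>l\<close>.\<close>
  have "P *\<^sub>v vec N (\<lambda>k. if k < r then u $ k else 0) \<in> vs.span ?G" if "r \<le> N" for r
   using that
  proof (induction r)
   case 0
   have "P *\<^sub>v vec N (\<lambda>k. if k < 0 then u $ k else 0) = 0\<^sub>v N" using P by (intro eq_vecI) (auto simp: scalar_prod_def)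
   then show ?case using z by simp
  next
   case (Suc r)
   then have r: "r < N" by simp
   let ?u = "vec N (\<lambda>k. if k < r then u $ k else 0)"
   have "vec N (\<lambda>k. if k < Suc r then u $ k else 0) = ?u + u $ r \<cdot>\<^sub>v unit_vec N r"
    using r by (intro eq_vecI) (auto simp: less_Suc_eq)
   then have "P *\<^sub>v vec N (\<lambda>k. if k < Suc r then u $ k else 0) = P *\<^sub>v ?u + u $ r \<cdot>\<^sub>v (P *\<^sub>v unit_vec N r)"
    using mult_add_distrib_mat_vec[OF P, of ?u "u $ r \<cdot>\<^sub>v unit_vec N r"] mult_mat_vec[OF P, of "unit_vec N r" "u $ r"] by simp
   also have "P *\<^sub>v unit_vec N r = col P r" using mult_unit_vec[OF P r] .
   finally have e: "P *\<^sub>v vec N (\<lambda>k. if k < Suc r then u $ k else 0) = P *\<^sub>v ?u + u $ r \<cdot>\<^sub>v col P r" .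
   have "u $ r \<cdot>\<^sub>v col P r \<in> vs.span ?G"
   proof (cases "u $ r = 0")
    case True
    then have "u $ r \<cdot>\<^sub>v col P r = 0\<^sub>v N" using P by (intro eq_vecI) auto
    then show ?thesis using z by simp
   next
    case False
    then have "col P r \<in> vs.span ?G" using u(2)[OF r] r gen by blast
    then show ?thesis using ksubspaceD(4)[OF W, of "col P r" "u $ r"] by (simp add: module_vec_simps)
   qed
   then show ?case unfolding e using ksubspaceD(3)[OF W Suc.IH] r by (simp add: module_vec_simps)
  qed
  from this[of N] have "P *\<^sub>v vec N (\<lambda>k. if k < N then u $ k else 0) \<in> vs.span ?G" by simp
  moreover have "vec N (\<lambda>k. if k < N then u $ k else 0) = u" using u(1) by (intro eq_vecI) auto
  ultimately show ?L unfolding v chain_degree_space_def G by simp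
 qed
qed

lemma mt_index: "x \<in> carrier L ==> a < N ==> k < N ==> mt x $$ (a, k) = (Q *\<^sub>v (\<rho> x *\<^sub>v col P k)) $ a"
proof -
 assume x: "x \<in> carrier L" and ak: "a < N" "k < N"
 note r = rho_D(1)[OF x]
 have "mt x $$ (a, k) = col (mt x) k $ a" using ak mt_cl[OF x] by simp
 also have "col (mt x) k = (Q * \<rho> x) *\<^sub>v col P k" unfolding mt_def using col_mult2[OF mcl[OF Q r] P ak(2)] .
 also have "\<dots> = Q *\<^sub>v (\<rho> x *\<^sub>v col P k)" using P ak by (intro assoc_mult_mat_vec[OF Q r]) auto
 finally show ?thesis .
qed

lemma gr_eq: "gr k = {x \<in> carrier L. \<forall>a<N. \<forall>b<N. mt x $$ (a, b) \<noteq> 0 \<longrightarrow> dg a = dg b + k}"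
proof (intro equalityI subsetI)
 fix x assume "x \<in> gr k"
 then have x: "x \<in> carrier L" and d: "\<And>l v. v \<in> chain_degree_space N (\<rho> X) ws ls l ==> \<rho> x *\<^sub>v v \<in> chain_degree_space N (\<rho> X) ws ls (l + k)"
  unfolding gr_def mat_degree_space_def by blast+
 have "dg a = dg b + k" if ab: "a < N" "b < N" "mt x $$ (a, b) \<noteq> 0" for a b
 proof -
  have "col P b \<in> chain_degree_space N (\<rho> X) ws ls (dg b)"
   unfolding degree_space using P ab P_vec[OF ab(2)] by (auto split: if_splits)
  from d[OF this] show ?thesis using ab mt_index[OF x ab(1,2)] unfolding degree_space by simp
 qed
 then show "x \<in> {x \<in> carrier L. \<forall>a<N. \<forall>b<N. mt x $$ (a, b) \<noteq> 0 \<longrightarrow> dg a = dg b + k}" using x by blast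
next
 fix x assume "x \<in> {x \<in> carrier L. \<forall>a<N. \<forall>b<N. mt x $$ (a, b) \<noteq> 0 \<longrightarrow> dg a = dg b + k}"
 then have x: "x \<in> carrier L" and d: "\<And>a b. a < N ==> b < N ==> mt x $$ (a, b) \<noteq> 0 ==> dg a = dg b + k" by blast+
 note r = rho_D(1)[OF x]
 have "\<rho> x *\<^sub>v v \<in> chain_degree_space N (\<rho> X) ws ls (l + k)" if v: "v \<in> chain_degree_space N (\<rho> X) ws ls l" for l v
 proof -
  have vc: "v \<in> carrier_vec N" and vd: "\<And>a. a < N ==> (Q *\<^sub>v v) $ a \<noteq> 0 ==> dg a = l" using v unfolding degree_space by blast+
  have qv: "Q *\<^sub>v v \<in> carrier_vec N" using Q vc by simp
  have "mt x *\<^sub>v (Q *\<^sub>v v) = (Q * \<rho> x) *\<^sub>v (P *\<^sub>v (Q *\<^sub>v v))"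
   unfolding mt_def by (rule assoc_mult_mat_vec[OF mcl[OF Q r] P qv])
  also have "P *\<^sub>v (Q *\<^sub>v v) = v" using assoc_mult_mat_vec[OF P Q vc] PQ vc by simp
  also have "(Q * \<rho> x) *\<^sub>v v = Q *\<^sub>v (\<rho> x *\<^sub>v v)" by (rule assoc_mult_mat_vec[OF Q r vc])
  finally have e: "Q *\<^sub>v (\<rho> x *\<^sub>v v) = mt x *\<^sub>v (Q *\<^sub>v v)" by simp
  have "dg a = l + k" if a: "a < N" "(Q *\<^sub>v (\<rho> x *\<^sub>v v)) $ a \<noteq> 0" for a
  proof -
   obtain b where b: "b < N" "mt x $$ (a, b) \<noteq> 0" "(Q *\<^sub>v v) $ b \<noteq> 0"
    using mult_vec_support[OF mt_cl[OF x] qv a(1)] a(2) unfolding e by blast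
   show ?thesis using d[OF a(1) b(1,2)] vd[OF b(1,3)] by simp
  qed
  then show ?thesis unfolding degree_space using r vc by simp
 qed
 then show "x \<in> gr k" unfolding gr_def mat_degree_space_def using x by blast
qed

abbreviation "IJ \<equiv> chain_index ws ls"
definition hi :: "nat \<times> nat => nat" where "hi = inv_into {..<N} h"

lemma hi: "p \<in> IJ ==> hi p < N" "p \<in> IJ ==> h (hi p) = p" "k < N ==> hi (h k) = k" "k < N ==> h k \<in> IJ"
 using bij_betw_imp_surj_on[OF bij] bij_betw_imp_inj_on[OF bij] bij_betwE[OF bij]
 unfolding hi_def by (auto intro: inv_into_into[of _ h "{..<N}", simplified] f_inv_into_f inv_into_f_f)

lemma h_eq: "k < N ==> p \<in> IJ ==> h k = p \<longleftrightarrow> k = hi p" using hi by metis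

lemma ls_zero: "i < length ws ==> (\<rho> X ^\<^sub>m (ls ! i)) *\<^sub>v (ws ! i) = 0\<^sub>v N" and ws_cl: "i < length ws ==> ws ! i \<in> carrier_vec N"
proof -
 assume i: "i < length ws"
 then have *: "\<exists>a. ws ! i \<in> vec_comp m n a" "(\<rho> X ^\<^sub>m (ls ! i)) *\<^sub>v (ws ! i) = 0\<^sub>v N"
  using chain unfolding chain_basis_def by blast+
 show "(\<rho> X ^\<^sub>m (ls ! i)) *\<^sub>v (ws ! i) = 0\<^sub>v N" by (rule *)
 show "ws ! i \<in> carrier_vec N" using *(1) unfolding vec_comp_def by blast
qed

text \<open>Jordan form: \<open>X\<close> moves one step along a chain, and the vanishing of the
  power given by \<open>ls\<close> supplies the zero at its end.\<close>

lemma mt_X: "a < N ==> k < N ==> mt X $$ (a, k) = (if fst (h a) = fst (h k) \<and> snd (h a) = Suc (snd (h k)) then 1 else 0)"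
proof -
 assume ak: "a < N" "k < N"
 obtain i j where ij: "h k = (i, j)" by (cases "h k")
 have I: "i < length ws" "j < ls ! i" using hi(4)[OF ak(2)] ij by (auto simp: chain_index_def)
 have e: "mt X $$ (a, k) = (Q *\<^sub>v ((\<rho> X ^\<^sub>m Suc j) *\<^sub>v (ws ! i))) $ a"
  using mt_index[OF X_cl ak] col_P[OF ak(2)] pow_vec_Suc[OF rho_D(1)[OF X_cl] ws_cl[OF I(1)], of j] ij by simp
 show ?thesis
 proof (cases "Suc j < ls ! i")
  case True
  then have p: "(i, Suc j) \<in> IJ" using I by (simp add: chain_index_def)
  have "mt X $$ (a, k) = unit_vec N (hi (i, Suc j)) $ a"
   unfolding e using col_P[OF hi(1)[OF p]] P_vec[OF hi(1)[OF p]] hi(2)[OF p] by simp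
  then show ?thesis using ak hi(1)[OF p] h_eq[OF ak(1) p] ij by (cases "h a") auto
 next
  case False
  then have s: "Suc j = ls ! i" using I by simp
  have "mt X $$ (a, k) = 0" unfolding e s ls_zero[OF I(1)] using Q ak by simp
  moreover have "\<not> (fst (h a) = i \<and> snd (h a) = Suc j)" using hi(4)[OF ak(1)] s by (auto simp: chain_index_def)
  ultimately show ?thesis using ij by simp
 qed
qed

lemma X_gr: "X \<in> gr 2"
 unfolding gr_eq using X_cl by (auto simp: mt_X dg_def)

text \<open>Entries are set to zero off the index set, so that shifting a position past the end of a
  chain needs no separate treatment.\<close>

definition ent :: "'k mat => nat \<times> nat => nat \<times> nat => 'k" where
 "ent B p q = (if p \<in> IJ \<and> q \<in> IJ then B $$ (hi p, hi q) else 0)"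

lemma IJ_down: "(i, Suc j) \<in> IJ ==> (i, j) \<in> IJ" by (auto simp: chain_index_def)

text \<open>Compares one entry of the two products: on the left \<open>X\<close> shifts the row back
  along its chain, on the right it shifts the column forward.\<close>

lemma commute_ent:
 assumes B: "B \<in> carrier_mat N N" "mt X * B = B * mt X" and q: "(i, j) \<in> IJ" and p: "(i', j') \<in> IJ"
 shows "(case j' of 0 => 0 | Suc l => ent B (i', l) (i, j)) = ent B (i', j') (i, Suc j)"
proof -
 note X = mt_cl[OF X_cl]
 let ?a = "hi (i', j')" and ?k = "hi (i, j)"
 note ak = hi(1)[OF p] hi(1)[OF q] and hh = hi(2)[OF p] hi(2)[OF q]
 have "(mt X * B) $$ (?a, ?k) = (case j' of 0 => 0 | Suc l => ent B (i', l) (i, j))"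
 proof (cases j')
  case 0
  have "mt X $$ (?a, c) * B $$ (c, ?k) = 0" if "c < N" for c using mt_X[OF ak(1) that] hh 0 by simp
  then have "(mt X * B) $$ (?a, ?k) = 0" unfolding index_mult[OF X B(1) ak] by (intro sum.neutral) auto
  then show ?thesis using 0 by simp
 next
  case (Suc l)
  have pl: "(i', l) \<in> IJ" using p Suc IJ_down by blast
  have "mt X $$ (?a, c) * B $$ (c, ?k) = (if c = hi (i', l) then B $$ (c, ?k) else 0)" if "c < N" for c
   using mt_X[OF ak(1) that] hh(1) Suc h_eq[OF that pl] by (cases "h c") auto
  then have "(mt X * B) $$ (?a, ?k) = (\<Sum>c<N. if c = hi (i', l) then B $$ (c, ?k) else 0)"
   unfolding index_mult[OF X B(1) ak] by (intro sum.cong) auto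
  then show ?thesis using hi(1)[OF pl] pl q Suc by (simp add: ent_def)
 qed
 moreover have "(B * mt X) $$ (?a, ?k) = ent B (i', j') (i, Suc j)"
 proof (cases "(i, Suc j) \<in> IJ")
  case True
  have "B $$ (?a, c) * mt X $$ (c, ?k) = (if c = hi (i, Suc j) then B $$ (?a, c) else 0)" if "c < N" for c
   using mt_X[OF that ak(2)] hh(2) h_eq[OF that True] by (cases "h c") auto
  then have "(B * mt X) $$ (?a, ?k) = (\<Sum>c<N. if c = hi (i, Suc j) then B $$ (?a, c) else 0)"
   unfolding index_mult[OF B(1) X ak] by (intro sum.cong) auto
  then show ?thesis using hi(1)[OF True] True p by (simp add: ent_def)
 next
  case False
  have "B $$ (?a, c) * mt X $$ (c, ?k) = 0" if "c < N" for c
   using mt_X[OF that ak(2)] hh(2) hi(4)[OF that] False by (cases "h c") auto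
  then have "(B * mt X) $$ (?a, ?k) = 0" unfolding index_mult[OF B(1) X ak] by (intro sum.neutral) auto
  then show ?thesis using False by (simp add: ent_def)
 qed
 ultimately show ?thesis using B(2) by simp
qed

text \<open>A column at position \<open>j\<close> of its chain lies in the image of the j-th power
  of \<open>X\<close>, and so does its image under \<open>B\<close>; therefore rows at positions
  below \<open>j\<close> cannot occur.\<close>

lemma commute_down:
 assumes B: "B \<in> carrier_mat N N" "mt X * B = B * mt X"
 shows "(i', j') \<in> IJ ==> ent B (i', j') (i, Suc (j' + e)) = 0"
proof (induction j')
 case 0
 show ?case
 proof (cases "(i, e) \<in> IJ")
  case True
  from commute_ent[OF B True 0] show ?thesis by simp
 next
  case False
  then show ?thesis using IJ_down by (auto simp: ent_def)
 qed
next
 case (Suc j')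
 show ?case
 proof (cases "(i, Suc (j' + e)) \<in> IJ")
  case True
  from commute_ent[OF B True Suc.prems] show ?thesis using Suc.IH[OF IJ_down[OF Suc.prems]] by simp
 next
  case False
  then show ?thesis using IJ_down by (auto simp: ent_def)
 qed
qed

text \<open>The power \<open>Suc e\<close> of \<open>X\<close> kills the column vector, hence also
  its image under \<open>B\<close>; so no row can be further from the end of its chain. Here
  \<open>e\<close> counts the remaining steps in the chain of the column.\<close>

lemma commute_up:
 assumes B: "B \<in> carrier_mat N N" "mt X * B = B * mt X"
 shows "i < length ws ==> i' < length ws ==> Suc (j + e) = ls ! i ==> Suc (j' + e) < ls ! i' ==> ent B (i', j') (i, j) = 0"
proof (induction e arbitrary: j j')
 case 0
 have q: "(i, j) \<in> IJ" and p: "(i', Suc j') \<in> IJ" and nq: "(i, Suc j) \<notin> IJ" using 0 by (auto simp: chain_index_def)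
 from commute_ent[OF B q p] show ?case using nq by (simp add: ent_def)
next
 case (Suc e)
 have q: "(i, j) \<in> IJ" and p: "(i', Suc j') \<in> IJ" using Suc.prems by (auto simp: chain_index_def)
 from commute_ent[OF B q p] show ?case using Suc.IH[of "Suc j" "Suc j'"] Suc.prems by simp
qed

text \<open>A nonzero entry of negative degree violates one of the two chain conditions: if the row
  position is not below the column position, the degree equation forces the row to be further from
  the end of its chain.\<close>

lemma X_inj:
 assumes B: "B \<in> carrier_mat N N" and d: "1 \<le> d" and deg: "\<And>a b. a < N ==> b < N ==> B $$ (a, b) \<noteq> 0 ==> dg a = dg b - int d"
  and c: "mt X * B = B * mt X"
 shows "B = 0\<^sub>m N N"
proof (rule eq_matI)
 fix a k assume "a < dim_row (0\<^sub>m N N :: 'k mat)" "k < dim_col (0\<^sub>m N N :: 'k mat)"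
 then have ak: "a < N" "k < N" by auto
 obtain i' j' where a: "h a = (i', j')" by (cases "h a")
 obtain i j where k: "h k = (i, j)" by (cases "h k")
 have I: "(i', j') \<in> IJ" "(i, j) \<in> IJ" using hi(4)[OF ak(1)] hi(4)[OF ak(2)] a k by auto
 have e: "B $$ (a, k) = ent B (i', j') (i, j)" using I hi(3)[OF ak(1)] hi(3)[OF ak(2)] a k by (simp add: ent_def)
 have "B $$ (a, k) = 0"
 proof (rule ccontr)
  assume nz: "B $$ (a, k) \<noteq> 0"
  from deg[OF ak nz] have dd: "2 * int j' - int (ls ! i') = 2 * int j - int (ls ! i) - int d" by (simp add: dg_def a k)
  show False
  proof (cases "j' < j")
   case True
   then obtain e where "j = Suc (j' + e)" using less_imp_Suc_add by blast
   then show False using commute_down[OF B c I(1), of i e] e nz by simp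
  next
   case False
   have l: "i < length ws" "i' < length ws" "j < ls ! i" using I by (auto simp: chain_index_def)
   have "Suc (j + (ls ! i - Suc j)) = ls ! i" using l by simp
   moreover have "Suc (j' + (ls ! i - Suc j)) < ls ! i'" using l dd d False by linarith
   ultimately show False using commute_up[OF B c l(1,2)] e nz by metis
  qed
 qed
 then show "B $$ (a, k) = 0\<^sub>m N N $$ (a, k)" using ak by simp
qed (use B in auto)

text \<open>Isolates what depends on the family: nondegeneracy of the supertrace form and closure
  under degree components. The remaining axioms follow from the change of basis.\<close>

lemma matrix_grading:
 assumes partner: "\<And>x k c. x \<in> gr k ==> x \<in> hcomp L c ==> x \<noteq> \<zero> ==> \<exists>l e. \<exists>y\<in>gr l \<inter> hcomp L e. strd pr (mt x * mt y) \<noteq> 0"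
  and component: "\<And>x k. x \<in> hcomp L 0 ==> (\<And>a b. a < N ==> b < N ==> mt x $$ (a, b) \<noteq> 0 ==> dg a < dg b)
   ==> P * mat N N (\<lambda>(a, b). if dg a = dg b + k then mt x $$ (a, b) else 0) * Q \<in> C 0"
 shows "matrix_grading L \<chi> N mt dg pr X gr"
proof (intro matrix_grading.intro matrix_grading_axioms.intro super_env_algebra_axioms)
 show "mt (x \<oplus> y) = mt x + mt y" if "x \<in> carrier L" "y \<in> carrier L" for x y
  unfolding mt_def rho_D(2)[OF that] by (rule conj_add[OF Q rho_D(1)[OF that(1)] rho_D(1)[OF that(2)] P])
 show "mt (r \<odot> x) = r \<cdot>\<^sub>m mt x" if "x \<in> carrier L" for x r
  unfolding mt_def rho_D(3)[OF that] by (rule conj_smult[OF Q rho_D(1)[OF that] P])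
 show "x = y" if "x \<in> carrier L" "y \<in> carrier L" "mt x = mt y" for x y
 proof -
  have "\<rho> x = P * mt x * Q" "\<rho> y = P * mt y * Q"
   unfolding mt_def by (rule PQ_id(2)[OF rho_D(1), symmetric], rule that)+
  then have "\<rho> x = \<rho> y" using that(3) by (simp only:)
  then show ?thesis using inj_onD[OF rho_inj _ that(1,2)] by blast
 qed
 show "mt (brk L x y) = mt x * mt y - ksign c e \<cdot>\<^sub>m (mt y * mt x)" if xy: "x \<in> hcomp L c" "y \<in> hcomp L e" for x y c e
 proof -
  note r = rho_D(1)[OF hc_cl[OF xy(1)]] rho_D(1)[OF hc_cl[OF xy(2)]]
  let ?s = "ksign c e :: 'k" let ?U = "\<rho> x * \<rho> y" and ?V = "\<rho> y * \<rho> x"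
  have UV: "?U \<in> carrier_mat N N" "?V \<in> carrier_mat N N" using r by (auto intro: mcl)
  have "Q * (?U - ?s \<cdot>\<^sub>m ?V) * P = Q * (?U + (- ?s) \<cdot>\<^sub>m ?V) * P"
   using UV by (intro arg_cong[of _ _ "\<lambda>M. Q * M * P"] eq_matI) auto
  also have "\<dots> = Q * ?U * P + (- ?s) \<cdot>\<^sub>m (Q * ?V * P)"
   using conj_add[OF Q UV(1) _ P, of "(- ?s) \<cdot>\<^sub>m ?V"] conj_smult[OF Q UV(2) P, of "- ?s"] UV by simp
  also have "\<dots> = mt x * mt y + (- ?s) \<cdot>\<^sub>m (mt y * mt x)" unfolding mt_def conj_mult[OF r] conj_mult[OF r(2,1)] ..
  also have "\<dots> = mt x * mt y - ?s \<cdot>\<^sub>m (mt y * mt x)"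
   using mt_cl[OF hc_cl[OF xy(1)]] mt_cl[OF hc_cl[OF xy(2)]] by (intro eq_matI) auto
  finally show ?thesis unfolding mt_def rho_brk[OF xy] .
 qed
 show "mt (pmap L x) = mt x ^\<^sub>m CHAR('k)" if "x \<in> hcomp L 0" for x
  using mt_power[OF hc_cl[OF that], of "CHAR('k)"] rho_pmap[OF that] by (simp add: mt_def)
 show "\<chi> x = strd pr (mt X * mt x)" if x: "x \<in> carrier L" for x
 proof -
  note r = rho_D(1)[OF X_cl] rho_D(1)[OF x]
  show ?thesis unfolding chi[OF x] strd_conj[OF mcl[OF r]] conj_mult[OF r] mt_def ..
 qed
 show "\<exists>y\<in>hcomp L 0. mt y = mat N N (\<lambda>(a, b). if dg a = dg b + k then mt x $$ (a, b) else 0)"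
  if "x \<in> hcomp L 0" "\<And>a b. a < N ==> b < N ==> mt x $$ (a, b) \<noteq> 0 ==> dg a < dg b" for x k
  by (rule lift[OF mat_carrier component[OF that]])
qed (fact prime mt_cl mt_par X_even X_gr gr_eq X_inj partner)+

end

section \<open>The matrix Lie superalgebras\<close>

lemma bit_shift: "(a :: bit) = (a + b) + b" by (cases a; cases b) auto

context coordinates begin

lemma nonzero_entry:
 assumes x: "x \<in> carrier L" "x \<noteq> \<zero>"
 shows "\<exists>a<N. \<exists>b<N. mt x $$ (a, b) \<noteq> 0"
proof (rule ccontr)
 assume *: "\<not> ?thesis"
 have z: "\<zero> \<in> carrier L" by (rule hc_cl[OF hcomp_D(2)])
 have mx: "mt x = 0\<^sub>m N N" using * mt_cl[OF x(1)] by (intro eq_matI) auto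
 have "\<rho> x = P * mt x * Q" unfolding mt_def by (rule PQ_id(2)[OF rho_D(1)[OF x(1)], symmetric])
 also have "\<dots> = 0\<^sub>m N N" unfolding mx using P Q by simp
 finally have "\<rho> x = 0\<^sub>m N N" .
 moreover have "\<rho> \<zero> = 0\<^sub>m N N"
 proof -
  have "\<rho> \<zero> = 0 \<cdot>\<^sub>m \<rho> \<zero>" using rho_D(3)[OF z, of 0] by (simp add: smult_zero)
  also have "\<dots> = 0\<^sub>m N N" using rho_D(1)[OF z] by (intro eq_matI) auto
  finally show ?thesis .
 qed
 ultimately have "x = \<zero>" using inj_onD[OF rho_inj _ x(1) z] by simp
 then show False using x(2) by simp
qed

lemma strd_lift: "M \<in> carrier_mat N N ==> supertrace m (P * M * Q) = strd pr M"
 using strd_conj[OF mcl[OF mcl[OF P] Q], of M] PQ_id(1)[of M] by simp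

lemma partnerI:
 assumes M: "M \<in> carrier_mat N N" "P * M * Q \<in> C e" and deg: "\<And>a b. a < N ==> b < N ==> M $$ (a, b) \<noteq> 0 ==> dg a = dg b + l"
  and nz: "strd pr (mt x * M) \<noteq> 0"
 shows "\<exists>l e. \<exists>y\<in>gr l \<inter> hcomp L e. strd pr (mt x * mt y) \<noteq> 0"
proof -
 obtain y where y: "y \<in> hcomp L e" "mt y = M" using lift[OF M] by blast
 have "y \<in> gr l" unfolding gr_eq using hc_cl[OF y(1)] deg y(2) by blast
 then show ?thesis using y nz by blast
qed

definition elem :: "nat => nat => 'k mat" where "elem a b = mat N N (\<lambda>(i, j). if i = a \<and> j = b then 1 else 0)"

lemma elem_cl: "elem a b \<in> carrier_mat N N" by (simp add: elem_def)

lemma elem_gl: "a < N ==> b < N ==> P * elem a b * Q \<in> gl_comp m n (pr a + pr b)"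
 by (rule gl_lift[OF elem_cl]) (auto simp: elem_def bit_shift[symmetric] split: if_splits simp del: add_bit_eq_xor)

lemma strd_elem: "B \<in> carrier_mat N N ==> a < N ==> b < N ==> strd pr (B * elem b a) = ksign (pr a) (pr a) * B $$ (a, b)"
proof -
 assume B: "B \<in> carrier_mat N N" and ab: "a < N" "b < N"
 have "(\<Sum>k<N. ksign (pr i) (pr i) * (B $$ (i, k) * elem b a $$ (k, i))) = (if i = a then ksign (pr a) (pr a) * B $$ (a, b) else 0)" if i: "i < N" for i
 proof -
  have "(\<Sum>k<N. ksign (pr i) (pr i) * (B $$ (i, k) * elem b a $$ (k, i))) = (\<Sum>k<N. if k = b then (if i = a then ksign (pr a) (pr a) * B $$ (a, b) else 0) else 0)"
   using i by (intro sum.cong) (auto simp: elem_def)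
  then show ?thesis using ab by simp
 qed
 then have "strd pr (B * elem b a) = (\<Sum>i<N. if i = a then ksign (pr a) (pr a) * B $$ (a, b) else 0)"
  unfolding strd_mult[OF B elem_cl] by (intro sum.cong) auto
 then show ?thesis using ab by simp
qed

text \<open>Under the supertrace the elementary matrix at \<open>(b, a)\<close> reads off the entry
  at \<open>(a, b)\<close> up to sign, and it is homogeneous of the opposite degree.\<close>

lemma elem_partner:
 assumes x: "x \<in> carrier L" and ab: "a < N" "b < N" "mt x $$ (a, b) \<noteq> 0" and C: "P * elem b a * Q \<in> C e"
 shows "\<exists>l e. \<exists>y\<in>gr l \<inter> hcomp L e. strd pr (mt x * mt y) \<noteq> 0"
proof (rule partnerI[OF elem_cl C])
 show "dg i = dg j + (dg b - dg a)" if "i < N" "j < N" "elem b a $$ (i, j) \<noteq> 0" for i j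
  using that by (auto simp: elem_def split: if_splits)
 show "strd pr (mt x * elem b a) \<noteq> 0"
  unfolding strd_elem[OF mt_cl[OF x] ab(1,2)] using ab(3) by (simp add: ksign_def)
qed

abbreviation "filt x k \<equiv> mat N N (\<lambda>(a, b). if dg a = dg b + k then mt x $$ (a, b) else 0)"

lemma filt_gl: "x \<in> hcomp L 0 ==> P * filt x k * Q \<in> gl_comp m n 0"
 by (rule gl_lift) (use mt_par[of x 0] in \<open>auto split: if_splits\<close>)

lemma matrix_grading_gl:
 assumes C: "\<And>c. C c = gl_comp m n c"
 shows "matrix_grading L \<chi> N mt dg pr X gr"
proof (rule matrix_grading)
 fix x k c assume x: "x \<in> gr k" "x \<in> hcomp L c" "x \<noteq> \<zero>"
 obtain a b where ab: "a < N" "b < N" "mt x $$ (a, b) \<noteq> 0" using nonzero_entry[OF hc_cl[OF x(2)] x(3)] by blast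
 show "\<exists>l e. \<exists>y\<in>gr l \<inter> hcomp L e. strd pr (mt x * mt y) \<noteq> 0"
  by (rule elem_partner[OF hc_cl[OF x(2)] ab]) (unfold C, rule elem_gl[OF ab(2,1)])
qed (unfold C, rule filt_gl)

text \<open>Off-diagonal entries are detected by elementary matrices, which have supertrace 0. A
  nonzero diagonal element of sl is not scalar, because the identity has supertrace
  \<open>m - n\<close>, nonzero in the field; two different diagonal entries are then detected by a
  difference of diagonal units.\<close>

lemma matrix_grading_sl:
 assumes C: "\<And>c. C c = sl_comp m n c" and p: "\<not> int CHAR('k) dvd int m - int n"
 shows "matrix_grading L \<chi> N mt dg pr X gr"
proof (rule matrix_grading)
 fix x k c assume x: "x \<in> gr k" "x \<in> hcomp L c" "x \<noteq> \<zero>"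
 note xc = hc_cl[OF x(2)] and mx = mt_cl[OF hc_cl[OF x(2)]]
 have C': "P * M * Q \<in> C e" if "M \<in> carrier_mat N N" "P * M * Q \<in> gl_comp m n e" "strd pr M = 0" for M e
  unfolding C sl_comp_def using that strd_lift[OF that(1)] by simp
 show "\<exists>l e. \<exists>y\<in>gr l \<inter> hcomp L e. strd pr (mt x * mt y) \<noteq> 0"
 proof (cases "\<exists>a<N. \<exists>b<N. a \<noteq> b \<and> mt x $$ (a, b) \<noteq> 0")
  case True
  then obtain a b where ab: "a < N" "b < N" "mt x $$ (a, b) \<noteq> 0" "a \<noteq> b" by blast
  have e0: "strd pr (elem b a) = 0" unfolding strd_def using ab(4) by (intro sum.neutral) (auto simp: elem_def)
  show ?thesis by (rule elem_partner[OF xc ab(1-3) C'[OF elem_cl elem_gl[OF ab(2,1)] e0]])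
 next
  case False
  then have off: "mt x $$ (i, j) = 0" if "i < N" "j < N" "i \<noteq> j" for i j using that by blast
  obtain a where a: "a < N" "mt x $$ (a, a) \<noteq> 0" using nonzero_entry[OF xc x(3)] off by metis
  have "\<exists>b<N. mt x $$ (b, b) \<noteq> mt x $$ (a, a)"
  proof (rule ccontr)
   let ?r = "mt x $$ (a, a)"
   assume "\<not> ?thesis"
   then have diag: "mt x $$ (b, b) = ?r" if "b < N" for b using that by blast
   have "\<rho> x \<in> C c" using imageI[OF x(2), of \<rho>] unfolding rho_hcomp .
   then have "supertrace m (\<rho> x) = 0" unfolding C sl_comp_def by simp
   then have "strd pr (mt x) = 0" using strd_conj[OF rho_D(1)[OF xc]] by (simp add: mt_def)
   also have "strd pr (mt x) = ?r * strd pr (1\<^sub>m N)"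
    using mx diag by (auto simp: strd_def sum_distrib_left intro!: sum.cong)
   also have "strd pr (1\<^sub>m N) = supertrace m (1\<^sub>m N :: 'k mat)" using strd_conj[of "1\<^sub>m N"] P Q QP by simp
   also have "\<dots> = of_int (int m - int n)"
   proof -
    have "supertrace m (1\<^sub>m N :: 'k mat) = (\<Sum>i<N. if i < m then 1 else - 1)" by (auto simp: supertrace_def intro!: sum.cong)
    also have "\<dots> = (\<Sum>i<m. if i < m then 1 else - 1) + (\<Sum>i<n. if i + m < m then 1 else - 1 :: 'k)"
     using sum.nat_group by (simp add: lessThan_atLeast0 sum.atLeastLessThan_concat[of 0 m N, symmetric] sum.shift_bounds_nat_ivl[of _ 0 m n, simplified add.commute, simplified])
    finally show ?thesis by simp
   qed
   finally have "of_int (int m - int n) = (0 :: 'k)" using a(2) by simp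
   then show False using p by (simp only: of_int_eq_0_iff_char_dvd)
  qed
  then obtain b where b: "b < N" "mt x $$ (b, b) \<noteq> mt x $$ (a, a)" by blast
  let ?s = "\<lambda>i. ksign (pr i) (pr i) :: 'k"
  \<comment> \<open>The signs make both diagonal units contribute 1 to the supertrace, so that
    \<open>?D\<close> has supertrace 0 and pairs with \<open>mt x\<close> to the difference of its
    two diagonal entries.\<close>
  let ?D = "mat N N (\<lambda>(i, j). if i = j then (if i = a then ?s a else 0) - (if i = b then ?s b else 0) else 0)"
  have ss: "?s i * ?s i = 1" for i by (simp add: ksign_def)
  have D: "?D \<in> carrier_mat N N" by simp
  have "strd pr ?D = (\<Sum>i<N. (if i = a then 1 else 0) - (if i = b then 1 else 0))"
   unfolding strd_def by (auto simp: right_diff_distrib ss intro!: sum.cong)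
  also have "\<dots> = 0" using a(1) b(1) by (simp add: sum_subtractf)
  finally have D0: "strd pr ?D = 0" .
  have "strd pr (mt x * ?D) = (\<Sum>i<N. (if i = a then mt x $$ (a, a) else 0) - (if i = b then mt x $$ (b, b) else 0))"
   unfolding strd_mult[OF mx D]
  proof (rule sum.cong[OF refl])
   fix i assume "i \<in> {..<N}"
   then have i: "i < N" by simp
   have "(\<Sum>k<N. ?s i * (mt x $$ (i, k) * ?D $$ (k, i))) = (\<Sum>k<N. if k = i then ?s i * (mt x $$ (i, i) * ?D $$ (i, i)) else 0)"
    using i by (intro sum.cong) auto
   also have "\<dots> = ?s i * (mt x $$ (i, i) * ?D $$ (i, i))" using i by simp
   also have "\<dots> = (if i = a then mt x $$ (a, a) else 0) - (if i = b then mt x $$ (b, b) else 0)"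
    using i b(2) ss by (auto simp: mult.left_commute)
   finally show "(\<Sum>k<N. ?s i * (mt x $$ (i, k) * ?D $$ (k, i))) = (if i = a then mt x $$ (a, a) else 0) - (if i = b then mt x $$ (b, b) else 0)" .
  qed
  also have "\<dots> = mt x $$ (a, a) - mt x $$ (b, b)" using a(1) b(1) by (simp add: sum_subtractf)
  finally have nz: "strd pr (mt x * ?D) \<noteq> 0" using b(2) by simp
  have gl: "P * ?D * Q \<in> gl_comp m n 0" by (rule gl_lift[OF D]) (auto split: if_splits)
  have dg0: "dg i = dg j + 0" if "i < N" "j < N" "?D $$ (i, j) \<noteq> 0" for i j using that by (auto split: if_splits)
  show ?thesis by (rule partnerI[OF D C'[OF D gl D0] dg0 nz])
 qed
next
 fix x k assume x: "x \<in> hcomp L 0" and low: "\<And>a b. a < N ==> b < N ==> mt x $$ (a, b) \<noteq> 0 ==> dg a < dg b"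
 \<comment> \<open>An element that strictly lowers the degree has no diagonal entries.\<close>
 have "strd pr (filt x k) = 0" unfolding strd_def using low by (intro sum.neutral) fastforce
 then show "P * filt x k * Q \<in> C 0" unfolding C sl_comp_def using filt_gl[OF x] strd_lift[of "filt x k"] by simp
qed

end

section \<open>The orthosymplectic case\<close>

lemma bilin_sum:
 fixes K :: "'k::field mat"
 assumes "K \<in> carrier_mat N N" "u \<in> carrier_vec N" "w \<in> carrier_vec N"
 shows "bilin K u w = (\<Sum>i<N. \<Sum>j<N. u $ i * K $$ (i, j) * w $ j)"
proof -
 have "bilin K u w = (\<Sum>i<N. u $ i * (K *\<^sub>v w) $ i)" using assms by (simp add: bilin_def scalar_prod_def atLeast0LessThan)
 also have "\<dots> = (\<Sum>i<N. \<Sum>j<N. u $ i * K $$ (i, j) * w $ j)"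
  by (intro sum.cong refl) (simp only: lessThan_iff index_mult_vec[OF assms(1,3)] sum_distrib_left mult.assoc)
 finally show ?thesis .
qed

lemma bilin_unit:
 fixes K :: "'k::field mat"
 assumes K: "K \<in> carrier_mat N N" and ij: "i < N" "j < N"
 shows "bilin K (unit_vec N i) (unit_vec N j) = K $$ (i, j)"
 unfolding bilin_def mult_unit_vec[OF K ij(2)] using K ij by simp

lemma bilin_left:
 fixes K :: "'k::field mat"
 assumes "K \<in> carrier_mat N N" "M \<in> carrier_mat N N" "u \<in> carrier_vec N" "w \<in> carrier_vec N"
 shows "bilin K (M *\<^sub>v u) w = bilin (M\<^sup>T * K) u w"
proof -
 have "bilin K (M *\<^sub>v u) w = (K *\<^sub>v w) \<bullet> (M *\<^sub>v u)" using assms by (simp add: bilin_def comm_scalar_prod[of _ N])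
 also have "\<dots> = (M\<^sup>T *\<^sub>v (K *\<^sub>v w)) \<bullet> u" by (rule transpose_vec_mult_scalar[symmetric]) (use assms in auto)
 also have "M\<^sup>T *\<^sub>v (K *\<^sub>v w) = (M\<^sup>T * K) *\<^sub>v w" by (rule assoc_mult_mat_vec[symmetric, of _ N N]) (use assms in auto)
 also have "\<dots> \<bullet> u = bilin (M\<^sup>T * K) u w" unfolding bilin_def by (rule comm_scalar_prod[of _ N]) (use assms in auto)
 finally show ?thesis .
qed

lemma bilin_right:
 fixes K :: "'k::field mat"
 assumes "K \<in> carrier_mat N N" "M \<in> carrier_mat N N" "w \<in> carrier_vec N"
 shows "bilin K u (M *\<^sub>v w) = bilin (K * M) u w"
 unfolding bilin_def assoc_mult_mat_vec[OF assms] ..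

context coordinates begin

context
 fixes J :: "'k mat"
 assumes gram: "osp_gram m n J" and C: "\<And>c. C c = osp_comp m n J c"
  and orth: "\<And>k l v w. k + l \<noteq> 0 ==> v \<in> chain_degree_space N (\<rho> X) ws ls k ==> w \<in> chain_degree_space N (\<rho> X) ws ls l ==> bilin J v w = 0"
begin

text \<open>The Gram matrix of the bilinear form in the chain basis.\<close>

definition "JP = P\<^sup>T * J * P"
abbreviation "sn i \<equiv> (ksign (pr i) (pr i) :: 'k)"

lemma J_cl: "J \<in> carrier_mat N N" and J_det: "det J \<noteq> 0"
 using gram unfolding osp_gram_def gl_comp_def by blast+

lemma PT_cl: "P\<^sup>T \<in> carrier_mat N N" using P by simp

lemma JP_cl: "JP \<in> carrier_mat N N" unfolding JP_def by (intro mcl PT_cl J_cl P)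

lemma bilin_P: "u \<in> carrier_vec N ==> w \<in> carrier_vec N ==> bilin J (P *\<^sub>v u) (P *\<^sub>v w) = bilin JP u w"
 unfolding JP_def using bilin_left[OF J_cl P, of u "P *\<^sub>v w"] bilin_right[OF mcl[OF PT_cl J_cl] P, of w u] P by simp

lemma JP_index: "i < N ==> j < N ==> JP $$ (i, j) = bilin J (col P i) (col P j)"
 using bilin_P[of "unit_vec N i" "unit_vec N j"] bilin_unit[OF JP_cl] mult_unit_vec[OF P] by simp

lemma col_comp: "i < N ==> col P i \<in> vec_comp m n (pr i)"
 using P P_par unfolding vec_comp_def by auto

lemma JP_sym': "i < N ==> j < N ==> JP $$ (i, j) = ksign (pr i) (pr j) * JP $$ (j, i)"
proof -
 assume ij: "i < N" "j < N"
 have "\<forall>a b. \<forall>v\<in>vec_comp m n a. \<forall>w\<in>vec_comp m n b. bilin J v w = ksign a b * bilin J w v"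
  using gram unfolding osp_gram_def by blast
 then show ?thesis unfolding JP_index[OF ij] JP_index[OF ij(2,1)] using col_comp ij by blast
qed

lemma JP_par: "i < N ==> j < N ==> JP $$ (i, j) \<noteq> 0 ==> pr i = pr j"
proof -
 assume ij: "i < N" "j < N" and nz: "JP $$ (i, j) \<noteq> 0"
 obtain k where k: "k < N" "(P\<^sup>T * J) $$ (i, k) \<noteq> 0" "P $$ (k, j) \<noteq> 0"
  using mult_support[OF mcl[OF PT_cl J_cl] P ij] nz unfolding JP_def by blast
 obtain l where l: "l < N" "P\<^sup>T $$ (i, l) \<noteq> 0" "J $$ (l, k) \<noteq> 0" using mult_support[OF PT_cl J_cl ij(1) k(1,2)] .
 have "par m l = 0 + par m k" using gram l k unfolding osp_gram_def gl_comp_def by blast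
 moreover have "par m l = pr i" using P_par[OF l(1) ij(1)] l P ij by simp
 ultimately show ?thesis using P_par[OF k(1) ij(2) k(3)] by (simp only: add_0)
qed

lemma JP_sym: "i < N ==> j < N ==> JP $$ (i, j) = sn i * JP $$ (j, i)"
 using JP_sym'[of i j] JP_par[of j i] by (cases "JP $$ (j, i) = 0") auto

lemma JP_deg: "i < N ==> j < N ==> JP $$ (i, j) \<noteq> 0 ==> dg i + dg j = 0"
proof (rule ccontr)
 assume ij: "i < N" "j < N" "JP $$ (i, j) \<noteq> 0" "dg i + dg j \<noteq> 0"
 have "col P k \<in> chain_degree_space N (\<rho> X) ws ls (dg k)" if "k < N" for k
  unfolding degree_space using P that P_vec[OF that] by (auto split: if_splits)
 then show False using orth[OF ij(4)] JP_index[OF ij(1,2)] ij by simp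
qed

text \<open>Super-skewness is tested on pairs of basis vectors. For a homogeneous vector the sign is
  constant, because its coordinates are supported on basis vectors of its own parity.\<close>

lemma osp_coord:
 assumes M: "M \<in> carrier_mat N N" "P * M * Q \<in> gl_comp m n c"
 shows "P * M * Q \<in> C c \<longleftrightarrow> (\<forall>i<N. \<forall>j<N. (M\<^sup>T * JP) $$ (i, j) = - (ksign c (pr i) * (JP * M) $$ (i, j)))"
proof -
 let ?A = "P * M * Q"
 have MT: "M\<^sup>T \<in> carrier_mat N N" using M by simp
 have act: "?A *\<^sub>v (P *\<^sub>v u) = P *\<^sub>v (M *\<^sub>v u)" if u: "u \<in> carrier_vec N" for u
 proof -
  have "?A *\<^sub>v (P *\<^sub>v u) = (P * M) *\<^sub>v (Q *\<^sub>v (P *\<^sub>v u))" by (rule assoc_mult_mat_vec[OF mcl[OF P M(1)] Q]) (use P u in auto)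
  also have "Q *\<^sub>v (P *\<^sub>v u) = u" using assoc_mult_mat_vec[OF Q P u] QP u by simp
  also have "(P * M) *\<^sub>v u = P *\<^sub>v (M *\<^sub>v u)" by (rule assoc_mult_mat_vec[OF P M(1) u])
  finally show ?thesis .
 qed
 have L: "bilin J (?A *\<^sub>v (P *\<^sub>v u)) (P *\<^sub>v t) = bilin (M\<^sup>T * JP) u t" "bilin J (P *\<^sub>v u) (?A *\<^sub>v (P *\<^sub>v t)) = bilin (JP * M) u t"
  if u: "u \<in> carrier_vec N" "t \<in> carrier_vec N" for u t
  unfolding act[OF u(1)] act[OF u(2)] using bilin_P[of "M *\<^sub>v u" t] bilin_P[of u "M *\<^sub>v t"] bilin_left[OF JP_cl M(1) u] bilin_right[OF JP_cl M(1) u(2)] M u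
  by simp_all
 have PQv: "P *\<^sub>v (Q *\<^sub>v v) = v" if "v \<in> carrier_vec N" for v :: "'k vec" using assoc_mult_mat_vec[OF P Q that] PQ that by simp
 have K: "M\<^sup>T * JP \<in> carrier_mat N N" "JP * M \<in> carrier_mat N N" by (rule mcl[OF MT JP_cl], rule mcl[OF JP_cl M(1)])
 show ?thesis
 proof
  assume "?A \<in> C c"
  then have *: "bilin J (?A *\<^sub>v v) w = - (ksign c b * bilin J v (?A *\<^sub>v w))" if "v \<in> vec_comp m n b" "w \<in> carrier_vec N" for v w b
   using that unfolding C osp_comp_def by blast
  show "\<forall>i<N. \<forall>j<N. (M\<^sup>T * JP) $$ (i, j) = - (ksign c (pr i) * (JP * M) $$ (i, j))"
  proof (intro allI impI)
   fix i j assume ij: "i < N" "j < N"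
   have "bilin J (?A *\<^sub>v (P *\<^sub>v unit_vec N i)) (P *\<^sub>v unit_vec N j) = - (ksign c (pr i) * bilin J (P *\<^sub>v unit_vec N i) (?A *\<^sub>v (P *\<^sub>v unit_vec N j)))"
    using col_comp[OF ij(1)] P ij by (intro *) (simp_all add: mult_unit_vec[OF P])
   then show "(M\<^sup>T * JP) $$ (i, j) = - (ksign c (pr i) * (JP * M) $$ (i, j))"
    unfolding L[OF unit_vec_carrier unit_vec_carrier] bilin_unit[OF K(1) ij] bilin_unit[OF K(2) ij] .
  qed
 next
  assume *: "\<forall>i<N. \<forall>j<N. (M\<^sup>T * JP) $$ (i, j) = - (ksign c (pr i) * (JP * M) $$ (i, j))"
  show "?A \<in> C c" unfolding C osp_comp_def
  proof (intro CollectI conjI allI ballI M(2))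
   fix b and v w :: "'k vec" assume v: "v \<in> vec_comp m n b" and w: "w \<in> carrier_vec N"
   then have vc: "v \<in> carrier_vec N" by (simp add: vec_comp_def)
   let ?u = "Q *\<^sub>v v" and ?t = "Q *\<^sub>v w"
   have ut: "?u \<in> carrier_vec N" "?t \<in> carrier_vec N" using Q vc w by auto
   have up: "pr i = b" if i: "i < N" "?u $ i \<noteq> 0" for i
   proof -
    obtain k where k: "k < N" "Q $$ (i, k) \<noteq> 0" "v $ k \<noteq> 0" using mult_vec_support[OF Q vc i] .
    then show ?thesis using Q_par[OF k(1) i(1) k(2)] v unfolding vec_comp_def by simp
   qed
   have "bilin J (?A *\<^sub>v v) w = bilin (M\<^sup>T * JP) ?u ?t" using L(1)[OF ut] PQv[OF vc] PQv[OF w] by simp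
   also have "\<dots> = (\<Sum>i<N. \<Sum>j<N. - ksign c b * (?u $ i * (JP * M) $$ (i, j) * ?t $ j))"
    unfolding bilin_sum[OF K(1) ut]
   proof (intro sum.cong refl)
    fix i j assume "i \<in> {..<N}" "j \<in> {..<N}"
    then have ij: "i < N" "j < N" by auto
    show "?u $ i * (M\<^sup>T * JP) $$ (i, j) * ?t $ j = - ksign c b * (?u $ i * (JP * M) $$ (i, j) * ?t $ j)"
    proof (cases "?u $ i = 0")
     case False
     have "pr i = b" by (rule up[OF ij(1) False])
     then show ?thesis using *[rule_format, OF ij] by (simp only: mult_minus_left mult_minus_right mult_ac)
    qed (simp del: index_mult_mat_vec index_mult_mat)
   qed
   also have "\<dots> = - (ksign c b * bilin (JP * M) ?u ?t)"
    unfolding bilin_sum[OF K(2) ut] by (simp add: sum_distrib_left sum_negf del: index_mult_mat_vec index_mult_mat)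
   also have "bilin (JP * M) ?u ?t = bilin J v (?A *\<^sub>v w)" using L(2)[OF ut] PQv[OF vc] PQv[OF w] by simp
   finally show "bilin J (?A *\<^sub>v v) w = - (ksign c b * bilin J v (?A *\<^sub>v w))" .
  qed
 qed
qed

lemma mt_osp:
 assumes x: "x \<in> hcomp L c" and ij: "i < N" "j < N"
 shows "((mt x)\<^sup>T * JP) $$ (i, j) = - (ksign c (pr i) * (JP * mt x) $$ (i, j))"
proof -
 have "\<rho> x \<in> C c" using imageI[OF x, of \<rho>] unfolding rho_hcomp .
 then have "P * mt x * Q \<in> C c" unfolding mt_def PQ_id(2)[OF rho_D(1)[OF hc_cl[OF x]]] .
 then show ?thesis using osp_coord[OF mt_cl[OF hc_cl[OF x]], of c] C_gl ij by blast
qed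

lemma index_T: "M \<in> carrier_mat N N ==> i < N ==> j < N ==> (M\<^sup>T * JP) $$ (i, j) = (\<Sum>k<N. M $$ (k, i) * JP $$ (k, j))"
 by (subst index_mult[OF _ JP_cl]) (auto intro!: sum.cong)

text \<open>\<open>JP\<close> pairs only opposite degrees, so the defining equations of osp split by
  degree and components stay inside. For the partner, a nonzero entry of \<open>JP * mt x\<close> is
  detected by a rank-two skew element, the orthosymplectic substitute for an elementary
  matrix.\<close>

lemma matrix_grading_osp: "matrix_grading L \<chi> N mt dg pr X gr"
proof (rule matrix_grading)
 fix x k assume x: "x \<in> hcomp L 0"
 let ?F = "filt x k"
 have F: "?F \<in> carrier_mat N N" by simp
 note mx = mt_cl[OF hc_cl[OF x]]
 have "(?F\<^sup>T * JP) $$ (i, j) = - (ksign 0 (pr i) * (JP * ?F) $$ (i, j))" if ij: "i < N" "j < N" for i j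
 proof -
  have "(?F\<^sup>T * JP) $$ (i, j) = (\<Sum>l<N. if dg i + dg j = - k then mt x $$ (l, i) * JP $$ (l, j) else 0)"
   unfolding index_T[OF F ij] using ij JP_deg[OF _ ij(2)] by (intro sum.cong) (fastforce split: if_splits)+
  also have "\<dots> = (if dg i + dg j = - k then ((mt x)\<^sup>T * JP) $$ (i, j) else 0)" unfolding index_T[OF mx ij] by simp
  finally have 1: "(?F\<^sup>T * JP) $$ (i, j) = (if dg i + dg j = - k then ((mt x)\<^sup>T * JP) $$ (i, j) else 0)" .
  have "(JP * ?F) $$ (i, j) = (\<Sum>l<N. if dg i + dg j = - k then JP $$ (i, l) * mt x $$ (l, j) else 0)"
   unfolding index_mult[OF JP_cl F ij] using ij JP_deg[OF ij(1)] by (intro sum.cong) (fastforce split: if_splits)+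
  also have "\<dots> = (if dg i + dg j = - k then (JP * mt x) $$ (i, j) else 0)" unfolding index_mult[OF JP_cl mx ij] by simp
  finally show ?thesis unfolding 1 using mt_osp[OF x ij] by (simp only: if_distrib split: if_split) simp
 qed
 then show "P * ?F * Q \<in> C 0" using osp_coord[OF F filt_gl[OF x]] by blast
next
 fix x k c assume x: "x \<in> gr k" "x \<in> hcomp L c" "x \<noteq> \<zero>"
 note mx = mt_cl[OF hc_cl[OF x(2)]]
 have "\<exists>i<N. \<exists>j<N. (JP * mt x) $$ (i, j) \<noteq> 0"
 proof (rule ccontr)
  assume "\<not> ?thesis"
  then have z: "JP * mt x = 0\<^sub>m N N" using mx JP_cl by (intro eq_matI) (auto simp del: index_mult_mat(1))
  have QT: "Q\<^sup>T \<in> carrier_mat N N" using Q by simp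
  have QPT: "Q\<^sup>T * P\<^sup>T = 1\<^sub>m N" using transpose_mult[OF P Q] PQ by simp
  \<comment> \<open>The Gram matrix is invertible, being congruent to the invertible
    \<open>J\<close>; multiplying by its inverse, assembled from \<open>Q\<close> and
    \<open>J'\<close>, gives \<open>mt x = 0\<close>.\<close>
  obtain J' where J': "J' \<in> carrier_mat N N" "J' * J = 1\<^sub>m N"
   using det_non_zero_imp_unit[OF J_cl J_det, of "()"] unfolding Units_def ring_mat_simps by blast
  have "mt x = (Q * (J' * ((Q\<^sup>T * P\<^sup>T) * (J * P)))) * mt x"
  proof -
   have "J' * (J * P) = P" using assoc_mult_mat[OF J'(1) J_cl P] J'(2) P by simp
   then have e: "J' * (1\<^sub>m N * (J * P)) = P" using left_mult_one_mat[OF mcl[OF J_cl P]] by simp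
   show ?thesis unfolding QPT e QP using mx by simp
  qed
  also have "\<dots> = Q * (J' * (Q\<^sup>T * (JP * mt x)))"
   unfolding JP_def using J' J_cl P Q QT PT_cl mx by (simp add: assoc mcl)
  also have "\<dots> = 0\<^sub>m N N" unfolding z using J'(1) Q QT by simp
  finally have "mt x = 0\<^sub>m N N" .
  then show False using nonzero_entry[OF hc_cl[OF x(2)] x(3)] by auto
 qed
 then obtain i j where ij: "i < N" "j < N" and nz: "(JP * mt x) $$ (i, j) \<noteq> 0" by blast
 have pc: "pr i = c + pr j"
 proof -
  obtain l where l: "l < N" "JP $$ (i, l) \<noteq> 0" "mt x $$ (l, j) \<noteq> 0" using mult_support[OF JP_cl mx ij nz] .
  show ?thesis using JP_par[OF ij(1) l(1,2)] mt_par[OF x(2) l(1) ij(2) l(3)] by (simp only:)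
 qed
 let ?e = "ksign (pr i) (pr j) :: 'k"
 \<comment> \<open>For basis vectors e_i, e_j this is the map taking v to (e_j, v) e_i - ?e (e_i, v)
   e_j; the sign \<open>?e\<close> makes it super-skew for the form.\<close>
 let ?T = "mat N N (\<lambda>(a, b). (if a = i then JP $$ (j, b) else 0) - ?e * (if a = j then JP $$ (i, b) else 0))"
 have T: "?T \<in> carrier_mat N N" by simp
 have Tsupp: "(a = i \<and> JP $$ (j, b) \<noteq> 0) \<or> (a = j \<and> JP $$ (i, b) \<noteq> 0)" if "a < N" "b < N" "?T $$ (a, b) \<noteq> 0" for a b
  using that by (auto split: if_splits)
 have Tgl: "P * ?T * Q \<in> gl_comp m n (pr i + pr j)"
 proof (rule gl_lift[OF T])
  fix a b assume ab: "a < N" "b < N" "?T $$ (a, b) \<noteq> 0"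
  from Tsupp[OF ab] show "pr a = pr i + pr j + pr b"
  proof (elim disjE conjE)
   assume *: "a = i" "JP $$ (j, b) \<noteq> 0"
   have "pr j = pr b" by (rule JP_par[OF ij(2) ab(2) *(2)])
   then show ?thesis using bit_shift[of "pr i" "pr j"] *(1) by metis
  next
   assume *: "a = j" "JP $$ (i, b) \<noteq> 0"
   have "pr i = pr b" by (rule JP_par[OF ij(1) ab(2) *(2)])
   moreover have "pr j = (pr i + pr j) + pr i" unfolding add.commute[of "pr i" "pr j"] by (rule bit_shift)
   ultimately show ?thesis using *(1) by metis
  qed
 qed
 have sumT: "(\<Sum>k<N. f k * ?T $$ (k, b)) = f i * JP $$ (j, b) - ?e * (f j * JP $$ (i, b))" if b: "b < N" for f b
 proof -
  have "(\<Sum>k<N. f k * ?T $$ (k, b)) = (\<Sum>k<N. (if k = i then f i * JP $$ (j, b) else 0) - (if k = j then ?e * (f j * JP $$ (i, b)) else 0))"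
   using b by (intro sum.cong) (auto simp: algebra_simps)
  then show ?thesis using ij by (simp add: sum_subtractf)
 qed
 have "(?T\<^sup>T * JP) $$ (a, b) = - (ksign (pr i + pr j) (pr a) * (JP * ?T) $$ (a, b))" if ab: "a < N" "b < N" for a b
 proof -
  have 1: "(?T\<^sup>T * JP) $$ (a, b) = JP $$ (i, b) * JP $$ (j, a) - ?e * (JP $$ (j, b) * JP $$ (i, a))"
   unfolding index_T[OF T ab] using sumT[OF ab(1), of "\<lambda>k. JP $$ (k, b)"] by (simp only: mult.commute)
  have 2: "(JP * ?T) $$ (a, b) = (sn i * JP $$ (i, a)) * JP $$ (j, b) - ?e * ((sn j * JP $$ (j, a)) * JP $$ (i, b))"
  proof -
   have s: "JP $$ (a, l) = sn l * JP $$ (l, a)" if "l < N" for l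
    using JP_sym[OF ab(1) that] JP_par[OF ab(1) that] JP_sym[OF that ab(1)] by (cases "JP $$ (a, l) = 0") (auto simp: ksign_def)
   show ?thesis unfolding index_mult[OF JP_cl T ab] sumT[OF ab(2)] s[OF ij(1)] s[OF ij(2)] ..
  qed
  have pi: "JP $$ (i, a) = 0 \<or> pr a = pr i" and pj: "JP $$ (j, a) = 0 \<or> pr a = pr j"
   using JP_par[OF ij(1) ab(1)] JP_par[OF ij(2) ab(1)] by metis+
  show ?thesis unfolding 1 2 using pi pj by (cases "pr i"; cases "pr j") (auto simp: ksign_def algebra_simps)
 qed
 then have TC: "P * ?T * Q \<in> C (pr i + pr j)" using osp_coord[OF T Tgl] by blast
 have deg: "dg a = dg b + (dg i + dg j)" if ab: "a < N" "b < N" "?T $$ (a, b) \<noteq> 0" for a b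
  using Tsupp[OF ab] JP_deg[OF ij(2) ab(2)] JP_deg[OF ij(1) ab(2)] by auto
 have "strd pr (mt x * ?T) = (\<Sum>a<N. sn a * (mt x $$ (a, i) * JP $$ (j, a)) - ?e * (sn a * (mt x $$ (a, j) * JP $$ (i, a))))"
  unfolding strd_mult[OF mx T] sum_distrib_left[symmetric]
  by (intro sum.cong refl) (simp only: lessThan_iff sumT right_diff_distrib mult_ac)
 also have "\<dots> = (\<Sum>a<N. mt x $$ (a, i) * JP $$ (a, j)) - ?e * (sn i * (\<Sum>a<N. JP $$ (i, a) * mt x $$ (a, j)))"
 proof -
  have "sn a * (mt x $$ (a, i) * JP $$ (j, a)) = mt x $$ (a, i) * JP $$ (a, j)"
   "sn a * (mt x $$ (a, j) * JP $$ (i, a)) = sn i * (JP $$ (i, a) * mt x $$ (a, j))" if a: "a < N" for a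
   using JP_sym[OF a ij(2)] JP_par[OF ij(1) a] by (auto simp: mult_ac)
  note e = this
  have "(\<Sum>a<N. sn a * (mt x $$ (a, i) * JP $$ (j, a)) - ?e * (sn a * (mt x $$ (a, j) * JP $$ (i, a))))
    = (\<Sum>a<N. mt x $$ (a, i) * JP $$ (a, j) - ?e * (sn i * (JP $$ (i, a) * mt x $$ (a, j))))"
   by (intro sum.cong refl) (simp only: lessThan_iff e)
  also have "\<dots> = (\<Sum>a<N. mt x $$ (a, i) * JP $$ (a, j)) - ?e * (sn i * (\<Sum>a<N. JP $$ (i, a) * mt x $$ (a, j)))"
   by (simp only: sum_subtractf sum_distrib_left)
  finally show ?thesis .
 qed
 also have "(\<Sum>a<N. mt x $$ (a, i) * JP $$ (a, j)) = - (ksign c (pr i) * (JP * mt x) $$ (i, j))"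
  using mt_osp[OF x(2) ij] index_T[OF mx ij] by simp
 also have "(\<Sum>a<N. JP $$ (i, a) * mt x $$ (a, j)) = (JP * mt x) $$ (i, j)" by (rule index_mult[OF JP_cl mx ij, symmetric])
 finally have str: "strd pr (mt x * ?T) = - ((ksign c (pr i) + ?e * sn i) * (JP * mt x) $$ (i, j))"
  by (simp only: distrib_right minus_add_distrib mult.assoc diff_conv_add_uminus)
 \<comment> \<open>Since \<open>pr i = c + pr j\<close>, both halves of \<open>?T\<close> contribute
   with the same sign, and the factor is 2 or -2.\<close>
 have "(1 :: 'k) + 1 \<noteq> 0" "(- 1 :: 'k) - 1 \<noteq> 0" using two by (simp_all add: minus_equation_iff[of 1 1] eq_neg_iff_add_eq_0)
 then have "ksign c (pr i) + ?e * sn i \<noteq> 0" using pc by (cases c; cases "pr j") (auto simp: ksign_def)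
 then have "strd pr (mt x * ?T) \<noteq> 0" unfolding str using nz by (simp del: index_mult_mat(1))
 from partnerI[OF T TC deg this] show "\<exists>l e. \<exists>y\<in>gr l \<inter> hcomp L e. strd pr (mt x * mt y) \<noteq> 0" .
qed

end
end

section \<open>The main theorem\<close>

lemma odd_characteristic:
 assumes "CHAR('k::field) > 2"
 shows "prime CHAR('k)" "(2 :: 'k) \<noteq> 0"
proof -
 show "prime CHAR('k)" using assms by (intro prime_CHAR_semidom) auto
 have "\<not> CHAR('k) dvd 2" using assms by (auto dest: dvd_imp_le)
 then have "of_nat 2 \<noteq> (0 :: 'k)" by (simp add: of_nat_eq_0_iff_char_dvd del: of_nat_numeral)
 then show "(2 :: 'k) \<noteq> 0" by simp
qed

text \<open>\<open>Pp\<close> is the extra condition on the spaces V(k): trivial for gl and sl,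
  orthogonality for osp. \<open>step\<close> is the part that depends on the family.\<close>

lemma matrix_case:
 fixes L :: "('k::field, 'g) lie_superalg"
 assumes char: "CHAR('k) > 2" and lie: "lie_superalgebra L" and realized: "mat_realized m n C \<rho> L"
  and C: "\<And>c. C c \<subseteq> gl_comp m n c" and B: "\<forall>x\<in>carrier L. \<forall>y\<in>carrier L. B x y = supertrace m (\<rho> x * \<rho> y)"
  and X: "X \<in> hcomp L 0" and chi: "\<forall>x\<in>carrier L. \<chi> x = B X x" and gr: "mat_grading m n \<rho> L X Pp gr"
  and assoc: "associated_m L \<chi> gr S"
  and step: "\<And>ws ls P Q h pr. coordinates L \<chi> m n \<rho> C X gr ws ls P Q h pr ==> Pp (chain_degree_space (m + n) (\<rho> X) ws ls)
   ==> matrix_grading L \<chi> (m + n) (coordinates.mt \<rho> P Q) (coordinates.dg ls h) pr X gr"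
 shows "projective_supermodule TYPE('m) TYPE('n) (reduced_env L \<chi>) (Q_module L S \<chi>)
  \<and> algebra_iso (reduced_env L \<chi>)
    (matrix_algebra (kdim (reduced_env (sub_lie L S) \<chi>))
     (opposite_superalgebra (End_superalgebra (reduced_env L \<chi>) (Q_module L S \<chi>))))"
proof -
 note p = odd_characteristic[OF char]
 have pm: "pmap L x \<in> hcomp L 0" if "x \<in> hcomp L 0" for x using realized that unfolding mat_realized_def by blast
 interpret super_env_algebra L \<chi> by (rule super_env_algebraI[OF lie pm p(2)])
 have "\<rho> X \<in> C 0" using realized X unfolding mat_realized_def by blast
 then have gl: "\<rho> X \<in> gl_comp m n 0" using C by blast
 obtain ws ls where cb: "chain_basis m n (\<rho> X) ws ls" and Pp: "Pp (chain_degree_space (m + n) (\<rho> X) ws ls)"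
  and gr': "gr = mat_degree_space L \<rho> (chain_degree_space (m + n) (\<rho> X) ws ls)"
  using gr unfolding mat_grading_def Let_def by blast
 show ?thesis
 proof (rule exists_coordinates[OF gl cb p(2)])
  fix P Q :: "'k mat" and h pr
  assume co: "P \<in> carrier_mat (m + n) (m + n)" "Q \<in> carrier_mat (m + n) (m + n)" "P * Q = 1\<^sub>m (m + n)" "Q * P = 1\<^sub>m (m + n)"
   "bij_betw h {..<m + n} (chain_index ws ls)"
   "\<And>k. k < m + n ==> col P k = (\<rho> X ^\<^sub>m snd (h k)) *\<^sub>v (ws ! fst (h k))"
   "\<And>a k. a < m + n ==> k < m + n ==> P $$ (a, k) \<noteq> 0 ==> par m a = pr k"
   "\<And>a k. a < m + n ==> k < m + n ==> Q $$ (k, a) \<noteq> 0 ==> pr k = par m a"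
  have "coordinates L \<chi> m n \<rho> C X gr ws ls P Q h pr"
  proof (intro coordinates.intro coordinates_axioms.intro super_env_algebra_axioms)
   show "\<chi> x = supertrace m (\<rho> X * \<rho> x)" if "x \<in> carrier L" for x 
    using bspec[OF chi that] bspec[OF bspec[OF B subsetD[OF hc X]] that] by simp
  qed (fact p(1) realized C X cb gr' co)+
  from step[OF this Pp] have "matrix_grading L \<chi> (m + n) (coordinates.mt \<rho> P Q) (coordinates.dg ls h) pr X gr" .
  from matrix_grading.chi_grading[OF this assoc] show ?thesis by (rule chi_grading.projective_and_matrix)
 qed
qed

text \<open>An algebraically closed field is infinite, so Laurent polynomials along the cocharacter
  are determined by their values.\<close>

lemma exceptional_case:
 fixes L :: "('k::alg_closed_field, 'g) lie_superalg"
 assumes char: "CHAR('k) > 2" and lie: "lie_superalgebra L"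
  and alg: "\<And>i. i < length fs ==> fst (snd (fs ! i)) \<subseteq> carrier_mat (fst (fs ! i)) (fst (fs ! i))"
  and realized: "exc_realized fs \<theta> \<tau> L" and form: "invariant_form L B" and X: "X \<in> hcomp L 0"
  and chi: "\<forall>x\<in>carrier L. \<chi> x = B X x" and gr: "exc_grading fs \<theta> \<tau> L B X gr" and assoc: "associated_m L \<chi> gr S"
 shows "projective_supermodule TYPE('m) TYPE('n) (reduced_env L \<chi>) (Q_module L S \<chi>)
  \<and> algebra_iso (reduced_env L \<chi>)
    (matrix_algebra (kdim (reduced_env (sub_lie L S) \<chi>))
     (opposite_superalgebra (End_superalgebra (reduced_env L \<chi>) (Q_module L S \<chi>))))"
proof -
 note p = odd_characteristic[OF char]
 note r = realized[unfolded exc_realized_def, THEN conjunct2, THEN conjunct2, THEN conjunct2, THEN conjunct2, THEN conjunct1]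
 have pm: "pmap L x \<in> hcomp L 0" if "x \<in> hcomp L 0" for x using r that by blast
 interpret super_env_algebra L \<chi> by (rule super_env_algebraI[OF lie pm p(2)])
 obtain \<gamma> d C where c: "cocharacter fs \<gamma> d C" "gr = exc_degree_space fs \<theta> \<tau> L \<gamma>" "grading_properties L B X gr"
  using gr unfolding exc_grading_def by (elim bexE exE conjE)
 have "exceptional_grading L \<chi> fs \<theta> \<tau> B X gr \<gamma> d C"
  by (intro exceptional_grading.intro exceptional_grading_axioms.intro super_env_algebra_axioms)
   (fact infinite_alg_closed_field p(1) alg realized form X chi[rule_format] c)+
 from exceptional_grading.chi_grading[OF this assoc] show ?thesis by (rule chi_grading.projective_and_matrix)
qed

lemma sl2_alg_carrier: "sl2_alg \<subseteq> carrier_mat 2 2" by (auto simp: sl2_alg_def)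

lemma spin7_alg_carrier: "(spin7_alg :: 'k::field mat set) \<subseteq> carrier_mat 8 8"
proof
 fix A :: "'k mat" assume "A \<in> spin7_alg"
 then have A: "A \<in> kspan (module_mat TYPE('k) 8 8)
   {oct_left x * oct_left y - oct_left y * oct_left x | x y. x \<in> oct_imag \<and> y \<in> oct_imag}" by (simp add: spin7_alg_def)
 show "A \<in> carrier_mat 8 8"
  using matrix_vs A by (rule kspan_induct) (auto simp: module_mat_simps oct_left_def)
qed

lemma factors_carrier:
 "i < length D21_factors ==> fst (snd (D21_factors ! i)) \<subseteq> (carrier_mat (fst (D21_factors ! i)) (fst (D21_factors ! i)) :: 'k::field mat set)"
 "i < length F4_factors ==> fst (snd (F4_factors ! i)) \<subseteq> (carrier_mat (fst (F4_factors ! i)) (fst (F4_factors ! i)) :: 'k mat set)"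
 "i < length G3_factors ==> fst (snd (G3_factors ! i)) \<subseteq> (carrier_mat (fst (G3_factors ! i)) (fst (G3_factors ! i)) :: 'k mat set)"
proof -
 have g2: "(g2_alg :: 'k mat set) \<subseteq> carrier_mat 7 7" unfolding g2_alg_def by blast
 show "i < length D21_factors ==> fst (snd (D21_factors ! i)) \<subseteq> (carrier_mat (fst (D21_factors ! i)) (fst (D21_factors ! i)) :: 'k::field mat set)"
  "i < length F4_factors ==> fst (snd (F4_factors ! i)) \<subseteq> (carrier_mat (fst (F4_factors ! i)) (fst (F4_factors ! i)) :: 'k mat set)"
  "i < length G3_factors ==> fst (snd (G3_factors ! i)) \<subseteq> (carrier_mat (fst (G3_factors ! i)) (fst (G3_factors ! i)) :: 'k mat set)"
  unfolding D21_factors_def F4_factors_def G3_factors_def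
  by (auto simp: nth_Cons less_Suc_eq split: nat.splits dest!: subsetD[OF sl2_alg_carrier] subsetD[OF spin7_alg_carrier] subsetD[OF g2])
qed

theorem theorem4p4:
  fixes L :: "('k::alg_closed_field, 'g) lie_superalg"
    and R :: "('k, 'g) realization"
    and B :: "'g \<Rightarrow> 'g \<Rightarrow> 'k"
    and \<chi> :: "'g \<Rightarrow> 'k"
    and X :: 'g
    and gr :: "int \<Rightarrow> 'g set"
    and S :: "'g set"
  assumes "basic_classical R L B"
    and "X \<in> hcomp L 0" and "nilpotent_element R X"
    and "\<forall>x\<in>carrier L. \<chi> x = B X x"
    and "grading_for R L B X gr"
    and "associated_m L \<chi> gr S"
  shows "projective_supermodule TYPE('m) TYPE('n) (reduced_env L \<chi>) (Q_module L S \<chi>)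
    \<and> algebra_iso (reduced_env L \<chi>)
        (matrix_algebra (kdim (reduced_env (sub_lie L S) \<chi>))
          (opposite_superalgebra (End_superalgebra (reduced_env L \<chi>) (Q_module L S \<chi>))))"
proof (cases R)
  case (GL m n \<rho>)
  note bc = assms(1)[unfolded GL basic_classical.simps]
  have b: "CHAR('k) > 2" "lie_superalgebra L" "mat_realized m n (gl_comp m n) \<rho> L"
    "\<forall>x\<in>carrier L. \<forall>y\<in>carrier L. B x y = supertrace m (\<rho> x * \<rho> y)" using bc by blast+
  show ?thesis
    by (rule matrix_case[OF b(1-3) order_refl b(4) assms(2,4) assms(5)[unfolded GL grading_for.simps] assms(6)])
      (rule coordinates.matrix_grading_gl, assumption, rule refl)
next
  case (SL m n \<rho>)
  note bc = assms(1)[unfolded SL basic_classical.simps]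
  have b: "CHAR('k) > 2" "lie_superalgebra L" "mat_realized m n (sl_comp m n) \<rho> L"
    "\<forall>x\<in>carrier L. \<forall>y\<in>carrier L. B x y = supertrace m (\<rho> x * \<rho> y)" "\<not> int CHAR('k) dvd int m - int n" using bc by blast+
  have sl: "sl_comp m n c \<subseteq> (gl_comp m n c :: 'k mat set)" for c unfolding sl_comp_def by blast
  show ?thesis
    by (rule matrix_case[OF b(1-3) sl b(4) assms(2,4) assms(5)[unfolded SL grading_for.simps] assms(6)])
      (rule coordinates.matrix_grading_sl, assumption, rule refl, rule b(5))
next
  case (OSP m n J \<rho>)
  note bc = assms(1)[unfolded OSP basic_classical.simps]
  have b: "CHAR('k) > 2" "lie_superalgebra L" "mat_realized m n (osp_comp m n J) \<rho> L"
    "\<forall>x\<in>carrier L. \<forall>y\<in>carrier L. B x y = supertrace m (\<rho> x * \<rho> y)" "osp_gram m n J" using bc by blast+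
  have osp: "osp_comp m n J c \<subseteq> gl_comp m n c" for c unfolding osp_comp_def by blast
  show ?thesis
    by (rule matrix_case[OF b(1-3) osp b(4) assms(2,4) assms(5)[unfolded OSP grading_for.simps] assms(6)])
      (rule coordinates.matrix_grading_osp, assumption, rule b(5), rule refl, blast)
next
  case (D21 \<alpha> \<theta> \<tau>)
  note bc = assms(1)[unfolded D21 basic_classical.simps]
  have b: "CHAR('k) > 3" "lie_superalgebra L" "exc_realized D21_factors \<theta> \<tau> L" "invariant_form L B" using bc by blast+
  show ?thesis
    by (rule exceptional_case[OF _ b(2) factors_carrier(1) b(3,4) assms(2,4) assms(5)[unfolded D21 grading_for.simps] assms(6)])
      (use b(1) in simp_all)
next
  case (F4 \<theta> \<tau>)
  note bc = assms(1)[unfolded F4 basic_classical.simps]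
  have b: "CHAR('k) > 15" "lie_superalgebra L" "exc_realized F4_factors \<theta> \<tau> L" "invariant_form L B" using bc by blast+
  show ?thesis
    by (rule exceptional_case[OF _ b(2) factors_carrier(2) b(3,4) assms(2,4) assms(5)[unfolded F4 grading_for.simps] assms(6)])
      (use b(1) in simp_all)
next
  case (G3 \<theta> \<tau>)
  note bc = assms(1)[unfolded G3 basic_classical.simps]
  have b: "CHAR('k) > 15" "lie_superalgebra L" "exc_realized G3_factors \<theta> \<tau> L" "invariant_form L B" using bc by blast+
  show ?thesis
    by (rule exceptional_case[OF _ b(2) factors_carrier(3) b(3,4) assms(2,4) assms(5)[unfolded G3 grading_for.simps] assms(6)])
      (use b(1) in simp_all)
qed

end
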